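(* Let $\Gamma$ be a finite connected graph that contains $T_0$ or $S_0$. Then for every braid index $n\ge 5$, the graph braid group $B_n\Gamma$ is not a right-angled Artin group.
   Context: A graph is a finite connected 1-dimensional CW complex (loops and multiple edges allowed). A graph $\Gamma$ contains a graph $\Gamma'$ if some subdivision of $\Gamma'$ is a subgraph of some subdivision of $\Gamma$. The unordered configuration space is $UC_n\Gamma=\{\{x_1,\dots,x_n\}\subset\Gamma : x_i\ne x_j \text{ for } i\ne j\}$ and $B_n\Gamma=\pi_1(UC_n\Gamma)$. $T_0$ is the tree with ten vertices consisting of a central vertex $v$ adjacent to three vertices $u_1,u_2,u_3$, each $u_i$ being adjacent to two further vertices of valency one. $S_0$ is the graph consisting of a cycle together with two distinct vertices $x,y$ on the cycle, each of which has one additional pendant edge attached. A right-angled Artin group is a group admitting a finite presentation in which every relator is a commutator of two generators. *)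

theory Defs
  imports "HOL-Analysis.Analysis" "HOL-Algebra.Algebra"
begin

text \<open>A graph is given by a vertex set V, an edge set E and an endpoint map
  ends (orientation is irrelevant everywhere below); loops and multiple
  edges are allowed.\<close>

definition graph_adj :: "'e set \<Rightarrow> ('e \<Rightarrow> 'v \<times> 'v) \<Rightarrow> 'v \<Rightarrow> 'v \<Rightarrow> bool" where
  "graph_adj E ends a b \<longleftrightarrow> (\<exists>e\<in>E. ends e = (a, b) \<or> ends e = (b, a))"

definition finite_connected_graph :: "'v set \<Rightarrow> 'e set \<Rightarrow> ('e \<Rightarrow> 'v \<times> 'v) \<Rightarrow> bool" where
  "finite_connected_graph V E ends \<longleftrightarrow>
     finite V \<and> finite E \<and> V \<noteq> {} \<and>
     (\<forall>e\<in>E. fst (ends e) \<in> V \<and> snd (ends e) \<in> V) \<and>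
     (\<forall>a\<in>V. \<forall>b\<in>V. (graph_adj E ends)\<^sup>*\<^sup>* a b)"

text \<open>The subdivision of a graph in which edge e is replaced by a path of k e \<ge> 1
  edges; the new interior vertices are (e,i), 0<i<k e, the new edges are (e,i), i<k e.\<close>

definition subdiv_node :: "('e \<Rightarrow> 'v \<times> 'v) \<Rightarrow> ('e \<Rightarrow> nat) \<Rightarrow> 'e \<Rightarrow> nat \<Rightarrow> 'v + ('e \<times> nat)" where
  "subdiv_node ends k e i =
     (if i = 0 then Inl (fst (ends e)) else if i = k e then Inl (snd (ends e)) else Inr (e, i))"

definition subdiv_V :: "'v set \<Rightarrow> 'e set \<Rightarrow> ('e \<Rightarrow> nat) \<Rightarrow> ('v + ('e \<times> nat)) set" where
  "subdiv_V V E k = Inl ` V \<union> {Inr (e, i) | e i. e \<in> E \<and> 0 < i \<and> i < k e}"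

definition subdiv_E :: "'e set \<Rightarrow> ('e \<Rightarrow> nat) \<Rightarrow> ('e \<times> nat) set" where
  "subdiv_E E k = {(e, i) | e i. e \<in> E \<and> i < k e}"

definition subdiv_ends :: "('e \<Rightarrow> 'v \<times> 'v) \<Rightarrow> ('e \<Rightarrow> nat) \<Rightarrow> 'e \<times> nat \<Rightarrow> ('v + ('e \<times> nat)) \<times> ('v + ('e \<times> nat))" where
  "subdiv_ends ends k = (\<lambda>(e, i). (subdiv_node ends k e i, subdiv_node ends k e (Suc i)))"

text \<open>Gamma contains Gamma' iff some subdivision of Gamma' is (isomorphic to) a subgraph
  of some subdivision of Gamma: injective vertex and edge maps preserving incidence.\<close>

definition graph_contains ::
  "'v set \<Rightarrow> 'e set \<Rightarrow> ('e \<Rightarrow> 'v \<times> 'v) \<Rightarrow> 'w set \<Rightarrow> 'f set \<Rightarrow> ('f \<Rightarrow> 'w \<times> 'w) \<Rightarrow> bool" where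
  "graph_contains V E ends V' E' ends' \<longleftrightarrow>
     (\<exists>k k' fv fe.
        (\<forall>e\<in>E. 1 \<le> k e) \<and> (\<forall>e\<in>E'. 1 \<le> k' e) \<and>
        inj_on fv (subdiv_V V' E' k') \<and> fv ` subdiv_V V' E' k' \<subseteq> subdiv_V V E k \<and>
        inj_on fe (subdiv_E E' k') \<and> fe ` subdiv_E E' k' \<subseteq> subdiv_E E k \<and>
        (\<forall>x\<in>subdiv_E E' k'.
           subdiv_ends ends k (fe x) = map_prod fv fv (subdiv_ends ends' k' x) \<or>
           subdiv_ends ends k (fe x) = prod.swap (map_prod fv fv (subdiv_ends ends' k' x))))"

definition T0_V :: "nat set" where "T0_V = {0..9}"
definition T0_E :: "nat set" where "T0_E = {0..8}"
definition T0_ends :: "nat \<Rightarrow> nat \<times> nat" where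
  "T0_ends e = [(0,1),(0,2),(0,3),(1,4),(1,5),(2,6),(2,7),(3,8),(3,9)] ! e"

text \<open>S0: a cycle through two distinct vertices x = 0, y = 1 (realised by two parallel
  edges), with one pendant edge at x (to 2) and one at y (to 3).\<close>
definition S0_V :: "nat set" where "S0_V = {0..3}"
definition S0_E :: "nat set" where "S0_E = {0..3}"
definition S0_ends :: "nat \<Rightarrow> nat \<times> nat" where
  "S0_ends e = [(0,1),(1,0),(0,2),(1,3)] ! e"

datatype ('v, 'e) gpt = GV 'v | GE 'e real

definition char_map :: "('e \<Rightarrow> 'v \<times> 'v) \<Rightarrow> 'e \<Rightarrow> real \<Rightarrow> ('v, 'e) gpt" where
  "char_map ends e t =
     (if t = 0 then GV (fst (ends e)) else if t = 1 then GV (snd (ends e)) else GE e t)"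

definition graph_points :: "'v set \<Rightarrow> 'e set \<Rightarrow> ('v, 'e) gpt set" where
  "graph_points V E = GV ` V \<union> {GE e t | e t. e \<in> E \<and> 0 < t \<and> t < 1}"

definition graph_top :: "'v set \<Rightarrow> 'e set \<Rightarrow> ('e \<Rightarrow> 'v \<times> 'v) \<Rightarrow> ('v, 'e) gpt topology" where
  "graph_top V E ends = topology (\<lambda>U. U \<subseteq> graph_points V E \<and>
     (\<forall>e\<in>E. openin (top_of_set {0..1::real}) {t \<in> {0..1}. char_map ends e t \<in> U}))"

definition quot_top :: "'a topology \<Rightarrow> ('a \<Rightarrow> 'b) \<Rightarrow> 'b topology" where
  "quot_top T f = topology (\<lambda>U. U \<subseteq> f ` topspace T \<and> openin T {a \<in> topspace T. f a \<in> U})"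

definition ord_conf :: "'a topology \<Rightarrow> nat \<Rightarrow> (nat \<Rightarrow> 'a) topology" where
  "ord_conf T n = subtopology (product_topology (\<lambda>i. T) {..<n})
     {c. inj_on c {..<n}}"

definition unord_conf :: "'a topology \<Rightarrow> nat \<Rightarrow> 'a set topology" where
  "unord_conf T n = quot_top (ord_conf T n) (\<lambda>c. c ` {..<n})"

definition loops :: "'a topology \<Rightarrow> 'a \<Rightarrow> (real \<Rightarrow> 'a) set" where
  "loops T x0 = {p. pathin T p \<and> p 0 = x0 \<and> p 1 = x0}"

definition loop_homotopic :: "'a topology \<Rightarrow> 'a \<Rightarrow> (real \<Rightarrow> 'a) \<Rightarrow> (real \<Rightarrow> 'a) \<Rightarrow> bool" where
  "loop_homotopic T x0 p q \<longleftrightarrow>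
     homotopic_with (\<lambda>h. h 0 = x0 \<and> h 1 = x0) (top_of_set {0..1::real}) T p q"

definition loop_class :: "'a topology \<Rightarrow> 'a \<Rightarrow> (real \<Rightarrow> 'a) \<Rightarrow> (real \<Rightarrow> 'a) set" where
  "loop_class T x0 p = {q \<in> loops T x0. loop_homotopic T x0 p q}"

definition path_join :: "(real \<Rightarrow> 'a) \<Rightarrow> (real \<Rightarrow> 'a) \<Rightarrow> real \<Rightarrow> 'a" where
  "path_join p q = (\<lambda>t. if t \<le> 1/2 then p (2 * t) else q (2 * t - 1))"

definition fundamental_group :: "'a topology \<Rightarrow> 'a \<Rightarrow> (real \<Rightarrow> 'a) set monoid" where
  "fundamental_group T x0 =
     \<lparr>carrier = {loop_class T x0 p | p. p \<in> loops T x0},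
      mult = (\<lambda>A B. loop_class T x0 (path_join (SOME p. p \<in> A) (SOME q. q \<in> B))),
      one = loop_class T x0 (\<lambda>_. x0)\<rparr>"

definition graph_braid_group ::
  "'v set \<Rightarrow> 'e set \<Rightarrow> ('e \<Rightarrow> 'v \<times> 'v) \<Rightarrow> nat \<Rightarrow> ('v, 'e) gpt set \<Rightarrow> (real \<Rightarrow> ('v, 'e) gpt set) set monoid" where
  "graph_braid_group V E ends n base = fundamental_group (unord_conf (graph_top V E ends) n) base"

text \<open>Words over letters (s, b), b = True meaning s and b = False meaning s^-1;
  free reduction to normal form.\<close>
fun free_red :: "('s \<times> bool) list \<Rightarrow> ('s \<times> bool) list" where
  "free_red [] = []"
| "free_red (x # xs) =
     (case free_red xs of
        [] \<Rightarrow> [x]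
      | y # ys \<Rightarrow> (if fst y = fst x \<and> snd y \<noteq> snd x then ys else x # y # ys))"

definition free_group :: "'s set \<Rightarrow> ('s \<times> bool) list monoid" where
  "free_group S = \<lparr>carrier = {w. set (map fst w) \<subseteq> S \<and> free_red w = w},
                   mult = (\<lambda>u v. free_red (u @ v)), one = []\<rparr>"

definition group_commutator :: "('a, 'b) monoid_scheme \<Rightarrow> 'a \<Rightarrow> 'a \<Rightarrow> 'a" where
  "group_commutator G x y = x \<otimes>\<^bsub>G\<^esub> y \<otimes>\<^bsub>G\<^esub> inv\<^bsub>G\<^esub> x \<otimes>\<^bsub>G\<^esub> inv\<^bsub>G\<^esub> y"

definition normal_closure_in :: "('a, 'b) monoid_scheme \<Rightarrow> 'a set \<Rightarrow> 'a set" where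
  "normal_closure_in G R = generate G {g \<otimes>\<^bsub>G\<^esub> r \<otimes>\<^bsub>G\<^esub> inv\<^bsub>G\<^esub> g | g r. g \<in> carrier G \<and> r \<in> R}"

definition raag_presentation :: "nat set \<Rightarrow> (nat \<times> nat) set \<Rightarrow> (nat \<times> bool) list set monoid" where
  "raag_presentation S R =
     free_group S Mod normal_closure_in (free_group S)
       {group_commutator (free_group S) [(s, True)] [(t, True)] | s t. (s, t) \<in> R}"

definition is_raag :: "('a, 'b) monoid_scheme \<Rightarrow> bool" where
  "is_raag G \<longleftrightarrow> group G \<and>
     (\<exists>S R. finite S \<and> R \<subseteq> S \<times> S \<and> G \<cong> raag_presentation S R)"

end

(* Suppose the braid group G is right-angled Artin; homomorphisms out of G are then free to choose on letters as long as
adjacent letters commute.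

First case: three vertices of valency at least 3 are pairwise joined by paths avoiding the third (T_0, and S_0 with a third
branch vertex on an arc of its cycle). Let p_i swap neighbouring tokens at the first vertex, y two tokens at the second and
y' two tokens at the third. The p_i commute with y and y', and y commutes with a conjugate z of y' which swaps two of the
tokens permuted by the p_i. The commutators of the p_i permute tokens by 3-cycles and have exponent 0 in every letter, which
forces them into conjugates of the centralizer of a letter occurring in y. So the permutation of an odd letter of y commutes
with these 3-cycles and can only swap the two tokens of y. The same reasoning from z and from y' contradicts this.

Second case: one arc U of the cycle of S_0 has no branch vertex. Recording on which side tokens pass the end x of U defines a
homomorphism from G to the infinite dihedral group, where passing into U is a reflection; likewise for the other end. Both
have the same sign, since a loop of configurations crosses the ends of U an even number of times. Let y and z exchange two
tokens at either end and let c carry a further token round the cycle. Then z commutes with y and with c y c^-1, and the signs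
contradict each other in the central extension defined by the cup product of the two twisted classes. *)

theory Submission
 imports Defs
begin

section \<open>Reduced words, and homomorphisms from a RAAG prescribed on its letters\<close>

section \<open>Free groups and the universal property of a RAAG\<close>

text \<open>Apart from generation by letters that commute as prescribed, the algebra uses a RAAG
  only through \<open>extend_hom\<close>, applied to chosen targets: the integers, for exponents; G
  itself, for retractions; a semidirect product of G with a free group on subsets of G, whose words
  record where a letter s occurs and turn commutation into an equation between reduced words; and a
  central extension, in which lifts of commuting elements must commute. Exponent 0 is what makes the
  third target work: an element commuting with y might otherwise translate along y instead of fixing
  a coset. No cell model of the configuration space is used. Homomorphisms out of the braid group
  come from functions of two nearby configurations that satisfy a cocycle identity only locally;
  multiplying their values along a fine partition of a loop gives a homotopy invariant. Relations in
  the braid group come from motions with disjoint supports. The bound 5 is 2 + 3 in the first case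
  (two tokens for y, three for a 3-cycle) and 2 + 2 + 1 in the second (y, z and the token carried by
  c).\<close>

definition linv :: "'s \<times> bool => 's \<times> bool" where
 "linv x = (fst x, \<not> snd x)"

text \<open>One step of \<open>free_red\<close>, isolated so that reducing an append becomes a
  \<open>foldr\<close>; reduction works from the right end of the word.\<close>

definition push :: "'s \<times> bool => ('s \<times> bool) list => ('s \<times> bool) list" where
 "push x w = (case w of [] => [x]
  | y # ys => (if fst y = fst x \<and> snd y \<noteq> snd x then ys else x # y # ys))"

abbreviation reduced :: "('s \<times> bool) list => bool" where
 "reduced w \<equiv> free_red w = w"

lemma linv_linv [simp]: "linv (linv x) = x" and fst_linv [simp]: "fst (linv x) = fst x"
 and snd_linv [simp]: "snd (linv x) = (\<not> snd x)"
 by (simp_all add: linv_def)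

lemma push_simps [simp]: "push x [] = [x]"
 "push x (y # ys) = (if y = linv x then ys else x # y # ys)"
 by (auto simp: push_def linv_def prod_eq_iff)

lemma free_red_Cons [simp]: "free_red (x # xs) = push x (free_red xs)"
 by (simp add: push_def)

declare free_red.simps(2) [simp del]

lemma length_free_red: "length (free_red w) \<le> length w"
proof (induction w)
 case (Cons x w)
 thus ?case by (cases "free_red w") auto
qed simp

lemma set_free_red: "set (free_red w) \<subseteq> set w"
proof (induction w)
 case (Cons x w)
 thus ?case by (cases "free_red w") (auto split: if_splits)
qed simp

text \<open>A cancellation against the head would leave a word shorter than \<open>x # w\<close>, by
  \<open>length_free_red\<close>.\<close>

lemma reduced_tl:
 assumes "reduced (x # w)"
 shows "reduced w"
proof (cases "free_red w")
 case Nil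
 with assms show ?thesis by simp
next
 case (Cons y ys)
 have "length (free_red w) \<le> length w" by (rule length_free_red)
 with assms Cons show ?thesis by (auto split: if_splits)
qed

lemma reduced_Cons_Cons: "reduced (x # y # w) \<longleftrightarrow> y \<noteq> linv x \<and> reduced (y # w)"
proof (cases "reduced (y # w)")
 case True
 hence "free_red (x # y # w) = push x (y # w)" by (simp only: free_red_Cons[of x])
 moreover have "w \<noteq> x # y # w" by (rule notI, drule arg_cong[where f = length]) simp
 ultimately show ?thesis using True by simp
qed (use reduced_tl in blast)

lemma reduced_push: "reduced w ==> reduced (push x w)"
proof (cases w)
 case (Cons y ys)
 assume r: "reduced w"
 show ?thesis
 proof (cases "y = linv x")
  case True
  hence "push x w = ys" using Cons by simp
  thus ?thesis using r Cons reduced_tl[of y ys] by simp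
 next
  case False
  hence "push x w = x # y # ys" using Cons by simp
  thus ?thesis using r Cons False reduced_Cons_Cons[of x y ys] by simp
 qed
qed simp

lemma free_red_idem [simp]: "free_red (free_red w) = free_red w"
 by (induction w) (simp_all add: reduced_push)

lemma push_push_linv: "reduced w ==> push x (push (linv x) w) = w"
proof (cases w)
 case (Cons y ys)
 assume r: "reduced w"
 show ?thesis
 proof (cases "y = x")
  case True
  have "reduced ys" using r Cons reduced_tl[of y ys] by simp
  with r Cons True have "push x ys = x # ys" by simp
  with Cons True show ?thesis by simp
 qed (use Cons in auto)
qed simp

lemma free_red_append: "free_red (u @ v) = foldr push u (free_red v)"
 by (induction u) auto

lemma free_red_append_right [simp]: "free_red (u @ free_red v) = free_red (u @ v)"
 by (simp add: free_red_append)

text \<open>Rests on \<open>push_push_linv\<close>: pushing a letter and then its inverse onto a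
  reduced word changes nothing. Associativity of the free group follows.\<close>

lemma free_red_append_left [simp]: "free_red (free_red u @ v) = free_red (u @ v)"
proof (induction u)
 case (Cons x u)
 show ?case
 proof (cases "free_red u")
  case (Cons y ys)
  show ?thesis
  proof (cases "y = linv x")
   case True
   have "free_red (u @ v) = push y (free_red (ys @ v))"
    using Cons.IH Cons by (simp add: Cons)
   hence "push x (free_red (u @ v)) = free_red (ys @ v)"
    using True push_push_linv[of "free_red (ys @ v)" x] by simp
   thus ?thesis using Cons True by simp
  next
   case False
   thus ?thesis using Cons Cons.IH by simp
  qed
 qed (use Cons.IH in simp)
qed simp

lemma free_red_cancel: "free_red (a @ linv x # x # b) = free_red (a @ b)"
 using push_push_linv[of "free_red b" "linv x"] by (simp add: free_red_append)

lemma free_red_inverse: "free_red (rev (map linv w) @ w) = []"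
proof (induction w)
 case (Cons x w)
 have "rev (map linv (x # w)) @ x # w = rev (map linv w) @ linv x # x # w" by simp
 thus ?case using Cons free_red_cancel by metis
qed simp

lemma free_group_simps [simp]:
 "carrier (free_group S) = {w. set (map fst w) \<subseteq> S \<and> reduced w}"
 "u \<otimes>\<^bsub>free_group S\<^esub> v = free_red (u @ v)" "\<one>\<^bsub>free_group S\<^esub> = []"
 by (simp_all add: free_group_def)

lemma free_red_letters: "fst ` set w \<subseteq> S ==> fst ` set (free_red w) \<subseteq> S"
 using set_free_red by fast

lemma group_free_group: "group (free_group S)"
proof (rule groupI)
 fix x y assume "x \<in> carrier (free_group S)" "y \<in> carrier (free_group S)"
 thus "x \<otimes>\<^bsub>free_group S\<^esub> y \<in> carrier (free_group S)"
  using free_red_letters[of "x @ y" S] by auto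
next
 fix x assume x: "x \<in> carrier (free_group S)"
 have "fst ` set (rev (map linv x)) \<subseteq> S" using x by auto
 thus "\<exists>y\<in>carrier (free_group S). y \<otimes>\<^bsub>free_group S\<^esub> x = \<one>\<^bsub>free_group S\<^esub>"
  using free_red_letters[of "rev (map linv x)" S]
  by (intro bexI[of _ "free_red (rev (map linv x))"]) (simp_all add: free_red_inverse)
qed auto

definition (in group) word_val :: "('s => 'a) => ('s \<times> bool) list => 'a" where
 "word_val f w = foldr (\<lambda>x acc. (if snd x then f (fst x) else inv f (fst x)) \<otimes> acc) w \<one>"

context group
begin

lemma word_val_Nil [simp]: "word_val f [] = \<one>"
 and word_val_Cons [simp]: "word_val f (x # w) = (if snd x then f (fst x) else inv f (fst x)) \<otimes> word_val f w"
 by (simp_all add: word_val_def)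

lemma word_val_closed [simp]:
 "f ` S \<subseteq> carrier G ==> fst ` set w \<subseteq> S ==> word_val f w \<in> carrier G"
 by (induction w) (auto simp: image_subset_iff)

lemma word_val_append:
 "f ` S \<subseteq> carrier G ==> fst ` set u \<subseteq> S ==> fst ` set v \<subseteq> S ==>
  word_val f (u @ v) = word_val f u \<otimes> word_val f v"
proof (induction u)
 case Nil
 thus ?case using word_val_closed by simp
next
 case (Cons x u)
 have "f (fst x) \<in> carrier G" "word_val f u \<in> carrier G" "word_val f v \<in> carrier G"
  using Cons.prems word_val_closed[of f S] by auto
 thus ?case using Cons by (auto simp: m_assoc)
qed

lemma word_val_push:
 assumes f: "f ` S \<subseteq> carrier G" and "fst x \<in> S" "fst ` set w \<subseteq> S"
 shows "word_val f (push x w) = word_val f (x # w)"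
proof (cases w)
 case (Cons y ys)
 have 1: "f (fst x) \<in> carrier G" "word_val f ys \<in> carrier G"
  using assms Cons word_val_closed[OF f] by auto
 show ?thesis
 proof (cases "y = linv x")
  case True
  thus ?thesis using 1 Cons by (auto simp: m_assoc[symmetric])
 qed (use Cons in simp)
qed simp

lemma word_val_free_red:
 assumes f: "f ` S \<subseteq> carrier G"
 shows "fst ` set w \<subseteq> S ==> word_val f (free_red w) = word_val f w"
proof (induction w)
 case (Cons x w)
 have "fst ` set (free_red w) \<subseteq> S" using Cons.prems free_red_letters[of w S] by auto
 thus ?case using Cons word_val_push[OF f, of x "free_red w"] by auto
qed simp

lemma word_val_hom:
 assumes "f ` S \<subseteq> carrier G"
 shows "word_val f \<in> hom (free_group S) G"
proof (rule homI)
 fix x y assume "x \<in> carrier (free_group S)" "y \<in> carrier (free_group S)"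
 thus "word_val f (x \<otimes>\<^bsub>free_group S\<^esub> y) = word_val f x \<otimes> word_val f y"
  using word_val_free_red[OF assms, of "x @ y"] word_val_append[OF assms, of x y] by auto
qed (use word_val_closed[OF assms] in auto)

end

lemma hom_eq_on_generate:
 assumes "group G" "group H" "h \<in> hom G H" "k \<in> hom G H" "A \<subseteq> carrier G" "\<And>a. a \<in> A ==> h a = k a"
  and "x \<in> generate G A"
 shows "h x = k x"
proof -
 interpret h: group_hom G H h using assms by (simp add: group_hom_def group_hom_axioms_def)
 interpret k: group_hom G H k using assms by (simp add: group_hom_def group_hom_axioms_def)
 show ?thesis using assms(7)
 proof induction
  case (inv a)
  hence "a \<in> carrier G" using assms by auto
  with inv assms(6) show ?case by simp
 next
  case (eng a b)
  hence "a \<in> carrier G" "b \<in> carrier G" using h.G.generate_in_carrier assms(5) by auto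
  with eng show ?case by simp
 qed (use assms in auto)
qed

text \<open>The isomorphism in \<open>is_raag\<close> is traded for a surjection q from the free
  group with prescribed kernel, so that the quotient group appears only in
  \<open>is_raag_obtain\<close>.\<close>

locale raag = group G for G (structure) +
 fixes S :: "nat set" and R :: "(nat \<times> nat) set" and q :: "(nat \<times> bool) list => 'a"
 assumes finite_S: "finite S" and R_sub: "R \<subseteq> S \<times> S"
  and q_hom: "q \<in> hom (free_group S) G"
  and q_surj: "q ` carrier (free_group S) = carrier G"
  and q_kernel: "kernel (free_group S) G q = normal_closure_in (free_group S)
   {group_commutator (free_group S) [(s, True)] [(t, True)] | s t. (s, t) \<in> R}"
begin

definition \<iota> :: "nat => 'a" where "\<iota> s = q [(s, True)]"

sublocale q: group_hom "free_group S" G q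
 by (simp add: group_hom_def group_hom_axioms_def group_free_group q_hom)

lemma iota_closed [simp]: "s \<in> S ==> \<iota> s \<in> carrier G"
 unfolding \<iota>_def by (rule q.hom_closed) simp

lemma iota_image [simp]: "\<iota> ` S \<subseteq> carrier G" by auto

lemma group_commutator_eq_one_iff:
 "x \<in> carrier G ==> y \<in> carrier G ==> group_commutator G x y = \<one> \<longleftrightarrow> x \<otimes> y = y \<otimes> x"
proof -
 assume xy: "x \<in> carrier G" "y \<in> carrier G"
 hence "group_commutator G x y = (x \<otimes> y) \<otimes> inv (y \<otimes> x)"
  by (simp add: group_commutator_def inv_mult_group m_assoc)
 thus ?thesis using xy inv_equality[of "x \<otimes> y" "inv (y \<otimes> x)"] by auto
qed

lemma hom_group_commutator:
 assumes "group_hom A B h" "x \<in> carrier A" "y \<in> carrier A"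
 shows "h (group_commutator A x y) = group_commutator B (h x) (h y)"
proof -
 interpret group_hom A B h by fact
 show ?thesis using assms by (simp add: group_commutator_def)
qed

lemma letters_commute:
 assumes "(s, t) \<in> R"
 shows "\<iota> s \<otimes> \<iota> t = \<iota> t \<otimes> \<iota> s"
proof -
 let ?F = "free_group S" and ?c = "group_commutator (free_group S) [(s, True)] [(t, True)]"
 have st: "s \<in> S" "t \<in> S" using assms R_sub by auto
 hence mem: "[(s, True)] \<in> carrier ?F" "[(t, True)] \<in> carrier ?F" by auto
 hence c: "?c \<in> carrier ?F" unfolding group_commutator_def by (intro q.G.m_closed q.G.inv_closed)
 have "?c = \<one>\<^bsub>?F\<^esub> \<otimes>\<^bsub>?F\<^esub> ?c \<otimes>\<^bsub>?F\<^esub> inv\<^bsub>?F\<^esub> \<one>\<^bsub>?F\<^esub>"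
  using q.G.r_one q.G.l_one q.G.inv_one c by metis
 hence "?c \<in> kernel ?F G q"
  unfolding q_kernel normal_closure_in_def using assms q.G.one_closed by (intro generate.incl) blast
 hence "group_commutator G (\<iota> s) (\<iota> t) = \<one>"
  using hom_group_commutator[OF q.group_hom_axioms mem] by (simp add: kernel_def \<iota>_def)
 thus ?thesis using group_commutator_eq_one_iff[of "\<iota> s" "\<iota> t"] st by simp
qed

lemma q_letter: "s \<in> S ==> q [(s, b)] = (if b then \<iota> s else inv \<iota> s)"
proof (cases b)
 case False
 assume s: "s \<in> S"
 have "q [(s, False)] \<otimes> q [(s, True)] = q ([(s, False)] \<otimes>\<^bsub>free_group S\<^esub> [(s, True)])"
  using s by (intro q.hom_mult[symmetric]) auto
 also have "\<dots> = \<one>" using q.hom_one by (simp add: linv_def)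
 finally show ?thesis using s False q.hom_closed[of "[(s,False)]"]
  by (simp add: \<iota>_def[symmetric] inv_equality)
qed (simp add: \<iota>_def)

lemma q_eq_word_val: "w \<in> carrier (free_group S) ==> q w = word_val \<iota> w"
proof (induction w)
 case Nil
 thus ?case using q.hom_one by simp
next
 case (Cons x w)
 have r: "reduced (x # w)" using Cons.prems by simp
 hence w: "w \<in> carrier (free_group S)" using Cons.prems reduced_tl[of x w] by auto
 have x: "[x] \<in> carrier (free_group S)" using Cons.prems by auto
 have "q (x # w) = q ([x] \<otimes>\<^bsub>free_group S\<^esub> w)" using r by simp
 also have "\<dots> = q [x] \<otimes> q w" using x w by (rule q.hom_mult)
 also have "q [x] = (if snd x then \<iota> (fst x) else inv \<iota> (fst x))"
  using q_letter[of "fst x" "snd x"] x by simp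
 finally show ?case using Cons.IH[OF w] by simp
qed

lemma word_val_generate: "fst ` set w \<subseteq> U ==> word_val \<iota> w \<in> generate G (\<iota> ` U)"
 by (induction w) (auto intro: generate.intros)

lemma generate_letters: "generate G (\<iota> ` S) = carrier G"
proof
 show "generate G (\<iota> ` S) \<subseteq> carrier G" by (rule generate_incl) simp
 show "carrier G \<subseteq> generate G (\<iota> ` S)"
 proof
  fix x assume "x \<in> carrier G"
  then obtain w where w: "w \<in> carrier (free_group S)" "x = q w" using q_surj by blast
  thus "x \<in> generate G (\<iota> ` S)" using q_eq_word_val word_val_generate[of w S] by auto
 qed
qed

lemma hom_eqI:
 assumes "group H" "h \<in> hom G H" "k \<in> hom G H" "\<And>s. s \<in> S ==> h (\<iota> s) = k (\<iota> s)" "x \<in> carrier G"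
 shows "h x = k x"
 using assms generate_letters
 by (intro hom_eq_on_generate[of G H h k "\<iota> ` S" x]) (auto simp: is_group)

text \<open>Evaluating words under f kills every conjugate of a relator, hence the whole kernel of
  q, and so factors through q.\<close>

theorem extend_hom:
 assumes "group H" and f: "f ` S \<subseteq> carrier H"
  and comm: "\<And>s t. (s, t) \<in> R ==> f s \<otimes>\<^bsub>H\<^esub> f t = f t \<otimes>\<^bsub>H\<^esub> f s"
 obtains h where "h \<in> hom G H" "\<And>s. s \<in> S ==> h (\<iota> s) = f s"
proof -
 let ?F = "free_group S"
 interpret H: group H by fact
 interpret e: group_hom ?F H "H.word_val f"
  using H.word_val_hom[OF f] group_free_group by (simp add: group_hom_def group_hom_axioms_def H.is_group)
 let ?N = "{g \<otimes>\<^bsub>?F\<^esub> r \<otimes>\<^bsub>?F\<^esub> inv\<^bsub>?F\<^esub> g | g r. g \<in> carrier ?F \<and> r \<in>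
  {group_commutator ?F [(s, True)] [(t, True)] | s t. (s, t) \<in> R}}"
 have N: "?N \<subseteq> kernel ?F H (H.word_val f)"
 proof safe
  fix g s t assume g: "g \<in> carrier ?F" and st: "(s, t) \<in> R"
  let ?c = "group_commutator ?F [(s, True)] [(t, True)]"
  have S: "s \<in> S" "t \<in> S" using st R_sub by auto
  hence mem: "[(s, True)] \<in> carrier ?F" "[(t, True)] \<in> carrier ?F" by auto
  hence c: "?c \<in> carrier ?F" unfolding group_commutator_def by (intro q.G.m_closed q.G.inv_closed)
  have fc: "f s \<in> carrier H" "f t \<in> carrier H" using S f by auto
  have "H.word_val f ?c = group_commutator H (f s) (f t)"
   using hom_group_commutator[OF e.group_hom_axioms mem] fc by simp
  also have "\<dots> = \<one>\<^bsub>H\<^esub>"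
   unfolding group_commutator_def using fc comm[OF st] by (simp add: H.m_assoc)
  finally have 1: "H.word_val f ?c = \<one>\<^bsub>H\<^esub>" .
  have "H.word_val f (g \<otimes>\<^bsub>?F\<^esub> ?c \<otimes>\<^bsub>?F\<^esub> inv\<^bsub>?F\<^esub> g) = \<one>\<^bsub>H\<^esub>"
   using g c 1 by (simp only: e.hom_mult e.hom_inv q.G.m_closed q.G.inv_closed e.hom_closed H.r_one H.r_inv)
  thus "g \<otimes>\<^bsub>?F\<^esub> ?c \<otimes>\<^bsub>?F\<^esub> inv\<^bsub>?F\<^esub> g \<in> kernel ?F H (H.word_val f)"
   unfolding kernel_def using g c q.G.m_closed q.G.inv_closed by blast
 qed
 have ker: "kernel ?F G q \<subseteq> kernel ?F H (H.word_val f)"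
  unfolding q_kernel normal_closure_in_def using N e.subgroup_kernel
  by (rule q.G.generate_subgroup_incl)
 have well: "H.word_val f u = H.word_val f v" if "u \<in> carrier ?F" "v \<in> carrier ?F" "q u = q v" for u v
 proof -
  have "q (u \<otimes>\<^bsub>?F\<^esub> inv\<^bsub>?F\<^esub> v) = q v \<otimes> inv (q v)"
   using that by (simp only: q.hom_mult q.hom_inv q.G.inv_closed)
  hence "u \<otimes>\<^bsub>?F\<^esub> inv\<^bsub>?F\<^esub> v \<in> kernel ?F G q"
   unfolding kernel_def using that q.G.m_closed q.G.inv_closed q.hom_closed by (auto simp del: free_group_simps)
  hence "H.word_val f (u \<otimes>\<^bsub>?F\<^esub> inv\<^bsub>?F\<^esub> v) = \<one>\<^bsub>H\<^esub>" using ker unfolding kernel_def by blast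
  hence "H.word_val f u \<otimes>\<^bsub>H\<^esub> inv\<^bsub>H\<^esub> (H.word_val f v) = \<one>\<^bsub>H\<^esub>"
   using that by (simp only: e.hom_mult e.hom_inv q.G.inv_closed)
  thus ?thesis using e.hom_closed[OF that(1)] e.hom_closed[OF that(2)]
    H.inv_equality[of "H.word_val f u" "inv\<^bsub>H\<^esub> (H.word_val f v)"] by (simp del: free_group_simps)
 qed
 \<comment> \<open>A preimage word is chosen for each g; \<open>well\<close> makes the value
   independent of the choice.\<close>
 define h where "h g = H.word_val f (SOME w. w \<in> carrier ?F \<and> q w = g)" for g
 have h: "h (q w) = H.word_val f w" if "w \<in> carrier ?F" for w
 proof -
  have "(SOME v. v \<in> carrier ?F \<and> q v = q w) \<in> carrier ?F \<and> q (SOME v. v \<in> carrier ?F \<and> q v = q w) = q w"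
   by (rule someI[of "\<lambda>v. v \<in> carrier ?F \<and> q v = q w" w]) (use that in blast)
  thus ?thesis unfolding h_def using well that by blast
 qed
 have "h \<in> hom G H"
 proof (rule homI)
  fix x assume "x \<in> carrier G"
  then obtain w where "w \<in> carrier ?F" "x = q w" using q_surj by blast
  thus "h x \<in> carrier H" using h[of w] e.hom_closed[of w] by simp
 next
  fix x y assume "x \<in> carrier G" "y \<in> carrier G"
  then obtain u v where uv: "u \<in> carrier ?F" "x = q u" "v \<in> carrier ?F" "y = q v" using q_surj by blast
  have "h (x \<otimes> y) = h (q (u \<otimes>\<^bsub>?F\<^esub> v))" using uv by (simp only: q.hom_mult)
  thus "h (x \<otimes> y) = h x \<otimes>\<^bsub>H\<^esub> h y"
   using uv by (simp only: h e.hom_mult q.G.m_closed)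
 qed
 moreover have "h (\<iota> s) = f s" if "s \<in> S" for s
  unfolding \<iota>_def using h[of "[(s, True)]"] that f by auto
 ultimately show ?thesis using that by blast
qed

end

lemma is_raag_obtain:
 assumes "is_raag G"
 obtains S R q where "raag G S R q"
proof -
 obtain S R where SR: "group G" "finite S" "R \<subseteq> S \<times> S" "G \<cong> raag_presentation S R"
  using assms unfolding is_raag_def by blast
 let ?F = "free_group S"
 let ?N = "normal_closure_in ?F {group_commutator ?F [(s, True)] [(t, True)] | s t. (s, t) \<in> R}"
 interpret G: group G by fact
 interpret F: group ?F by (rule group_free_group)
 let ?C = "{group_commutator ?F [(s, True)] [(t, True)] | s t. (s, t) \<in> R}"
 have C: "?C \<subseteq> carrier ?F"
 proof safe
  fix s t assume "(s, t) \<in> R"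
  hence "[(s, True)] \<in> carrier ?F" "[(t, True)] \<in> carrier ?F" using SR by auto
  thus "group_commutator ?F [(s, True)] [(t, True)] \<in> carrier ?F"
   unfolding group_commutator_def by (intro F.m_closed F.inv_closed)
 qed
 have "?N \<lhd> ?F" unfolding normal_closure_in_def
 proof (rule F.normal_generateI)
  show "{g \<otimes>\<^bsub>?F\<^esub> r \<otimes>\<^bsub>?F\<^esub> inv\<^bsub>?F\<^esub> g | g r. g \<in> carrier ?F \<and> r \<in> ?C} \<subseteq> carrier ?F"
   using C F.m_closed F.inv_closed by blast
  fix h g assume "h \<in> {g \<otimes>\<^bsub>?F\<^esub> r \<otimes>\<^bsub>?F\<^esub> inv\<^bsub>?F\<^esub> g | g r. g \<in> carrier ?F \<and> r \<in> ?C}" and g: "g \<in> carrier ?F"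
  then obtain k r where k: "k \<in> carrier ?F" "r \<in> ?C" "h = k \<otimes>\<^bsub>?F\<^esub> r \<otimes>\<^bsub>?F\<^esub> inv\<^bsub>?F\<^esub> k" by blast
  have r: "r \<in> carrier ?F" using k C by blast
  have "g \<otimes>\<^bsub>?F\<^esub> h \<otimes>\<^bsub>?F\<^esub> inv\<^bsub>?F\<^esub> g = (g \<otimes>\<^bsub>?F\<^esub> k) \<otimes>\<^bsub>?F\<^esub> r \<otimes>\<^bsub>?F\<^esub> inv\<^bsub>?F\<^esub> (g \<otimes>\<^bsub>?F\<^esub> k)"
   unfolding k(3) using g k(1) r
   by (simp only: F.inv_mult_group F.m_assoc F.m_closed F.inv_closed)
  thus "g \<otimes>\<^bsub>?F\<^esub> h \<otimes>\<^bsub>?F\<^esub> inv\<^bsub>?F\<^esub> g \<in> {g \<otimes>\<^bsub>?F\<^esub> r \<otimes>\<^bsub>?F\<^esub> inv\<^bsub>?F\<^esub> g | g r. g \<in> carrier ?F \<and> r \<in> ?C}"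
   using F.m_closed[OF g k(1)] k(2) by blast
 qed
 then interpret N: normal ?N ?F .
 have "raag_presentation S R = ?F Mod ?N" by (simp add: raag_presentation_def)
 hence "?F Mod ?N \<cong> G" using SR G.iso_sym by metis
 then obtain \<phi> where phi: "\<phi> \<in> iso (?F Mod ?N) G" unfolding is_iso_def by blast
 let ?r = "\<lambda>w. ?N #>\<^bsub>?F\<^esub> w"
 have r: "?r \<in> hom ?F (?F Mod ?N)" by (rule N.r_coset_hom_Mod)
 have hom: "\<phi> \<circ> ?r \<in> hom ?F G" using r phi by (auto simp: iso_def intro: hom_compose)
 have surj: "(\<phi> \<circ> ?r) ` carrier ?F = carrier G"
 proof -
  have "?r ` carrier ?F = carrier (?F Mod ?N)" unfolding FactGroup_def RCOSETS_def by auto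
  hence "(\<phi> \<circ> ?r) ` carrier ?F = \<phi> ` carrier (?F Mod ?N)" by (simp only: image_comp[symmetric])
  thus ?thesis using phi by (simp add: iso_def bij_betw_def del: free_group_simps)
 qed
 have ker: "kernel ?F G (\<phi> \<circ> ?r) = ?N"
 proof -
  have inj: "inj_on \<phi> (carrier (?F Mod ?N))" using phi by (simp add: iso_def bij_betw_def)
  have grp: "group (?F Mod ?N)" by (rule N.factorgroup_is_group)
  have one: "\<phi> ?N = \<one>\<^bsub>G\<^esub>"
   using phi grp SR(1) hom_one[of \<phi> "?F Mod ?N" G] by (simp add: iso_def)
  have mem: "?r w \<in> carrier (?F Mod ?N)" if "w \<in> carrier ?F" for w
   using that r by (auto simp: hom_def)
  have Nm: "?N \<in> carrier (?F Mod ?N)" using group.is_monoid[OF grp] monoid.one_closed by fastforce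
  have "(\<phi> (?r w) = \<one>\<^bsub>G\<^esub>) = (w \<in> ?N)" if w: "w \<in> carrier ?F" for w
  proof -
   have "(\<phi> (?r w) = \<one>\<^bsub>G\<^esub>) = (?r w = ?N)"
    using inj_on_eq_iff[OF inj mem[OF w] Nm] one by simp
   also have "\<dots> = (w \<in> ?N)"
    using F.coset_join1[OF _ w N.subgroup_axioms] F.coset_join2[OF w N.subgroup_axioms] by blast
   finally show ?thesis .
  qed
  thus ?thesis unfolding kernel_def using N.subset by auto
 qed
 show ?thesis
  using that[of S R "\<phi> \<circ> ?r"] SR hom surj ker by (simp add: raag_def raag_axioms_def)
qed

section \<open>Cancellation in free groups, and prefixes fixed by a renaming of letters\<close>

section \<open>Reduced words\<close>

lemma reduced_appendD1: "reduced (u @ v) ==> reduced u"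
proof (induction u rule: induct_list012)
 case (3 x y zs)
 hence "y \<noteq> linv x" "reduced (y # zs @ v)" by (simp_all add: reduced_Cons_Cons del: free_red_Cons)
 thus ?case using 3 by (simp add: reduced_Cons_Cons del: free_red_Cons)
qed auto

lemma reduced_take: "reduced v ==> reduced (take i v)"
 using reduced_appendD1[of "take i v" "drop i v"] by simp

lemma reduced_drop: "reduced v ==> reduced (drop i v)"
proof (induction i arbitrary: v)
 case (Suc i)
 thus ?case
 proof (cases v)
  case (Cons y ys)
  thus ?thesis using Suc.IH[of ys] Suc.prems reduced_tl[of y ys] by (simp del: free_red_Cons)
 qed simp
qed simp

lemma reduced_join: "reduced (a @ [y]) ==> reduced (y # b) ==> reduced (a @ y # b)"
proof (induction a rule: induct_list012)
 case (2 x)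
 thus ?case by (simp add: reduced_Cons_Cons del: free_red_Cons)
next
 case (3 x z zs)
 hence "z \<noteq> linv x" "reduced (z # zs @ [y])" by (simp_all add: reduced_Cons_Cons del: free_red_Cons)
 thus ?case using 3 by (simp add: reduced_Cons_Cons del: free_red_Cons)
qed auto

lemma free_red_eq_if_length: "length (free_red w) = length w ==> free_red w = w"
proof (induction w)
 case (Cons x w)
 thus ?case using length_free_red[of w] by (cases "free_red w") (auto split: if_splits)
qed simp

text \<open>j is the number of letters that cancel where u meets v. One j serves all prefixes of v
  that are at least that long, which is what allows prefixes to be compared with v itself in
  \<open>fixed_prefix\<close>.\<close>

lemma free_red_take:
 assumes "reduced u" "reduced v"
 shows "\<exists>j \<le> length u. j \<le> length v \<and>
  (\<forall>i\<ge>j. free_red (u @ take i v) = take (length u - j) u @ drop j (take i v))"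
 using assms(1)
proof (induction u)
 case Nil
 thus ?case using reduced_take[OF assms(2)] by auto
next
 case (Cons x u)
 then obtain j where j: "j \<le> length u" "j \<le> length v"
  "\<And>i. i \<ge> j ==> free_red (u @ take i v) = take (length u - j) u @ drop j (take i v)"
  using reduced_tl by blast
 show ?case
 proof (cases "j < length u")
  case True
  then obtain y u' where u: "u = y # u'" by (cases u) auto
  have "y \<noteq> linv x" using Cons.prems u by (simp add: reduced_Cons_Cons del: free_red_Cons)
  hence "free_red ((x # u) @ take i v) = take (length (x # u) - j) (x # u) @ drop j (take i v)"
   if "i \<ge> j" for i
   using j(3)[OF that] True u by (cases j) (auto simp: Suc_diff_le take_Cons' split: if_splits)
  thus ?thesis using j by (intro exI[of _ j]) auto
 next
  case False
  hence ju: "j = length u" using j by simp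
  hence red: "free_red (u @ take i v) = drop j (take i v)" if "i \<ge> j" for i
   using j(3)[OF that] by simp
  show ?thesis
  proof (cases "j < length v \<and> v ! j = linv x")
   case True
   have "free_red ((x # u) @ take i v) = drop (Suc j) (take i v)" if "i \<ge> Suc j" for i
   proof -
    have "drop j (take i v) = v ! j # drop (Suc j) (take i v)"
     using True that by (subst Cons_nth_drop_Suc[symmetric]) auto
    thus ?thesis using red[of i] that True by simp
   qed
   thus ?thesis using ju True by (intro exI[of _ "Suc j"]) auto
  next
   case False
   have "free_red ((x # u) @ take i v) = x # drop j (take i v)" if "i \<ge> j" for i
   proof (cases "drop j (take i v)")
    case Nil
    thus ?thesis using red[OF that] by simp
   next
    case (Cons y ys)
    hence "j < length (take i v)" using drop_eq_Nil2 not_le_imp_less by fastforce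
    hence "y = v ! j" "j < length v" using nth_via_drop[OF Cons] by auto
    thus ?thesis using red[OF that] Cons False by auto
   qed
   thus ?thesis using ju j by (intro exI[of _ j]) auto
  qed
 qed
qed

definition height :: "('s \<times> bool) list => int" where
 "height w = (\<Sum>x\<leftarrow>w. if snd x then 1 else - 1)"

lemma height_simps [simp]: "height [] = 0" "height (x # w) = (if snd x then 1 else - 1) + height w"
 "height (u @ v) = height u + height v"
 by (simp_all add: height_def)

lemma height_free_red [simp]: "height (free_red w) = height w"
proof (induction w)
 case (Cons x w)
 thus ?case by (cases "free_red w") auto
qed simp

lemma abs_height_le: "\<bar>height w\<bar> \<le> int (length w)"
 by (induction w) auto

definition wmap :: "('s => 't) => ('s \<times> bool) list => ('t \<times> bool) list" where
 "wmap \<sigma> = map (apfst \<sigma>)"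

lemma wmap_simps [simp]: "wmap \<sigma> [] = []" "wmap \<sigma> (x # w) = apfst \<sigma> x # wmap \<sigma> w"
 "wmap \<sigma> (u @ v) = wmap \<sigma> u @ wmap \<sigma> v" "length (wmap \<sigma> w) = length w"
 "height (wmap \<sigma> w) = height w" "fst ` set (wmap \<sigma> w) = \<sigma> ` fst ` set w"
 by (induction w) (auto simp: wmap_def image_image height_def)

lemma wmap_take: "wmap \<sigma> (take i v) = take i (wmap \<sigma> v)"
 and wmap_drop: "wmap \<sigma> (drop i v) = drop i (wmap \<sigma> v)"
 by (simp_all add: wmap_def take_map drop_map)

lemma wmap_free_red:
 assumes "inj_on \<sigma> C"
 shows "fst ` set w \<subseteq> C ==> free_red (wmap \<sigma> w) = wmap \<sigma> (free_red w)"
proof (induction w)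
 case (Cons x w)
 hence IH: "free_red (wmap \<sigma> w) = wmap \<sigma> (free_red w)" by simp
 show ?case
 proof (cases "free_red w")
  case Nil
  thus ?thesis using IH by simp
 next
  case (Cons y ys)
  hence "fst y \<in> C" "fst x \<in> C" using Cons.prems free_red_letters[of w C] by auto
  hence "apfst \<sigma> y = linv (apfst \<sigma> x) \<longleftrightarrow> y = linv x"
   using assms by (auto simp: linv_def prod_eq_iff inj_on_eq_iff)
  thus ?thesis using IH Cons by simp
 qed
qed simp

text \<open>The equation says that v is almost invariant under renaming by \<sigma> followed by left
  multiplication with \<delta>. Away from both ends, the image of a prefix of v of length i is again
  a prefix of v, of length \<open>i + length \<delta> - 2 * j\<close>. Since \<delta> has height 0,
  a nonzero shift would make the heights of prefixes periodic and hence bounded, against the large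
  height of v. So the shift is 0.\<close>

lemma fixed_prefix:
 assumes red: "reduced \<delta>" "reduced v" "reduced \<kappa>" and inj: "inj_on \<sigma> C" and C: "fst ` set v \<subseteq> C"
  and eq: "free_red (\<delta> @ wmap \<sigma> v) = free_red (v @ \<kappa>)"
  and K: "length \<delta> \<le> K" "length \<kappa> \<le> K"
  and h: "height \<delta> = 0" "\<bar>height v\<bar> > 4 * int K"
  and i: "K \<le> i" "i + 2 * K \<le> length v"
 shows "free_red (\<delta> @ wmap \<sigma> (take i v)) = take i v"
proof -
 let ?L = "length v" and ?m = "length \<delta>"
 have redw: "reduced (wmap \<sigma> v)" using wmap_free_red[OF inj C] red by simp
 obtain j where j: "j \<le> ?m" "j \<le> ?L" "\<And>i. i \<ge> j ==> free_red (\<delta> @ take i (wmap \<sigma> v))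
   = take (?m - j) \<delta> @ drop j (take i (wmap \<sigma> v))"
  using free_red_take[OF red(1) redw] by auto
 obtain l where l: "l \<le> length \<kappa>" "l \<le> ?L" "free_red (v @ \<kappa>) = take (?L - l) v @ drop l \<kappa>"
  using free_red_take[OF red(2) red(3)] by (metis nle_le order_refl take_all_iff)
 have W: "take (?m - j) \<delta> @ drop j (wmap \<sigma> v) = take (?L - l) v @ drop l \<kappa>"
  using j(3)[of ?L] j(2) eq l(3) by simp
 have L: "?L > 4 * K" using h(2) abs_height_le[of v] by linarith
 \<comment> \<open>K <= i completes the cancellation with \<delta>; the margin 2 K at the other end
   keeps a prefix that is up to K longer clear of the at most K letters of v cancelled by
   \<kappa>.\<close>
 have A: "free_red (\<delta> @ wmap \<sigma> (take i v)) = take (i + ?m - 2 * j) v"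
  if i: "K \<le> i" "i + 2 * K \<le> ?L" for i
 proof -
  have "free_red (\<delta> @ wmap \<sigma> (take i v)) = take (?m - j) \<delta> @ drop j (take i (wmap \<sigma> v))"
   using j(1,3) K i by (simp add: wmap_take)
  also have "\<dots> = take (i + ?m - 2 * j) (take (?m - j) \<delta> @ drop j (wmap \<sigma> v))"
  proof -
   have "i + ?m - 2 * j - (?m - j) = i - j" "i + ?m - 2 * j \<ge> ?m - j" using j(1) K i by linarith+
   thus ?thesis by (simp add: drop_take)
  qed
  also have "\<dots> = take (i + ?m - 2 * j) v"
  proof -
   have "i + ?m - 2 * j \<le> ?L - l" using i K l j(1) by linarith
   thus ?thesis unfolding W by simp
  qed
  finally show ?thesis .
 qed
 define H where "H i = height (take i v)" for i
 have HA: "H i = H (i + ?m - 2 * j)" if "K \<le> i" "i + 2 * K \<le> ?L" for i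
 proof -
  have "height (free_red (\<delta> @ wmap \<sigma> (take i v))) = H i" using h(1) by (simp add: H_def)
  thus ?thesis using A[OF that] by (simp add: H_def)
 qed
 have "?m = 2 * j"
 proof (rule ccontr)
  assume ne: "?m \<noteq> 2 * j"
  \<comment> \<open>e is the size of the shift; it is at most K because j lies between 0 and the
    length of \<delta>.\<close>
  obtain e where e: "e \<ge> 1" "e \<le> K" "\<And>i. 2 * K \<le> i ==> i + 2 * K \<le> ?L ==> H i = H (i - e)"
  proof (cases "?m > 2 * j")
   case True
   have "H i = H (i - (?m - 2 * j))" if "2 * K \<le> i" "i + 2 * K \<le> ?L" for i
   proof -
    have "H (i - (?m - 2 * j)) = H (i - (?m - 2 * j) + ?m - 2 * j)" by (rule HA) (use that True K in linarith)+
    moreover have "i - (?m - 2 * j) + ?m - 2 * j = i" using that True K by linarith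
    ultimately show ?thesis by (simp only:)
   qed
   thus ?thesis using that[of "?m - 2 * j"] True K by auto
  next
   case False
   have "H i = H (i - (2 * j - ?m))" if "2 * K \<le> i" "i + 2 * K \<le> ?L" for i
   proof -
    have "i + ?m - 2 * j = i - (2 * j - ?m)" using False by linarith
    moreover have "H i = H (i + ?m - 2 * j)" by (rule HA) (use \<open>2 * K \<le> i\<close> \<open>i + 2 * K \<le> ?L\<close> in linarith)+
    ultimately show ?thesis by (simp only:)
   qed
   thus ?thesis using that[of "2 * j - ?m"] False ne K j(1) by auto
  qed
  have bound: "\<bar>H i\<bar> \<le> 2 * int K" if "i + 2 * K \<le> ?L" for i
   using that
  proof (induction i rule: less_induct)
   case (less i)
   show ?case
   proof (cases "i < 2 * K")
    case True
    thus ?thesis using abs_height_le[of "take i v"] by (simp add: H_def)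
   next
    case False
    hence "i - e < i" "i - e + 2 * K \<le> ?L" using e(1,2) less.prems by linarith+
    hence "\<bar>H (i - e)\<bar> \<le> 2 * int K" by (rule less.IH)
    moreover have "H i = H (i - e)" using e(3) False less.prems by simp
    ultimately show ?thesis by (simp only:)
   qed
  qed
  \<comment> \<open>The long prefix and the last 2 K letters contribute at most 2 K each, together
    less than the assumed height.\<close>
  have "height v = H (?L - 2 * K) + height (drop (?L - 2 * K) v)"
   unfolding H_def height_simps(3)[symmetric] by simp
  moreover have "\<bar>height (drop (?L - 2 * K) v)\<bar> \<le> 2 * int K"
   using abs_height_le[of "drop (?L - 2 * K) v"] L by simp
  ultimately show False using bound[of "?L - 2 * K"] h(2) L by simp
 qed
 thus ?thesis using A[OF i] by simp
qed

text \<open>Two consecutive fixed prefixes differ by exactly one letter; comparing lengths rules out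
  a cancellation at the end.\<close>

lemma fixed_letter:
 assumes "free_red (\<delta> @ wmap \<sigma> (take i v)) = take i v"
  and "free_red (\<delta> @ wmap \<sigma> (take (Suc i) v)) = take (Suc i) v" and i: "i < length v"
 shows "apfst \<sigma> (v ! i) = v ! i"
proof -
 have t: "take (Suc i) v = take i v @ [v ! i]" using i by (rule take_Suc_conv_app_nth)
 have "free_red (take i v @ [apfst \<sigma> (v ! i)]) = free_red (free_red (\<delta> @ wmap \<sigma> (take i v)) @ [apfst \<sigma> (v ! i)])"
  using assms(1) by simp
 also have "\<dots> = free_red (\<delta> @ wmap \<sigma> (take (Suc i) v))" by (simp only: free_red_append_left t wmap_simps append_assoc)
 also have "\<dots> = take i v @ [v ! i]" using assms(2) t by simp
 finally have f: "free_red (take i v @ [apfst \<sigma> (v ! i)]) = take i v @ [v ! i]" .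
 hence "free_red (take i v @ [apfst \<sigma> (v ! i)]) = take i v @ [apfst \<sigma> (v ! i)]"
  by (intro free_red_eq_if_length) simp
 thus ?thesis using f by simp
qed

section \<open>Semidirect products, later a target for \<open>extend_hom\<close>\<close>

section \<open>Semidirect products\<close>

definition semidirect :: "('w, 'c) monoid_scheme => ('a, 'b) monoid_scheme => ('a => 'w => 'w) => ('w \<times> 'a) monoid" where
 "semidirect F G \<alpha> = \<lparr>carrier = carrier F \<times> carrier G,
  mult = (\<lambda>(u, g) (v, h). (u \<otimes>\<^bsub>F\<^esub> \<alpha> g v, g \<otimes>\<^bsub>G\<^esub> h)), one = (\<one>\<^bsub>F\<^esub>, \<one>\<^bsub>G\<^esub>)\<rparr>"

lemma semidirect_simps [simp]: "carrier (semidirect F G \<alpha>) = carrier F \<times> carrier G"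
 "(u, g) \<otimes>\<^bsub>semidirect F G \<alpha>\<^esub> (v, h) = (u \<otimes>\<^bsub>F\<^esub> \<alpha> g v, g \<otimes>\<^bsub>G\<^esub> h)"
 "\<one>\<^bsub>semidirect F G \<alpha>\<^esub> = (\<one>\<^bsub>F\<^esub>, \<one>\<^bsub>G\<^esub>)"
 by (simp_all add: semidirect_def)

lemma group_semidirect:
 assumes "group F" "group G" and hom: "\<And>g. g \<in> carrier G ==> \<alpha> g \<in> hom F F"
  and act: "\<And>g h u. g \<in> carrier G ==> h \<in> carrier G ==> u \<in> carrier F ==> \<alpha> (g \<otimes>\<^bsub>G\<^esub> h) u = \<alpha> g (\<alpha> h u)"
  and one: "\<And>u. u \<in> carrier F ==> \<alpha> \<one>\<^bsub>G\<^esub> u = u"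
 shows "group (semidirect F G \<alpha>)"
proof -
 interpret F: group F by fact
 interpret G: group G by fact
 have cl: "\<alpha> g u \<in> carrier F" if "g \<in> carrier G" "u \<in> carrier F" for g u
  using hom that by (auto simp: hom_def)
 have mu: "\<alpha> g (u \<otimes>\<^bsub>F\<^esub> v) = \<alpha> g u \<otimes>\<^bsub>F\<^esub> \<alpha> g v"
  if "g \<in> carrier G" "u \<in> carrier F" "v \<in> carrier F" for g u v
  using hom that by (auto simp: hom_def)
 show ?thesis
 proof (rule groupI)
  fix x assume "x \<in> carrier (semidirect F G \<alpha>)"
  then obtain u g where x: "x = (u, g)" "u \<in> carrier F" "g \<in> carrier G" by auto
  let ?y = "(\<alpha> (inv\<^bsub>G\<^esub> g) (inv\<^bsub>F\<^esub> u), inv\<^bsub>G\<^esub> g)"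
  have "\<alpha> (inv\<^bsub>G\<^esub> g) \<one>\<^bsub>F\<^esub> = \<one>\<^bsub>F\<^esub>"
   using hom_one[OF hom[of "inv\<^bsub>G\<^esub> g"]] x assms(1) by simp
  hence "?y \<otimes>\<^bsub>semidirect F G \<alpha>\<^esub> x = \<one>\<^bsub>semidirect F G \<alpha>\<^esub>"
   using x mu[of "inv\<^bsub>G\<^esub> g" "inv\<^bsub>F\<^esub> u" u, symmetric] by simp
  thus "\<exists>y\<in>carrier (semidirect F G \<alpha>). y \<otimes>\<^bsub>semidirect F G \<alpha>\<^esub> x = \<one>\<^bsub>semidirect F G \<alpha>\<^esub>"
   using x cl by (intro bexI[of _ ?y]) auto
 qed (auto simp: cl mu act one F.m_assoc G.m_assoc)
qed

section \<open>Exponents, centralizers of letters, and a crossed homomorphism to words in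
  cosets\<close>

section \<open>Letters, exponents and stars\<close>

lemma (in group) commutes_pow:
 "x \<in> carrier G ==> y \<in> carrier G ==> x \<otimes> y = y \<otimes> x ==> x \<otimes> y [^] (n::nat) = y [^] n \<otimes> x"
proof (induction n)
 case (Suc n)
 have "x \<otimes> y [^] Suc n = (x \<otimes> y [^] n) \<otimes> y" using Suc.prems(1,2) by (simp add: m_assoc)
 also have "\<dots> = y [^] n \<otimes> (x \<otimes> y)" using Suc by (simp add: m_assoc)
 finally show ?case using Suc by (simp add: m_assoc)
qed simp

lemma (in group) commutes_inv:
 "x \<in> carrier G ==> y \<in> carrier G ==> x \<otimes> y = y \<otimes> x ==> x \<otimes> inv y = inv y \<otimes> x"
proof -
 assume xy: "x \<in> carrier G" "y \<in> carrier G" "x \<otimes> y = y \<otimes> x"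
 have "inv y \<otimes> (y \<otimes> x) \<otimes> inv y = inv y \<otimes> (x \<otimes> y) \<otimes> inv y" using xy by simp
 moreover have "inv y \<otimes> (y \<otimes> x) = x" using xy(1,2) by (simp add: m_assoc[symmetric])
 moreover have "inv y \<otimes> (x \<otimes> y) \<otimes> inv y = inv y \<otimes> x" using xy(1,2) by (simp add: m_assoc)
 ultimately show ?thesis by simp
qed

lemma (in group) generate_commute:
 assumes "z \<in> carrier G" "A \<subseteq> carrier G" "\<And>a. a \<in> A ==> z \<otimes> a = a \<otimes> z" and x: "x \<in> generate G A"
 shows "z \<otimes> x = x \<otimes> z"
 using x
proof induction
 case (inv a)
 hence "a \<in> carrier G" using assms by auto
 thus ?case using commutes_inv assms inv by auto
next
 case (eng a b)
 hence "a \<in> carrier G" "b \<in> carrier G" using generate_in_carrier assms by auto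
 hence "z \<otimes> (a \<otimes> b) = (z \<otimes> a) \<otimes> b" using assms by (simp add: m_assoc)
 also have "\<dots> = a \<otimes> (z \<otimes> b)" using \<open>a \<in> carrier G\<close> \<open>b \<in> carrier G\<close> assms eng by (simp add: m_assoc)
 finally show ?case using \<open>a \<in> carrier G\<close> \<open>b \<in> carrier G\<close> assms eng by (simp add: m_assoc)
qed (use assms in auto)

lemma hom_nat_pow:
 assumes "group G" "group H" "h \<in> hom G H" "x \<in> carrier G"
 shows "h (x [^]\<^bsub>G\<^esub> (n::nat)) = h x [^]\<^bsub>H\<^esub> n"
 using assms group_hom.hom_nat_pow[of G H h x n] by (simp add: group_hom_def group_hom_axioms_def)

context raag
begin

definition adj :: "nat => nat => bool" where
 "adj s t \<longleftrightarrow> s = t \<or> (s, t) \<in> R \<or> (t, s) \<in> R"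

definition star :: "nat => nat set" where "star s = {t \<in> S. adj s t}"

text \<open>In a RAAG this is the centralizer of the letter s; \<open>St_commute\<close> is the
  direction that enters the argument.\<close>

definition St :: "nat => 'a set" where "St s = generate G (\<iota> ` star s)"

lemma star_subset: "star s \<subseteq> S" by (auto simp: star_def)

lemma iota_star: "\<iota> ` star s \<subseteq> carrier G" using star_subset iota_image by blast

lemma subgroup_St: "subgroup (St s) G"
 unfolding St_def by (rule generate_is_subgroup[OF iota_star])

lemma St_closed: "x \<in> St s ==> x \<in> carrier G" using subgroup.subset[OF subgroup_St] by blast

lemma adj_commute: "adj s t ==> \<iota> s \<otimes> \<iota> t = \<iota> t \<otimes> \<iota> s"
 using letters_commute[of s t] letters_commute[of t s] unfolding adj_def by auto

lemma St_commute: "s \<in> S ==> x \<in> St s ==> \<iota> s \<otimes> x = x \<otimes> \<iota> s"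
 unfolding St_def
 by (rule generate_commute[OF _ iota_star]) (auto simp: star_def intro: adj_commute)

lemma ex_expo: "\<exists>h. h \<in> hom G integer_group \<and> (\<forall>t\<in>S. h (\<iota> t) = (if t = s then 1 else 0))"
proof -
 obtain h where "h \<in> hom G integer_group" "\<And>t. t \<in> S ==> h (\<iota> t) = (if t = s then 1 else 0 :: int)"
  by (rule extend_hom[of integer_group "\<lambda>t. if t = s then 1 else 0"]) auto
 thus ?thesis by blast
qed

definition expo :: "nat => 'a => int" where
 "expo s = (SOME h. h \<in> hom G integer_group \<and> (\<forall>t\<in>S. h (\<iota> t) = (if t = s then 1 else 0)))"

lemma expo_hom: "expo s \<in> hom G integer_group"
 and expo_iota: "t \<in> S ==> expo s (\<iota> t) = (if t = s then 1 else 0)"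
 using someI_ex[OF ex_expo[of s]] unfolding expo_def by auto

lemma expo_mult [simp]: "x \<in> carrier G ==> y \<in> carrier G ==> expo s (x \<otimes> y) = expo s x + expo s y"
 using expo_hom[of s] by (auto simp: hom_def)

lemma expo_one [simp]: "expo s \<one> = 0"
 using hom_one[OF expo_hom[of s]] by (simp add: is_group)

lemma expo_inv [simp]: "x \<in> carrier G ==> expo s (inv x) = - expo s x"
 using expo_mult[of "inv x" x s] by simp

lemma expo_pow [simp]: "x \<in> carrier G ==> expo s (x [^] (n::nat)) = int n * expo s x"
 by (induction n) (auto simp: algebra_simps)

text \<open>\<delta> is the crossed homomorphism that sends s to the one-letter word
  \<open>St s\<close> and all other letters to the empty word: for a word of x it lists, with signs,
  the cosets of \<open>St s\<close> at which s is read. If x has exponent 0 and commutes with Y,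
  then for large M the word of Y^M is almost invariant under x, and by \<open>fixed_prefix\<close> x
  fixes its letter number K. The words of Y^M and Z^M share their first K + 1 letters, so all of XX
  fixes one coset of \<open>St s\<close>, which is the claim. Words of elements of the subgroup of U
  use only cosets with a representative in that subgroup.\<close>

lemma subset_common_coset:
 assumes s: "s \<in> S" and U: "U \<subseteq> S" and Y: "Y \<in> generate G (\<iota> ` U)" and Z: "Z \<in> carrier G"
  and YZ: "Y \<otimes> Z = Z \<otimes> Y" and e: "expo s Y = expo s Z" "expo s Y \<noteq> 0"
  and fin: "finite XX" and XX: "XX \<subseteq> carrier G" "\<And>x. x \<in> XX ==> expo s x = 0"
  and comm: "\<And>x. x \<in> XX ==> x \<otimes> Y = Y \<otimes> x \<or> x \<otimes> Z = Z \<otimes> x"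
 shows "\<exists>h\<in>generate G (\<iota> ` U). \<forall>x\<in>XX. inv h \<otimes> x \<otimes> h \<in> St s"
proof -
 \<comment> \<open>All subsets of G serve as letters, since they are visibly closed under
   translation; the cosets that really occur are singled out later as \<open>L\<close>.\<close>
 let ?C = "Pow (carrier G)" and ?U = "generate G (\<iota> ` U)"
 let ?F = "free_group ?C"
 let ?\<alpha> = "\<lambda>g. wmap (l_coset G g)"
 let ?D = "semidirect ?F G ?\<alpha>"
 have lcl: "l_coset G g A \<in> ?C" if "g \<in> carrier G" "A \<in> ?C" for g A
  using that by (auto simp: l_coset_def)
 have lassoc: "l_coset G g (l_coset G h A) = l_coset G (g \<otimes> h) A"
  if "g \<in> carrier G" "h \<in> carrier G" "A \<in> ?C" for g h A
  using that lcos_m_assoc[of A g h] by auto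
 have inj: "inj_on (l_coset G g) ?C" if "g \<in> carrier G" for g
 proof (rule inj_on_inverseI[of _ "l_coset G (inv g)"])
  show "l_coset G (inv g) (l_coset G g A) = A" if A: "A \<in> ?C" for A
   using lassoc[of "inv g" g A] \<open>g \<in> carrier G\<close> A lcos_mult_one[of A] by simp
 qed
 have wred: "free_red (wmap (l_coset G g) w) = wmap (l_coset G g) (free_red w)"
  if "g \<in> carrier G" "fst ` set w \<subseteq> ?C" for g w
  using wmap_free_red[OF inj] that by blast
 have wcl: "fst ` set (wmap (l_coset G g) w) \<subseteq> ?C" if "g \<in> carrier G" "fst ` set w \<subseteq> ?C" for g w
  unfolding wmap_simps(6) using that lcl by blast
 have wassoc: "wmap (l_coset G (g \<otimes> h)) w = wmap (l_coset G g) (wmap (l_coset G h) w)"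
  if "g \<in> carrier G" "h \<in> carrier G" "fst ` set w \<subseteq> ?C" for g h w
  using that(3) by (induction w) (auto simp: lassoc that(1,2) prod_eq_iff)
 have D: "group ?D"
 proof (rule group_semidirect)
  fix g assume g: "g \<in> carrier G"
  show "?\<alpha> g \<in> hom ?F ?F"
  proof (rule homI)
   fix x assume "x \<in> carrier ?F"
   hence "fst ` set x \<subseteq> ?C" "reduced x" by simp_all
   thus "?\<alpha> g x \<in> carrier ?F"
    using wcl[OF g, of x] wred[OF g, of x] by simp
  next
   fix x y assume xy: "x \<in> carrier ?F" "y \<in> carrier ?F"
   hence "fst ` set (x @ y) \<subseteq> ?C" by (simp add: image_Un)
   from wred[OF g this] show "?\<alpha> g (x \<otimes>\<^bsub>?F\<^esub> y) = ?\<alpha> g x \<otimes>\<^bsub>?F\<^esub> ?\<alpha> g y" by simp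
  qed
 next
  fix g h u assume "g \<in> carrier G" "h \<in> carrier G" "u \<in> carrier ?F"
  thus "?\<alpha> (g \<otimes> h) u = ?\<alpha> g (?\<alpha> h u)" by (intro wassoc) simp_all
 next
  fix u assume "u \<in> carrier ?F"
  hence "fst ` set u \<subseteq> ?C" by simp
  thus "?\<alpha> \<one> u = u" by (induction u) (auto simp: prod_eq_iff lcos_mult_one)
 qed (simp_all add: group_free_group is_group)
 have StC: "St s \<in> ?C" using St_closed by auto
 have St_fix: "l_coset G x (St s) = St s" if "x \<in> St s" for x
  using subgroup.lcos_module_rev coset_join3[OF _ subgroup_St] that St_closed by simp
 \<comment> \<open>The relations survive because a letter commuting with s lies in
   \<open>St s\<close> and therefore fixes this coset.\<close>
 define f where "f t = (if t = s then [(St s, True)] else [], \<iota> t)" for t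
 obtain \<Phi> where \<Phi>: "\<Phi> \<in> hom G ?D" "\<And>t. t \<in> S ==> \<Phi> (\<iota> t) = f t"
 proof (rule extend_hom[OF D, of f])
  show "f ` S \<subseteq> carrier ?D" using StC by (auto simp: f_def linv_def)
  fix t u assume tu: "(t, u) \<in> R"
  hence tuS: "t \<in> S" "u \<in> S" using R_sub by auto
  have "\<iota> t \<in> St s" if "u = s" using that tu tuS by (auto simp: St_def star_def adj_def intro: generate.incl)
  moreover have "\<iota> u \<in> St s" if "t = s" using that tu tuS by (auto simp: St_def star_def adj_def intro: generate.incl)
  ultimately show "f t \<otimes>\<^bsub>?D\<^esub> f u = f u \<otimes>\<^bsub>?D\<^esub> f t"
   using letters_commute[OF tu] St_fix by (auto simp: f_def)
 qed blast
 have \<Phi>cl: "\<Phi> x \<in> carrier ?D" if "x \<in> carrier G" for x using \<Phi> that by (auto simp: hom_def)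
 have \<Phi>mult: "\<Phi> (x \<otimes> y) = \<Phi> x \<otimes>\<^bsub>?D\<^esub> \<Phi> y" if "x \<in> carrier G" "y \<in> carrier G" for x y
  using \<Phi> that by (auto simp: hom_def)
 have split_mult: "fst (a \<otimes>\<^bsub>?D\<^esub> b) = free_red (fst a @ ?\<alpha> (snd a) (fst b))"
  "snd (a \<otimes>\<^bsub>?D\<^esub> b) = snd a \<otimes> snd b" for a b by (cases a; cases b; simp)+
 have snd\<Phi>: "snd (\<Phi> x) = x" if "x \<in> carrier G" for x
 proof (rule hom_eqI[OF is_group _ _ _ that])
  show "(\<lambda>x. snd (\<Phi> x)) \<in> hom G G"
   using \<Phi>cl \<Phi>mult split_mult(2) by (intro homI) (auto simp: mem_Times_iff simp del: free_group_simps)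
  show "(\<lambda>x. x) \<in> hom G G" by (auto simp: hom_def)
 qed (simp add: \<Phi>(2) f_def)
 define \<delta> where "\<delta> x = fst (\<Phi> x)" for x
 have \<delta>mult: "\<delta> (x \<otimes> y) = free_red (\<delta> x @ ?\<alpha> x (\<delta> y))" if "x \<in> carrier G" "y \<in> carrier G" for x y
  unfolding \<delta>_def using that by (simp only: \<Phi>mult split_mult snd\<Phi>)
 have \<delta>F: "fst ` set (\<delta> x) \<subseteq> ?C" "reduced (\<delta> x)" if "x \<in> carrier G" for x
  using \<Phi>cl[OF that] by (auto simp: \<delta>_def mem_Times_iff image_subset_iff)
 have \<delta>one: "\<delta> \<one> = []" using hom_one[OF \<Phi>(1) is_group D] by (simp add: \<delta>_def)
 have h\<delta>: "height (\<delta> x) = expo s x" if "x \<in> carrier G" for x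
 proof (rule hom_eqI[OF _ _ expo_hom _ that])
  show "(\<lambda>x. height (\<delta> x)) \<in> hom G integer_group"
   by (intro homI) (simp_all add: \<delta>mult)
 qed (auto simp: expo_iota \<delta>_def \<Phi>(2) f_def)
 have \<delta>inv: "\<delta> (inv x) = free_red (rev (map linv (?\<alpha> (inv x) (\<delta> x))))" if x: "x \<in> carrier G" for x
 proof -
  have "free_red (\<delta> (inv x) @ ?\<alpha> (inv x) (\<delta> x)) = []"
   using \<delta>mult[of "inv x" x] x \<delta>one by simp
  have "rev (map linv (?\<alpha> (inv x) (\<delta> x))) = rev (map linv (?\<alpha> (inv x) (\<delta> x)))" ..
  let ?w = "?\<alpha> (inv x) (\<delta> x)"
  have r: "free_red (?w @ rev (map linv ?w)) = []"
   using free_red_inverse[of "rev (map linv ?w)"] by (simp add: rev_map comp_def)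
  have "\<delta> (inv x) = free_red (\<delta> (inv x) @ free_red (?w @ rev (map linv ?w)))"
   using r \<delta>F(2)[of "inv x"] x by simp
  also have "\<dots> = free_red (free_red (\<delta> (inv x) @ ?w) @ rev (map linv ?w))" by simp
  finally show ?thesis using \<open>free_red (\<delta> (inv x) @ ?w) = []\<close> by simp
 qed
 define L where "L = {l_coset G h (St s) | h. h \<in> ?U}"
 have UG: "?U \<subseteq> carrier G" using U by (intro generate_incl) auto
 have sg: "subgroup ?U G" using U by (intro generate_is_subgroup) auto
 have Lact: "l_coset G g c \<in> L" if g: "g \<in> ?U" and c: "c \<in> L" for g c
 proof -
  obtain h where h: "h \<in> ?U" "c = l_coset G h (St s)" using c by (auto simp: L_def)
  have gh: "g \<otimes> h \<in> ?U" using g h subgroup.m_closed[OF sg] by blast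
  have "l_coset G g c = l_coset G (g \<otimes> h) (St s)"
   unfolding h(2) by (rule lassoc) (use g h UG StC in auto)
  thus ?thesis using gh by (auto simp: L_def)
 qed
 have \<delta>L: "fst ` set (\<delta> g) \<subseteq> L" if "g \<in> ?U" for g
  using that
 proof induction
  case one
  thus ?case by (simp add: \<delta>one)
 next
  case (incl h)
  then obtain t where t: "t \<in> U" "h = \<iota> t" by auto
  have "St s = l_coset G \<one> (St s)" using lcos_mult_one StC by auto
  hence "St s \<in> L" unfolding L_def using generate.one by blast
  thus ?case using t U by (auto simp: \<delta>_def \<Phi>(2) f_def)
 next
  case (inv h)
  hence h: "h \<in> ?U" "h \<in> carrier G" "inv h \<in> ?U" using UG by (auto intro: generate.intros)
  from inv obtain t where t: "t \<in> U" "h = \<iota> t" by auto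
  have "St s = l_coset G \<one> (St s)" using lcos_mult_one StC by auto
  hence "St s \<in> L" unfolding L_def using generate.one by blast
  hence "fst ` set (\<delta> h) \<subseteq> L" using t U by (auto simp: \<delta>_def \<Phi>(2) f_def)
  hence "fst ` set (rev (map linv (?\<alpha> (inv h) (\<delta> h)))) \<subseteq> L"
   using Lact[OF h(3)] by (auto simp: image_image wmap_def)
  thus ?case unfolding \<delta>inv[OF h(2)] by (rule free_red_letters)
 next
  case (eng g h)
  hence 1: "fst ` set (\<delta> g @ ?\<alpha> g (\<delta> h)) \<subseteq> L" using Lact by (auto simp: image_Un)
  have "g \<in> carrier G" "h \<in> carrier G" using eng UG by auto
  thus ?case using free_red_letters[OF 1] by (simp only: \<delta>mult)
 qed
 have Yc: "Y \<in> carrier G" using Y UG by auto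
 \<comment> \<open>The quotient of Z and Y has exponent 0 and commutes with Y, so it can be treated
   like the elements of XX.\<close>
 define w where "w = Z \<otimes> inv Y"
 have wc: "w \<in> carrier G" using Yc Z by (simp add: w_def)
 have wY: "w \<otimes> Y = Y \<otimes> w"
 proof -
  have "w \<otimes> Y = Z" using Yc Z by (simp add: w_def m_assoc)
  moreover have "Y \<otimes> w = (Y \<otimes> Z) \<otimes> inv Y" using Yc Z by (simp add: w_def m_assoc)
  moreover have "\<dots> = Z" using Yc Z unfolding YZ by (simp add: m_assoc)
  ultimately show ?thesis by simp
 qed
 have Zw: "Z = w \<otimes> Y" using Yc Z by (simp add: w_def m_assoc)
 have ew: "expo s w = 0" using e Yc Z by (simp add: w_def)
 define K where "K = Max ((\<lambda>x. length (\<delta> x)) ` insert w XX)"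
 have K: "length (\<delta> x) \<le> K" if "x \<in> insert w XX" for x
  unfolding K_def using fin that by (intro Max_ge) auto
 \<comment> \<open>K does not depend on M, while the height of the word of Y^M is M times a nonzero
   integer; 4 K + 2 passes the bound of \<open>fixed_prefix\<close> with one letter to
   spare.\<close>
 define M where "M = 4 * K + 2"
 have Mh: "\<bar>expo s (A [^] M)\<bar> > 4 * int K + 1" if "A \<in> carrier G" "expo s A \<noteq> 0" for A
 proof -
  have "\<bar>expo s (A [^] M)\<bar> = int M * \<bar>expo s A\<bar>" using that by (simp add: abs_mult)
  moreover have "int M * \<bar>expo s A\<bar> \<ge> int M * 1" using that by (intro mult_left_mono) auto
  moreover have "int M > 4 * int K + 1" by (simp add: M_def)
  ultimately show ?thesis by linarith
 qed
 have fixp: "free_red (\<delta> x @ ?\<alpha> x (take i (\<delta> (A [^] M)))) = take i (\<delta> (A [^] M))"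
  if A: "A \<in> carrier G" "expo s A \<noteq> 0" and x: "x \<in> insert w XX" "x \<otimes> A = A \<otimes> x"
   and i: "i = K \<or> i = Suc K" for x A i
 proof (rule fixed_prefix[of _ _ "?\<alpha> (A [^] M) (\<delta> x)" _ ?C K])
  have xc: "x \<in> carrier G" using x XX wc by auto
  have Mc: "A [^] M \<in> carrier G" using A by simp
  have xM: "x \<otimes> A [^] M = A [^] M \<otimes> x" using commutes_pow xc A x by auto
  show "free_red (\<delta> x @ ?\<alpha> x (\<delta> (A [^] M))) = free_red (\<delta> (A [^] M) @ ?\<alpha> (A [^] M) (\<delta> x))"
   using \<delta>mult[OF xc Mc] \<delta>mult[OF Mc xc] xM by simp
  show "reduced (?\<alpha> (A [^] M) (\<delta> x))" using wred[OF Mc \<delta>F(1)[OF xc]] \<delta>F(2)[OF xc] by simp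
  show "height (\<delta> x) = 0" using h\<delta>[OF xc] x XX ew by auto
  have hM: "\<bar>height (\<delta> (A [^] M))\<bar> > 4 * int K + 1" using h\<delta>[OF Mc] Mh[OF A] by simp
  thus "4 * int K < \<bar>height (\<delta> (A [^] M))\<bar>" by simp
  show "i + 2 * K \<le> length (\<delta> (A [^] M))"
   using hM abs_height_le[of "\<delta> (A [^] M)"] i by linarith
  show "inj_on (l_coset G x) ?C" using inj xc by blast
 qed (use K x i \<delta>F XX wc A in auto)
 have len: "K < length (\<delta> (A [^] M))" if "A \<in> carrier G" "expo s A \<noteq> 0" for A
  using Mh[OF that] h\<delta>[of "A [^] M"] abs_height_le[of "\<delta> (A [^] M)"] that by simp
 have fixl: "apfst (l_coset G x) (\<delta> (A [^] M) ! K) = \<delta> (A [^] M) ! K"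
  if A: "A \<in> carrier G" "expo s A \<noteq> 0" and x: "x \<in> insert w XX" "x \<otimes> A = A \<otimes> x" for x A
  using fixp[OF A x] len[OF A] by (intro fixed_letter[of "\<delta> x"]) auto
 define vY where "vY = \<delta> (Y [^] M)"
 define vZ where "vZ = \<delta> (Z [^] M)"
 have YMc: "Y [^] M \<in> carrier G" using Yc by simp
 have eY: "expo s Y \<noteq> 0" and eZ: "expo s Z \<noteq> 0" using e by auto
 have vYF: "fst ` set vY \<subseteq> ?C" "reduced vY" unfolding vY_def using \<delta>F[OF YMc] by auto
 have lenY: "K < length vY" unfolding vY_def by (rule len[OF Yc eY])
 \<comment> \<open>The length of the word of w^M is not bounded by K, so the fixed prefix is
   obtained one factor w at a time.\<close>
 have wpow: "free_red (\<delta> (w [^] (n::nat)) @ ?\<alpha> (w [^] n) (take i vY)) = take i vY"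
  if i: "i = K \<or> i = Suc K" for i n
 proof (induction n)
  case 0
  have "?\<alpha> \<one> u = u" if "fst ` set u \<subseteq> ?C" for u
   using that by (induction u) (auto simp: prod_eq_iff lcos_mult_one)
  moreover have "fst ` set (take i vY) \<subseteq> ?C" using vYF(1) set_take_subset[of i vY] by blast
  ultimately have "?\<alpha> \<one> (take i vY) = take i vY" by blast
  thus ?case using reduced_take[OF vYF(2)] by (simp add: \<delta>one)
 next
  case (Suc n)
  have wn: "w [^] n \<in> carrier G" using wc by simp
  have tC: "fst ` set (take i vY) \<subseteq> ?C" using vYF(1) set_take_subset[of i vY] by blast
  have w1: "free_red (\<delta> w @ ?\<alpha> w (take i vY)) = take i vY"
   unfolding vY_def by (rule fixp[OF Yc eY _ wY i]) simp
  have "free_red (\<delta> (w [^] Suc n) @ ?\<alpha> (w [^] Suc n) (take i vY))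
    = free_red (\<delta> (w [^] n) @ ?\<alpha> (w [^] n) (\<delta> w @ ?\<alpha> w (take i vY)))"
   using \<delta>mult[OF wn wc] wassoc[OF wn wc tC] by simp
  also have "\<dots> = free_red (\<delta> (w [^] n) @ free_red (?\<alpha> (w [^] n) (\<delta> w @ ?\<alpha> w (take i vY))))" by simp
  also have "free_red (?\<alpha> (w [^] n) (\<delta> w @ ?\<alpha> w (take i vY))) = ?\<alpha> (w [^] n) (take i vY)"
  proof -
   have "fst ` set (\<delta> w @ ?\<alpha> w (take i vY)) \<subseteq> ?C"
    using \<delta>F(1)[OF wc] wcl[OF wc tC] by (simp add: image_Un)
   from wred[OF wn this] show ?thesis using w1 by simp
  qed
  finally show ?case using Suc by simp
 qed
 have wM: "w [^] M \<in> carrier G" using wc by simp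
 have ZM: "Z [^] M = w [^] M \<otimes> Y [^] M" unfolding Zw using pow_mult_distrib[OF wY wc Yc] by simp
 have lw: "apfst (l_coset G (w [^] M)) (vY ! K) = vY ! K"
  using wpow lenY by (intro fixed_letter[of "\<delta> (w [^] M)"]) auto
 have "vZ = free_red (\<delta> (w [^] M) @ ?\<alpha> (w [^] M) vY)"
  unfolding vZ_def vY_def ZM using \<delta>mult[OF wM YMc] .
 also have "\<dots> = free_red (free_red (\<delta> (w [^] M) @ ?\<alpha> (w [^] M) (take K vY)) @ ?\<alpha> (w [^] M) (drop K vY))"
  unfolding free_red_append_left append_assoc wmap_simps(3)[symmetric] by simp
 also have "\<dots> = free_red (take K vY @ ?\<alpha> (w [^] M) (drop K vY))" using wpow[of K M] by simp
 also have "\<dots> = take K vY @ ?\<alpha> (w [^] M) (drop K vY)"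
 proof -
  have d: "?\<alpha> (w [^] M) (drop K vY) = vY ! K # ?\<alpha> (w [^] M) (drop (Suc K) vY)"
   using lw lenY by (subst Cons_nth_drop_Suc[symmetric]) auto
  have dC: "fst ` set (drop K vY) \<subseteq> ?C" using vYF(1) set_drop_subset[of K vY] by blast
  have "reduced (?\<alpha> (w [^] M) (drop K vY))"
   using wred[OF wM dC] reduced_drop[OF vYF(2), of K] by simp
  moreover have "reduced (take K vY @ [vY ! K])"
   unfolding take_Suc_conv_app_nth[OF lenY, symmetric] by (rule reduced_take[OF vYF(2)])
  ultimately show ?thesis unfolding d by (rule reduced_join[rotated])
 qed
 finally have vZ: "vZ = take K vY @ ?\<alpha> (w [^] M) (drop K vY)" .
 have "vZ ! K = vY ! K"
 proof -
  have "?\<alpha> (w [^] M) (drop K vY) = vY ! K # ?\<alpha> (w [^] M) (drop (Suc K) vY)"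
   using lw lenY by (subst Cons_nth_drop_Suc[symmetric]) auto
  thus ?thesis using vZ lenY by (simp add: nth_append)
 qed
 hence fixed: "apfst (l_coset G x) (vY ! K) = vY ! K" if "x \<in> XX" for x
  using comm[OF that] fixl[OF Yc eY, of x] fixl[OF Z eZ, of x] that by (auto simp: vY_def vZ_def)
 have "Y [^] M \<in> ?U"
  using Y by (induction M) (auto intro: generate.intros)
 hence "fst ` set vY \<subseteq> L" unfolding vY_def by (rule \<delta>L)
 hence "fst (vY ! K) \<in> L" using nth_mem[OF lenY] by blast
 then obtain h where h: "h \<in> ?U" "fst (vY ! K) = l_coset G h (St s)" by (auto simp: L_def)
 have hc: "h \<in> carrier G" using h UG by auto
 have "inv h \<otimes> x \<otimes> h \<in> St s" if x: "x \<in> XX" for x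
 proof -
  have xc: "x \<in> carrier G" using x XX by auto
  have "l_coset G x (l_coset G h (St s)) = l_coset G h (St s)"
   using arg_cong[OF fixed[OF x], of fst] h by simp
  hence "l_coset G (x \<otimes> h) (St s) = l_coset G h (St s)" using lassoc[OF xc hc StC] by simp
  moreover have "x \<otimes> h \<in> l_coset G (x \<otimes> h) (St s)"
   using subgroup.one_closed[OF subgroup_St] xc hc by (force simp: l_coset_def)
  ultimately have "x \<otimes> h \<in> l_coset G h (St s)" by simp
  then obtain k where k: "k \<in> St s" "x \<otimes> h = h \<otimes> k" unfolding l_coset_def by blast
  have "inv h \<otimes> x \<otimes> h = inv h \<otimes> (x \<otimes> h)" using xc hc by (simp only: m_assoc inv_closed)
  also have "\<dots> = (inv h \<otimes> h) \<otimes> k" unfolding k(2) using hc St_closed[OF k(1)] by (simp only: m_assoc inv_closed)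
  also have "\<dots> = k" using hc St_closed[OF k(1)] by simp
  finally show ?thesis using k(1) by simp
 qed
 thus ?thesis using h(1) by blast
qed

end

section \<open>Cup products as obstructions to commuting in a RAAG\<close>

section \<open>Commuting pairs in a RAAG and central extensions\<close>

definition dihedral :: "(int \<times> int) monoid" where
 "dihedral = \<lparr>carrier = {1, - 1} \<times> UNIV, mult = (\<lambda>(e, m) (e', m'). (e * e', m + e * m')), one = (1, 0)\<rparr>"

lemma dihedral_simps [simp]: "carrier dihedral = {1, - 1} \<times> UNIV"
 "(e, m) \<otimes>\<^bsub>dihedral\<^esub> (e', m') = (e * e', m + e * m')" "\<one>\<^bsub>dihedral\<^esub> = (1, 0)"
 by (simp_all add: dihedral_def)

lemma group_dihedral: "group dihedral"
proof (rule groupI)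
 fix x assume "x \<in> carrier dihedral"
 then obtain e m where x: "x = (e, m)" "e = 1 \<or> e = - 1" by auto
 thus "\<exists>y\<in>carrier dihedral. y \<otimes>\<^bsub>dihedral\<^esub> x = \<one>\<^bsub>dihedral\<^esub>"
  by (intro bexI[of _ "(e, - (e * m))"]) auto
qed (auto simp: algebra_simps)

definition bform :: "nat set => (nat => nat => int) => (nat => int) => (nat => int) => int" where
 "bform S \<beta> f g = (\<Sum>i\<in>S. \<Sum>j\<in>S. \<beta> i j * f i * g j)"

lemma bform_add: "bform S \<beta> (\<lambda>i. f i + f' i) g = bform S \<beta> f g + bform S \<beta> f' g"
 "bform S \<beta> f (\<lambda>i. g i + g' i) = bform S \<beta> f g + bform S \<beta> f g'"
 by (simp_all add: bform_def algebra_simps sum.distrib)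

lemma bform_minus: "bform S \<beta> (\<lambda>i. - f i) g = - bform S \<beta> f g"
 by (simp add: bform_def sum_negf)

lemma bform_single:
 assumes "finite S" "s \<in> S" "t \<in> S"
 shows "bform S \<beta> (\<lambda>i. if i = s then 1 else 0) (\<lambda>i. if i = t then 1 else 0) = \<beta> s t"
proof -
 have "bform S \<beta> (\<lambda>i. if i = s then 1 else 0) (\<lambda>i. if i = t then 1 else 0)
  = (\<Sum>i\<in>S. \<Sum>j\<in>S. if j = t then (if i = s then \<beta> i j else 0) else 0)"
  unfolding bform_def by (intro sum.cong) auto
 thus ?thesis using assms by simp
qed

text \<open>The central extension of (Z^2 semidirect {1, -1}) x Z^S by Z whose cocycle is
 the cup product of the two twisted classes plus a bilinear form on Z^S.\<close>

definition twisted :: "nat set => (nat => nat => int) => (int \<times> int \<times> int \<times> (nat => int) \<times> int) monoid" where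
 "twisted S \<beta> = \<lparr>carrier = {(e, m, m', f, c). e = 1 \<or> e = - 1},
  mult = (\<lambda>(e1, m1, m1', f1, c1) (e2, m2, m2', f2, c2).
   (e1 * e2, m1 + e1 * m2, m1' + e1 * m2', \<lambda>i. f1 i + f2 i, c1 + c2 + m1 * e1 * m2' + bform S \<beta> f1 f2)),
  one = (1, 0, 0, \<lambda>_. 0, 0)\<rparr>"

lemma twisted_simps [simp]: "(e, m, m', f, c) \<in> carrier (twisted S \<beta>) \<longleftrightarrow> e = 1 \<or> e = - 1"
 "(e1, m1, m1', f1, c1) \<otimes>\<^bsub>twisted S \<beta>\<^esub> (e2, m2, m2', f2, c2) =
  (e1 * e2, m1 + e1 * m2, m1' + e1 * m2', \<lambda>i. f1 i + f2 i, c1 + c2 + m1 * e1 * m2' + bform S \<beta> f1 f2)"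
 "\<one>\<^bsub>twisted S \<beta>\<^esub> = (1, 0, 0, \<lambda>_. 0, 0)"
 by (simp_all add: twisted_def)

lemma bform_zero [simp]: "bform S \<beta> (\<lambda>_. 0) g = 0"
 by (simp add: bform_def)

lemma group_twisted: "group (twisted S \<beta>)"
proof (rule groupI)
 fix x assume "x \<in> carrier (twisted S \<beta>)"
 then obtain e m m' f c where x: "x = (e, m, m', f, c)" "e = 1 \<or> e = - 1" by (cases x) auto
 let ?y = "(e, - (e * m), - (e * m'), \<lambda>i. - f i, - c + m * m' + bform S \<beta> f f)"
 show "\<exists>y\<in>carrier (twisted S \<beta>). y \<otimes>\<^bsub>twisted S \<beta>\<^esub> x = \<one>\<^bsub>twisted S \<beta>\<^esub>"
  using x by (intro bexI[of _ ?y]) (auto simp: bform_minus)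
next
 fix x y z assume "x \<in> carrier (twisted S \<beta>)" "y \<in> carrier (twisted S \<beta>)" "z \<in> carrier (twisted S \<beta>)"
 then obtain e m m' f c e2 m2 m2' f2 c2 e3 m3 m3' f3 c3 where
  x: "x = (e, m, m', f, c)" "e = 1 \<or> e = - 1" and
  y: "y = (e2, m2, m2', f2, c2)" "e2 = 1 \<or> e2 = - 1" and
  z: "z = (e3, m3, m3', f3, c3)" by (cases x; cases y; cases z) auto
 show "x \<otimes>\<^bsub>twisted S \<beta>\<^esub> y \<otimes>\<^bsub>twisted S \<beta>\<^esub> z = x \<otimes>\<^bsub>twisted S \<beta>\<^esub> (y \<otimes>\<^bsub>twisted S \<beta>\<^esub> z)"
  using x(2) y(2) unfolding x(1) y(1) z by (auto simp: bform_add algebra_simps)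
qed (auto simp: twisted_def)

context raag
begin

text \<open>The letters are lifted to the central extension \<open>twisted\<close>; the condition on
  \<beta> says exactly that the lifts of commuting letters commute. So the images of x and y commute
  as well, and the identity compares the central coordinates of the two products, where sign 1
  removes the twist.\<close>

lemma commuting_pair_identity:
 assumes psi: "\<psi> \<in> hom G dihedral" "\<psi>' \<in> hom G dihedral"
  and sgn: "\<And>s. s \<in> S ==> fst (\<psi> (\<iota> s)) = fst (\<psi>' (\<iota> s))"
  and \<beta>: "\<And>s t. (s, t) \<in> R ==>
   snd (\<psi> (\<iota> s)) * fst (\<psi> (\<iota> s)) * snd (\<psi>' (\<iota> t)) + \<beta> s t =
   snd (\<psi> (\<iota> t)) * fst (\<psi> (\<iota> t)) * snd (\<psi>' (\<iota> s)) + \<beta> t s"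
  and xy: "x \<in> carrier G" "y \<in> carrier G" "x \<otimes> y = y \<otimes> x"
  and one: "fst (\<psi> x) = 1" "fst (\<psi> y) = 1"
 shows "snd (\<psi> x) * snd (\<psi>' y) + bform S \<beta> (\<lambda>i. expo i x) (\<lambda>i. expo i y) =
  snd (\<psi> y) * snd (\<psi>' x) + bform S \<beta> (\<lambda>i. expo i y) (\<lambda>i. expo i x)"
proof -
 let ?T = "twisted S \<beta>"
 define f where "f s = (fst (\<psi> (\<iota> s)), snd (\<psi> (\<iota> s)), snd (\<psi>' (\<iota> s)), \<lambda>i. if i = s then 1 else 0 :: int, 0 :: int)" for s
 have cl: "fst (\<psi> u) = 1 \<or> fst (\<psi> u) = - 1" if "u \<in> carrier G" for u
  using hom_in_carrier[OF psi(1) that] by (auto simp: mem_Times_iff)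
 have mult: "fst (\<psi> (u \<otimes> v)) = fst (\<psi> u) * fst (\<psi> v)" "snd (\<psi> (u \<otimes> v)) = snd (\<psi> u) + fst (\<psi> u) * snd (\<psi> v)"
  "fst (\<psi>' (u \<otimes> v)) = fst (\<psi>' u) * fst (\<psi>' v)" "snd (\<psi>' (u \<otimes> v)) = snd (\<psi>' u) + fst (\<psi>' u) * snd (\<psi>' v)"
  if "u \<in> carrier G" "v \<in> carrier G" for u v
  using hom_mult[OF psi(1) that] hom_mult[OF psi(2) that] by (simp_all add: dihedral_def case_prod_unfold)
 obtain \<Phi> where \<Phi>: "\<Phi> \<in> hom G ?T" "\<And>s. s \<in> S ==> \<Phi> (\<iota> s) = f s"
 proof (rule extend_hom[OF group_twisted[of S \<beta>], of f])
  show "f ` S \<subseteq> carrier ?T" using cl by (auto simp: f_def)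
  fix s t assume st: "(s, t) \<in> R"
  hence S: "s \<in> S" "t \<in> S" using R_sub by auto
  have "\<psi> (\<iota> s \<otimes> \<iota> t) = \<psi> (\<iota> t \<otimes> \<iota> s)" "\<psi>' (\<iota> s \<otimes> \<iota> t) = \<psi>' (\<iota> t \<otimes> \<iota> s)"
   using letters_commute[OF st] by simp_all
  hence "snd (\<psi> (\<iota> s)) + fst (\<psi> (\<iota> s)) * snd (\<psi> (\<iota> t)) = snd (\<psi> (\<iota> t)) + fst (\<psi> (\<iota> t)) * snd (\<psi> (\<iota> s))"
   "snd (\<psi>' (\<iota> s)) + fst (\<psi> (\<iota> s)) * snd (\<psi>' (\<iota> t)) = snd (\<psi>' (\<iota> t)) + fst (\<psi> (\<iota> t)) * snd (\<psi>' (\<iota> s))"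
   using mult(2,4)[of "\<iota> s" "\<iota> t"] mult(2,4)[of "\<iota> t" "\<iota> s"] S sgn by simp_all
  thus "f s \<otimes>\<^bsub>?T\<^esub> f t = f t \<otimes>\<^bsub>?T\<^esub> f s"
   using \<beta>[OF st] S by (auto simp: f_def bform_single finite_S add.commute mult.commute)
 qed blast
 have split: "fst (a \<otimes>\<^bsub>?T\<^esub> b) = fst a * fst b"
  "fst (snd (a \<otimes>\<^bsub>?T\<^esub> b)) = fst (snd a) + fst a * fst (snd b)"
  "fst (snd (snd (a \<otimes>\<^bsub>?T\<^esub> b))) = fst (snd (snd a)) + fst a * fst (snd (snd b))"
  "fst (snd (snd (snd (a \<otimes>\<^bsub>?T\<^esub> b)))) i = fst (snd (snd (snd a))) i + fst (snd (snd (snd b))) i"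
  for a b i by (cases a; cases b; simp)+
 have Tcl: "fst a = 1 \<or> fst a = - 1" if "a \<in> carrier ?T" for a using that by (cases a) auto
 have \<Phi>cl: "fst (\<Phi> u) = 1 \<or> fst (\<Phi> u) = - 1" if "u \<in> carrier G" for u
  using hom_in_carrier[OF \<Phi>(1) that] Tcl by blast
 have 1: "(fst (\<Phi> u), fst (snd (\<Phi> u))) = \<psi> u" if "u \<in> carrier G" for u
 proof (rule hom_eqI[OF group_dihedral _ psi(1) _ that])
  show "(\<lambda>u. (fst (\<Phi> u), fst (snd (\<Phi> u)))) \<in> hom G dihedral"
   by (rule homI) (use \<Phi>cl in \<open>auto simp: hom_mult[OF \<Phi>(1)] split\<close>)
 qed (simp add: \<Phi>(2) f_def)
 have 2: "(fst (\<Phi> u), fst (snd (snd (\<Phi> u)))) = \<psi>' u" if "u \<in> carrier G" for u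
 proof (rule hom_eqI[OF group_dihedral _ psi(2) _ that])
  show "(\<lambda>u. (fst (\<Phi> u), fst (snd (snd (\<Phi> u))))) \<in> hom G dihedral"
   by (rule homI) (use \<Phi>cl in \<open>auto simp: hom_mult[OF \<Phi>(1)] split\<close>)
 qed (simp add: \<Phi>(2) f_def sgn)
 have 3: "fst (snd (snd (snd (\<Phi> u)))) i = expo i u" if "u \<in> carrier G" for u i
 proof (rule hom_eqI[OF _ _ expo_hom _ that])
  show "(\<lambda>u. fst (snd (snd (snd (\<Phi> u)))) i) \<in> hom G integer_group"
   by (rule homI) (auto simp: hom_mult[OF \<Phi>(1)] split)
 qed (auto simp: \<Phi>(2) f_def expo_iota)
 have c: "snd (snd (snd (snd (a \<otimes>\<^bsub>?T\<^esub> b)))) = snd (snd (snd (snd a))) + snd (snd (snd (snd b)))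
   + fst (snd a) * fst a * fst (snd (snd b)) + bform S \<beta> (fst (snd (snd (snd a)))) (fst (snd (snd (snd b))))"
  for a b by (cases a; cases b; simp)
 have form: "fst (\<Phi> u) = fst (\<psi> u)" "fst (snd (\<Phi> u)) = snd (\<psi> u)" "fst (snd (snd (\<Phi> u))) = snd (\<psi>' u)"
  "fst (snd (snd (snd (\<Phi> u)))) = (\<lambda>i. expo i u)" if "u \<in> carrier G" for u
  using arg_cong[OF 1[OF that], of fst] arg_cong[OF 1[OF that], of snd] arg_cong[OF 2[OF that], of snd] 3[OF that] by auto
 have "\<Phi> x \<otimes>\<^bsub>?T\<^esub> \<Phi> y = \<Phi> y \<otimes>\<^bsub>?T\<^esub> \<Phi> x"
  using hom_mult[OF \<Phi>(1) xy(1,2)] hom_mult[OF \<Phi>(1) xy(2,1)] xy(3) by (simp only:)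
 from arg_cong[OF this, of "\<lambda>a. snd (snd (snd (snd a)))"] show ?thesis
  unfolding c form[OF xy(1)] form[OF xy(2)] one by simp
qed

text \<open>In a free group on s and r commuting elements are powers of one element, so their
  exponents are proportional. Here this comes from the extension with trivial dihedral part and the
  matrix unit at (s, r) as form, which is admissible because no relation joins s and r.\<close>

lemma nonadjacent_exponents:
 assumes "s \<in> S" "r \<in> S" "\<not> adj s r" "x \<in> carrier G" "y \<in> carrier G" "x \<otimes> y = y \<otimes> x"
 shows "expo s x * expo r y = expo s y * expo r x"
proof -
 let ?\<beta> = "\<lambda>i j. if i = s \<and> j = r then 1 else 0 :: int"
 have triv: "(\<lambda>_. (1, 0)) \<in> hom G dihedral" by (rule homI) auto
 have b: "bform S ?\<beta> f g = f s * g r" for f g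
 proof -
  have "bform S ?\<beta> f g = (\<Sum>i\<in>S. \<Sum>j\<in>S. if j = r then (if i = s then f i * g j else 0) else 0)"
   unfolding bform_def by (intro sum.cong) auto
  thus ?thesis using assms(1,2) finite_S by simp
 qed
 have sym: "snd (1::int, 0::int) * fst (1::int, 0::int) * snd (1::int, 0::int) + ?\<beta> t u =
   snd (1::int, 0::int) * fst (1::int, 0::int) * snd (1::int, 0::int) + ?\<beta> u t" if "(t, u) \<in> R" for t u
  using that assms(3) by (auto simp: adj_def)
 show ?thesis
  using commuting_pair_identity[OF triv triv refl _ assms(4-6), of ?\<beta>, OF sym] unfolding b by simp
qed

text \<open>Conjugation by c turns m into - m but preserves every exponent, so the bilinear form
  contributes equally to the identities for the pair y, z and for the pair with y conjugated. Their
  difference is 2 m m' = 0.\<close>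

theorem no_twisted_torus:
 assumes psi: "\<psi> \<in> hom G dihedral" "\<psi>' \<in> hom G dihedral"
  and sgn: "\<And>x. x \<in> carrier G ==> fst (\<psi> x) = fst (\<psi>' x)"
  and G: "y \<in> carrier G" "z \<in> carrier G" "c \<in> carrier G"
  and yz: "y \<otimes> z = z \<otimes> y" and cyz: "(c \<otimes> y \<otimes> inv c) \<otimes> z = z \<otimes> (c \<otimes> y \<otimes> inv c)"
  and y: "\<psi> y = (1, m)" "\<psi>' y = (1, 0)" and z: "\<psi> z = (1, 0)" "\<psi>' z = (1, m')"
  and c: "fst (\<psi> c) = - 1" and nz: "m \<noteq> 0" "m' \<noteq> 0"
 shows False
proof -
 define e where "e s = fst (\<psi> (\<iota> s))" for s
 define a where "a s = snd (\<psi> (\<iota> s))" for s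
 define b where "b s = snd (\<psi>' (\<iota> s))" for s
 \<comment> \<open>Any form that balances the twisted cup product on each pair of letters will do;
   the order of the indices makes sure that each pair is corrected once.\<close>
 define \<beta> where "\<beta> s t = (if s < t then a t * e t * b s - a s * e s * b t else 0)" for s t :: nat
 have \<beta>: "a s * e s * b t + \<beta> s t = a t * e t * b s + \<beta> t s" for s t
  by (cases s t rule: linorder_cases) (auto simp: \<beta>_def)
 interpret D: group dihedral by (rule group_dihedral)
 interpret p: group_hom G dihedral \<psi> by unfold_locales (rule psi)
 interpret p': group_hom G dihedral \<psi>' by unfold_locales (rule psi)
 have inv_d: "inv\<^bsub>dihedral\<^esub> (- 1, k) = (- 1, k)" for k
  by (rule D.inv_equality) auto
 have c': "fst (\<psi>' c) = - 1" using c sgn G by simp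
 obtain k where k: "\<psi> c = (- 1, k)" using c by (cases "\<psi> c") auto
 obtain k' where k': "\<psi>' c = (- 1, k')" using c' by (cases "\<psi>' c") auto
 let ?y = "c \<otimes> y \<otimes> inv c"
 have yc: "?y \<in> carrier G" using G by simp
 have py: "\<psi> ?y = (1, - m)" "\<psi>' ?y = (1, 0)" using G k k' y by (simp_all add: inv_d del: dihedral_simps(1))
 have ey: "expo i ?y = expo i y" for i using G by simp
 have "m * m' + bform S \<beta> (\<lambda>i. expo i y) (\<lambda>i. expo i z) = bform S \<beta> (\<lambda>i. expo i z) (\<lambda>i. expo i y)"
  using commuting_pair_identity[OF psi, of \<beta> y z] \<beta> G yz y z sgn by (simp add: a_def b_def e_def)
 moreover have "- m * m' + bform S \<beta> (\<lambda>i. expo i y) (\<lambda>i. expo i z) = bform S \<beta> (\<lambda>i. expo i z) (\<lambda>i. expo i y)"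
  using commuting_pair_identity[OF psi, of \<beta> ?y z] \<beta> G yc cyz py z sgn ey by (simp add: a_def b_def e_def)
 ultimately have "m * m' = 0" by linarith
 thus False using nz by simp
qed

end

section \<open>Odd letters, and the algebraic core of the first case\<close>

section \<open>Permutation representations of a RAAG\<close>

definition perm_group :: "'p set => ('p => 'p) monoid" where
 "perm_group A = \<lparr>carrier = {p. p permutes A}, mult = (\<circ>), one = id\<rparr>"

lemma perm_group_simps [simp]: "carrier (perm_group A) = {p. p permutes A}"
 "p \<otimes>\<^bsub>perm_group A\<^esub> q = p \<circ> q" "\<one>\<^bsub>perm_group A\<^esub> = id"
 by (simp_all add: perm_group_def)

lemma group_perm_group: "group (perm_group A)"
proof (rule groupI)
 fix x assume "x \<in> carrier (perm_group A)"
 thus "\<exists>y\<in>carrier (perm_group A). y \<otimes>\<^bsub>perm_group A\<^esub> x = \<one>\<^bsub>perm_group A\<^esub>"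
  using permutes_inv permutes_inv_o(2) by fastforce
qed (auto intro: permutes_compose permutes_id)

text \<open>Stands in for "the two tokens swapped": an odd permutation commuting with 3-cycles may
  still rotate three points, and this set does not see the rotation.\<close>

definition two_cycle_points :: "('p => 'p) => 'p set" where
 "two_cycle_points q = {p. q p \<noteq> p \<and> q (q p) = p}"

lemma two_cycle_points_conj:
 assumes "bij g"
 shows "two_cycle_points (g \<circ> q \<circ> inv_into UNIV g) = g ` two_cycle_points q"
proof -
 have inj: "inj g" and surj: "surj g" using assms by (auto simp: bij_def)
 have e: "(g \<circ> q \<circ> inv_into UNIV g) (g a) = g (q a)" for a using inj by simp
 have m: "g a \<in> two_cycle_points (g \<circ> q \<circ> inv_into UNIV g) \<longleftrightarrow> a \<in> two_cycle_points q" for a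
  unfolding two_cycle_points_def mem_Collect_eq e using inj by (simp add: inj_eq)
 show ?thesis
 proof (rule Set.set_eqI)
  fix x
  obtain a where "x = g a" using surj by (rule surjE)
  thus "x \<in> two_cycle_points (g \<circ> q \<circ> inv_into UNIV g) \<longleftrightarrow> x \<in> g ` two_cycle_points q"
   using m[of a] inj by (simp add: inj_image_mem_iff)
 qed
qed

definition sign_group :: "int monoid" where
 "sign_group = \<lparr>carrier = {1, - 1}, mult = (*), one = 1\<rparr>"

lemma sign_group_simps [simp]: "carrier sign_group = {1, - 1}" "x \<otimes>\<^bsub>sign_group\<^esub> y = x * y" "\<one>\<^bsub>sign_group\<^esub> = 1"
 by (simp_all add: sign_group_def)

lemma group_sign_group: "group sign_group"
 by (rule groupI) auto

abbreviation (in group) cj :: "'a => 'a => 'a" where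
 "cj g x \<equiv> g \<otimes> x \<otimes> inv g"

lemma (in group) cj_cj:
 "g \<in> carrier G ==> h \<in> carrier G ==> x \<in> carrier G ==> cj g (cj h x) = cj (g \<otimes> h) x"
 by (simp add: inv_mult_group m_assoc)

lemma (in group) cj_mult:
 assumes "g \<in> carrier G" "x \<in> carrier G" "y \<in> carrier G"
 shows "cj g x \<otimes> cj g y = cj g (x \<otimes> y)"
proof -
 have "cj g x \<otimes> cj g y = g \<otimes> x \<otimes> (inv g \<otimes> g) \<otimes> y \<otimes> inv g"
  using assms by (simp only: m_assoc m_closed inv_closed)
 thus ?thesis using assms by (simp add: m_assoc)
qed

lemma (in group) cj_commute:
 assumes "g \<in> carrier G" "x \<in> carrier G" "y \<in> carrier G" "x \<otimes> y = y \<otimes> x"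
 shows "cj g x \<otimes> cj g y = cj g y \<otimes> cj g x"
 using assms by (simp only: cj_mult)

lemma (in group) cj_fixed: "g \<in> carrier G ==> x \<in> carrier G ==> x \<otimes> g = g \<otimes> x ==> cj g x = x"
proof -
 assume gx: "g \<in> carrier G" "x \<in> carrier G" "x \<otimes> g = g \<otimes> x"
 have "cj g x = x \<otimes> g \<otimes> inv g" by (simp only: gx(3))
 thus ?thesis using gx(1,2) by (simp add: m_assoc)
qed

context raag
begin

text \<open>Killing the letters outside the star respects all commutations. The retraction pushes an
  element into \<open>St s\<close> without losing its commutation with elements already
  there.\<close>

lemma ex_retraction:
 obtains \<rho> where "\<rho> \<in> hom G G" "\<And>x. x \<in> carrier G ==> \<rho> x \<in> St s" "\<And>x. x \<in> St s ==> \<rho> x = x"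
  "\<And>r x. r \<in> star s ==> x \<in> carrier G ==> expo r (\<rho> x) = expo r x"
proof -
 obtain \<rho> where \<rho>: "\<rho> \<in> hom G G" "\<And>t. t \<in> S ==> \<rho> (\<iota> t) = (if t \<in> star s then \<iota> t else \<one>)"
 proof (rule extend_hom[OF is_group, of "\<lambda>t. if t \<in> star s then \<iota> t else \<one>"])
  show "(\<lambda>t. if t \<in> star s then \<iota> t else \<one>) ` S \<subseteq> carrier G" by auto
  fix t u assume "(t, u) \<in> R"
  moreover from this have "t \<in> S" "u \<in> S" using R_sub by auto
  ultimately show "(if t \<in> star s then \<iota> t else \<one>) \<otimes> (if u \<in> star s then \<iota> u else \<one>) =
    (if u \<in> star s then \<iota> u else \<one>) \<otimes> (if t \<in> star s then \<iota> t else \<one>)"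
   using letters_commute[of t u] by simp
 qed blast
 interpret \<rho>: group_hom G G \<rho> by unfold_locales (rule \<rho>)
 have "\<rho> x \<in> St s" if "x \<in> generate G (\<iota> ` S)" for x
  using that
 proof induction
  case (incl h)
  thus ?case using \<rho>(2) subgroup.one_closed[OF subgroup_St]
   by (auto simp: St_def intro: generate.incl[OF imageI])
 next
  case (inv h)
  hence "\<rho> h \<in> St s" "h \<in> carrier G" using \<rho>(2) subgroup.one_closed[OF subgroup_St]
   by (auto simp: St_def intro: generate.incl[OF imageI])
  thus ?case using subgroup.m_inv_closed[OF subgroup_St] by simp
 next
  case (eng a b)
  hence "a \<in> carrier G" "b \<in> carrier G" using generate_letters by auto
  thus ?case using eng subgroup.m_closed[OF subgroup_St] by simp
 qed (use subgroup.one_closed[OF subgroup_St] in simp)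
 moreover have "\<rho> x = x" if "x \<in> St s" for x
  by (rule hom_eq_on_generate[OF is_group is_group \<rho>(1) _ iota_star[of s] _ that[unfolded St_def]])
   (use \<rho>(2) star_subset[of s] in \<open>auto simp: hom_def\<close>)
 moreover have "expo r (\<rho> x) = expo r x" if "r \<in> star s" "x \<in> carrier G" for r x
 proof (rule hom_eqI[OF _ _ expo_hom _ that(2)])
  show "(\<lambda>x. expo r (\<rho> x)) \<in> hom G integer_group" by (rule homI) auto
 qed (use \<rho>(2) that(1) in \<open>auto simp: expo_iota\<close>)
 ultimately show ?thesis using that[OF \<rho>(1)] generate_letters by simp
qed

text \<open>The sign of \<open>\<pi> x\<close> is the parity of the total exponent of x in the
  letters with odd permutation, because both sides are homomorphisms that agree on letters.\<close>

lemma odd_letter: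
 assumes \<pi>: "\<pi> \<in> hom G (perm_group A)" and A: "finite A" and x: "x \<in> carrier G" "sign (\<pi> x) = - 1"
 obtains s where "s \<in> S" "sign (\<pi> (\<iota> s)) = - 1" "expo s x \<noteq> 0"
proof -
 let ?O = "{s \<in> S. sign (\<pi> (\<iota> s)) = - 1}"
 let ?\<chi> = "\<lambda>x. if even (\<Sum>s\<in>?O. expo s x) then 1 else - 1 :: int"
 have perm: "permutation (\<pi> u)" if "u \<in> carrier G" for u
  using hom_in_carrier[OF \<pi> that] A permutation_permutes by auto
 have sg: "sign (\<pi> u) = 1 \<or> sign (\<pi> u) = - 1" for u by (simp add: sign_def)
 have "sign (\<pi> x) = ?\<chi> x"
 proof (rule hom_eqI[OF group_sign_group _ _ _ x(1)])
  show "(\<lambda>x. sign (\<pi> x)) \<in> hom G sign_group"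
   by (rule homI) (use sg in \<open>auto simp: hom_mult[OF \<pi>] sign_compose perm\<close>)
  show "?\<chi> \<in> hom G sign_group"
   by (rule homI) (auto simp: sum.distrib)
  fix t assume t: "t \<in> S"
  have "(\<Sum>s\<in>?O. expo s (\<iota> t)) = (\<Sum>s\<in>?O. if s = t then 1 else 0)"
   using t by (intro sum.cong) (auto simp: expo_iota)
  thus "sign (\<pi> (\<iota> t)) = ?\<chi> (\<iota> t)" using finite_S t sg[of "\<iota> t"] by auto
 qed
 hence "(\<Sum>s\<in>?O. expo s x) \<noteq> 0" using x(2) by (auto split: if_splits)
 then obtain s where "s \<in> ?O" "expo s x \<noteq> 0" by (meson sum.neutral)
 thus ?thesis using that by auto
qed

text \<open>Write z for \<open>cj \<delta> y'\<close>. By \<open>rigid\<close>, once N lies in a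
  conjugate of \<open>St s\<close> for an odd letter s, the same conjugate of s has 2-cycle points
  D; for the \<delta>-conjugate of N one gets the image of D instead. This excludes a common odd
  letter of y and z. An odd letter s of y and an odd letter r of z then commute, and r can be
  compared with s inside \<open>St s\<close> in two ways: through z their 2-cycle points differ,
  through the retraction of y' they agree.\<close>

theorem no_swap_triangle:
 assumes \<pi>: "\<pi> \<in> hom G (perm_group A)" and A: "finite A"
  and G: "y \<in> carrier G" "y' \<in> carrier G" "\<delta> \<in> carrier G" "N \<subseteq> carrier G" and fin: "finite N"
  and yz: "y \<otimes> cj \<delta> y' = cj \<delta> y' \<otimes> y"
  and Ny: "\<And>n. n \<in> N ==> n \<otimes> y = y \<otimes> n" "\<And>n. n \<in> N ==> n \<otimes> y' = y' \<otimes> n"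
  and N0: "\<And>n s. n \<in> N ==> expo s n = 0"
  and odd: "sign (\<pi> y) = - 1" "sign (\<pi> (cj \<delta> y')) = - 1"
  and rigid: "\<And>\<sigma>. \<sigma> permutes A ==> sign \<sigma> = - 1 ==> (\<And>n. n \<in> N ==> \<sigma> \<circ> \<pi> n = \<pi> n \<circ> \<sigma>) ==>
   two_cycle_points \<sigma> = D"
  and D: "\<pi> \<delta> ` D \<noteq> D"
 shows False
proof -
 interpret P: group "perm_group A" by (rule group_perm_group)
 interpret \<pi>: group_hom G "perm_group A" \<pi> by unfold_locales (rule \<pi>)
 have pin: "\<pi> x permutes A" if "x \<in> carrier G" for x using \<pi>.hom_closed[OF that] by simp
 have perm: "permutation (\<pi> u)" if "u \<in> carrier G" for u using pin[OF that] A permutation_permutes by auto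
 have bijp: "bij (\<pi> u)" if "u \<in> carrier G" for u using pin[OF that] permutes_bij by blast
 let ?T = "\<lambda>x. two_cycle_points (\<pi> x)"
 have invp: "\<pi> (inv g) = inv_into UNIV (\<pi> g)" if g: "g \<in> carrier G" for g
 proof -
  have "\<pi> (inv g) \<circ> \<pi> g = id" "\<pi> g \<circ> \<pi> (inv g) = id"
   using \<pi>.hom_mult[of "inv g" g] \<pi>.hom_mult[of g "inv g"] g by simp_all
  thus ?thesis using inv_unique_comp[of "\<pi> g" "\<pi> (inv g)"] by simp
 qed
 have Tcj: "?T (cj g x) = \<pi> g ` ?T x" if "g \<in> carrier G" "x \<in> carrier G" for g x
  using two_cycle_points_conj[OF bijp[OF that(1)], of "\<pi> x"] that by (simp add: invp del: \<pi>.hom_inv)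
 have signcj: "sign (\<pi> (cj g x)) = sign (\<pi> x)" if "g \<in> carrier G" "x \<in> carrier G" for g x
 proof -
  have "sign (\<pi> (cj g x)) = sign (\<pi> g) * sign (\<pi> x) * sign (\<pi> g)"
   using that perm[OF that(1)] perm[OF that(2)]
   by (simp add: invp sign_compose sign_inverse permutation_compose permutation_inverse del: \<pi>.hom_inv)
  thus ?thesis by (simp add: mult.commute mult.left_commute)
 qed
 define z where "z = cj \<delta> y'"
 have z: "z \<in> carrier G" using G by (simp add: z_def)
 have Nc: "n \<in> carrier G" if "n \<in> N" for n using that G by auto
 have N\<delta>z: "cj \<delta> n \<otimes> z = z \<otimes> cj \<delta> n" if "n \<in> N" for n
  unfolding z_def using G Nc Ny that by (intro cj_commute) auto
 have key: "?T (cj g (\<iota> s)) = D"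
  if s: "s \<in> S" "sign (\<pi> (\<iota> s)) = - 1" and g: "g \<in> carrier G" and St: "\<And>n. n \<in> N ==> cj (inv g) n \<in> St s"
  for s g
 proof (rule rigid)
  show "\<pi> (cj g (\<iota> s)) permutes A" using s g by (intro pin) simp
  show "sign (\<pi> (cj g (\<iota> s))) = - 1" using signcj s g by simp
  fix n assume n: "n \<in> N"
  have "cj g (\<iota> s) \<otimes> cj g (cj (inv g) n) = cj g (cj (inv g) n) \<otimes> cj g (\<iota> s)"
   using St_commute[OF s(1) St[OF n]] g s Nc[OF n] by (intro cj_commute) auto
  moreover have "cj g (cj (inv g) n) = n" using cj_cj[of g "inv g" n] g Nc[OF n] by simp
  ultimately have "cj g (\<iota> s) \<otimes> n = n \<otimes> cj g (\<iota> s)" by simp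
  hence "\<pi> (cj g (\<iota> s) \<otimes> n) = \<pi> (n \<otimes> cj g (\<iota> s))" by simp
  moreover have "cj g (\<iota> s) \<in> carrier G" using g s by simp
  ultimately show "\<pi> (cj g (\<iota> s)) \<circ> \<pi> n = \<pi> n \<circ> \<pi> (cj g (\<iota> s))"
   using \<pi>.hom_mult Nc[OF n] by simp
 qed
 \<comment> \<open>Powers of y and of z or its inverse equalize the exponents of s. Then N, which
   commutes with y, and its \<delta>-conjugate, which commutes with z, lie in one conjugate of
   \<open>St s\<close>, and the conjugated letter would have both D and its image as 2-cycle
   points.\<close>
 have never_both: False if s: "s \<in> S" "sign (\<pi> (\<iota> s)) = - 1" and e: "expo s y \<noteq> 0" "expo s z \<noteq> 0" for s
 proof -
  define z' where "z' = (if expo s y * expo s z > 0 then z else inv z)"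
  define Y where "Y = y [^] nat \<bar>expo s z\<bar>"
  define Z where "Z = z' [^] nat \<bar>expo s y\<bar>"
  have z': "z' \<in> carrier G" using z by (simp add: z'_def)
  have YZc: "Y \<in> carrier G" "Z \<in> carrier G" using G z' by (simp_all add: Y_def Z_def)
  have comm_z': "x \<otimes> z' = z' \<otimes> x" if "x \<otimes> z = z \<otimes> x" "x \<in> carrier G" for x
   using that commutes_inv z by (simp add: z'_def)
  have comm_Z: "x \<otimes> Z = Z \<otimes> x" if "x \<otimes> z = z \<otimes> x" "x \<in> carrier G" for x
   unfolding Z_def using comm_z' that z' by (intro commutes_pow) auto
  have comm_Y: "x \<otimes> Y = Y \<otimes> x" if "x \<otimes> y = y \<otimes> x" "x \<in> carrier G" for x
   unfolding Y_def using that G by (intro commutes_pow) auto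
  have "y \<otimes> Z = Z \<otimes> y" using comm_Z yz G by (simp add: z_def)
  hence YZ: "Y \<otimes> Z = Z \<otimes> Y" using comm_Y[of Z] YZc by simp
  have eY: "expo s Y = expo s Z" "expo s Y \<noteq> 0"
  proof -
   have 1: "expo s Y = \<bar>expo s z\<bar> * expo s y" unfolding Y_def by (subst expo_pow) (use G in auto)
   have 2: "expo s Z = \<bar>expo s y\<bar> * expo s z'" unfolding Z_def by (subst expo_pow) (use z' in auto)
   have "expo s z' = (if expo s y * expo s z > 0 then expo s z else - expo s z)" using z by (simp add: z'_def)
   thus "expo s Y = expo s Z" "expo s Y \<noteq> 0" unfolding 1 2 using e
    by (auto simp: abs_if zero_less_mult_iff)
  qed
  have "\<exists>h\<in>generate G (\<iota> ` S). \<forall>x\<in>N \<union> cj \<delta> ` N. inv h \<otimes> x \<otimes> h \<in> St s"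
  proof (rule subset_common_coset[OF s(1) subset_refl _ YZc(2) YZ eY])
   show "Y \<in> generate G (\<iota> ` S)" using YZc generate_letters by simp
   show "finite (N \<union> cj \<delta> ` N)" using fin by simp
   show "N \<union> cj \<delta> ` N \<subseteq> carrier G" using G by auto
   show "expo s x = 0" if "x \<in> N \<union> cj \<delta> ` N" for x using that N0 Nc G by auto
   show "x \<otimes> Y = Y \<otimes> x \<or> x \<otimes> Z = Z \<otimes> x" if "x \<in> N \<union> cj \<delta> ` N" for x
    using that
   proof
    assume "x \<in> N"
    thus ?thesis using comm_Y[of x] Ny(1) Nc by blast
   next
    assume "x \<in> cj \<delta> ` N"
    then obtain n where n: "n \<in> N" "x = cj \<delta> n" by blast
    hence "x \<in> carrier G" using Nc G by simp
    thus ?thesis using comm_Z[of x] N\<delta>z[OF n(1)] n(2) by simp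
   qed
  qed
  then obtain h where h: "h \<in> carrier G" "\<And>x. x \<in> N \<union> cj \<delta> ` N ==> inv h \<otimes> x \<otimes> h \<in> St s"
   using generate_letters by auto
  have 1: "?T (cj h (\<iota> s)) = D" using key[OF s h(1)] h by simp
  have "?T (cj (inv \<delta> \<otimes> h) (\<iota> s)) = D"
  proof (rule key[OF s])
   fix n assume n: "n \<in> N"
   have "cj (inv (inv \<delta> \<otimes> h)) n = inv h \<otimes> cj \<delta> n \<otimes> h"
    using G h Nc[OF n] by (simp add: inv_mult_group m_assoc)
   thus "cj (inv (inv \<delta> \<otimes> h)) n \<in> St s" using h n by simp
  qed (use G h in simp)
  moreover have "cj h (\<iota> s) = cj \<delta> (cj (inv \<delta> \<otimes> h) (\<iota> s))"
   using cj_cj[of \<delta> "inv \<delta> \<otimes> h" "\<iota> s"] G h s by (simp add: m_assoc[symmetric])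
  ultimately have "?T (cj h (\<iota> s)) = \<pi> \<delta> ` D"
   using Tcj[of \<delta> "cj (inv \<delta> \<otimes> h) (\<iota> s)"] G h s by simp
  thus False using 1 D by simp
 qed
 obtain s where s: "s \<in> S" "sign (\<pi> (\<iota> s)) = - 1" "expo s y \<noteq> 0"
  using odd_letter[OF \<pi> A G(1) odd(1)] .
 obtain r where r: "r \<in> S" "sign (\<pi> (\<iota> r)) = - 1" "expo r z \<noteq> 0"
  using odd_letter[OF \<pi> A z] odd(2) unfolding z_def by blast
 have sz: "expo s z = 0" using never_both s by blast
 have ry: "expo r y = 0" using never_both r by blast
 have ry': "expo r y' \<noteq> 0" using r(3) G by (simp add: z_def)
 \<comment> \<open>Otherwise \<open>nonadjacent_exponents\<close> for the commuting pair y, z gives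
   that the exponent of s in y times that of r in z is 0, as z has exponent 0 at s.\<close>
 have "adj s r"
  using nonadjacent_exponents[OF s(1) r(1) _ G(1) z] yz s r sz by (auto simp: z_def[symmetric])
 hence rs: "r \<in> star s" using r by (simp add: star_def)
 \<comment> \<open>z has exponent 0 at s and commutes with y, so it may join N here.\<close>
 have "\<exists>h\<in>generate G (\<iota> ` S). \<forall>x\<in>insert z N. inv h \<otimes> x \<otimes> h \<in> St s"
 proof (rule subset_common_coset[OF s(1) subset_refl _ G(1) refl refl s(3)])
  show "y \<in> generate G (\<iota> ` S)" using G generate_letters by simp
  show "x \<otimes> y = y \<otimes> x \<or> x \<otimes> y = y \<otimes> x" if "x \<in> insert z N" for x
   using that Ny yz by (auto simp: z_def)
 qed (use fin G z N0 sz in auto)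
 then obtain h where h: "h \<in> carrier G" "\<And>x. x \<in> insert z N ==> inv h \<otimes> x \<otimes> h \<in> St s"
  using generate_letters by auto
 \<comment> \<open>The representative h can be changed by an element of \<open>St s\<close>, which
   commutes with s; the two choices of k made below for r thus leave the statement about s
   intact.\<close>
 have Ts: "?T (cj (h \<otimes> k) (\<iota> s)) = D" if k: "k \<in> St s" for k
 proof -
  have kc: "k \<in> carrier G" using k St_closed by blast
  have "cj k (\<iota> s) = \<iota> s" using St_commute[OF s(1) k] kc s(1) by (intro cj_fixed) auto
  hence "cj (h \<otimes> k) (\<iota> s) = cj h (\<iota> s)" using cj_cj[of h k "\<iota> s"] h kc s by simp
  thus ?thesis using key[OF s(1,2) h(1)] h by simp
 qed
 \<comment> \<open>The comparison through z: the \<delta>-conjugate of N commutes with z, whose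
   exponent at r is nonzero, so r receives the image of D while s keeps D.\<close>
 have Tne: "?T (\<iota> s) \<noteq> ?T (\<iota> r)"
 proof -
  define z1 where "z1 = inv h \<otimes> z \<otimes> h"
  have z1: "z1 \<in> St s" "z1 \<in> carrier G" using h z by (auto simp: z1_def)
  have "\<exists>k\<in>generate G (\<iota> ` star s). \<forall>x\<in>(\<lambda>n. inv h \<otimes> cj \<delta> n \<otimes> h) ` N. inv k \<otimes> x \<otimes> k \<in> St r"
  proof (rule subset_common_coset[OF r(1) star_subset _ z1(2) refl refl])
   show "z1 \<in> generate G (\<iota> ` star s)" using z1 by (simp add: St_def)
   show "expo r z1 \<noteq> 0" using r h z by (simp add: z1_def)
   show "x \<otimes> z1 = z1 \<otimes> x \<or> x \<otimes> z1 = z1 \<otimes> x" if x: "x \<in> (\<lambda>n. inv h \<otimes> cj \<delta> n \<otimes> h) ` N" for x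
   proof -
    obtain n where n: "n \<in> N" "x = inv h \<otimes> cj \<delta> n \<otimes> h" using x by auto
    have "cj (inv h) (cj \<delta> n) \<otimes> cj (inv h) z = cj (inv h) z \<otimes> cj (inv h) (cj \<delta> n)"
     using N\<delta>z[OF n(1)] Nc[OF n(1)] G h z by (intro cj_commute) auto
    thus ?thesis using n h by (simp add: z1_def)
   qed
  qed (use fin G h N0 Nc in auto)
  then obtain k where k: "k \<in> St s" "\<And>n. n \<in> N ==> inv k \<otimes> (inv h \<otimes> cj \<delta> n \<otimes> h) \<otimes> k \<in> St r"
   by (auto simp: St_def)
  have kc: "k \<in> carrier G" using k St_closed by blast
  have "?T (cj (inv \<delta> \<otimes> (h \<otimes> k)) (\<iota> r)) = D"
  proof (rule key[OF r(1,2)])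
   fix n assume n: "n \<in> N"
   have "cj (inv (inv \<delta> \<otimes> (h \<otimes> k))) n = inv k \<otimes> (inv h \<otimes> cj \<delta> n \<otimes> h) \<otimes> k"
    using G h kc Nc[OF n] by (simp add: inv_mult_group m_assoc)
   thus "cj (inv (inv \<delta> \<otimes> (h \<otimes> k))) n \<in> St r" using k(2)[OF n] by simp
  qed (use G h kc in simp)
  moreover have "cj (h \<otimes> k) (\<iota> r) = cj \<delta> (cj (inv \<delta> \<otimes> (h \<otimes> k)) (\<iota> r))"
   using cj_cj[of \<delta> "inv \<delta> \<otimes> (h \<otimes> k)" "\<iota> r"] G h kc r by (simp add: m_assoc[symmetric])
  ultimately have "?T (cj (h \<otimes> k) (\<iota> r)) = \<pi> \<delta> ` D"
   using Tcj[of \<delta> "cj (inv \<delta> \<otimes> (h \<otimes> k)) (\<iota> r)"] G h kc r by simp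
  moreover have "?T (cj (h \<otimes> k) (\<iota> s)) = D" by (rule Ts[OF k(1)])
  ultimately show ?thesis
   using Tcj[of "h \<otimes> k" "\<iota> r"] Tcj[of "h \<otimes> k" "\<iota> s"] h kc r s D by auto
 qed
 obtain \<rho> where \<rho>: "\<rho> \<in> hom G G" "\<And>x. x \<in> carrier G ==> \<rho> x \<in> St s" "\<And>x. x \<in> St s ==> \<rho> x = x"
  "\<And>r x. r \<in> star s ==> x \<in> carrier G ==> expo r (\<rho> x) = expo r x"
  using ex_retraction[of s] by blast
 \<comment> \<open>The comparison through y'. It need not commute with y, so its conjugate by h may
   lie outside \<open>St s\<close>. The retraction moves it inside, keeps its exponent at r, and
   fixes the conjugates of N, which therefore still commute with it.\<close>
 define y1 where "y1 = \<rho> (inv h \<otimes> y' \<otimes> h)"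
 have y1: "y1 \<in> St s" "y1 \<in> carrier G" unfolding y1_def using \<rho>(2)[of "inv h \<otimes> y' \<otimes> h"] G h(1) St_closed[of _ s] by (simp_all)
 have "\<exists>k\<in>generate G (\<iota> ` star s). \<forall>x\<in>(\<lambda>n. inv h \<otimes> n \<otimes> h) ` N. inv k \<otimes> x \<otimes> k \<in> St r"
 proof (rule subset_common_coset[OF r(1) star_subset _ y1(2) refl refl])
  show "y1 \<in> generate G (\<iota> ` star s)" using y1 by (simp add: St_def)
  show "expo r y1 \<noteq> 0" using \<rho>(4)[OF rs] ry' h G by (simp add: y1_def)
  show "x \<otimes> y1 = y1 \<otimes> x \<or> x \<otimes> y1 = y1 \<otimes> x" if x: "x \<in> (\<lambda>n. inv h \<otimes> n \<otimes> h) ` N" for x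
  proof -
   obtain n where n: "n \<in> N" "x = inv h \<otimes> n \<otimes> h" using x by auto
   have "cj (inv h) n \<otimes> cj (inv h) y' = cj (inv h) y' \<otimes> cj (inv h) n"
    using Ny(2)[OF n(1)] Nc[OF n(1)] G h by (intro cj_commute) auto
   hence "\<rho> (x \<otimes> (inv h \<otimes> y' \<otimes> h)) = \<rho> ((inv h \<otimes> y' \<otimes> h) \<otimes> x)" using n h by simp
   hence "\<rho> x \<otimes> y1 = y1 \<otimes> \<rho> x"
    using hom_mult[OF \<rho>(1)] n Nc[OF n(1)] G h by (simp add: y1_def)
   moreover have "x \<in> St s" using h n by simp
   ultimately show ?thesis using \<rho>(3) by simp
  qed
 qed (use fin G h N0 Nc in auto)
 then obtain k where k: "k \<in> St s" "\<And>n. n \<in> N ==> inv k \<otimes> (inv h \<otimes> n \<otimes> h) \<otimes> k \<in> St r"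
  by (auto simp: St_def)
 have kc: "k \<in> carrier G" using k St_closed by blast
 have "?T (cj (h \<otimes> k) (\<iota> r)) = D"
 proof (rule key[OF r(1,2)])
  fix n assume n: "n \<in> N"
  have "cj (inv (h \<otimes> k)) n = inv k \<otimes> (inv h \<otimes> n \<otimes> h) \<otimes> k"
   using G h kc Nc[OF n] by (simp add: inv_mult_group m_assoc)
  thus "cj (inv (h \<otimes> k)) n \<in> St r" using k(2)[OF n] by simp
 qed (use h kc in simp)
 hence "\<pi> (h \<otimes> k) ` ?T (\<iota> r) = \<pi> (h \<otimes> k) ` ?T (\<iota> s)"
  using Tcj[of "h \<otimes> k"] Ts[OF k(1)] h kc r s by auto
 moreover have "inj (\<pi> (h \<otimes> k))" using bijp[of "h \<otimes> k"] h kc by (auto simp: bij_def)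
 ultimately show False using Tne inj_image_eq_iff by blast
qed

end

section \<open>Homotopy classes of paths as elements of one group\<close>

section \<open>Paths up to homotopy\<close>

lemma continuous_map_glue:
 fixes a b :: "'m::topological_space => real"
 assumes "continuous_on S a" "continuous_on S b"
  and "continuous_map (top_of_set (S \<inter> {x. a x \<le> b x})) Tp f"
  and "continuous_map (top_of_set (S \<inter> {x. b x \<le> a x})) Tp g"
  and "\<And>x. x \<in> S ==> a x = b x ==> f x = g x"
 shows "continuous_map (top_of_set S) Tp (\<lambda>x. if a x \<le> b x then f x else g x)"
proof (rule continuous_map_cases_le)
 have "{x \<in> topspace (top_of_set S). a x \<le> b x} = S \<inter> {x. a x \<le> b x}"
  "{x \<in> topspace (top_of_set S). b x \<le> a x} = S \<inter> {x. b x \<le> a x}" by auto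
 thus "continuous_map (subtopology (top_of_set S) {x \<in> topspace (top_of_set S). a x \<le> b x}) Tp f"
  "continuous_map (subtopology (top_of_set S) {x \<in> topspace (top_of_set S). b x \<le> a x}) Tp g"
  using assms(3,4) by (simp_all add: subtopology_subtopology Int_assoc[symmetric])
qed (use assms in auto)

lemma continuous_map_precompose:
 fixes h :: "'m::topological_space => 'n::topological_space"
 assumes "continuous_map (top_of_set T) Tp f" "continuous_on S h" "h ` S \<subseteq> T"
 shows "continuous_map (top_of_set S) Tp (\<lambda>x. f (h x))"
proof -
 have "continuous_map (top_of_set S) (top_of_set T) h"
  using assms(2,3) by (simp add: image_subset_iff_funcset)
 from continuous_map_compose[OF this assms(1)] show ?thesis by (simp add: comp_def)
qed

lemma pathin_join:
 assumes "pathin Tp p" "pathin Tp q" "p 1 = q 0"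
 shows "pathin Tp (path_join p q)"
 unfolding pathin_def path_join_def
proof (rule continuous_map_glue[where b = "\<lambda>_. 1/2"])
 show "continuous_map (top_of_set ({0..1} \<inter> {x. x \<le> 1/2})) Tp (\<lambda>x. p (2 * x))"
  by (rule continuous_map_precompose[OF assms(1)[unfolded pathin_def]]) (auto intro!: continuous_intros)
 show "continuous_map (top_of_set ({0..1} \<inter> {x. 1/2 \<le> x})) Tp (\<lambda>x. q (2 * x - 1))"
  by (rule continuous_map_precompose[OF assms(2)[unfolded pathin_def]]) (auto intro!: continuous_intros)
 show "p (2 * t) = q (2 * t - 1)" if "t = 1/2" for t unfolding that using assms(3) by simp
qed (auto intro!: continuous_intros)

definition path_rev :: "(real => 'a) => real => 'a" where
 "path_rev p = (\<lambda>t. p (1 - t))"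

lemma path_ends [simp]: "path_join p q 0 = p 0" "path_join p q 1 = q 1" "path_rev p 0 = p 1" "path_rev p 1 = p 0"
 by (simp_all add: path_join_def path_rev_def)

lemma pathin_rev: "pathin Tp p ==> pathin Tp (path_rev p)"
 unfolding pathin_def path_rev_def
 by (rule continuous_map_precompose[of "{0..1}"]) (auto intro!: continuous_intros)

lemma pathin_const: "u \<in> topspace Tp ==> pathin Tp (\<lambda>_. u)"
 by (simp add: pathin_def)

lemma pathin_in: "pathin Tp p ==> 0 \<le> t ==> t \<le> 1 ==> p t \<in> topspace Tp"
 unfolding pathin_def by (auto simp: continuous_map_def)

definition path_homotopic :: "'a topology => (real => 'a) => (real => 'a) => bool" where
 "path_homotopic Tp p q \<longleftrightarrow> homotopic_with (\<lambda>h. h 0 = p 0 \<and> h 1 = p 1) (top_of_set {0..1::real}) Tp p q"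

lemma path_homotopic_ends: "path_homotopic Tp p q ==> q 0 = p 0 \<and> q 1 = p 1"
 unfolding path_homotopic_def by (drule homotopic_with_imp_property) simp

lemma path_homotopic_pathin: "path_homotopic Tp p q ==> pathin Tp p \<and> pathin Tp q"
 unfolding path_homotopic_def pathin_def by (rule homotopic_with_imp_continuous_maps)

lemma path_homotopic_refl: "pathin Tp p ==> path_homotopic Tp p p"
 unfolding path_homotopic_def pathin_def by (rule homotopic_with_equal) auto

lemma path_homotopic_sym: "path_homotopic Tp p q ==> path_homotopic Tp q p"
 using path_homotopic_ends[of Tp p q] unfolding path_homotopic_def
 by (auto dest: homotopic_with_symD)

lemma path_homotopic_trans [trans]:
 "path_homotopic Tp p q ==> path_homotopic Tp q r ==> path_homotopic Tp p r"
 using path_homotopic_ends[of Tp p q] unfolding path_homotopic_def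
 by (auto intro: homotopic_with_trans)

lemma path_homotopic_square:
 "path_homotopic Tp p q \<longleftrightarrow> (\<exists>h :: real \<times> real => 'a. continuous_map (top_of_set ({0..1} \<times> {0..1})) Tp h \<and>
  (\<forall>t. h (0, t) = p t) \<and> (\<forall>t. h (1, t) = q t) \<and> (\<forall>s\<in>{0..1}. h (s, 0) = p 0 \<and> h (s, 1) = p 1))"
 by (simp add: path_homotopic_def homotopic_with_def)

lemma path_homotopic_join:
 assumes "path_homotopic Tp p p'" "path_homotopic Tp q q'" "p 1 = q 0"
 shows "path_homotopic Tp (path_join p q) (path_join p' q')"
proof -
 obtain h where h: "continuous_map (top_of_set ({0..1} \<times> {0..1})) Tp h" "\<And>t. h (0, t) = p t" "\<And>t. h (1, t) = p' t"
  "\<And>s. s \<in> {0..1::real} ==> h (s, 0::real) = p 0" "\<And>s. s \<in> {0..1} ==> h (s, 1) = p 1"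
  using assms(1) unfolding path_homotopic_square by metis
 obtain k where k: "continuous_map (top_of_set ({0..1} \<times> {0..1})) Tp k" "\<And>t. k (0, t) = q t" "\<And>t. k (1, t) = q' t"
  "\<And>s. s \<in> {0..1::real} ==> k (s, 0::real) = q 0" "\<And>s. s \<in> {0..1} ==> k (s, 1) = q 1"
  using assms(2) unfolding path_homotopic_square by metis
 let ?H = "\<lambda>x. if snd x \<le> 1/2 then h (fst x, 2 * snd x) else k (fst x, 2 * snd x - 1)"
 have "continuous_map (top_of_set ({0..1} \<times> {0..1})) Tp ?H"
 proof (rule continuous_map_glue[where b = "\<lambda>_. 1/2"])
  show "continuous_map (top_of_set ({0..1} \<times> {0..1} \<inter> {x. snd x \<le> 1/2})) Tp (\<lambda>x. h (fst x, 2 * snd x))"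
   by (rule continuous_map_precompose[OF h(1)]) (auto intro!: continuous_intros)
  show "continuous_map (top_of_set ({0..1} \<times> {0..1} \<inter> {x. 1/2 \<le> snd x})) Tp (\<lambda>x. k (fst x, 2 * snd x - 1))"
   by (rule continuous_map_precompose[OF k(1)]) (auto intro!: continuous_intros)
  show "h (fst x, 2 * snd x) = k (fst x, 2 * snd x - 1)" if "x \<in> {0..1} \<times> {0..1}" "snd x = 1/2" for x
  proof -
   have "fst x \<in> {0..1}" using that by auto
   thus ?thesis unfolding that(2) using h(5)[of "fst x"] k(4)[of "fst x"] assms(3) by simp
  qed
 qed (auto intro!: continuous_intros)
 thus ?thesis unfolding path_homotopic_square
  by (intro exI[of _ ?H]) (use h k in \<open>auto simp: path_join_def\<close>)
qed

text \<open>Two paths with common ends in a convex parameter domain are linearly homotopic, and K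
  carries the homotopy over. With an interval as domain this gives reparametrizations, with a square
  it gives commuting motions.\<close>

lemma path_homotopic_in_convex:
 fixes K :: "'c::real_normed_vector => 'a"
 assumes C: "convex C" and \<alpha>: "continuous_on {0..1::real} \<alpha>" "\<alpha> ` {0..1} \<subseteq> C"
  and \<beta>: "continuous_on {0..1} \<beta>" "\<beta> ` {0..1} \<subseteq> C"
  and ends: "\<alpha> 0 = \<beta> 0" "\<alpha> 1 = \<beta> 1" and K: "continuous_map (top_of_set C) Tp K"
 shows "path_homotopic Tp (\<lambda>t. K (\<alpha> t)) (\<lambda>t. K (\<beta> t))"
proof -
 have "homotopic_paths C \<alpha> \<beta>"
 proof (rule homotopic_paths_linear)
  fix t :: real assume "t \<in> {0..1}"
  thus "closed_segment (\<alpha> t) (\<beta> t) \<subseteq> C"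
   using assms by (intro closed_segment_subset) auto
 qed (use assms in \<open>auto simp: path_def pathstart_def pathfinish_def\<close>)
 hence "homotopic_with (\<lambda>r. r 0 = \<alpha> 0 \<and> r 1 = \<alpha> 1) (top_of_set {0..1}) (top_of_set C) \<alpha> \<beta>"
  by (simp add: homotopic_paths_def pathstart_def pathfinish_def)
 hence "path_homotopic Tp (K \<circ> \<alpha>) (K \<circ> \<beta>)"
  unfolding path_homotopic_def
  by (rule homotopic_with_compose_continuous_map_left[OF _ K]) simp
 thus ?thesis by (simp add: comp_def)
qed

lemma path_homotopic_reparam:
 assumes "pathin Tp p" "continuous_on {0..1::real} f" "f ` {0..1} \<subseteq> {0..1}" "continuous_on {0..1} g" "g ` {0..1} \<subseteq> {0..1}"
  "f 0 = g 0" "f 1 = g 1"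
 shows "path_homotopic Tp (\<lambda>t. p (f t)) (\<lambda>t. p (g t))"
 using path_homotopic_in_convex[of "{0..1}" f g Tp p] assms by (simp add: pathin_def)

lemma path_homotopic_eq_on:
 assumes "pathin Tp p" "\<And>t. t \<in> {0..1} ==> p t = q t"
 shows "path_homotopic Tp p q"
 unfolding path_homotopic_def by (rule homotopic_with_equal) (use assms in \<open>auto simp: pathin_def\<close>)

lemma path_homotopic_assoc:
 assumes p: "pathin Tp p" "pathin Tp q" "pathin Tp r" "p 1 = q 0" "q 1 = r 0"
 shows "path_homotopic Tp (path_join (path_join p q) r) (path_join p (path_join q r))"
proof -
 let ?P = "path_join p (path_join q r)"
 define f :: "real => real" where "f t = (if t \<le> 1/2 then (if t \<le> 1/4 then 2 * t else t + 1/4) else (t + 1) / 2)" for t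
 have P: "pathin Tp ?P" using p by (intro pathin_join) auto
 have c: "continuous_on {0..1} f"
  unfolding f_def
  by (intro continuous_on_cases_le) (auto intro!: continuous_intros continuous_on_cases_le)
 have "path_homotopic Tp (\<lambda>t. ?P (f t)) (\<lambda>t. ?P t)"
  by (rule path_homotopic_reparam[OF P c]) (auto simp: f_def intro!: continuous_intros)
 moreover have "?P (f t) = path_join (path_join p q) r t" if "t \<in> {0..1}" for t
 proof -
  consider "t \<le> 1/4" | "1/4 < t" "t \<le> 1/2" | "1/2 < t" by linarith
  thus ?thesis
  proof cases
   case 1
   thus ?thesis by (simp add: path_join_def f_def)
  next
   case 2
   hence f: "f t = t + 1/4" "\<not> t + 1/4 \<le> 1/2" "2 * (t + 1/4) - 1 \<le> 1/2" by (simp_all add: f_def)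
   have "2 * (2 * (t + 1/4) - 1) = 2 * (2 * t) - 1" by simp
   thus ?thesis using 2 unfolding f(1) path_join_def by (simp only: f if_False if_True) (simp add: not_le)
  next
   case 3
   hence f: "f t = (t + 1) / 2" by (simp add: f_def)
   show ?thesis using 3 unfolding f path_join_def by (simp add: field_simps)
  qed
 qed
 hence "path_homotopic Tp (path_join (path_join p q) r) (\<lambda>t. ?P (f t))"
  using p by (intro path_homotopic_eq_on pathin_join) auto
 ultimately show ?thesis using path_homotopic_trans by blast
qed

lemma path_homotopic_unit:
 assumes p: "pathin Tp p" "p 0 = u"
 shows "path_homotopic Tp (path_join (\<lambda>_. u) p) p"
proof -
 let ?f = "\<lambda>t::real. if t \<le> 1/2 then 0 else 2 * t - 1"
 have "path_homotopic Tp (\<lambda>t. p (?f t)) (\<lambda>t. p t)"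
  by (rule path_homotopic_reparam[OF p(1)]) (auto intro!: continuous_intros continuous_on_cases_le)
 moreover have "(\<lambda>t. p (?f t)) = path_join (\<lambda>_. u) p" using p by (auto simp: path_join_def)
 ultimately show ?thesis by simp
qed

lemma path_homotopic_rev:
 assumes p: "pathin Tp p"
 shows "path_homotopic Tp (path_join (path_rev p) p) (\<lambda>_. p 1)"
proof -
 let ?f = "\<lambda>t::real. if t \<le> 1/2 then 1 - 2 * t else 2 * t - 1"
 have "path_homotopic Tp (\<lambda>t. p (?f t)) (\<lambda>t. p 1)"
  by (rule path_homotopic_reparam[OF p]) (auto intro!: continuous_intros continuous_on_cases_le)
 moreover have "(\<lambda>t. p (?f t)) = path_join (path_rev p) p" by (auto simp: path_join_def path_rev_def)
 ultimately show ?thesis by simp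
qed

lemma loop_class_eq_iff:
 assumes "p \<in> loops Tp u" "q \<in> loops Tp u"
 shows "loop_class Tp u p = loop_class Tp u q \<longleftrightarrow> path_homotopic Tp p q"
proof -
 have l: "loop_homotopic Tp u r s \<longleftrightarrow> path_homotopic Tp r s" if "r \<in> loops Tp u" for r s
  using that by (simp add: loop_homotopic_def path_homotopic_def loops_def)
 have q: "q \<in> loop_class Tp u q" using l[OF assms(2)] assms path_homotopic_refl
  by (auto simp: loop_class_def loops_def)
 show ?thesis
 proof
  assume "loop_class Tp u p = loop_class Tp u q"
  hence "q \<in> loop_class Tp u p" using q by simp
  thus "path_homotopic Tp p q" using l[OF assms(1)] by (simp add: loop_class_def)
 next
  assume "path_homotopic Tp p q"
  thus "loop_class Tp u p = loop_class Tp u q"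
   unfolding loop_class_def using l[OF assms(1)] l[OF assms(2)]
   by (auto intro: path_homotopic_trans path_homotopic_sym)
 qed
qed

lemma some_in_loop_class:
 assumes "p \<in> loops Tp u"
 shows "(SOME r. r \<in> loop_class Tp u p) \<in> loops Tp u" "path_homotopic Tp (SOME r. r \<in> loop_class Tp u p) p"
proof -
 have "p \<in> loop_class Tp u p"
  using assms path_homotopic_refl by (auto simp: loop_class_def loops_def loop_homotopic_def path_homotopic_def)
 hence s: "(SOME r. r \<in> loop_class Tp u p) \<in> loop_class Tp u p"
  by (rule someI[of "\<lambda>r. r \<in> loop_class Tp u p"])
 thus "(SOME r. r \<in> loop_class Tp u p) \<in> loops Tp u" by (simp add: loop_class_def)
 from s have "loop_homotopic Tp u p (SOME r. r \<in> loop_class Tp u p)" by (simp add: loop_class_def)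
 hence "path_homotopic Tp p (SOME r. r \<in> loop_class Tp u p)"
  using assms by (simp add: loop_homotopic_def path_homotopic_def loops_def)
 thus "path_homotopic Tp (SOME r. r \<in> loop_class Tp u p) p" by (rule path_homotopic_sym)
qed

lemma loops_join: "p \<in> loops Tp u ==> q \<in> loops Tp u ==> path_join p q \<in> loops Tp u"
 by (auto simp: loops_def intro: pathin_join)

lemma fundamental_group_mult:
 assumes "p \<in> loops Tp u" "q \<in> loops Tp u"
 shows "loop_class Tp u p \<otimes>\<^bsub>fundamental_group Tp u\<^esub> loop_class Tp u q = loop_class Tp u (path_join p q)"
proof -
 have "path_homotopic Tp (path_join (SOME r. r \<in> loop_class Tp u p) (SOME r. r \<in> loop_class Tp u q)) (path_join p q)"
  using some_in_loop_class[OF assms(1)] some_in_loop_class[OF assms(2)]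
  by (intro path_homotopic_join) (auto simp: loops_def)
 thus ?thesis
  using some_in_loop_class(1)[OF assms(1)] some_in_loop_class(1)[OF assms(2)] assms
  by (simp add: fundamental_group_def loop_class_eq_iff loops_join)
qed

text \<open>That the fundamental group is a group enters as an assumption, discharged later from
  \<open>is_raag\<close>, which contains it.\<close>

locale based_space =
 fixes Tp :: "'a topology" and x0 :: 'a
 assumes x0: "x0 \<in> topspace Tp" and path_conn: "path_connected_space Tp"
  and grp: "group (fundamental_group Tp x0)"
begin

abbreviation "FG \<equiv> fundamental_group Tp x0"

sublocale FG: group FG by (rule grp)

abbreviation fg_mult (infixl "\<star>" 70) where "x \<star> y \<equiv> x \<otimes>\<^bsub>FG\<^esub> y"
abbreviation fg_inv ("inv\<^sub>F _" [81] 80) where "inv\<^sub>F x \<equiv> inv\<^bsub>FG\<^esub> x"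

definition \<kappa> :: "'a => real => 'a" where
 "\<kappa> u = (SOME p. pathin Tp p \<and> p 0 = x0 \<and> p 1 = u)"

lemma \<kappa>: "u \<in> topspace Tp ==> pathin Tp (\<kappa> u) \<and> \<kappa> u 0 = x0 \<and> \<kappa> u 1 = u"
proof -
 assume "u \<in> topspace Tp"
 hence "\<exists>p. pathin Tp p \<and> p 0 = x0 \<and> p 1 = u" using path_conn x0 by (auto simp: path_connected_space_def)
 thus ?thesis unfolding \<kappa>_def by (rule someI_ex)
qed

text \<open>Closing every path up by chosen paths from the base point turns concatenation of
  arbitrary paths into multiplication in one group. As \<open>\<kappa> x0\<close> may be a
  nontrivial loop, a loop at the base point is sent to a conjugate of its class.\<close>

definition cls :: "(real => 'a) => (real => 'a) set" where
 "cls p = loop_class Tp x0 (path_join (\<kappa> (p 0)) (path_join p (path_rev (\<kappa> (p 1)))))"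

lemma cls_loop: "pathin Tp p ==> path_join (\<kappa> (p 0)) (path_join p (path_rev (\<kappa> (p 1)))) \<in> loops Tp x0"
 using \<kappa>[of "p 0"] \<kappa>[of "p 1"] pathin_in[of Tp p 0] pathin_in[of Tp p 1]
 by (auto simp: loops_def intro!: pathin_join pathin_rev)

lemma cls_closed [simp]: "pathin Tp p ==> cls p \<in> carrier FG"
 unfolding cls_def using cls_loop by (auto simp: fundamental_group_def)

lemma cls_cong: "path_homotopic Tp p q ==> cls p = cls q"
proof -
 assume h: "path_homotopic Tp p q"
 hence e: "q 0 = p 0" "q 1 = p 1" and pq: "pathin Tp p" "pathin Tp q"
  using path_homotopic_ends[OF h] path_homotopic_pathin[OF h] by auto
 note k = \<kappa>[of "p 0"] \<kappa>[of "p 1"] pathin_in[OF pq(1), of 0] pathin_in[OF pq(1), of 1]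
 have "path_homotopic Tp (path_join (\<kappa> (p 0)) (path_join p (path_rev (\<kappa> (p 1)))))
  (path_join (\<kappa> (p 0)) (path_join q (path_rev (\<kappa> (p 1)))))"
  using k h by (intro path_homotopic_join path_homotopic_refl pathin_rev) auto
 thus ?thesis using cls_loop[OF pq(1)] cls_loop[OF pq(2)] e by (simp add: cls_def loop_class_eq_iff)
qed

lemma cls_join:
 assumes p: "pathin Tp p" "pathin Tp q" "p 1 = q 0"
 shows "cls (path_join p q) = cls p \<star> cls q"
proof -
 define a b c where "a = \<kappa> (p 0)" and "b = \<kappa> (q 0)" and "c = path_rev (\<kappa> (q 1))"
 have a: "pathin Tp a" "a 1 = p 0" "a 0 = x0" and b: "pathin Tp b" "b 1 = q 0" "b 0 = x0"
  and c: "pathin Tp c" "c 0 = q 1" "c 1 = x0"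
  using \<kappa> pathin_in[OF p(1), of 0] pathin_in[OF p(2), of 0] pathin_in[OF p(2), of 1]
  by (auto simp: a_def b_def c_def intro: pathin_rev)
 let ?b = "path_rev b"
 have rb: "pathin Tp ?b" using b by (intro pathin_rev)
 note P = a b c rb p
 let ?J = "path_join"
 have "path_homotopic Tp (?J (?J a (?J p ?b)) (?J b (?J q c))) (?J a (?J (?J p ?b) (?J b (?J q c))))"
  by (rule path_homotopic_assoc) (use P in \<open>auto intro!: pathin_join\<close>)
 also have "path_homotopic Tp \<dots> (?J a (?J p (?J ?b (?J b (?J q c)))))"
  by (intro path_homotopic_join path_homotopic_refl path_homotopic_assoc) (use P in \<open>auto intro!: pathin_join\<close>)
 also have "path_homotopic Tp \<dots> (?J a (?J p (?J (?J ?b b) (?J q c))))"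
  by (intro path_homotopic_join path_homotopic_refl path_homotopic_sym[OF path_homotopic_assoc])
   (use P in \<open>auto intro!: pathin_join\<close>)
 also have "path_homotopic Tp \<dots> (?J a (?J p (?J (\<lambda>_. b 1) (?J q c))))"
  by (intro path_homotopic_join path_homotopic_refl path_homotopic_rev) (use P in \<open>auto intro!: pathin_join\<close>)
 also have "path_homotopic Tp \<dots> (?J a (?J p (?J q c)))"
  by (intro path_homotopic_join path_homotopic_refl path_homotopic_unit) (use P in \<open>auto intro!: pathin_join\<close>)
 also have "path_homotopic Tp \<dots> (?J a (?J (?J p q) c))"
  by (intro path_homotopic_join path_homotopic_refl path_homotopic_sym[OF path_homotopic_assoc])
   (use P in \<open>auto intro!: pathin_join\<close>)
 finally have "path_homotopic Tp (?J (?J a (?J p ?b)) (?J b (?J q c))) (?J a (?J (?J p q) c))" .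
 moreover have "?J a (?J p ?b) \<in> loops Tp x0" "?J b (?J q c) \<in> loops Tp x0" "?J a (?J (?J p q) c) \<in> loops Tp x0"
  using P by (auto simp: loops_def intro!: pathin_join)
 ultimately have "loop_class Tp x0 (?J a (?J p ?b)) \<star> loop_class Tp x0 (?J b (?J q c)) = loop_class Tp x0 (?J a (?J (?J p q) c))"
  by (simp add: fundamental_group_mult loop_class_eq_iff loops_join)
 thus ?thesis using p(3) by (simp add: cls_def a_def b_def c_def)
qed

lemma cls_const [simp]:
 assumes "u \<in> topspace Tp"
 shows "cls (\<lambda>_. u) = \<one>\<^bsub>FG\<^esub>"
proof -
 have u: "pathin Tp (\<lambda>_. u)" using assms by (rule pathin_const)
 have "cls (\<lambda>_. u) \<star> cls (\<lambda>_. u) = cls (\<lambda>_. u)"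
  using cls_join[OF u u] cls_cong[OF path_homotopic_unit[OF u]] by simp
 thus ?thesis using cls_closed[OF u] FG.l_cancel_one[of "cls (\<lambda>_. u)" "cls (\<lambda>_. u)"] by simp
qed

lemma cls_rev:
 assumes "pathin Tp p"
 shows "cls (path_rev p) = inv\<^sub>F cls p"
proof (rule FG.inv_equality[symmetric])
 have "cls (path_rev p) \<star> cls p = cls (path_join (path_rev p) p)"
  using assms by (intro cls_join[symmetric] pathin_rev) auto
 also have "\<dots> = cls (\<lambda>_. p 1)" using assms by (intro cls_cong path_homotopic_rev)
 finally show "cls (path_rev p) \<star> cls p = \<one>\<^bsub>FG\<^esub>" using pathin_in[OF assms, of 1] by simp
qed (use assms pathin_rev[OF assms] in auto)

lemma cls_square:
 fixes K :: "real \<times> real => 'a"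
 assumes K: "continuous_map (top_of_set ({0..1} \<times> {0..1})) Tp K"
 shows "cls (\<lambda>t. K (t, 0)) \<star> cls (\<lambda>t. K (1, t)) = cls (\<lambda>t. K (0, t)) \<star> cls (\<lambda>t. K (t, 1))"
  and "cls (\<lambda>t. K (t, t)) = cls (\<lambda>t. K (t, 0)) \<star> cls (\<lambda>t. K (1, t))"
proof -
 have P: "pathin Tp (\<lambda>t. K (f t, g t))" if "continuous_on {0..1} f" "continuous_on {0..1} g"
  "f ` {0..1} \<subseteq> {0..1}" "g ` {0..1} \<subseteq> {0..1}" for f g :: "real => real"
  unfolding pathin_def
 proof (rule continuous_map_precompose[OF K, of "{0..1}" "\<lambda>t. (f t, g t)"])
  show "continuous_on {0..1} (\<lambda>t. (f t, g t))" by (rule continuous_on_Pair[OF that(1,2)])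
  show "(\<lambda>t. (f t, g t)) ` {0..1} \<subseteq> {0..1} \<times> {0..1}"
   using that(3,4) by (simp add: image_subset_iff)
 qed
 let ?a = "\<lambda>t::real. (min 1 (2 * t), max 0 (2 * t - 1))"
 let ?b = "\<lambda>t::real. (max 0 (2 * t - 1), min 1 (2 * t))"
 have a: "path_join (\<lambda>t. K (t, 0)) (\<lambda>t. K (1, t)) = (\<lambda>t. K (?a t))"
  and b: "path_join (\<lambda>t. K (0, t)) (\<lambda>t. K (t, 1)) = (\<lambda>t. K (?b t))"
 proof -
  have "path_join (\<lambda>t. K (t, 0)) (\<lambda>t. K (1, t)) t = K (?a t)"
   "path_join (\<lambda>t. K (0, t)) (\<lambda>t. K (t, 1)) t = K (?b t)" for t
  proof -
   have "t \<le> 1/2 ==> min 1 (2 * t) = 2 * t" "t \<le> 1/2 ==> max 0 (2 * t - 1) = 0"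
    "\<not> t \<le> 1/2 ==> min 1 (2 * t) = 1" "\<not> t \<le> 1/2 ==> max 0 (2 * t - 1) = 2 * t - 1" by linarith+
   thus "path_join (\<lambda>t. K (t, 0)) (\<lambda>t. K (1, t)) t = K (?a t)"
    "path_join (\<lambda>t. K (0, t)) (\<lambda>t. K (t, 1)) t = K (?b t)"
    unfolding path_join_def by (cases "t \<le> 1/2"; simp only: if_True if_False simp_thms)+
  qed
  thus "path_join (\<lambda>t. K (t, 0)) (\<lambda>t. K (1, t)) = (\<lambda>t. K (?a t))"
   "path_join (\<lambda>t. K (0, t)) (\<lambda>t. K (t, 1)) = (\<lambda>t. K (?b t))" by auto
 qed
 have 1: "cls (path_join (\<lambda>t. K (t, 0)) (\<lambda>t. K (1, t))) = cls (\<lambda>t. K (t, 0)) \<star> cls (\<lambda>t. K (1, t))"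
  and 2: "cls (path_join (\<lambda>t. K (0, t)) (\<lambda>t. K (t, 1))) = cls (\<lambda>t. K (0, t)) \<star> cls (\<lambda>t. K (t, 1))"
  by (intro cls_join P continuous_on_const continuous_on_id; auto)+
 have cvx: "convex ({0..1::real} \<times> {0..1::real})" by (intro convex_Times convex_real_interval)
 have "path_homotopic Tp (\<lambda>t. K (?a t)) (\<lambda>t. K (?b t))"
  by (rule path_homotopic_in_convex[OF cvx _ _ _ _ _ _ K]) (auto intro!: continuous_intros)
 from cls_cong[OF this] show "cls (\<lambda>t. K (t, 0)) \<star> cls (\<lambda>t. K (1, t)) = cls (\<lambda>t. K (0, t)) \<star> cls (\<lambda>t. K (t, 1))"
  using 1 2 a b by simp
 have "path_homotopic Tp (\<lambda>t. K (t, t)) (\<lambda>t. K (?a t))"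
  by (rule path_homotopic_in_convex[OF cvx _ _ _ _ _ _ K]) (auto intro!: continuous_intros)
 from cls_cong[OF this] show "cls (\<lambda>t. K (t, t)) = cls (\<lambda>t. K (t, 0)) \<star> cls (\<lambda>t. K (1, t))"
  using 1 a by simp
qed

end

section \<open>Flat transport along paths with values in a group\<close>

section \<open>Holonomy of locally defined cocycles\<close>

lemma lebesgue_mesh:
 fixes S :: "'m::real_normed_vector set"
 assumes "compact S" "S \<noteq> {}" and f: "continuous_map (top_of_set S) Tp f"
  and cov: "\<And>u. u \<in> topspace Tp ==> \<exists>B. openin Tp B \<and> u \<in> B \<and> Q B"
 shows "\<exists>\<delta>>0. \<forall>T. T \<subseteq> S --> (\<forall>x\<in>T. \<forall>y\<in>T. norm (x - y) \<le> \<delta>) -->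
  (\<exists>B. openin Tp B \<and> Q B \<and> f ` T \<subseteq> B)"
proof -
 let ?C = "{A. open A \<and> (\<exists>B. openin Tp B \<and> Q B \<and> f ` (S \<inter> A) \<subseteq> B)}"
 have "\<exists>A\<in>?C. x \<in> A" if x: "x \<in> S" for x
 proof -
  have "f x \<in> topspace Tp" using f x by (auto simp: continuous_map_def)
  then obtain B where B: "openin Tp B" "f x \<in> B" "Q B" using cov by blast
  have "openin (top_of_set S) {x \<in> S. f x \<in> B}"
   using openin_continuous_map_preimage[OF f B(1)] by simp
  then obtain A where A: "open A" "{x \<in> S. f x \<in> B} = S \<inter> A" by (auto simp: openin_open)
  thus ?thesis using B x by (intro bexI[of _ A]) auto
 qed
 hence C: "S \<subseteq> \<Union>?C" by (simp only: subset_iff Union_iff) simp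
 obtain x where "x \<in> S" using assms(2) by blast
 with C have ne: "?C \<noteq> {}" by (metis Union_empty empty_iff subsetD)
 have op: "open B" if "B \<in> ?C" for B using that by simp
 obtain \<delta> where d: "0 < \<delta>" "\<And>T. T \<subseteq> S ==> diameter T < \<delta> ==> \<exists>B \<in> ?C. T \<subseteq> B"
  by (rule Lebesgue_number_lemma[OF assms(1) ne C op]) blast+
 show ?thesis
 proof (intro exI[of _ "\<delta> / 2"] conjI allI impI)
  fix T assume T: "T \<subseteq> S" "\<forall>x\<in>T. \<forall>y\<in>T. norm (x - y) \<le> \<delta> / 2"
  have "diameter T \<le> \<delta> / 2" using d(1) T(2) by (intro diameter_le) auto
  hence "diameter T < \<delta>" using d(1) by simp
  from d(2)[OF T(1) this] obtain A where A: "A \<in> ?C" "T \<subseteq> A" ..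
  from A(1) obtain B where B: "openin Tp B" "Q B" "f ` (S \<inter> A) \<subseteq> B" by blast
  have "f ` T \<subseteq> B" using B(3) A(2) T(1) by blast
  thus "\<exists>B. openin Tp B \<and> Q B \<and> f ` T \<subseteq> B" using B by blast
 qed (use d in simp)
qed

lemma path_mesh:
 assumes p: "pathin Tp p" and cov: "\<And>u. u \<in> topspace Tp ==> \<exists>B. openin Tp B \<and> u \<in> B \<and> Q B"
 shows "\<exists>N0\<ge>1::nat. \<forall>N\<ge>N0. \<forall>i<N.
  \<exists>B. openin Tp B \<and> Q B \<and> p ` {real i / real N..real (Suc i) / real N} \<subseteq> B"
proof -
 have "{0..1::real} \<noteq> {}" by simp
 from lebesgue_mesh[OF compact_Icc this p[unfolded pathin_def] cov]
 obtain \<delta> where d: "\<delta> > 0" "\<forall>T. T \<subseteq> {0..1} --> (\<forall>x\<in>T. \<forall>y\<in>T. norm (x - y) \<le> \<delta>) -->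
  (\<exists>B. openin Tp B \<and> Q B \<and> p ` T \<subseteq> B)" by blast
 obtain N0 :: nat where N0: "1 / \<delta> \<le> real N0" using real_arch_simple by blast
 show ?thesis
 proof (intro exI[of _ "Suc N0"] conjI allI impI)
  fix N i assume N: "Suc N0 \<le> N" "i < N"
  have "1 / \<delta> \<le> real N" "0 < real N" using N0 N by linarith+
  hence w: "1 / real N \<le> \<delta>" using d(1) by (simp add: field_simps)
  have s: "real (Suc i) / real N = real i / real N + 1 / real N" by (simp add: add_divide_distrib)
  have le: "real (Suc i) / real N \<le> 1" "0 \<le> real i / real N" using N by (simp_all add: divide_le_eq)
  let ?T = "{real i / real N..real (Suc i) / real N}"
  have "?T \<subseteq> {0..1}" using le by (auto simp del: of_nat_Suc)
  moreover have "\<forall>x\<in>?T. \<forall>y\<in>?T. norm (x - y) \<le> \<delta>" using w s by (auto simp: abs_if simp del: of_nat_Suc)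
  ultimately show "\<exists>B. openin Tp B \<and> Q B \<and> p ` ?T \<subseteq> B" using d(2) by blast
 qed simp
qed

primrec hprod :: "('w, 'z) monoid_scheme => nat => (nat => 'w) => 'w" where
 "hprod W 0 f = \<one>\<^bsub>W\<^esub>"
| "hprod W (Suc n) f = hprod W n f \<otimes>\<^bsub>W\<^esub> f n"

lemma (in group) hprod_closed: "(\<And>i. i < n ==> f i \<in> carrier G) ==> hprod G n f \<in> carrier G"
 by (induction n) auto

lemma hprod_cong: "(\<And>i. i < n ==> f i = h i) ==> hprod W n f = hprod W n h"
 by (induction n) auto

lemma (in group) hprod_add:
 assumes "\<And>i. i < n + k ==> f i \<in> carrier G"
 shows "hprod G (n + k) f = hprod G n f \<otimes> hprod G k (\<lambda>j. f (n + j))"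
 using assms
proof (induction k)
 case 0
 thus ?case using hprod_closed[of n f] by simp
next
 case (Suc k)
 thus ?case using hprod_closed[of n f] hprod_closed[of k "\<lambda>j. f (n + j)"] by (simp add: m_assoc)
qed

lemma (in group) hprod_blocks:
 assumes "\<And>i. i < n * k ==> f i \<in> carrier G"
 shows "hprod G (n * k) f = hprod G n (\<lambda>i. hprod G k (\<lambda>j. f (i * k + j)))"
 using assms
proof (induction n)
 case (Suc n)
 have "hprod G (Suc n * k) f = hprod G (n * k + k) f" by (simp add: add.commute)
 also have "\<dots> = hprod G (n * k) f \<otimes> hprod G k (\<lambda>j. f (n * k + j))"
  using Suc.prems by (intro hprod_add) auto
 finally show ?case using Suc by simp
qed simp

text \<open>A flat connection given by its local transport: g is defined for all pairs of points,
  but the cocycle identity is demanded only inside a small open set around each point.\<close>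

locale cocycle = W: group W for W :: "('w, 'z) monoid_scheme" (structure) +
 fixes Tp :: "'a topology" and g :: "'a => 'a => 'w"
 assumes g_closed: "\<And>a b. a \<in> topspace Tp ==> b \<in> topspace Tp ==> g a b \<in> carrier W"
  and g_local: "\<And>u. u \<in> topspace Tp ==> \<exists>B. openin Tp B \<and> u \<in> B \<and>
   (\<forall>a\<in>B. \<forall>b\<in>B. \<forall>c\<in>B. g a b \<otimes> g b c = g a c)"
begin

definition good :: "'a set => bool" where
 "good B \<longleftrightarrow> B \<subseteq> topspace Tp \<and> (\<forall>a\<in>B. \<forall>b\<in>B. \<forall>c\<in>B. g a b \<otimes> g b c = g a c)"

lemma good_cover: "u \<in> topspace Tp ==> \<exists>B. openin Tp B \<and> u \<in> B \<and> good B"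
 using g_local[of u] openin_subset unfolding good_def by blast

lemma good_self:
 assumes "good B" "a \<in> B"
 shows "g a a = \<one>"
proof -
 have "a \<in> topspace Tp" "g a a \<otimes> g a a = g a a" using assms by (auto simp: good_def)
 thus ?thesis using g_closed W.l_cancel_one[of "g a a" "g a a"] by simp
qed

definition hol_mesh :: "nat => (real => 'a) => 'w" where
 "hol_mesh N p = hprod W N (\<lambda>i. g (p (real i / real N)) (p (real (Suc i) / real N)))"

definition fine_mesh :: "nat => (real => 'a) => bool" where
 "fine_mesh N p \<longleftrightarrow> N \<ge> 1 \<and> (\<forall>i<N. \<exists>B. good B \<and> p ` {real i / real N..real (Suc i) / real N} \<subseteq> B)"

definition hol :: "(real => 'a) => 'w" where
 "hol p = hol_mesh (SOME N. fine_mesh N p) p"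

lemma fine_mesh_pos: "fine_mesh N p ==> N \<ge> 1"
 by (simp add: fine_mesh_def)

lemma ex_fine_mesh:
 assumes "pathin Tp p"
 obtains N0 where "N0 \<ge> 1" "\<And>N. N \<ge> N0 ==> fine_mesh N p"
proof -
 from path_mesh[OF assms good_cover]
 obtain N0 :: nat where N0: "N0 \<ge> 1" "\<forall>N\<ge>N0. \<forall>i<N.
  \<exists>B. openin Tp B \<and> good B \<and> p ` {real i / real N..real (Suc i) / real N} \<subseteq> B"
  by blast
 have "fine_mesh N p" if N: "N \<ge> N0" for N
  unfolding fine_mesh_def
 proof (intro conjI allI impI)
  show "N \<ge> 1" using N N0(1) by simp
  fix i assume "i < N"
  with N0(2) N show "\<exists>B. good B \<and> p ` {real i / real N..real (Suc i) / real N} \<subseteq> B" by blast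
 qed
 thus ?thesis using that N0(1) by blast
qed

lemma telescope:
 assumes "good B" "\<And>j. j \<le> k ==> a j \<in> B"
 shows "hprod W k (\<lambda>j. g (a j) (a (Suc j))) = g (a 0) (a k)"
 using assms(2)
proof (induction k)
 case 0
 thus ?case using good_self[OF assms(1)] by simp
next
 case (Suc k)
 thus ?case using assms(1) by (simp add: good_def)
qed

lemma mesh_in:
 assumes p: "pathin Tp p" and i: "i \<le> N"
 shows "p (real i / real N) \<in> topspace Tp"
 using i by (intro pathin_in[OF p]) (auto simp: divide_le_eq_1)

lemma hol_mesh_closed: "pathin Tp p ==> hol_mesh N p \<in> carrier W"
 unfolding hol_mesh_def by (intro W.hprod_closed g_closed mesh_in) auto

lemma hol_mesh_refine:
 assumes p: "pathin Tp p" and N: "fine_mesh N p" and k: "k \<ge> 1"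
 shows "hol_mesh (N * k) p = hol_mesh N p"
proof -
 let ?f = "\<lambda>i. g (p (real i / real (N * k))) (p (real (Suc i) / real (N * k)))"
 have "hol_mesh (N * k) p = hprod W N (\<lambda>i. hprod W k (\<lambda>j. ?f (i * k + j)))"
  unfolding hol_mesh_def using p by (intro W.hprod_blocks g_closed mesh_in) auto
 also have "\<dots> = hol_mesh N p" unfolding hol_mesh_def
 proof (rule hprod_cong)
  fix i assume i: "i < N"
  obtain B where B: "good B" "p ` {real i / real N..real (Suc i) / real N} \<subseteq> B"
   using N i unfolding fine_mesh_def by blast
  let ?a = "\<lambda>j. p (real (i * k + j) / real (N * k))"
  have NK: "real N > 0" "real k > 0" using i k by auto
  have "?a j \<in> B" if "j \<le> k" for j
  proof -
   have "real (i * k + j) / real (N * k) = (real i + real j / real k) / real N"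
    using NK by (simp add: field_simps)
   moreover have "0 \<le> real j / real k" "real j / real k \<le> 1" using that NK by (auto simp: divide_le_eq_1)
   ultimately have "real (i * k + j) / real (N * k) \<in> {real i / real N..real (Suc i) / real N}"
    using NK by (auto intro!: divide_right_mono)
   thus ?thesis using B(2) by blast
  qed
  hence "hprod W k (\<lambda>j. g (?a j) (?a (Suc j))) = g (?a 0) (?a k)" by (rule telescope[OF B(1)])
  moreover have "real (i * k + 0) / real (N * k) = real i / real N" using NK by simp
  moreover have "real (i * k + k) / real (N * k) = real (Suc i) / real N"
  proof -
   have "real (i * k + k) = real (Suc i) * real k" by (simp add: algebra_simps)
   thus ?thesis using NK by simp
  qed
  ultimately show "hprod W k (\<lambda>j. ?f (i * k + j)) = g (p (real i / real N)) (p (real (Suc i) / real N))"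
   by (simp only: add_Suc_right)
 qed
 finally show ?thesis .
qed

text \<open>Two fine meshes have their product as a common refinement, and refining does not change
  the value.\<close>

lemma hol_eq:
 assumes "pathin Tp p" "fine_mesh N p"
 shows "hol p = hol_mesh N p"
proof -
 let ?M = "SOME N. fine_mesh N p"
 have M: "fine_mesh ?M p" using assms(2) by (rule someI[of "\<lambda>N. fine_mesh N p"])
 have "hol_mesh (?M * N) p = hol_mesh ?M p"
  by (rule hol_mesh_refine[OF assms(1) M fine_mesh_pos[OF assms(2)]])
 moreover have "hol_mesh (N * ?M) p = hol_mesh N p"
  by (rule hol_mesh_refine[OF assms fine_mesh_pos[OF M]])
 ultimately show ?thesis by (simp add: hol_def mult.commute)
qed

lemma hol_closed: "pathin Tp p ==> hol p \<in> carrier W"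
 using hol_mesh_closed by (simp add: hol_def)

lemma hol_join:
 assumes p: "pathin Tp p" "pathin Tp q" "p 1 = q 0"
 shows "hol (path_join p q) = hol p \<otimes> hol q"
proof -
 obtain N1 where N1: "\<And>N. N \<ge> N1 ==> fine_mesh N p" using ex_fine_mesh[OF p(1)] by blast
 obtain N2 where N2: "\<And>N. N \<ge> N2 ==> fine_mesh N q" using ex_fine_mesh[OF p(2)] by blast
 obtain N3 where N3: "\<And>N. N \<ge> N3 ==> fine_mesh N (path_join p q)"
  using ex_fine_mesh[OF pathin_join[OF p]] by blast
 define N where "N = N1 + N2 + N3 + 1"
 have N: "fine_mesh N p" "fine_mesh N q" "fine_mesh (N + N) (path_join p q)" "N > 0"
  using N1[of N] N2[of N] N3[of "N + N"] by (auto simp: N_def)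
 let ?r = "path_join p q"
 let ?f = "\<lambda>i. g (?r (real i / real (N + N))) (?r (real (Suc i) / real (N + N)))"
 have 1: "?r (real i / real (N + N)) = p (real i / real N)" if "i \<le> N" for i
 proof -
  have "real i / real (N + N) \<le> 1/2" "2 * (real i / real (N + N)) = real i / real N"
   using that N(4) by (simp_all add: field_simps)
  thus ?thesis unfolding path_join_def by simp
 qed
 have 2: "?r (real (N + i) / real (N + N)) = q (real i / real N)" for i
 proof (cases "i = 0")
  case True
  thus ?thesis using 1[of N] N(4) p(3) by simp
 next
  case False
  hence "\<not> real (N + i) / real (N + N) \<le> 1/2" "2 * (real (N + i) / real (N + N)) - 1 = real i / real N"
   using N(4) by (simp_all add: field_simps)
  thus ?thesis unfolding path_join_def by simp
 qed
 have "hol ?r = hprod W (N + N) ?f"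
  using hol_eq[OF pathin_join[OF p] N(3)] by (simp add: hol_mesh_def)
 also have "\<dots> = hprod W N ?f \<otimes> hprod W N (\<lambda>j. ?f (N + j))"
  using pathin_join[OF p] by (intro W.hprod_add g_closed mesh_in) auto
 also have "hprod W N ?f = hol p"
  unfolding hol_eq[OF p(1) N(1)] hol_mesh_def by (intro hprod_cong) (simp only: 1 Suc_leI less_imp_le)
 also have "hprod W N (\<lambda>j. ?f (N + j)) = hol q"
  unfolding hol_eq[OF p(2) N(2)] hol_mesh_def by (intro hprod_cong) (simp only: add_Suc_right[symmetric] 2)
 finally show ?thesis .
qed

text \<open>The homotopy is cut into boxes, each mapped into a good set. Going around a box either
  way gives the same value, so the products along consecutive curves of the grid agree; the fixed
  ends contribute 1.\<close>

lemma hol_homotopic: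
 assumes "path_homotopic Tp p q"
 shows "hol p = hol q"
proof -
 have pq: "pathin Tp p" "pathin Tp q" using path_homotopic_pathin[OF assms] by auto
 obtain h where h: "continuous_map (top_of_set ({0..1} \<times> {0..1})) Tp h" "\<And>t. h (0, t) = p t" "\<And>t. h (1, t) = q t"
  "\<And>s. s \<in> {0..1::real} ==> h (s, 0::real) = p 0 \<and> h (s, 1) = p 1"
  using assms unfolding path_homotopic_square by metis
 let ?S = "{0..1::real} \<times> {0..1::real}"
 have "?S \<noteq> {}" by simp
 from lebesgue_mesh[OF compact_Times[OF compact_Icc compact_Icc] this h(1) good_cover]
 obtain \<delta> where d: "\<delta> > 0" "\<forall>T. T \<subseteq> ?S --> (\<forall>x\<in>T. \<forall>y\<in>T. norm (x - y) \<le> \<delta>) -->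
  (\<exists>B. openin Tp B \<and> good B \<and> h ` T \<subseteq> B)" by blast
 obtain N1 where N1: "\<And>N. N \<ge> N1 ==> fine_mesh N p" using ex_fine_mesh[OF pq(1)] by blast
 obtain N2 where N2: "\<And>N. N \<ge> N2 ==> fine_mesh N q" using ex_fine_mesh[OF pq(2)] by blast
 \<comment> \<open>The factor 2 arises because a difference inside a box is bounded by the sum of
   the two sides, each 1 / N.\<close>
 obtain N3 :: nat where N3: "2 / \<delta> \<le> real N3" using real_arch_simple by blast
 define N where "N = N1 + N2 + N3 + 1"
 have N: "fine_mesh N p" "fine_mesh N q" "N > 0" using N1[of N] N2[of N] by (auto simp: N_def)
 have "2 / \<delta> \<le> real N" using N3 by (simp add: N_def)
 hence w: "2 / real N \<le> \<delta>" using d(1) N(3) by (simp add: field_simps)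
 let ?x = "\<lambda>i j. h (real j / real N, real i / real N)"
 have box: "\<exists>B. good B \<and> ?x i j \<in> B \<and> ?x (Suc i) j \<in> B \<and> ?x i (Suc j) \<in> B \<and> ?x (Suc i) (Suc j) \<in> B"
  if ij: "i < N" "j < N" for i j
 proof -
  let ?T = "{real j / real N..real (Suc j) / real N} \<times> {real i / real N..real (Suc i) / real N}"
  have s: "real (Suc k) / real N = real k / real N + 1 / real N" for k by (simp add: add_divide_distrib)
  have le: "real (Suc i) / real N \<le> 1" "real (Suc j) / real N \<le> 1" using ij by (auto simp: divide_le_eq_1)
  have nn: "0 \<le> real k / real N" for k by simp
  have "\<exists>B. openin Tp B \<and> good B \<and> h ` ?T \<subseteq> B"
  proof (rule d(2)[rule_format])
   show "?T \<subseteq> ?S" by (rule Sigma_mono; use le nn[of i] nn[of j] in \<open>auto simp del: of_nat_Suc intro: order_trans\<close>)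
   fix x y assume xy: "x \<in> ?T" "y \<in> ?T"
   have "norm (x - y) \<le> norm (fst (x - y)) + norm (snd (x - y))"
    using norm_Pair_le[of "fst (x - y)" "snd (x - y)"] by (simp only: prod.collapse)
   also have "norm (fst (x - y)) \<le> 1 / real N" using xy s[of j] by (auto simp: abs_if)
   also have "norm (snd (x - y)) \<le> 1 / real N" using xy s[of i] by (auto simp: abs_if)
   finally show "norm (x - y) \<le> \<delta>" using w by simp
  qed
  then obtain B where B: "good B" "h ` ?T \<subseteq> B" by blast
  have "real k / real N \<le> real (Suc k) / real N" for k by (simp add: divide_right_mono)
  thus ?thesis using B by (intro exI[of _ B]) (auto simp: image_subset_iff)
 qed
 have xin: "?x i j \<in> topspace Tp" if "i \<le> N" "j \<le> N" for i j
 proof -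
  have "(real j / real N, real i / real N) \<in> ?S" using that by (auto simp: divide_le_eq_1)
  thus ?thesis using h(1) by (auto simp: continuous_map_def)
 qed
 have row: "hprod W i (\<lambda>i. g (?x i j) (?x (Suc i) j)) \<otimes> g (?x i j) (?x i (Suc j))
   = g (?x 0 j) (?x 0 (Suc j)) \<otimes> hprod W i (\<lambda>i. g (?x i (Suc j)) (?x (Suc i) (Suc j)))"
  if iN: "i \<le> N" and jN: "j < N" for i j
  using iN
 proof (induction i)
  case 0
  have "?x 0 j \<in> topspace Tp" "?x 0 (Suc j) \<in> topspace Tp" by (rule xin; use jN in simp)+
  thus ?case using g_closed by simp
 next
  case (Suc i)
  hence i: "i < N" by simp
  obtain B where B: "good B" "?x i j \<in> B" "?x (Suc i) j \<in> B" "?x i (Suc j) \<in> B" "?x (Suc i) (Suc j) \<in> B"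
   using box[OF i jN] by blast
  have e: "g (?x i j) (?x (Suc i) j) \<otimes> g (?x (Suc i) j) (?x (Suc i) (Suc j))
   = g (?x i j) (?x i (Suc j)) \<otimes> g (?x i (Suc j)) (?x (Suc i) (Suc j))"
   using B unfolding good_def by metis
  define P where "P = hprod W i (\<lambda>i. g (?x i j) (?x (Suc i) j))"
  define P' where "P' = hprod W i (\<lambda>i. g (?x i (Suc j)) (?x (Suc i) (Suc j)))"
  have c: "P \<in> carrier W" "P' \<in> carrier W"
   unfolding P_def P'_def by (intro W.hprod_closed g_closed xin; use i jN in linarith)+
  have c2: "g (?x i j) (?x (Suc i) j) \<in> carrier W" "g (?x (Suc i) j) (?x (Suc i) (Suc j)) \<in> carrier W"
   "g (?x i j) (?x i (Suc j)) \<in> carrier W" "g (?x i (Suc j)) (?x (Suc i) (Suc j)) \<in> carrier W"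
   "g (?x 0 j) (?x 0 (Suc j)) \<in> carrier W"
   by (intro g_closed xin; use i jN in linarith)+
  have IH: "P \<otimes> g (?x i j) (?x i (Suc j)) = g (?x 0 j) (?x 0 (Suc j)) \<otimes> P'"
   using Suc.IH i by (simp add: P_def P'_def)
  have "(P \<otimes> g (?x i j) (?x (Suc i) j)) \<otimes> g (?x (Suc i) j) (?x (Suc i) (Suc j))
   = P \<otimes> (g (?x i j) (?x i (Suc j)) \<otimes> g (?x i (Suc j)) (?x (Suc i) (Suc j)))"
   using c c2 e by (simp only: W.m_assoc)
  also have "\<dots> = (P \<otimes> g (?x i j) (?x i (Suc j))) \<otimes> g (?x i (Suc j)) (?x (Suc i) (Suc j))"
   using c c2 by (simp only: W.m_assoc)
  also have "\<dots> = g (?x 0 j) (?x 0 (Suc j)) \<otimes> (P' \<otimes> g (?x i (Suc j)) (?x (Suc i) (Suc j)))"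
   unfolding IH using c c2 by (simp only: W.m_assoc)
  finally show ?case by (simp only: P_def P'_def hprod.simps)
 qed
 have one: "g u u = \<one>" if "u \<in> topspace Tp" for u
  using good_cover[OF that] good_self by blast
 have edge: "?x 0 j = p 0" "?x N j = p 1" if "j \<le> N" for j
  using h(4)[of "real j / real N"] that N(3) by (auto simp: divide_le_eq_1)
 have "hprod W N (\<lambda>i. g (?x i j) (?x (Suc i) j)) = hprod W N (\<lambda>i. g (?x i 0) (?x (Suc i) 0))" if "j \<le> N" for j
  using that
 proof (induction j)
  case (Suc j)
  have c: "hprod W N (\<lambda>i. g (?x i k) (?x (Suc i) k)) \<in> carrier W" if "k \<le> N" for k
   by (intro W.hprod_closed g_closed xin; use that in linarith)
  have ends: "p 0 \<in> topspace Tp" "p 1 \<in> topspace Tp" using pathin_in[OF pq(1)] by auto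
  have "hprod W N (\<lambda>i. g (?x i (Suc j)) (?x (Suc i) (Suc j))) = hprod W N (\<lambda>i. g (?x i j) (?x (Suc i) j))"
   using row[of N j] Suc.prems edge[of j] edge[of "Suc j"] one ends c[of j] c[of "Suc j"] by simp
  thus ?case using Suc by simp
 qed simp
 from this[of N] show ?thesis
  using hol_eq[OF pq(1) N(1)] hol_eq[OF pq(2) N(2)] N(3) h(2,3) by (simp add: hol_mesh_def)
qed

lemma hol_const: "u \<in> topspace Tp ==> hol (\<lambda>_. u) = \<one>"
proof -
 assume u: "u \<in> topspace Tp"
 have "hol (\<lambda>_. u) \<otimes> hol (\<lambda>_. u) = hol (\<lambda>_. u)"
  using hol_join[of "\<lambda>_. u" "\<lambda>_. u"] pathin_const[OF u] by (simp add: path_join_def)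
 thus ?thesis
  using hol_closed[OF pathin_const[OF u]] W.l_cancel_one[of "hol (\<lambda>_. u)" "hol (\<lambda>_. u)"] by simp
qed

lemma hol_rev:
 assumes "pathin Tp p"
 shows "hol (path_rev p) = inv hol p"
proof (rule W.inv_equality[symmetric])
 have "hol (path_rev p) \<otimes> hol p = hol (path_join (path_rev p) p)"
  using assms by (intro hol_join[symmetric] pathin_rev) auto
 also have "\<dots> = hol (\<lambda>_. p 1)" using assms by (intro hol_homotopic path_homotopic_rev)
 finally show "hol (path_rev p) \<otimes> hol p = \<one>"
  using pathin_in[OF assms, of 1] by (simp add: hol_const)
qed (use hol_closed[OF assms] hol_closed[OF pathin_rev[OF assms]] in simp_all)

text \<open>With a local primitive \<theta> along the path the product telescopes. This is how the
  holonomy of concrete motions is computed.\<close>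

lemma hol_local:
 assumes p: "pathin Tp p" and \<theta>: "\<And>t. t \<in> {0..1} ==> \<theta> t \<in> carrier W"
  and loc: "\<And>t. t \<in> {0..1} ==> \<exists>e>0. \<forall>s\<in>{0..1}. \<forall>s'\<in>{0..1}. \<bar>s - t\<bar> < e --> \<bar>s' - t\<bar> < e -->
   g (p s) (p s') = inv \<theta> s \<otimes> \<theta> s'"
 shows "hol p = inv \<theta> 0 \<otimes> \<theta> 1"
proof -
 define Q where "Q B \<longleftrightarrow> (\<forall>s\<in>B. \<forall>s'\<in>B. g (p s) (p s') = inv \<theta> s \<otimes> \<theta> s')" for B
 have cov: "\<exists>B. openin (top_of_set {0..1}) B \<and> t \<in> B \<and> Q B" if "t \<in> topspace (top_of_set {0..1})" for t :: real
 proof -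
  have t: "t \<in> {0..1}" using that by simp
  obtain e where e: "e > 0 \<and> (\<forall>s\<in>{0..1}. \<forall>s'\<in>{0..1}. \<bar>s - t\<bar> < e --> \<bar>s' - t\<bar> < e -->
   g (p s) (p s') = inv \<theta> s \<otimes> \<theta> s')" using loc[OF t] ..
  have b: "s \<in> {0..1} \<inter> ball t e \<longleftrightarrow> s \<in> {0..1} \<and> \<bar>s - t\<bar> < e" for s
   by (simp add: dist_real_def abs_minus_commute)
  have "Q ({0..1} \<inter> ball t e)" unfolding Q_def Ball_def b using e by blast
  moreover have "t \<in> {0..1} \<inter> ball t e" using t e by simp
  moreover have "openin (top_of_set {0..1}) ({0..1} \<inter> ball t e)" by (rule openin_open_Int) simp
  ultimately show ?thesis by blast
 qed
 have "pathin (top_of_set {0..1}) (\<lambda>t. t)" by (simp add: pathin_def)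
 from path_mesh[OF this cov]
 obtain N1 :: nat where N1: "\<forall>N\<ge>N1. \<forall>i<N. \<exists>B. openin (top_of_set {0..1}) B \<and> Q B \<and>
   (\<lambda>t. t) ` {real i / real N..real (Suc i) / real N} \<subseteq> B" by blast
 obtain N2 where N2: "\<And>N. N \<ge> N2 ==> fine_mesh N p" using ex_fine_mesh[OF p(1)] by blast
 define N where "N = N1 + N2 + 1"
 have N: "fine_mesh N p" "N > 0" "N \<ge> N1" using N2[of N] by (auto simp: N_def)
 have step: "g (p (real i / real N)) (p (real (Suc i) / real N)) = inv \<theta> (real i / real N) \<otimes> \<theta> (real (Suc i) / real N)"
  if i: "i < N" for i
 proof -
  obtain B where B: "Q B" "(\<lambda>t. t) ` {real i / real N..real (Suc i) / real N} \<subseteq> B" using N1 N(3) i by blast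
  have "real i / real N \<le> real (Suc i) / real N" by (simp add: divide_right_mono)
  hence "real i / real N \<in> B" "real (Suc i) / real N \<in> B"
   using B(2) by (auto simp: image_subset_iff simp del: of_nat_Suc)
  with B(1) show ?thesis unfolding Q_def by (elim ballE) auto
 qed
 have \<theta>N: "\<theta> (real i / real N) \<in> carrier W" if "i \<le> N" for i
  using that by (intro \<theta>) (auto simp: divide_le_eq_1)
 have "hprod W i (\<lambda>i. g (p (real i / real N)) (p (real (Suc i) / real N))) = inv \<theta> 0 \<otimes> \<theta> (real i / real N)"
  if "i \<le> N" for i
  using that
 proof (induction i)
  case 0
  thus ?case using \<theta>[of 0] by simp
 next
  case (Suc i)
  define a where "a = \<theta> (real i / real N)"
  define b where "b = \<theta> (real (Suc i) / real N)"
  have ab: "a \<in> carrier W" "b \<in> carrier W" "\<theta> 0 \<in> carrier W" using \<theta>N[of i] \<theta>N[of "Suc i"] \<theta>[of 0] Suc.prems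
   by (simp_all add: a_def b_def)
  have "hprod W (Suc i) (\<lambda>i. g (p (real i / real N)) (p (real (Suc i) / real N)))
   = (inv \<theta> 0 \<otimes> a) \<otimes> (inv a \<otimes> b)"
   using Suc.IH Suc.prems step[of i] by (simp add: a_def b_def)
  also have "\<dots> = inv \<theta> 0 \<otimes> ((a \<otimes> inv a) \<otimes> b)"
   using ab by (simp only: W.m_assoc W.m_closed W.inv_closed)
  also have "\<dots> = inv \<theta> 0 \<otimes> b" using ab by simp
  finally show ?case by (simp add: b_def)
 qed
 from this[of N] show ?thesis using hol_eq[OF p N(1)] N(2) by (simp add: hol_mesh_def)
qed

end

locale based_cocycle = based_space Tp x0 + cocycle W Tp g
 for Tp :: "'a topology" and x0 :: 'a and W :: "('w, 'z) monoid_scheme" (structure) and g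
begin

text \<open>The base point is arbitrary, while computations start at a convenient configuration u.
  Conjugating by the holonomy of the path \<open>\<kappa> u\<close> yields the plain value
  \<open>hol p\<close> on loops at u. The last clause covers all elements of the group, as required
  for comparing signs in \<open>no_free_arc\<close>.\<close>

lemma ex_hol_hom_conj:
 assumes u: "u \<in> topspace Tp"
 obtains \<psi> k where "\<psi> \<in> hom FG W"
  "\<And>p. pathin Tp p ==> p 0 = u ==> p 1 = u ==> \<psi> (cls p) = hol p"
  "k \<in> carrier W" "\<And>p. p \<in> loops Tp x0 ==> \<psi> (loop_class Tp x0 p) = inv k \<otimes> hol p \<otimes> k"
proof -
 define k where "k = hol (\<kappa> u)"
 have kp: "pathin Tp (\<kappa> u)" "\<kappa> u 0 = x0" "\<kappa> u 1 = u" using \<kappa>[OF u] by auto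
 have k: "k \<in> carrier W" using hol_closed kp by (simp add: k_def)
 define \<psi> where "\<psi> A = inv k \<otimes> hol (SOME r. r \<in> A) \<otimes> k" for A
 have \<psi>: "\<psi> (loop_class Tp x0 p) = inv k \<otimes> hol p \<otimes> k" if "p \<in> loops Tp x0" for p
  unfolding \<psi>_def using hol_homotopic[OF some_in_loop_class(2)[OF that]] by simp
 have "\<psi> \<in> hom FG W"
 proof (rule homI)
  fix x assume "x \<in> carrier FG"
  then obtain p where p: "p \<in> loops Tp x0" "x = loop_class Tp x0 p" by (auto simp: fundamental_group_def)
  hence "hol p \<in> carrier W" by (intro hol_closed) (simp add: loops_def)
  thus "\<psi> x \<in> carrier W" using \<psi> p k by simp
 next
  fix x y assume "x \<in> carrier FG" "y \<in> carrier FG"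
  then obtain p q where p: "p \<in> loops Tp x0" "x = loop_class Tp x0 p" and q: "q \<in> loops Tp x0" "y = loop_class Tp x0 q"
   by (auto simp: fundamental_group_def)
  define a b where "a = hol p" and "b = hol q"
  have pq: "a \<in> carrier W" "b \<in> carrier W" "hol (path_join p q) = a \<otimes> b"
   using p q hol_closed hol_join unfolding a_def b_def by (auto simp: loops_def)
  have "\<psi> (x \<star> y) = inv k \<otimes> (a \<otimes> b) \<otimes> k"
   using p q \<psi>[OF loops_join] pq by (simp add: fundamental_group_mult)
  also have "\<dots> = inv k \<otimes> a \<otimes> (k \<otimes> inv k) \<otimes> b \<otimes> k"
   using pq k by (simp add: W.m_assoc)
  also have "\<dots> = (inv k \<otimes> a \<otimes> k) \<otimes> (inv k \<otimes> b \<otimes> k)"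
   using pq(1,2) k by (simp only: W.m_assoc W.m_closed W.inv_closed)
  finally show "\<psi> (x \<star> y) = \<psi> x \<otimes> \<psi> y" using p q \<psi> by (simp add: a_def b_def)
 qed
 moreover have "\<psi> (cls p) = hol p" if p: "pathin Tp p" "p 0 = u" "p 1 = u" for p
 proof -
  define a where "a = hol p"
  have a: "a \<in> carrier W" using hol_closed p by (simp add: a_def)
  let ?l = "path_join (\<kappa> u) (path_join p (path_rev (\<kappa> u)))"
  have "hol ?l = k \<otimes> (a \<otimes> inv k)"
   using kp p by (simp add: hol_join hol_rev pathin_join pathin_rev k_def a_def)
  hence "\<psi> (cls p) = inv k \<otimes> (k \<otimes> (a \<otimes> inv k)) \<otimes> k"
   using \<psi>[OF cls_loop[OF p(1)]] p by (simp add: cls_def)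
  also have "\<dots> = (inv k \<otimes> k) \<otimes> a \<otimes> (inv k \<otimes> k)"
   using a k by (simp only: W.m_assoc W.m_closed W.inv_closed)
  also have "\<dots> = a" using a k by simp
  finally show ?thesis by (simp add: a_def)
 qed
 ultimately show ?thesis using that[of \<psi> k] k \<psi> by blast
qed

lemma ex_hol_hom:
 assumes u: "u \<in> topspace Tp"
 obtains \<psi> where "\<psi> \<in> hom FG W"
  "\<And>p. pathin Tp p ==> p 0 = u ==> p 1 = u ==> \<psi> (cls p) = hol p"
 by (rule ex_hol_hom_conj[OF u]) (rule that)

end

section \<open>Configuration spaces, and motions with supports\<close>

section \<open>Configuration spaces and motions of tokens\<close>

lemma openin_quot_top:
 "openin (quot_top S f) U \<longleftrightarrow> U \<subseteq> f ` topspace S \<and> openin S {a \<in> topspace S. f a \<in> U}"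
proof -
 have "istopology (\<lambda>U. U \<subseteq> f ` topspace S \<and> openin S {a \<in> topspace S. f a \<in> U})"
  unfolding istopology_def
 proof (intro conjI allI impI)
  fix A B assume "A \<subseteq> f ` topspace S \<and> openin S {a \<in> topspace S. f a \<in> A}"
   and "B \<subseteq> f ` topspace S \<and> openin S {a \<in> topspace S. f a \<in> B}"
  moreover have "{a \<in> topspace S. f a \<in> A \<inter> B} = {a \<in> topspace S. f a \<in> A} \<inter> {a \<in> topspace S. f a \<in> B}" by auto
  ultimately show "A \<inter> B \<subseteq> f ` topspace S" "openin S {a \<in> topspace S. f a \<in> A \<inter> B}" by auto
 next
  fix \<K> assume K: "\<forall>A\<in>\<K>. A \<subseteq> f ` topspace S \<and> openin S {a \<in> topspace S. f a \<in> A}"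
  have "{a \<in> topspace S. f a \<in> \<Union>\<K>} = (\<Union>A\<in>\<K>. {a \<in> topspace S. f a \<in> A})" by auto
  thus "\<Union>\<K> \<subseteq> f ` topspace S" "openin S {a \<in> topspace S. f a \<in> \<Union>\<K>}" using K by auto
 qed
 thus ?thesis by (simp add: quot_top_def)
qed

lemma topspace_quot_top [simp]: "topspace (quot_top S f) = f ` topspace S"
proof -
 have "{a \<in> topspace S. f a \<in> f ` topspace S} = topspace S" by auto
 hence "openin (quot_top S f) (f ` topspace S)" by (simp add: openin_quot_top)
 hence "f ` topspace S \<subseteq> topspace (quot_top S f)" by (rule openin_subset)
 moreover have "topspace (quot_top S f) \<subseteq> f ` topspace S"
  using openin_topspace[of "quot_top S f"] unfolding openin_quot_top by blast
 ultimately show ?thesis by blast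
qed

lemma continuous_map_quot_top: "continuous_map S (quot_top S f) f"
 unfolding continuous_map_def topspace_quot_top openin_quot_top by blast

lemma topspace_ord_conf: "topspace (ord_conf T n) = {c \<in> PiE {..<n} (\<lambda>_. topspace T). inj_on c {..<n}}"
 unfolding ord_conf_def topspace_subtopology topspace_product_topology by blast

lemma topspace_unord_conf: "topspace (unord_conf T n) = {u. u \<subseteq> topspace T \<and> finite u \<and> card u = n}"
proof
 show "topspace (unord_conf T n) \<subseteq> {u. u \<subseteq> topspace T \<and> finite u \<and> card u = n}"
 proof
  fix u assume "u \<in> topspace (unord_conf T n)"
  then obtain c where c: "c \<in> topspace (ord_conf T n)" "u = c ` {..<n}"
   unfolding unord_conf_def topspace_quot_top by blast
  hence "inj_on c {..<n}" "\<And>i. i < n ==> c i \<in> topspace T" by (auto simp: topspace_ord_conf PiE_iff)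
  thus "u \<in> {u. u \<subseteq> topspace T \<and> finite u \<and> card u = n}" unfolding c(2) by (auto simp: card_image)
 qed
 show "{u. u \<subseteq> topspace T \<and> finite u \<and> card u = n} \<subseteq> topspace (unord_conf T n)"
 proof clarify
  fix u assume u: "u \<subseteq> topspace T" "finite u" "n = card u"
  then obtain h where h: "bij_betw h {..<card u} u" using ex_bij_betw_nat_finite[of u] by (auto simp: atLeast0LessThan)
  let ?c = "restrict h {..<card u}"
  have "?c \<in> topspace (ord_conf T (card u))" "u = ?c ` {..<card u}"
   using h u by (auto simp: topspace_ord_conf bij_betw_def inj_on_def)
  thus "u \<in> topspace (unord_conf T (card u))" unfolding unord_conf_def topspace_quot_top by blast
 qed
qed

lemma continuous_map_conf:
 assumes A: "finite A" "card A = n" and F: "\<And>a. a \<in> A ==> continuous_map Z T (F a)"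
  and inj: "\<And>z. z \<in> topspace Z ==> inj_on (\<lambda>a. F a z) A"
 shows "continuous_map Z (unord_conf T n) (\<lambda>z. (\<lambda>a. F a z) ` A)"
proof -
 obtain h where h: "bij_betw h {..<n} A" using ex_bij_betw_nat_finite[of A] A by (auto simp: atLeast0LessThan)
 have hA: "h i \<in> A" if "i < n" for i using h that by (auto simp: bij_betw_def)
 let ?c = "\<lambda>z. restrict (\<lambda>i. F (h i) z) {..<n}"
 have "continuous_map Z (product_topology (\<lambda>i. T) {..<n}) ?c"
  unfolding continuous_map_componentwise using F hA by (auto intro: continuous_map_eq)
 moreover have "inj_on (?c z) {..<n}" if "z \<in> topspace Z" for z
  using inj[OF that] h by (auto simp: inj_on_def bij_betw_def)
 ultimately have c: "continuous_map Z (ord_conf T n) ?c"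
  unfolding ord_conf_def by (auto simp: continuous_map_in_subtopology)
 have "?c z ` {..<n} = (\<lambda>a. F a z) ` A" for z
 proof -
  have "?c z ` {..<n} = (\<lambda>a. F a z) ` h ` {..<n}" by (auto simp: image_image)
  thus ?thesis using h by (simp add: bij_betw_def)
 qed
 thus ?thesis
  using continuous_map_compose[OF c continuous_map_quot_top[of _ "\<lambda>c. c ` {..<n}"]]
  by (simp add: unord_conf_def comp_def)
qed

text \<open>The preimage in the ordered space is the union of the product boxes over all orderings
  of u.\<close>

lemma openin_unord_conf_box:
 assumes u: "finite u" "card u = n" and V: "\<And>a. a \<in> u ==> openin T (V a)"
 shows "openin (unord_conf T n) {w \<in> topspace (unord_conf T n). \<exists>\<sigma>. bij_betw \<sigma> u w \<and> (\<forall>a\<in>u. \<sigma> a \<in> V a)}"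
  (is "openin _ ?O")
proof -
 let ?B = "\<lambda>\<tau>. topspace (ord_conf T n) \<inter> PiE {..<n} (\<lambda>i. V (\<tau> i))"
 let ?q = "\<lambda>c. c ` {..<n}"
 have ob: "openin (ord_conf T n) (?B \<tau>)" if "bij_betw \<tau> {..<n} u" for \<tau>
 proof -
  have "openin (product_topology (\<lambda>i. T) {..<n}) (PiE {..<n} (\<lambda>i. V (\<tau> i)))"
   using that V by (auto simp: openin_PiE_gen bij_betw_def)
  hence "openin (ord_conf T n) ({c. inj_on c {..<n}} \<inter> PiE {..<n} (\<lambda>i. V (\<tau> i)))"
   unfolding ord_conf_def by (rule openin_subtopology_Int2)
  from openin_Int[OF openin_topspace this] show ?thesis
   by (simp add: topspace_ord_conf Int_def conj_ac)
 qed
 have "{c \<in> topspace (ord_conf T n). ?q c \<in> ?O} = (\<Union>\<tau>\<in>{\<tau>. bij_betw \<tau> {..<n} u}. ?B \<tau>)"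
 proof (intro equalityI subsetI)
  fix c assume c: "c \<in> {c \<in> topspace (ord_conf T n). ?q c \<in> ?O}"
  then obtain \<sigma> where s: "bij_betw \<sigma> u (?q c)" "\<And>a. a \<in> u ==> \<sigma> a \<in> V a" by auto
  have ci: "bij_betw c {..<n} (?q c)" "c \<in> extensional {..<n}" using c by (auto simp: topspace_ord_conf bij_betw_def PiE_def)
  define \<tau> where "\<tau> = inv_into u \<sigma> \<circ> c"
  have "bij_betw \<tau> {..<n} u" unfolding \<tau>_def by (rule bij_betw_trans[OF ci(1) bij_betw_inv_into[OF s(1)]])
  moreover have "c i \<in> V (\<tau> i)" if "i < n" for i
  proof -
   have ci': "c i \<in> \<sigma> ` u" using s(1) that by (auto simp: bij_betw_def)
   hence "\<sigma> (\<tau> i) = c i" "\<tau> i \<in> u" by (auto simp: \<tau>_def f_inv_into_f inv_into_into)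
   thus ?thesis using s(2)[of "\<tau> i"] by simp
  qed
  ultimately show "c \<in> (\<Union>\<tau>\<in>{\<tau>. bij_betw \<tau> {..<n} u}. ?B \<tau>)" using c ci(2) by (auto simp: PiE_def)
 next
  fix c assume "c \<in> (\<Union>\<tau>\<in>{\<tau>. bij_betw \<tau> {..<n} u}. ?B \<tau>)"
  then obtain \<tau> where t: "bij_betw \<tau> {..<n} u" "c \<in> topspace (ord_conf T n)" "\<And>i. i < n ==> c i \<in> V (\<tau> i)" by auto
  have ci: "bij_betw c {..<n} (?q c)" using t by (auto simp: topspace_ord_conf bij_betw_def)
  let ?s = "c \<circ> inv_into {..<n} \<tau>"
  have "bij_betw ?s u (?q c)" by (rule bij_betw_trans[OF bij_betw_inv_into[OF t(1)] ci])
  moreover have "?s a \<in> V a" if "a \<in> u" for a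
  proof -
   have a: "a \<in> \<tau> ` {..<n}" using t(1) that by (auto simp: bij_betw_def)
   have "\<tau> (inv_into {..<n} \<tau> a) = a" "inv_into {..<n} \<tau> a < n"
    using f_inv_into_f[OF a] inv_into_into[OF a] by simp_all
   thus ?thesis using t(3)[of "inv_into {..<n} \<tau> a"] by simp
  qed
  moreover have "?q c \<in> topspace (unord_conf T n)"
   unfolding unord_conf_def topspace_quot_top using t(2) by (rule imageI)
  ultimately show "c \<in> {c \<in> topspace (ord_conf T n). ?q c \<in> ?O}" using t(2) by blast
 qed
 moreover have "openin (ord_conf T n) (\<Union>\<tau>\<in>{\<tau>. bij_betw \<tau> {..<n} u}. ?B \<tau>)"
  by (rule openin_Union) (use ob in blast)
 ultimately have "openin (ord_conf T n) {c \<in> topspace (ord_conf T n). ?q c \<in> ?O}" by (simp only:)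
 moreover have "?O \<subseteq> ?q ` topspace (ord_conf T n)"
 proof -
  have "topspace (unord_conf T n) = ?q ` topspace (ord_conf T n)" by (simp only: unord_conf_def topspace_quot_top)
  thus ?thesis by blast
 qed
 ultimately show ?thesis by (subst unord_conf_def) (simp only: openin_quot_top simp_thms)
qed

lemma pathin_subpath:
 assumes p: "pathin T p" and ab: "a \<in> {0..1}" "b \<in> {0..1}"
 shows "pathin T (\<lambda>s. p (a + (b - a) * s))"
 unfolding pathin_def
proof (rule continuous_map_precompose[OF p[unfolded pathin_def]])
 show "(\<lambda>s. a + (b - a) * s) ` {0..1} \<subseteq> {0..1}"
 proof clarify
  fix s :: real assume s: "s \<in> {0..1}"
  have "a + (b - a) * s = (1 - s) * a + s * b" by (simp add: algebra_simps)
  thus "a + (b - a) * s \<in> {0..1}"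
   using convexD_alt[of "{0..1::real}" a b s] ab s by simp
 qed
qed (intro continuous_intros)

text \<open>F a is the trajectory of the token starting at a, and Z is the support. Points outside u
  or outside Z rest, so the same F can be applied to any configuration that agrees with u on Z and
  whose tokens lie in T; see \<open>moves_disjoint\<close>.\<close>

definition moves :: "'a topology => 'a set => 'a set => ('a => real => 'a) => bool" where
 "moves T u Z F \<longleftrightarrow> (\<forall>a\<in>u. pathin T (F a)) \<and> (\<forall>a. F a 0 = a) \<and>
  (\<forall>t\<in>{0..1}. inj_on (\<lambda>a. F a t) u) \<and> (\<forall>a\<in>u \<inter> Z. \<forall>t\<in>{0..1}. F a t \<in> Z) \<and>
  (\<forall>a. a \<notin> u \<inter> Z --> (\<forall>t\<in>{0..1}. F a t = a))"

definition fin :: "('a => real => 'a) => 'a set => 'a set" where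
 "fin F u = (\<lambda>a. F a 1) ` u"

definition track :: "('a => real => 'a) => 'a set => real => 'a set" where
 "track F u t = (\<lambda>a. F a t) ` u"

definition mcomp :: "'a set => ('a => real => 'a) => ('a => real => 'a) => 'a => real => 'a" where
 "mcomp u F H a = (if a \<in> u then path_join (F a) (H (F a 1)) else (\<lambda>_. a))"

definition mrev :: "'a set => ('a => real => 'a) => 'a => real => 'a" where
 "mrev u F b = (if b \<in> fin F u then path_rev (F (inv_into u (\<lambda>a. F a 1) b)) else (\<lambda>_. b))"

definition slide :: "'a => (real => 'a) => 'a => real => 'a" where
 "slide a \<gamma> b = (if b = a then \<gamma> else (\<lambda>_. b))"

lemma slide_at: "slide a \<gamma> b t = (if b = a then \<gamma> t else b)"
 by (simp add: slide_def)

lemma movesD: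
 assumes "moves T u Z F"
 shows "a \<in> u ==> pathin T (F a)" "F a 0 = a" "t \<in> {0..1} ==> inj_on (\<lambda>a. F a t) u"
  "a \<in> u ==> a \<in> Z ==> t \<in> {0..1} ==> F a t \<in> Z"
  "a \<notin> u \<or> a \<notin> Z ==> t \<in> {0..1} ==> F a t = a"
 using assms by (auto simp: moves_def)

lemma moves_subset: "moves T u Z F ==> u \<subseteq> topspace T"
 using movesD(1,2) pathin_in[of T _ 0] by (metis order_refl subsetI zero_le_one)

lemma moves_mono:
 assumes "moves T u Z F" "Z \<subseteq> Z'"
 shows "moves T u Z' F"
 unfolding moves_def
proof (intro conjI ballI allI impI)
 fix a t assume "a \<in> u \<inter> Z'" "t \<in> {0..1::real}"
 thus "F a t \<in> Z'" using movesD(4,5)[OF assms(1), of a t] assms(2) by (cases "a \<in> Z") auto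
next
 fix a t assume "a \<notin> u \<inter> Z'" "t \<in> {0..1::real}"
 thus "F a t = a" using movesD(5)[OF assms(1), of a t] assms(2) by blast
qed (use movesD[OF assms(1)] in auto)

lemma card_fin: "moves T u Z F ==> card (fin F u) = card u"
 unfolding fin_def by (rule card_image) (rule movesD(3); simp)

lemma finite_fin: "finite u ==> finite (fin F u)"
 by (simp add: fin_def)

lemma fin_subset: "moves T u Z F ==> fin F u \<subseteq> topspace T"
 unfolding fin_def using movesD(1) pathin_in[of T _ 1] by fastforce

lemma moves_id: "u \<subseteq> topspace T ==> moves T u Z (\<lambda>a _. a)"
 by (auto simp: moves_def intro: pathin_const)

lemma mcomp_at:
 "mcomp u F H a t = (if a \<in> u then (if t \<le> 1/2 then F a (2 * t) else H (F a 1) (2 * t - 1)) else a)"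
 by (simp add: mcomp_def path_join_def)

lemma moves_mcomp:
 assumes F: "moves T u Z F" and H: "moves T (fin F u) Z H"
 shows "moves T u Z (mcomp u F H)" "fin (mcomp u F H) u = fin H (fin F u)"
  "track (mcomp u F H) u = path_join (track F u) (track H (fin F u))"
proof -
 have fu: "F a 1 \<in> fin F u" if "a \<in> u" for a using that by (simp add: fin_def)
 have FZ: "F a 1 \<in> Z \<longleftrightarrow> a \<in> Z" if "a \<in> u" for a
  using movesD(4)[OF F that, of 1] movesD(5)[OF F, of a 1] by (cases "a \<in> Z") auto
 show "moves T u Z (mcomp u F H)"
  unfolding moves_def
 proof (intro conjI ballI allI impI)
  fix a assume "a \<in> u"
  thus "pathin T (mcomp u F H a)"
   using movesD(1)[OF F] movesD(1)[OF H fu] movesD(2)[OF H] by (auto simp: mcomp_def intro: pathin_join)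
 next
  fix a show "mcomp u F H a 0 = a" using movesD(2)[OF F] by (simp add: mcomp_at)
 next
  fix t :: real assume t: "t \<in> {0..1}"
  show "inj_on (\<lambda>a. mcomp u F H a t) u"
  proof (cases "t \<le> 1/2")
   case True
   thus ?thesis using movesD(3)[OF F, of "2 * t"] t by (simp add: mcomp_at inj_on_def)
  next
   case False
   have "inj_on (\<lambda>b. H b (2 * t - 1)) (fin F u)" "inj_on (\<lambda>a. F a 1) u"
    using movesD(3)[OF H, of "2 * t - 1"] movesD(3)[OF F, of 1] t False by auto
   hence "inj_on ((\<lambda>b. H b (2 * t - 1)) \<circ> (\<lambda>a. F a 1)) u" by (auto simp: fin_def intro: comp_inj_on)
   thus ?thesis using False by (simp add: mcomp_at inj_on_def)
  qed
 next
  fix a t assume a: "a \<in> u \<inter> Z" and t: "t \<in> {0..1::real}"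
  have "t \<le> 1/2 ==> F a (2 * t) \<in> Z" using movesD(4)[OF F, of a "2 * t"] a t by auto
  moreover have "\<not> t \<le> 1/2 ==> H (F a 1) (2 * t - 1) \<in> Z"
   using movesD(4)[OF H fu, of a "2 * t - 1"] FZ a t by auto
  ultimately show "mcomp u F H a t \<in> Z" using a by (auto simp: mcomp_at)
 next
  fix a t assume a: "a \<notin> u \<inter> Z" and t: "t \<in> {0..1::real}"
  show "mcomp u F H a t = a"
  proof (cases "a \<in> u")
   case True
   hence aZ: "a \<notin> Z" using a by simp
   have "t \<le> 1/2 ==> F a (2 * t) = a" using movesD(5)[OF F, of a "2 * t"] aZ t by auto
   moreover have "F a 1 = a" using movesD(5)[OF F, of a 1] aZ by auto
   moreover have "\<not> t \<le> 1/2 ==> H a (2 * t - 1) = a" using movesD(5)[OF H, of a "2 * t - 1"] aZ t by auto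
   ultimately show ?thesis using True by (simp add: mcomp_at)
  qed (simp add: mcomp_at)
 qed
 show "fin (mcomp u F H) u = fin H (fin F u)"
  by (auto simp: fin_def mcomp_at image_image)
 show "track (mcomp u F H) u = path_join (track F u) (track H (fin F u))"
  by (auto simp: track_def fin_def mcomp_at path_join_def fun_eq_iff image_image)
qed

lemma mrev_at:
 assumes F: "moves T u Z F" and a: "a \<in> u"
 shows "mrev u F (F a 1) = path_rev (F a)"
proof -
 have "inv_into u (\<lambda>a. F a 1) (F a 1) = a" using movesD(3)[OF F, of 1] a by (intro inv_into_f_f) auto
 thus ?thesis using a by (auto simp: mrev_def fin_def)
qed

lemma moves_mrev:
 assumes F: "moves T u Z F"
 shows "moves T (fin F u) Z (mrev u F)" "fin (mrev u F) (fin F u) = u"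
  "track (mrev u F) (fin F u) = path_rev (track F u)"
proof -
 have r: "mrev u F (F a 1) t = F a (1 - t)" if "a \<in> u" for a t using mrev_at[OF F that] by (simp add: path_rev_def)
 have FZ: "F a 1 \<in> Z \<longleftrightarrow> a \<in> Z" if "a \<in> u" for a
  using movesD(4)[OF F that, of 1] movesD(5)[OF F, of a 1] by (cases "a \<in> Z") auto
 show "moves T (fin F u) Z (mrev u F)"
  unfolding moves_def
 proof (intro conjI ballI allI impI)
  fix b assume "b \<in> fin F u"
  then obtain a where "a \<in> u" "b = F a 1" by (auto simp: fin_def)
  thus "pathin T (mrev u F b)" using mrev_at[OF F] pathin_rev[OF movesD(1)[OF F]] by simp
 next
  fix b show "mrev u F b 0 = b"
  proof (cases "b \<in> fin F u")
   case True
   then obtain a where "a \<in> u" "b = F a 1" by (auto simp: fin_def)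
   thus ?thesis using r by simp
  qed (simp add: mrev_def)
 next
  fix t :: real assume "t \<in> {0..1}"
  hence "inj_on (\<lambda>a. F a (1 - t)) u" using movesD(3)[OF F, of "1 - t"] by auto
  thus "inj_on (\<lambda>b. mrev u F b t) (fin F u)" by (auto simp: fin_def inj_on_def r)
 next
  fix b t assume b: "b \<in> fin F u \<inter> Z" and t: "t \<in> {0..1::real}"
  then obtain a where a: "a \<in> u" "b = F a 1" by (auto simp: fin_def)
  thus "mrev u F b t \<in> Z" using r FZ b t movesD(4)[OF F, of a "1 - t"] by auto
 next
  fix b t assume b: "b \<notin> fin F u \<inter> Z" and t: "t \<in> {0..1::real}"
  show "mrev u F b t = b"
  proof (cases "b \<in> fin F u")
   case True
   then obtain a where a: "a \<in> u" "b = F a 1" by (auto simp: fin_def)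
   hence "a \<notin> Z" using FZ b by (auto simp: fin_def)
   hence "F a (1 - t) = a" "F a 1 = a" using t movesD(5)[OF F, of a "1 - t"] movesD(5)[OF F, of a 1] by auto
   thus ?thesis using r[OF a(1), of t] a(2) by simp
  qed (simp add: mrev_def)
 qed
 show "fin (mrev u F) (fin F u) = u"
  using r movesD(2)[OF F] by (force simp: fin_def image_image)
 show "track (mrev u F) (fin F u) = path_rev (track F u)"
  using r by (auto simp: fin_def track_def path_rev_def fun_eq_iff image_image)
qed

lemma moves_slide:
 assumes a: "a \<in> u" "a \<in> Z" and \<gamma>: "pathin T \<gamma>" "\<gamma> 0 = a"
  and free: "\<And>t. t \<in> {0..1} ==> \<gamma> t \<in> Z \<and> \<gamma> t \<notin> u - {a}" and u: "u \<subseteq> topspace T"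
 shows "moves T u Z (slide a \<gamma>)" "fin (slide a \<gamma>) u = insert (\<gamma> 1) (u - {a})"
proof -
 show "moves T u Z (slide a \<gamma>)"
  unfolding moves_def
 proof (intro conjI ballI allI impI)
  fix b assume "b \<in> u"
  thus "pathin T (slide a \<gamma> b)" using \<gamma>(1) u pathin_const[of b T] by (cases "b = a") (auto simp: slide_def)
 next
  fix t :: real assume t: "t \<in> {0..1}"
  show "inj_on (\<lambda>b. slide a \<gamma> b t) u"
  proof (rule inj_onI)
   fix b c assume "b \<in> u" "c \<in> u" "slide a \<gamma> b t = slide a \<gamma> c t"
   thus "b = c" using free[OF t] by (cases "b = a"; cases "c = a") (simp_all add: slide_at)
  qed
 next
  fix b show "slide a \<gamma> b 0 = b" using \<gamma>(2) by (simp add: slide_at)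
 next
  fix b t assume "b \<in> u \<inter> Z" "t \<in> {0..1::real}"
  thus "slide a \<gamma> b t \<in> Z" using free by (simp add: slide_at)
 next
  fix b t assume "b \<notin> u \<inter> Z" "t \<in> {0..1::real}"
  thus "slide a \<gamma> b t = b" using a by (auto simp: slide_at)
 qed
 show "fin (slide a \<gamma>) u = insert (\<gamma> 1) (u - {a})"
 proof -
  have "(\<lambda>b. slide a \<gamma> b 1) ` (u - {a}) = (\<lambda>b. b) ` (u - {a})"
   by (rule image_cong) (auto simp: slide_def)
  moreover have "u = insert a (u - {a})" using a by blast
  hence "fin (slide a \<gamma>) u = (\<lambda>b. slide a \<gamma> b 1) ` insert a (u - {a})"
   unfolding fin_def by (rule arg_cong)
  hence "fin (slide a \<gamma>) u = insert (slide a \<gamma> a 1) ((\<lambda>b. slide a \<gamma> b 1) ` (u - {a}))"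
   by (simp only: image_insert)
  moreover have "slide a \<gamma> a 1 = \<gamma> 1" by (simp add: slide_def)
  ultimately show ?thesis by simp
 qed
qed

text \<open>F neither moves tokens inside Z' nor brings tokens into it, so H meets the same tokens
  after F as before.\<close>

lemma moves_disjoint:
 assumes F: "moves T u Z F" and H: "moves T u Z' H" and Z: "Z \<inter> Z' = {}"
 shows "moves T (fin F u) Z' H" "fin F u \<inter> Z' = u \<inter> Z'"
proof -
 have Fid: "F a t = a" if "a \<in> Z'" "t \<in> {0..1}" for a t using movesD(5)[OF F, of a t] that Z by auto
 have FZ: "F a t \<in> Z" if "a \<in> u" "a \<in> Z" "t \<in> {0..1}" for a t using movesD(4)[OF F that] .
 have Fo: "F a 1 = a" if "a \<notin> Z" for a using movesD(5)[OF F, of a 1] that by auto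
 have in1: "b \<in> u" if "b \<in> fin F u" "b \<notin> Z" for b
  using that FZ[of _ 1] Fo by (auto simp: fin_def) (metis Fo)
 show e: "fin F u \<inter> Z' = u \<inter> Z'"
  using in1 Z Fid[of _ 1] by (force simp: fin_def)
 have Hid: "H b t = b" if "b \<notin> u \<inter> Z'" "t \<in> {0..1}" for b t using movesD(5)[OF H, of b t] that by auto
 show "moves T (fin F u) Z' H"
  unfolding moves_def
 proof (intro conjI ballI allI impI)
  fix b assume b: "b \<in> fin F u"
  show "pathin T (H b)"
  proof (cases "b \<in> Z'")
   case True
   thus ?thesis using b e movesD(1)[OF H] by auto
  next
   case False
   have "b \<in> topspace T" using fin_subset[OF F] b by auto
   hence "path_homotopic T (\<lambda>_. b) (H b)" using Hid[of b] False
    by (intro path_homotopic_eq_on pathin_const) auto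
   thus ?thesis using path_homotopic_pathin by blast
  qed
 next
  fix b show "H b 0 = b" using movesD(2)[OF H] .
 next
  fix t :: real assume t: "t \<in> {0..1}"
  show "inj_on (\<lambda>b. H b t) (fin F u)"
  proof (rule inj_onI)
   fix b c assume bc: "b \<in> fin F u" "c \<in> fin F u" "H b t = H c t"
   have HZ: "H b t \<in> Z'" if "b \<in> u" "b \<in> Z'" for b using movesD(4)[OF H that t] .
   have inj: "inj_on (\<lambda>b. H b t) u" using movesD(3)[OF H t] .
   show "b = c"
   proof -
    have bu: "b \<in> Z' ==> b \<in> u" and cu: "c \<in> Z' ==> c \<in> u" using bc(1,2) e by blast+
    have bZ: "b \<notin> Z' ==> H b t = b" and cZ: "c \<notin> Z' ==> H c t = c" using Hid t by blast+
    consider "b \<in> Z'" "c \<in> Z'" | "b \<in> Z'" "c \<notin> Z'" | "b \<notin> Z'" "c \<in> Z'" | "b \<notin> Z'" "c \<notin> Z'" by blast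
    thus ?thesis
    proof cases
     case 1
     thus ?thesis using inj_onD[OF inj bc(3)] bu cu by blast
    next
     case 2
     hence "c \<in> Z'" using HZ[OF bu] cZ bc(3) by simp
     with 2 show ?thesis by simp
    next
     case 3
     hence "b \<in> Z'" using HZ[OF cu] bZ bc(3) by simp
     with 3 show ?thesis by simp
    next
     case 4
     show ?thesis by (rule trans[OF bZ[OF 4(1), symmetric] trans[OF bc(3) cZ[OF 4(2)]]])
    qed
   qed
  qed
 next
  fix b t assume "b \<in> fin F u \<inter> Z'" "t \<in> {0..1::real}"
  thus "H b t \<in> Z'" using e movesD(4)[OF H] by auto
 next
  fix b t assume "b \<notin> fin F u \<inter> Z'" "t \<in> {0..1::real}"
  thus "H b t = b" using e Hid by auto
 qed
qed

lemma pathin_track: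
 assumes F: "moves T u Z F" and u: "finite u" "card u = n"
 shows "pathin (unord_conf T n) (track F u)"
 unfolding pathin_def track_def
 by (rule continuous_map_conf[OF u]) (use movesD(1,3)[OF F] in \<open>auto simp: pathin_def\<close>)

lemma track_ends: "moves T u Z F ==> track F u 0 = u" "track F u 1 = fin F u"
 using movesD(2)[of T u Z F] by (auto simp: track_def fin_def)

text \<open>A token is pushed along a path by moving first the last token on the path to its end.\<close>

lemma push_along_path:
 assumes H: "Hausdorff_space T"
 shows "finite u ==> u \<subseteq> topspace T ==> a \<in> u ==> pathin T \<gamma> ==> \<gamma> ` {0..1} \<subseteq> Z ==> \<gamma> 0 = a ==> \<gamma> 1 = b ==> b \<notin> u ==>
  \<exists>F. moves T u Z F \<and> fin F u = insert b (u - {a})"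
proof (induction "card (u \<inter> \<gamma> ` {0..1})" arbitrary: u b \<gamma> rule: less_induct)
 case less
 have compact_pre: "compact {t \<in> {0..1}. \<delta> t \<in> C}" if "pathin T \<delta>" "finite C" "C \<subseteq> topspace T" for \<delta> :: "real => 'a" and C
 proof -
  have "closedin T C" using H that(2,3) by (simp add: closedin_Hausdorff_finite)
  hence "closedin (top_of_set {0..1}) {t \<in> topspace (top_of_set {0..1}). \<delta> t \<in> C}"
   using that(1) closedin_continuous_map_preimage unfolding pathin_def by blast
  hence "closed {t \<in> {0..1}. \<delta> t \<in> C}" by (simp add: closedin_closed_eq)
  moreover have "bounded {t \<in> {0..1}. \<delta> t \<in> C}" by (rule bounded_subset[of "{0..1}"]) auto
  ultimately show ?thesis by (simp only: compact_eq_bounded_closed)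
 qed
 have bT: "b \<in> topspace T" using pathin_in[OF less.prems(4), of 1] less.prems(7) by simp
 \<comment> \<open>Stopping at the first visit of b keeps b off the remaining path, so that the
   token moved to b is not counted again and the induction measure drops.\<close>
 let ?S1 = "{t \<in> {0..1}. \<gamma> t \<in> {b}}"
 have "1 \<in> ?S1" using less.prems(7) by simp
 hence "compact ?S1" "?S1 \<noteq> {}"
  using compact_pre[OF less.prems(4), of "{b}"] bT by (blast, blast)
 from compact_attains_inf[OF this] obtain t1 where t1_in: "t1 \<in> ?S1" and t1_le: "\<forall>t\<in>?S1. t1 \<le> t" ..
 note t1 = t1_in t1_le[rule_format]
 define \<delta> where "\<delta> s = \<gamma> (t1 * s)" for s
 have t1': "0 \<le> t1" "t1 \<le> 1" "\<gamma> t1 = b" using t1(1) by auto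
 have ts: "t1 * s \<in> {0..1}" if "s \<in> {0..1}" for s using t1' that by (auto simp: mult_le_one)
 have \<delta>p: "pathin T \<delta>"
 proof -
  have "\<delta> = (\<lambda>s. \<gamma> (0 + (t1 - 0) * s))" by (rule ext) (simp add: \<delta>_def)
  moreover have "pathin T (\<lambda>s. \<gamma> (0 + (t1 - 0) * s))" by (rule pathin_subpath[OF less.prems(4)]) (use t1' in auto)
  ultimately show ?thesis by (simp only:)
 qed
 have \<delta>sub: "\<delta> ` {0..1} \<subseteq> \<gamma> ` {0..1}" using ts by (auto simp: \<delta>_def)
 have \<delta>Z: "\<delta> s \<in> Z" if "s \<in> {0..1}" for s using \<delta>sub less.prems(5) that by blast
 have t1pos: "t1 \<noteq> 0" using t1' less.prems by auto
 have \<delta>b: "\<delta> s \<noteq> b" if "s \<in> {0..1}" "s < 1" for s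
 proof
  assume "\<delta> s = b"
  hence "t1 \<le> t1 * s" using t1(2)[of "t1 * s"] ts[OF that(1)] by (auto simp: \<delta>_def)
  thus False using that t1' t1pos by (simp add: mult_le_cancel_left1)
 qed
 let ?S2 = "{s \<in> {0..1}. \<delta> s \<in> u}"
 have "0 \<in> ?S2" using less.prems(3,6) by (simp add: \<delta>_def)
 hence "compact ?S2" "?S2 \<noteq> {}"
  using compact_pre[OF \<delta>p less.prems(1,2)] by (blast, blast)
 from compact_attains_sup[OF this] obtain s1 where s1_in: "s1 \<in> ?S2" and s1_le: "\<forall>s\<in>?S2. s \<le> s1" ..
 note s1 = s1_in s1_le[rule_format]
 define c where "c = \<delta> s1"
 have cu: "c \<in> u" "s1 \<in> {0..1}" using s1(1) by (auto simp: c_def)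
 have s1lt: "s1 < 1" using s1(1) less.prems(8) t1' by (cases "s1 = 1") (auto simp: \<delta>_def)
 define \<epsilon> where "\<epsilon> s = \<delta> (s1 + (1 - s1) * s)" for s
 have es: "s1 + (1 - s1) * s \<in> {0..1}" if "s \<in> {0..1}" for s
 proof -
  have "0 \<le> (1 - s1) * s" "(1 - s1) * s \<le> 1 - s1" using that s1lt by (auto simp: mult_left_le)
  thus ?thesis using cu by auto
 qed
 have \<epsilon>p: "pathin T \<epsilon>"
  unfolding \<epsilon>_def by (rule pathin_subpath[OF \<delta>p cu(2)]) simp
 have "\<epsilon> s \<in> Z \<and> \<epsilon> s \<notin> u - {c}" if "s \<in> {0..1}" for s
 proof -
  have "\<epsilon> s \<in> Z" using \<delta>Z[OF es[OF that]] by (simp add: \<epsilon>_def)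
  moreover have "\<epsilon> s \<notin> u" if "s > 0"
  proof
   assume "\<epsilon> s \<in> u"
   hence "s1 + (1 - s1) * s \<le> s1" using s1(2)[of "s1 + (1 - s1) * s"] es[OF \<open>s \<in> {0..1}\<close>] by (simp add: \<epsilon>_def)
   thus False using that s1lt by (simp add: mult_le_0_iff)
  qed
  moreover have "\<epsilon> 0 = c" by (simp add: \<epsilon>_def c_def)
  ultimately show ?thesis using that by (cases "s = 0") auto
 qed
 moreover have cZ: "c \<in> Z" using \<delta>Z[OF cu(2)] by (simp add: c_def)
 moreover have "\<epsilon> 0 = c" "\<epsilon> 1 = b" using t1' by (simp_all add: \<epsilon>_def c_def \<delta>_def)
 ultimately have F1: "moves T u Z (slide c \<epsilon>)" "fin (slide c \<epsilon>) u = insert b (u - {c})"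
  using moves_slide[OF cu(1) cZ \<epsilon>p _ _ less.prems(2)] by auto
 show ?case
 proof (cases "c = a")
  case True
  thus ?thesis using F1 by blast
 next
  case False
  let ?u1 = "insert b (u - {c})"
  define \<eta> where "\<eta> s = \<delta> (s1 * s)" for s
  have hs: "s1 * s \<in> {0..1}" "s1 * s < 1" if "s \<in> {0..1}" for s
   using that cu s1lt by (auto simp: mult_le_one intro: le_less_trans[OF mult_left_le])
  have \<eta>p: "pathin T \<eta>"
  proof -
   have "\<eta> = (\<lambda>s. \<delta> (0 + (s1 - 0) * s))" by (rule ext) (simp add: \<eta>_def)
   moreover have "pathin T (\<lambda>s. \<delta> (0 + (s1 - 0) * s))" by (rule pathin_subpath[OF \<delta>p _ cu(2)]) simp
   ultimately show ?thesis by (simp only:)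
  qed
  have \<eta>sub: "\<eta> ` {0..1} \<subseteq> \<gamma> ` {0..1}" using hs \<delta>sub by (force simp: \<eta>_def)
  have bn: "b \<notin> \<eta> ` {0..1}"
  proof
   assume "b \<in> \<eta> ` {0..1}"
   then obtain s where s: "s \<in> {0..1}" "b = \<delta> (s1 * s)" unfolding \<eta>_def by blast
   from \<delta>b[OF hs(1)[OF s(1)] hs(2)[OF s(1)]] s(2) show False by simp
  qed
  have "?u1 \<inter> \<eta> ` {0..1} \<subset> u \<inter> \<gamma> ` {0..1}"
  proof (rule psubsetI)
   show "?u1 \<inter> \<eta> ` {0..1} \<subseteq> u \<inter> \<gamma> ` {0..1}" using \<eta>sub bn by auto
   have "c \<in> u \<inter> \<gamma> ` {0..1}" using cu \<delta>sub by (auto simp: c_def)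
   moreover have "c \<notin> ?u1" using cu less.prems(8) by auto
   ultimately show "?u1 \<inter> \<eta> ` {0..1} \<noteq> u \<inter> \<gamma> ` {0..1}" by blast
  qed
  hence lt: "card (?u1 \<inter> \<eta> ` {0..1}) < card (u \<inter> \<gamma> ` {0..1})"
   using less.prems(1) by (intro psubset_card_mono) auto
  obtain F2 where F2: "moves T ?u1 Z F2" "fin F2 ?u1 = insert c (?u1 - {a})"
  proof -
   have "\<exists>F. moves T ?u1 Z F \<and> fin F ?u1 = insert c (?u1 - {a})"
    by (rule less.hyps[OF lt])
     (use less.prems bT \<eta>p \<eta>sub False cu in \<open>auto simp: \<eta>_def c_def \<delta>_def\<close>)
   thus thesis using that by blast
  qed
  have "insert c (?u1 - {a}) = insert b (u - {a})" using False cu less.prems by auto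
  thus ?thesis using moves_mcomp(1,2)[OF F1(1), of F2] F1(2) F2 by (intro exI[of _ "mcomp u (slide c \<epsilon>) F2"]) simp
 qed
qed

text \<open>One by one, tokens outside B are pushed to empty places of B. Only the final set is
  prescribed; which token arrives where is left open.\<close>

lemma conf_connected:
 assumes H: "Hausdorff_space T" and Z: "path_connectedin T Z"
 shows "finite u ==> u \<subseteq> topspace T ==> B \<subseteq> Z ==> finite B ==> card B = card (u \<inter> Z) ==>
  \<exists>F. moves T u Z F \<and> fin F u = (u - Z) \<union> B"
proof (induction "card (u \<inter> Z - B)" arbitrary: u rule: less_induct)
 case less
 show ?case
 proof (cases "u \<inter> Z \<subseteq> B")
  case True
  hence "u \<inter> Z = B" using card_subset_eq[of B "u \<inter> Z"] less.prems by auto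
  hence "fin (\<lambda>a _. a) u = (u - Z) \<union> B" by (auto simp: fin_def)
  thus ?thesis using moves_id[OF less.prems(2)] by blast
 next
  case False
  then obtain a where a: "a \<in> u" "a \<in> Z" "a \<notin> B" by blast
  have "\<not> B \<subseteq> u \<inter> Z"
  proof
   assume "B \<subseteq> u \<inter> Z"
   hence "B = u \<inter> Z" using card_subset_eq[of "u \<inter> Z" B] less.prems by auto
   thus False using a by auto
  qed
  then obtain b where b: "b \<in> B" "b \<notin> u" "b \<in> Z" using less.prems(3) by auto
  obtain \<gamma> where g: "pathin T \<gamma>" "\<gamma> ` {0..1} \<subseteq> Z" "\<gamma> 0 = a" "\<gamma> 1 = b"
  proof -
   have "\<exists>g. pathin T g \<and> g \<in> {0..1} \<rightarrow> Z \<and> g 0 = a \<and> g 1 = b"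
    using Z a(2) b(3) by (simp add: path_connectedin)
   thus thesis using that by (auto simp: image_subset_iff_funcset)
  qed
  obtain F where F: "moves T u Z F" "fin F u = insert b (u - {a})"
   using push_along_path[OF H less.prems(1,2) a(1) g b(2)] by blast
  let ?v = "insert b (u - {a})"
  have bT: "b \<in> topspace T" using fin_subset[OF F(1)] F(2) by auto
  have vZ: "?v \<inter> Z - B \<subset> u \<inter> Z - B" "?v - Z = u - Z" "?v \<inter> Z = insert b (u \<inter> Z - {a})" using a b by auto
  have "\<exists>F'. moves T ?v Z F' \<and> fin F' ?v = (?v - Z) \<union> B"
  proof (rule less.hyps)
   show "card (?v \<inter> Z - B) < card (u \<inter> Z - B)" using less.prems(1) vZ(1) by (intro psubset_card_mono) auto
   have "card (u \<inter> Z) = Suc (card (u \<inter> Z - {a}))"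
    using a less.prems(1) by (intro card.remove) auto
   hence "card (insert b (u \<inter> Z - {a})) = card (u \<inter> Z)"
    using b less.prems(1) by simp
   thus "card B = card (?v \<inter> Z)" using less.prems(5) vZ(3) by simp
  qed (use less.prems bT in auto)
  then obtain F' where F': "moves T ?v Z F'" "fin F' ?v = (?v - Z) \<union> B" by blast
  show ?thesis
   using moves_mcomp(1,2)[OF F(1), of F'] F(2) F' vZ(2) by (intro exI[of _ "mcomp u F F'"]) simp
 qed
qed

lemma path_connected_space_conf:
 assumes "Hausdorff_space T" "path_connected_space T"
 shows "path_connected_space (unord_conf T n)"
 unfolding path_connected_space_def topspace_unord_conf
proof clarify
 fix u w assume u: "u \<subseteq> topspace T" "finite u" "n = card u" and w: "w \<subseteq> topspace T" "finite w" "card w = card u"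
 have "path_connectedin T (topspace T)" using assms(2) by (simp add: path_connectedin_topspace)
 then obtain F where F: "moves T u (topspace T) F" "fin F u = (u - topspace T) \<union> w"
  using conf_connected[OF assms(1) _ u(2,1) w(1,2)] w(3) u(1) by (auto simp: Int_absorb2)
 hence "pathin (unord_conf T (card u)) (track F u)" "track F u 0 = u" "track F u 1 = w"
  using pathin_track[OF F(1) u(2)] track_ends(1)[OF F(1)] track_ends(2)[of F u] F(2) u(1,3) by auto
 thus "\<exists>g. pathin (unord_conf T (card u)) g \<and> g 0 = u \<and> g 1 = w" by blast
qed

locale braid = based_space "unord_conf T n" base for T :: "'a topology" and n base
begin

abbreviation conf_mult (infixl "\<star>" 70) where "x \<star> y \<equiv> x \<otimes>\<^bsub>FG\<^esub> y"
abbreviation conf_inv ("inv\<^sub>F _" [81] 80) where "inv\<^sub>F x \<equiv> inv\<^bsub>FG\<^esub> x"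

definition M :: "'a set => ('a => real => 'a) => (real => 'a set) set" where
 "M u F = cls (track F u)"

lemma M_closed [simp]: "moves T u Z F ==> finite u ==> card u = n ==> M u F \<in> carrier FG"
 unfolding M_def by (rule cls_closed[OF pathin_track])

lemma M_mcomp:
 assumes "moves T u Z F" "moves T (fin F u) Z H" "finite u" "card u = n"
 shows "M u (mcomp u F H) = M u F \<star> M (fin F u) H"
 unfolding M_def moves_mcomp(3)[OF assms(1,2)]
proof (rule cls_join)
 show "pathin (unord_conf T n) (track F u)" using pathin_track assms by blast
 show "pathin (unord_conf T n) (track H (fin F u))"
  using pathin_track[OF assms(2) finite_fin[OF assms(3)]] card_fin[OF assms(1)] assms by simp
 show "track F u 1 = track H (fin F u) 0" using track_ends(1)[OF assms(2)] track_ends(2)[of F u] by simp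
qed

lemma M_mrev:
 assumes "moves T u Z F" "finite u" "card u = n"
 shows "M (fin F u) (mrev u F) = inv\<^sub>F M u F"
 unfolding M_def moves_mrev(3)[OF assms(1)] by (rule cls_rev[OF pathin_track[OF assms]])

text \<open>With disjoint supports the two motions can run on independent clocks, which spans a
  square in the configuration space; the relation is \<open>cls_square\<close> for it.\<close>

lemma M_commute:
 assumes F: "moves T u Z F" and H: "moves T u Z' H" and Z: "Z \<inter> Z' = {}" and u: "finite u" "card u = n"
 shows "M u F \<star> M (fin F u) H = M u H \<star> M (fin H u) F"
proof -
 let ?X = "unord_conf T n"
 define K where "K x = (\<lambda>a. if a \<in> Z then F a (fst x) else H a (snd x)) ` u" for x
 have Fid: "F a t = a" if "a \<notin> u \<or> a \<notin> Z" "t \<in> {0..1}" for a t using movesD(5)[OF F that] .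
 have Hid: "H a t = a" if "a \<notin> u \<or> a \<notin> Z'" "t \<in> {0..1}" for a t using movesD(5)[OF H that] .
 have cont: "continuous_map (top_of_set ({0..1} \<times> {0..1})) ?X K"
  unfolding K_def
 proof (rule continuous_map_conf[OF u])
  fix a assume a: "a \<in> u"
  have "continuous_map (top_of_set ({0..1} \<times> {0..1})) T (\<lambda>x. F a (fst x))"
   by (rule continuous_map_precompose[OF movesD(1)[OF F a, unfolded pathin_def]]) (auto intro: continuous_on_fst)
  moreover have "continuous_map (top_of_set ({0..1} \<times> {0..1})) T (\<lambda>x. H a (snd x))"
   by (rule continuous_map_precompose[OF movesD(1)[OF H a, unfolded pathin_def]]) (auto intro: continuous_on_snd)
  ultimately show "continuous_map (top_of_set ({0..1} \<times> {0..1})) T (\<lambda>x. if a \<in> Z then F a (fst x) else H a (snd x))"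
   by (cases "a \<in> Z") auto
 next
  fix x :: "real \<times> real" assume "x \<in> topspace (top_of_set ({0..1} \<times> {0..1}))"
  hence x: "fst x \<in> {0..1}" "snd x \<in> {0..1}" by auto
  have iF: "inj_on (\<lambda>a. F a (fst x)) u" and iH: "inj_on (\<lambda>a. H a (snd x)) u"
   using movesD(3)[OF F x(1)] movesD(3)[OF H x(2)] by auto
  have mix: "F a (fst x) \<noteq> H b (snd x)" if ab: "a \<in> u" "a \<in> Z" "b \<in> u" "b \<notin> Z" for a b
  proof -
   have FZ: "F a (fst x) \<in> Z" using movesD(4)[OF F ab(1,2) x(1)] .
   show ?thesis
   proof (cases "b \<in> Z'")
    case True
    thus ?thesis using movesD(4)[OF H ab(3) True x(2)] FZ Z by auto
   next
    case False
    thus ?thesis using Hid[of b "snd x"] x FZ ab(4) by auto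
   qed
  qed
  show "inj_on (\<lambda>a. if a \<in> Z then F a (fst x) else H a (snd x)) u"
  proof (rule inj_onI)
   fix a b assume ab: "a \<in> u" "b \<in> u" "(if a \<in> Z then F a (fst x) else H a (snd x)) = (if b \<in> Z then F b (fst x) else H b (snd x))"
   consider "a \<in> Z" "b \<in> Z" | "a \<in> Z" "b \<notin> Z" | "a \<notin> Z" "b \<in> Z" | "a \<notin> Z" "b \<notin> Z" by blast
   thus "a = b"
   proof cases
    case 1 thus ?thesis using inj_onD[OF iF, of a b] ab by simp
   next
    case 2 thus ?thesis using mix[of a b] ab by simp
   next
    case 3 thus ?thesis using mix[OF ab(2) 3(2) ab(1) 3(1)] ab(3) by simp
   next
    case 4 thus ?thesis using inj_onD[OF iH, of a b] ab by simp
   qed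
  qed
 qed
 have cls_eq: "cls p = cls q" if "pathin ?X p" "\<And>t. t \<in> {0..1} ==> p t = q t" for p q
  using cls_cong[OF path_homotopic_eq_on[OF that]] .
 have tF: "pathin ?X (track F u)" "pathin ?X (track H u)" using pathin_track F H u by blast+
 have mH: "moves T (fin F u) Z' H" by (rule moves_disjoint(1)[OF F H Z])
 have mF: "moves T (fin H u) Z F" by (rule moves_disjoint(1)[OF H F]) (use Z in blast)
 have tH: "pathin ?X (track H (fin F u))" "pathin ?X (track F (fin H u))"
  using pathin_track[OF mH finite_fin[OF u(1)]] pathin_track[OF mF finite_fin[OF u(1)]] card_fin[OF F] card_fin[OF H] u by simp_all
 have 1: "cls (track F u) = cls (\<lambda>t. K (t, 0))"
 proof (intro cls_eq tF)
  fix t :: real assume t: "t \<in> {0..1}"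
  have "F a t = (if a \<in> Z then F a t else H a 0)" for a
   using movesD(2)[OF H, of a] Fid[of a t] t by (cases "a \<in> Z") simp_all
  thus "track F u t = K (t, 0)" unfolding track_def K_def fst_conv snd_conv by (intro image_cong refl)
 qed
 have 2: "cls (track H (fin F u)) = cls (\<lambda>t. K (1, t))"
 proof (intro cls_eq tH)
  fix t :: real assume t: "t \<in> {0..1}"
  have "H (F a 1) t = (if a \<in> Z then F a 1 else H a t)" if "a \<in> u" for a
  proof (cases "a \<in> Z")
   case True
   hence "F a 1 \<in> Z" using movesD(4)[OF F that, of 1] by simp
   hence "F a 1 \<notin> Z'" using Z by auto
   thus ?thesis using Hid[of "F a 1" t] t True by auto
  next
   case False
   thus ?thesis using Fid[of a 1] by simp
  qed
  thus "track H (fin F u) t = K (1, t)" by (auto simp: track_def K_def fin_def image_image intro!: image_cong)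
 qed
 have 3: "cls (track H u) = cls (\<lambda>t. K (0, t))"
 proof (intro cls_eq tF)
  fix t :: real assume t: "t \<in> {0..1}"
  have "H a t = (if a \<in> Z then F a 0 else H a t)" for a
   using movesD(2)[OF F, of a] Hid[of a t] t Z by auto
  thus "track H u t = K (0, t)" unfolding track_def K_def fst_conv snd_conv by (intro image_cong refl)
 qed
 have 4: "cls (track F (fin H u)) = cls (\<lambda>t. K (t, 1))"
 proof (intro cls_eq tH)
  fix t :: real assume t: "t \<in> {0..1}"
  have "F (H a 1) t = (if a \<in> Z then F a t else H a 1)" if "a \<in> u" for a
  proof (cases "a \<in> Z")
   case True
   hence "H a 1 = a" using Hid[of a 1] Z by auto
   thus ?thesis using True by simp
  next
   case False
   have "H a 1 \<notin> Z"
    using movesD(4)[OF H that, of 1] Hid[of a 1] False Z by (cases "a \<in> Z'") auto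
   thus ?thesis using Fid[of "H a 1" t] t False by auto
  qed
  thus "track F (fin H u) t = K (t, 1)" by (auto simp: track_def K_def fin_def image_image intro!: image_cong)
 qed
 show ?thesis unfolding M_def 1 2 3 4 by (rule cls_square(1)[OF cont])
qed

end

section \<open>The permutation of tokens as a holonomy\<close>

section \<open>Monodromy of configurations\<close>

text \<open>Of the topology only openness of balls is demanded, so that d can be assembled from
  continuous functions and rescaled.\<close>

locale metric_conf =
 fixes T :: "'a topology" and d :: "'a => 'a => real"
 assumes d_nonneg: "0 \<le> d a b" and d_sym: "d a b = d b a" and d_tri: "d a c \<le> d a b + d b c"
  and d_zero: "a \<in> topspace T ==> b \<in> topspace T ==> d a b = 0 \<longleftrightarrow> a = b"
  and ball_open: "a \<in> topspace T ==> openin T {b \<in> topspace T. d a b < r}"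
begin

lemma d_self [simp]: "a \<in> topspace T ==> d a a = 0"
 using d_zero by blast

lemma Hausdorff: "Hausdorff_space T"
 unfolding Hausdorff_space_def
proof (intro allI impI)
 fix a b assume ab: "a \<in> topspace T \<and> b \<in> topspace T \<and> a \<noteq> b"
 define r where "r = d a b / 2"
 have r: "r > 0" using ab d_zero[of a b] d_nonneg[of a b] by (simp add: r_def less_le)
 let ?U = "{c \<in> topspace T. d a c < r}" and ?V = "{c \<in> topspace T. d b c < r}"
 have "disjnt ?U ?V"
 proof (clarsimp simp: disjnt_iff)
  fix c assume "d a c < r" "d b c < r"
  thus False using d_tri[of a b c] d_sym[of b c] by (simp add: r_def)
 qed
 moreover have "a \<in> ?U" "b \<in> ?V" "openin T ?U" "openin T ?V" using ab r ball_open by auto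
 ultimately show "\<exists>U V. openin T U \<and> openin T V \<and> a \<in> U \<and> b \<in> V \<and> disjnt U V" by blast
qed

lemma ex_separation:
 assumes "finite u" "u \<subseteq> topspace T"
 obtains r where "r > 0" "\<And>a b. a \<in> u ==> b \<in> u ==> a \<noteq> b ==> 6 * r \<le> d a b"
proof -
 let ?D = "insert 1 ((\<lambda>(a, b). d a b) ` {p \<in> u \<times> u. fst p \<noteq> snd p})"
 have fin: "finite ?D" using assms(1) by (auto intro: finite_subset[of _ "u \<times> u"])
 note m = Min_in[OF fin insert_not_empty] Min_le[OF fin]
 have "Min ?D > 0"
 proof -
  have "x > 0" if "x \<in> ?D" for x
   using that d_zero d_nonneg assms(2) by (auto simp: less_le subset_iff)
  thus ?thesis using m(1) by blast
 qed
 moreover have "Min ?D \<le> d a b" if "a \<in> u" "b \<in> u" "a \<noteq> b" for a b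
  using that by (intro m(2)) force
 ultimately show ?thesis using that[of "Min ?D / 6"] by auto
qed

definition near :: "'a set => 'a => 'a" where
 "near w p = (SOME q. q \<in> w \<and> (\<forall>q'\<in>w. d p q \<le> d p q'))"

text \<open>The reason for the factor 6: after both configurations are perturbed by less than r, the
  partner of a point is within 2 r and every other point is beyond 4 r.\<close>

lemma near_match:
 assumes sep: "\<And>a b. a \<in> I ==> b \<in> I ==> a \<noteq> b ==> 6 * r \<le> d (c a) (c b)"
  and f: "\<And>a. a \<in> I ==> d (c a) (f a) < r" and f': "\<And>a. a \<in> I ==> d (c a) (f' a) < r" and a: "a \<in> I"
 shows "near (f ` I) (f' a) = f a"
proof -
 have 1: "d (f' a) (f a) < 2 * r"
  using d_tri[of "f' a" "f a" "c a"] f[OF a] f'[OF a] d_sym[of "c a" "f' a"] by simp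
 have 2: "4 * r < d (f' a) (f b)" if "b \<in> I" "b \<noteq> a" for b
 proof -
  have "d (c a) (c b) \<le> d (c a) (f' a) + d (f' a) (c b)" by (rule d_tri)
  moreover have "d (f' a) (c b) \<le> d (f' a) (f b) + d (f b) (c b)" by (rule d_tri)
  ultimately show ?thesis using sep[OF a that(1)] that f[OF that(1)] f'[OF a] d_sym[of "f b" "c b"] by auto
 qed
 have r: "r > 0" using f[OF a] d_nonneg[of "c a" "f a"] by linarith
 have "f a \<in> f ` I \<and> (\<forall>q'\<in>f ` I. d (f' a) (f a) \<le> d (f' a) q')"
 proof (intro conjI ballI)
  fix q' assume "q' \<in> f ` I"
  then obtain b where b: "b \<in> I" "q' = f b" by blast
  show "d (f' a) (f a) \<le> d (f' a) q'" using 1 2[OF b(1)] b(2) r by (cases "b = a") auto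
 qed (use a in simp)
 hence n: "near (f ` I) (f' a) \<in> f ` I \<and> (\<forall>q'\<in>f ` I. d (f' a) (near (f ` I) (f' a)) \<le> d (f' a) q')"
  unfolding near_def by (rule someI)
 then obtain b where b: "b \<in> I" "near (f ` I) (f' a) = f b" by blast
 have "d (f' a) (f b) \<le> d (f' a) (f a)" using n b a by simp
 hence "b = a" using 1 2[OF b(1)] r by linarith
 thus ?thesis using b by simp
qed

lemma path_close:
 assumes p: "\<And>a. a \<in> I ==> pathin T (p a)" and I: "finite I" and t: "t \<in> {0..1}" and r: "r > 0"
 obtains e where "e > 0" "\<And>s a. s \<in> {0..1} ==> \<bar>s - t\<bar> < e ==> a \<in> I ==> d (p a t) (p a s) < r"
proof -
 have "\<forall>a\<in>I. \<exists>e>0. \<forall>s\<in>{0..1}. \<bar>s - t\<bar> < e --> d (p a t) (p a s) < r"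
 proof
  fix a assume a: "a \<in> I"
  have pt: "p a t \<in> topspace T" using pathin_in[OF p[OF a]] t by simp
  have "openin (top_of_set {0..1}) {s \<in> topspace (top_of_set {0..1}). p a s \<in> {b \<in> topspace T. d (p a t) b < r}}"
   using openin_continuous_map_preimage[OF p[OF a, unfolded pathin_def] ball_open[OF pt]] .
  then obtain A where A: "open A" "{s \<in> topspace (top_of_set {0..1}). p a s \<in> {b \<in> topspace T. d (p a t) b < r}} = {0..1} \<inter> A"
   by (auto simp: openin_open)
  have "t \<in> {0..1} \<inter> A" unfolding A(2)[symmetric] using t pt r by simp
  hence "t \<in> A" by simp
  then obtain e where e: "e > 0" "\<And>s. dist s t < e ==> s \<in> A" using A(1) by (auto simp: open_dist)
  have "d (p a t) (p a s) < r" if "s \<in> {0..1}" "\<bar>s - t\<bar> < e" for s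
  proof -
   have "s \<in> {0..1} \<inter> A" using e(2) that by (auto simp: dist_real_def)
   thus ?thesis unfolding A(2)[symmetric] by simp
  qed
  thus "\<exists>e>0. \<forall>s\<in>{0..1}. \<bar>s - t\<bar> < e --> d (p a t) (p a s) < r" using e(1) by blast
 qed
 then obtain ee where ee: "\<forall>a\<in>I. ee a > 0 \<and> (\<forall>s\<in>{0..1}. \<bar>s - t\<bar> < ee a --> d (p a t) (p a s) < r)"
  by metis
 define e where "e = Min (insert 1 (ee ` I))"
 have "e > 0" unfolding e_def using I ee by (subst Min_gr_iff) auto
 moreover have "e \<le> ee a" if "a \<in> I" for a unfolding e_def using I that by (intro Min_le) auto
 hence "d (p a t) (p a s) < r" if "s \<in> {0..1}" "\<bar>s - t\<bar> < e" "a \<in> I" for s a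
  using ee that by (meson less_le_trans)
 ultimately show ?thesis using that by blast
qed

end

text \<open>In symbols \<alpha> after the inverse of \<beta>, so that composition telescopes as in
  \<open>transition_comp\<close>.\<close>

definition transition :: "'p set => 'i set => ('i => 'p) => ('i => 'p) => 'p => 'p" where
 "transition A I \<alpha> \<beta> x = (if x \<in> A then \<alpha> (inv_into I \<beta> x) else x)"

lemma transition_at: "bij_betw \<beta> I A ==> i \<in> I ==> transition A I \<alpha> \<beta> (\<beta> i) = \<alpha> i"
 by (auto simp: transition_def bij_betw_def)

lemma transition_comp:
 assumes "bij_betw \<alpha> I A" "bij_betw \<beta> I A" "bij_betw \<gamma> I A"
 shows "transition A I \<alpha> \<beta> \<circ> transition A I \<beta> \<gamma> = transition A I \<alpha> \<gamma>"
proof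
 fix x
 show "(transition A I \<alpha> \<beta> \<circ> transition A I \<beta> \<gamma>) x = transition A I \<alpha> \<gamma> x"
 proof (cases "x \<in> A")
  case True
  then obtain i where "i \<in> I" "x = \<gamma> i" using assms(3) by (auto simp: bij_betw_def)
  thus ?thesis using assms by (simp add: transition_at)
 qed (simp add: transition_def)
qed

lemma transition_self: "bij_betw \<alpha> I A ==> transition A I \<alpha> \<alpha> = id"
 by (rule ext) (auto simp: transition_def bij_betw_def f_inv_into_f)

lemma transition_permutes:
 assumes "bij_betw \<alpha> I A" "bij_betw \<beta> I A"
 shows "transition A I \<alpha> \<beta> permutes A"
proof (rule bij_imp_permutes)
 have "bij_betw (\<alpha> \<circ> inv_into I \<beta>) A A" by (rule bij_betw_trans[OF bij_betw_inv_into[OF assms(2)] assms(1)])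
 thus "bij_betw (transition A I \<alpha> \<beta>) A A" by (rule bij_betw_cong[THEN iffD1, rotated]) (simp add: transition_def)
qed (simp add: transition_def)

locale metric_braid = metric_conf T d + braid T n base for T :: "'a topology" and d n base
begin

text \<open>An arbitrary numbering of each configuration by the points of u1, except that u1 numbers
  itself identically; loops at u1 thereby get their actual permutation.\<close>

definition lab :: "'a set => 'a set => 'a => 'a" where
 "lab u1 w = (if w = u1 then id else (SOME h. bij_betw h w u1))"

lemma lab:
 assumes "finite u1" "finite w" "card w = card u1"
 shows "bij_betw (lab u1 w) w u1"
proof (cases "w = u1")
 case False
 have "\<exists>h. bij_betw h w u1" using finite_same_card_bij assms by blast
 hence "bij_betw (SOME h. bij_betw h w u1) w u1" by (rule someI_ex)
 thus ?thesis using False by (simp add: lab_def)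
qed (simp add: lab_def)

text \<open>Transfers numberings by matching nearest points. For configurations far apart the result
  may fail to be a permutation, and \<open>id\<close> is a default that keeps the values in the
  group.\<close>

definition mono_cocycle :: "'a set => 'a set => 'a set => 'a => 'a" where
 "mono_cocycle u1 v w = (let m = transition u1 w (\<lambda>p. lab u1 v (near v p)) (lab u1 w) in if m permutes u1 then m else id)"

lemma mono_cocycle_match:
 assumes u1: "finite u1"
  and sep: "\<And>a b. a \<in> I ==> b \<in> I ==> a \<noteq> b ==> 6 * r \<le> d (c a) (c b)"
  and f: "\<And>a. a \<in> I ==> d (c a) (f a) < r" and f': "\<And>a. a \<in> I ==> d (c a) (f' a) < r"
  and I: "finite I" "card I = card u1" "inj_on f I" "inj_on f' I"
 shows "mono_cocycle u1 (f ` I) (f' ` I) = transition u1 I (lab u1 (f ` I) \<circ> f) (lab u1 (f' ` I) \<circ> f')"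
  "bij_betw (lab u1 (f ` I) \<circ> f) I u1" "bij_betw (lab u1 (f' ` I) \<circ> f') I u1"
proof -
 have bf: "bij_betw f I (f ` I)" "bij_betw f' I (f' ` I)" using I by (auto simp: bij_betw_def)
 have lf: "bij_betw (lab u1 (f ` I)) (f ` I) u1" "bij_betw (lab u1 (f' ` I)) (f' ` I) u1"
  using I u1 by (auto intro!: lab simp: card_image)
 show b: "bij_betw (lab u1 (f ` I) \<circ> f) I u1" "bij_betw (lab u1 (f' ` I) \<circ> f') I u1"
  using bij_betw_trans[OF bf(1) lf(1)] bij_betw_trans[OF bf(2) lf(2)] by auto
 have "transition u1 (f' ` I) (\<lambda>p. lab u1 (f ` I) (near (f ` I) p)) (lab u1 (f' ` I))
   = transition u1 I (lab u1 (f ` I) \<circ> f) (lab u1 (f' ` I) \<circ> f')" (is "?m = ?m'")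
 proof
  fix x
  show "?m x = ?m' x"
  proof (cases "x \<in> u1")
   case True
   then obtain i where i: "i \<in> I" "x = (lab u1 (f' ` I) \<circ> f') i" using b(2) by (auto simp: bij_betw_def)
   have "?m x = lab u1 (f ` I) (near (f ` I) (f' i))"
    using transition_at[OF lf(2), of "f' i"] i by simp
   also have "\<dots> = ?m' x"
    using near_match[of I r c f f' i, OF sep f f' i(1)] transition_at[OF b(2) i(1)] i(2) by simp
   finally show ?thesis .
  qed (simp add: transition_def)
 qed
 thus "mono_cocycle u1 (f ` I) (f' ` I) = ?m'"
  using transition_permutes[OF b] by (simp add: mono_cocycle_def Let_def)
qed

lemma mono_is_cocycle:
 assumes u1: "finite u1" "card u1 = n"
 shows "cocycle (perm_group u1) (unord_conf T n) (mono_cocycle u1)"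
proof -
 interpret P: group "perm_group u1" by (rule group_perm_group)
 show ?thesis
 proof
  fix v w show "mono_cocycle u1 v w \<in> carrier (perm_group u1)"
   by (simp add: mono_cocycle_def Let_def permutes_id)
 next
  fix u assume "u \<in> topspace (unord_conf T n)"
  hence u: "u \<subseteq> topspace T" "finite u" "card u = n" by (auto simp: topspace_unord_conf)
  obtain r where r: "r > 0" "\<And>a b. a \<in> u ==> b \<in> u ==> a \<noteq> b ==> 6 * r \<le> d a b"
   using ex_separation[OF u(2,1)] by blast
  let ?B = "{w \<in> topspace (unord_conf T n). \<exists>\<sigma>. bij_betw \<sigma> u w \<and> (\<forall>a\<in>u. \<sigma> a \<in> {b \<in> topspace T. d a b < r})}"
  have B1: "openin (unord_conf T n) ?B"
   by (rule openin_unord_conf_box[OF u(2,3)]) (use u ball_open in auto)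
  have B2: "u \<in> ?B"
  proof -
   have "bij_betw (\<lambda>a. a) u u" by (simp add: bij_betw_def)
   thus ?thesis using u r by (auto simp: topspace_unord_conf intro!: exI[of _ "\<lambda>a. a"])
  qed
  have B3: "mono_cocycle u1 x y \<otimes>\<^bsub>perm_group u1\<^esub> mono_cocycle u1 y z = mono_cocycle u1 x z"
   if xyz: "x \<in> ?B" "y \<in> ?B" "z \<in> ?B" for x y z
  proof -
   obtain f where f: "bij_betw f u x" "\<forall>a\<in>u. d a (f a) < r" using xyz(1) by auto
   obtain g where g: "bij_betw g u y" "\<forall>a\<in>u. d a (g a) < r" using xyz(2) by auto
   obtain h where h: "bij_betw h u z" "\<forall>a\<in>u. d a (h a) < r" using xyz(3) by auto
   have e: "x = f ` u" "y = g ` u" "z = h ` u" "inj_on f u" "inj_on g u" "inj_on h u"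
    using f g h by (auto simp: bij_betw_def)
   have c: "card u = card u1" using u u1 by simp
   have m: "mono_cocycle u1 (f ` u) (g ` u) = transition u1 u (lab u1 (f ` u) \<circ> f) (lab u1 (g ` u) \<circ> g)"
    "bij_betw (lab u1 (f ` u) \<circ> f) u u1"
    if fg: "\<forall>a\<in>u. d a (f a) < r" "\<forall>a\<in>u. d a (g a) < r" "inj_on f u" "inj_on g u" for f g
    by (rule mono_cocycle_match[of u1 u r "\<lambda>a. a" f g, OF u1(1) r(2) fg(1,2)[rule_format] u(2) c fg(3,4)]; assumption)+
   have "mono_cocycle u1 x y \<circ> mono_cocycle u1 y z = mono_cocycle u1 x z"
    unfolding e(1-3) m(1)[OF f(2) g(2) e(4,5)] m(1)[OF g(2) h(2) e(5,6)] m(1)[OF f(2) h(2) e(4,6)]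
    by (rule transition_comp[OF m(2)[OF f(2) g(2) e(4,5)] m(2)[OF g(2) h(2) e(5,6)] m(2)[OF h(2) g(2) e(6,5)]])
   thus ?thesis by simp
  qed
  show "\<exists>B. openin (unord_conf T n) B \<and> u \<in> B \<and> (\<forall>a\<in>B. \<forall>b\<in>B. \<forall>c\<in>B.
    mono_cocycle u1 a b \<otimes>\<^bsub>perm_group u1\<^esub> mono_cocycle u1 b c = mono_cocycle u1 a c)"
   by (intro exI[of _ ?B] conjI ballI B1 B2 B3)
 qed
qed

text \<open>The value sends the end of each trajectory back to its start, which is the direction
  compatible with concatenating loops from left to right. For swaps both directions agree.\<close>

lemma ex_monodromy:
 assumes u1: "u1 \<subseteq> topspace T" "finite u1" "card u1 = n"
 obtains \<pi> where "\<pi> \<in> hom FG (perm_group u1)"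
  "\<And>F Z. moves T u1 Z F ==> fin F u1 = u1 ==> \<pi> (M u1 F) = transition u1 u1 id (\<lambda>a. F a 1)"
proof -
 let ?X = "unord_conf T n" and ?P = "perm_group u1"
 interpret c: cocycle ?P ?X "mono_cocycle u1" by (rule mono_is_cocycle[OF u1(2,3)])
 interpret bc: based_cocycle ?X base ?P "mono_cocycle u1" by unfold_locales
 have u1X: "u1 \<in> topspace ?X" using u1 by (simp add: topspace_unord_conf)
 obtain \<pi> where pi: "\<pi> \<in> hom FG ?P" "\<And>p. pathin ?X p ==> p 0 = u1 ==> p 1 = u1 ==> \<pi> (cls p) = c.hol p"
  using bc.ex_hol_hom[OF u1X] by blast
 have "\<pi> (M u1 F) = transition u1 u1 id (\<lambda>a. F a 1)" if F: "moves T u1 Z F" "fin F u1 = u1" for F Z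
 proof -
  define p where "p = track F u1"
  have pp: "pathin ?X p" unfolding p_def by (rule pathin_track[OF F(1) u1(2,3)])
  have p01: "p 0 = u1" "p 1 = u1" using track_ends(1)[OF F(1)] track_ends(2)[of F u1] F(2) by (simp_all add: p_def)
  define \<alpha> where "\<alpha> t = lab u1 (p t) \<circ> (\<lambda>a. F a t)" for t
  have inj: "inj_on (\<lambda>a. F a t) u1" if "t \<in> {0..1}" for t using movesD(3)[OF F(1) that] .
  have \<alpha>: "bij_betw (\<alpha> t) u1 u1" if "t \<in> {0..1}" for t
  proof -
   have "bij_betw (\<lambda>a. F a t) u1 (p t)" using inj[OF that] by (simp add: bij_betw_def p_def track_def)
   moreover have "bij_betw (lab u1 (p t)) (p t) u1"
    using u1 inj[OF that] by (intro lab) (auto simp: p_def track_def card_image)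
   ultimately show ?thesis unfolding \<alpha>_def by (rule bij_betw_trans)
  qed
  have idb: "bij_betw id u1 u1" by simp
  \<comment> \<open>\<open>\<alpha> t\<close> reads off the number that the token started at a
    carries at time t, so this transition is a primitive in the sense of \<open>hol_local\<close>:
    nearest-point matching follows the trajectories for short times.\<close>
  let ?th = "\<lambda>t. transition u1 u1 id (\<alpha> t)"
  have inv: "inv\<^bsub>?P\<^esub> (?th t) = transition u1 u1 (\<alpha> t) id" if "t \<in> {0..1}" for t
   by (rule c.W.inv_equality)
    (use transition_comp[OF \<alpha>[OF that] idb \<alpha>[OF that]] transition_self[OF \<alpha>[OF that]]
     transition_permutes[OF idb \<alpha>[OF that]] transition_permutes[OF \<alpha>[OF that] idb] in auto)
  have "c.hol p = inv\<^bsub>?P\<^esub> (?th 0) \<otimes>\<^bsub>?P\<^esub> ?th 1"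
  proof (rule c.hol_local[OF pp])
   fix t :: real assume "t \<in> {0..1}"
   thus "?th t \<in> carrier ?P" using transition_permutes[OF idb \<alpha>] by simp
  next
   fix t :: real assume t: "t \<in> {0..1}"
   have "(\<lambda>a. F a t) ` u1 \<subseteq> topspace T" using pathin_in[OF movesD(1)[OF F(1)]] t by auto
   then obtain r where r: "r > 0" "\<And>a b. a \<in> (\<lambda>a. F a t) ` u1 ==> b \<in> (\<lambda>a. F a t) ` u1 ==> a \<noteq> b ==> 6 * r \<le> d a b"
    using ex_separation[of "(\<lambda>a. F a t) ` u1"] u1(2) by blast
   have sep: "6 * r \<le> d (F a t) (F b t)" if "a \<in> u1" "b \<in> u1" "a \<noteq> b" for a b
    using r(2) that inj_onD[OF inj[OF t]] by blast
   obtain e where e: "e > 0" "\<And>s a. s \<in> {0..1} ==> \<bar>s - t\<bar> < e ==> a \<in> u1 ==> d (F a t) (F a s) < r"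
    using path_close[of u1 F t r, OF movesD(1)[OF F(1)] u1(2) t r(1)] by blast
   have "mono_cocycle u1 (p s) (p s') = inv\<^bsub>?P\<^esub> (?th s) \<otimes>\<^bsub>?P\<^esub> ?th s'"
    if s: "s \<in> {0..1}" "s' \<in> {0..1}" "\<bar>s - t\<bar> < e" "\<bar>s' - t\<bar> < e" for s s'
   proof -
    have "mono_cocycle u1 (p s) (p s') = transition u1 u1 (\<alpha> s) (\<alpha> s')"
     unfolding p_def track_def \<alpha>_def
     by (rule mono_cocycle_match(1)[OF u1(2) sep e(2)[OF s(1,3)] e(2)[OF s(2,4)] u1(2) refl inj[OF s(1)] inj[OF s(2)]])
    also have "\<dots> = inv\<^bsub>?P\<^esub> (?th s) \<otimes>\<^bsub>?P\<^esub> ?th s'"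
     unfolding inv[OF s(1)] perm_group_simps by (rule transition_comp[symmetric, OF \<alpha>[OF s(1)] idb \<alpha>[OF s(2)]])
    finally show ?thesis .
   qed
   thus "\<exists>e>0. \<forall>s\<in>{0..1}. \<forall>s'\<in>{0..1}. \<bar>s - t\<bar> < e --> \<bar>s' - t\<bar> < e -->
     mono_cocycle u1 (p s) (p s') = inv\<^bsub>?P\<^esub> (?th s) \<otimes>\<^bsub>?P\<^esub> ?th s'" using e(1) by blast
  qed
  also have "\<dots> = transition u1 u1 id (\<lambda>a. F a 1)"
  proof -
   have a0: "\<alpha> 0 = (\<lambda>a. F a 0)" "\<alpha> 1 = (\<lambda>a. F a 1)" by (auto simp: \<alpha>_def p01 lab_def)
   have "\<alpha> 0 = id" unfolding a0 using movesD(2)[OF F(1)] by auto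
   hence "?th 0 = id" using transition_self[OF idb] by simp
   thus ?thesis using a0 c.W.inv_one by simp
  qed
  finally show ?thesis using pi(2)[OF pp p01] by (simp add: M_def p_def)
 qed
 thus ?thesis using that pi(1) by blast
qed

end

section \<open>Exchanging two tokens at a branch point\<close>

section \<open>Labelled motions and swaps in a tripod\<close>

definition swp :: "'a => 'a => 'a => 'a" where
 "swp a b c = (if c = a then b else if c = b then a else c)"

lemma swp_transpose: "swp a b = Transposition.transpose a b"
 by (auto simp: swp_def Transposition.transpose_def)

lemma swp_swp [simp]: "swp a b (swp a b c) = c"
 by (simp add: swp_def)

lemma swp_image: "a \<in> u ==> b \<in> u ==> swp a b ` u = u"
proof -
 assume ab: "a \<in> u" "b \<in> u"
 hence "swp a b e \<in> u" if "e \<in> u" for e using that by (simp add: swp_def)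
 thus ?thesis by (force intro: image_eqI[of _ _ "swp a b e" for e])
qed

lemma swp_permutes: "a \<in> u ==> b \<in> u ==> swp a b permutes u"
 unfolding swp_transpose by (rule permutes_swap_id)

lemma sign_swp: "a \<noteq> b ==> sign (swp a b) = - 1"
 unfolding swp_transpose by (simp add: sign_swap_id)

lemma two_cycle_points_swp: "a \<noteq> b ==> two_cycle_points (swp a b) = {a, b}"
 by (auto simp: two_cycle_points_def swp_def split: if_splits)

lemma transition_swp:
 assumes "a \<in> u" "b \<in> u" "\<And>e. e \<in> u ==> \<beta> e = swp a b e"
 shows "transition u u id \<beta> = swp a b"
proof
 fix x
 have bij: "bij_betw \<beta> u u"
 proof (rule bij_betwI[where g = "swp a b"])
  show "\<beta> \<in> u \<rightarrow> u" "swp a b \<in> u \<rightarrow> u" using assms by (auto simp: swp_def)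
  show "swp a b (\<beta> e) = e" if "e \<in> u" for e using assms(3)[OF that] by simp
  show "\<beta> (swp a b e) = e" if "e \<in> u" for e
  proof -
   have "swp a b e \<in> u" using that assms(1,2) by (simp add: swp_def)
   thus ?thesis using assms(3) by simp
  qed
 qed
 show "transition u u id \<beta> x = swp a b x"
 proof (cases "x \<in> u")
  case True
  hence s: "swp a b x \<in> u" using assms(1,2) by (simp add: swp_def)
  have "\<beta> (swp a b x) = x" using assms(3)[OF s] by simp
  thus ?thesis using transition_at[OF bij s, of id] by simp
 next
  case False
  thus ?thesis using assms by (auto simp: transition_def swp_def)
 qed
qed

text \<open>Unlike \<open>conf_connected\<close>, this prescribes the destination of every single
  token.\<close>

definition reach :: "'a topology => 'a set => 'a set => ('a => 'a) => bool" where
 "reach T Z u f \<longleftrightarrow> (\<exists>F. moves T u Z F \<and> (\<forall>a\<in>u. F a 1 = f a))"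

lemma reach_inj:
 assumes "reach T Z u f"
 shows "inj_on f u"
proof -
 obtain F where F: "moves T u Z F" "\<forall>a\<in>u. F a 1 = f a" using assms by (auto simp: reach_def)
 have "inj_on (\<lambda>a. F a 1) u" using movesD(3)[OF F(1), of 1] by simp
 thus ?thesis using F(2) by (simp add: inj_on_def)
qed

lemma reach_comp:
 assumes "reach T Z u f" "reach T Z (f ` u) g" "\<And>a. a \<in> u ==> h a = g (f a)"
 shows "reach T Z u h"
proof -
 obtain F where F: "moves T u Z F" "\<forall>a\<in>u. F a 1 = f a" using assms by (auto simp: reach_def)
 have fin: "fin F u = f ` u" unfolding fin_def using F(2) by (intro image_cong) auto
 obtain H where H: "moves T (fin F u) Z H" "\<forall>a\<in>f ` u. H a 1 = g a" using assms fin by (auto simp: reach_def)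
 have "mcomp u F H a 1 = h a" if "a \<in> u" for a using that F(2) H(2) assms(3) by (simp add: mcomp_at)
 thus ?thesis unfolding reach_def using moves_mcomp(1)[OF F(1) H(1)] by blast
qed

lemma reach_inverse:
 assumes "reach T Z u f" "\<And>a. a \<in> u ==> g (f a) = a"
 shows "reach T Z (f ` u) g"
proof -
 obtain F where F: "moves T u Z F" "\<forall>a\<in>u. F a 1 = f a" using assms by (auto simp: reach_def)
 have fin: "fin F u = f ` u" unfolding fin_def using F(2) by (intro image_cong) auto
 have "mrev u F (f a) 1 = g (f a)" if "a \<in> u" for a
 proof -
  have "mrev u F (F a 1) 1 = a" using mrev_at[OF F(1) that] movesD(2)[OF F(1)] by simp
  thus ?thesis using F(2) assms(2) that by simp
 qed
 thus ?thesis unfolding reach_def using moves_mrev(1)[OF F(1)] fin by auto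
qed

text \<open>Conjugation of motions: go by f, swap the images, return by the reverse of f.\<close>

lemma reach_swp_conj:
 assumes f: "reach T Z u f" and ab: "a \<in> u" "b \<in> u" and s: "reach T Z (f ` u) (swp (f a) (f b))"
 shows "reach T Z u (swp a b)"
proof -
 have inj: "inj_on f u" by (rule reach_inj[OF f])
 have e: "swp (f a) (f b) (f c) = f (swp a b c)" if "c \<in> u" for c
  using inj_on_eq_iff[OF inj that ab(1)] inj_on_eq_iff[OF inj that ab(2)] by (simp add: swp_def)
 have 1: "reach T Z u (\<lambda>c. f (swp a b c))" by (rule reach_comp[OF f s]) (simp add: e)
 have im: "(\<lambda>c. f (swp a b c)) ` u = f ` u" using swp_image[OF ab] by (metis image_image)
 have 2: "reach T Z (f ` u) (inv_into u f)" by (rule reach_inverse[OF f]) (rule inv_into_f_f[OF inj])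
 show ?thesis
 proof (rule reach_comp[OF 1])
  show "reach T Z ((\<lambda>c. f (swp a b c)) ` u) (inv_into u f)" unfolding im by (rule 2)
  fix c assume "c \<in> u"
  hence "swp a b c \<in> u" using ab by (simp add: swp_def)
  thus "swp a b c = inv_into u f (f (swp a b c))" using inv_into_f_f[OF inj] by simp
 qed
qed

definition tripod :: "'a topology => (nat => real => 'a) => bool" where
 "tripod T l \<longleftrightarrow> (\<forall>i<3. pathin T (l i)) \<and>
  (\<forall>i<3. \<forall>j<3. \<forall>s\<in>{0..1}. \<forall>t\<in>{0..1}. l i s = l j t \<longleftrightarrow> s = t \<and> (i = j \<or> s = 0))"

definition legs :: "(nat => real => 'a) => 'a set" where
 "legs l = (\<Union>i<3. l i ` {0..1})"

lemma tripodD: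
 assumes "tripod T l"
 shows "i < 3 ==> pathin T (l i)"
  "i < 3 ==> j < 3 ==> 0 \<le> s ==> s \<le> 1 ==> 0 \<le> t ==> t \<le> 1 ==> l i s = l j t \<longleftrightarrow> s = t \<and> (i = j \<or> s = 0)"
 using assms by (auto simp: tripod_def)

lemma legs_in: "i < 3 ==> 0 \<le> s ==> s \<le> 1 ==> l i s \<in> legs l"
 unfolding legs_def by (intro UN_I[of i] imageI) auto

lemma legs_subset: "tripod T l ==> legs l \<subseteq> topspace T"
 using pathin_in tripodD(1) by (fastforce simp: legs_def)

definition legpath :: "(nat => real => 'a) => nat => real => nat => real => real => 'a" where
 "legpath l i s j s' = path_join (\<lambda>t. l i (s + (0 - s) * t)) (\<lambda>t. l j (0 + (s' - 0) * t))"

lemma legpath: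
 assumes T: "tripod T l" and ij: "i < 3" "j < 3" and s: "0 < s" "s \<le> 1" "0 < s'" "s' \<le> 1"
 shows "pathin T (legpath l i s j s')" "legpath l i s j s' 0 = l i s" "legpath l i s j s' 1 = l j s'"
  "t \<in> {0..1} ==> (t \<le> 1/2 \<and> legpath l i s j s' t = l i (s * (1 - 2 * t)) \<and> s * (1 - 2 * t) \<in> {0..s})
   \<or> (t > 1/2 \<and> legpath l i s j s' t = l j (s' * (2 * t - 1)) \<and> s' * (2 * t - 1) \<in> {0<..s'})"
proof -
 have c: "l i 0 = l j 0" using tripodD(2)[OF T ij, of 0 0] by simp
 have p: "pathin T (\<lambda>t. l i (s + (0 - s) * t))" "pathin T (\<lambda>t. l j (0 + (s' - 0) * t))"
  by (rule pathin_subpath[OF tripodD(1)[OF T ij(1)]] pathin_subpath[OF tripodD(1)[OF T ij(2)]]; use s in simp)+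
 show "pathin T (legpath l i s j s')" unfolding legpath_def by (rule pathin_join[OF p]) (simp add: c)
 show "legpath l i s j s' 0 = l i s" "legpath l i s j s' 1 = l j s'" by (simp_all add: legpath_def)
 assume t: "t \<in> {0..1}"
 show "(t \<le> 1/2 \<and> legpath l i s j s' t = l i (s * (1 - 2 * t)) \<and> s * (1 - 2 * t) \<in> {0..s})
   \<or> (t > 1/2 \<and> legpath l i s j s' t = l j (s' * (2 * t - 1)) \<and> s' * (2 * t - 1) \<in> {0<..s'})"
 proof (cases "t \<le> 1/2")
  case True
  have "s * (1 - 2 * t) \<le> s * 1" using s t by (intro mult_left_mono) auto
  thus ?thesis using True s t by (simp add: legpath_def path_join_def algebra_simps)
 next
  case False
  have "s' * (2 * t - 1) \<le> s' * 1" using s t by (intro mult_left_mono) auto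
  thus ?thesis using False s t by (simp add: legpath_def path_join_def)
 qed
qed

lemma legpath_free:
 assumes T: "tripod T l" and ij: "i < 3" "j < 3" and s: "0 < s" "s \<le> 1" "0 < s'" "s' \<le> 1"
  and free: "\<And>t. 0 \<le> t ==> t < s ==> l i t \<notin> u" "\<And>t. 0 \<le> t ==> t \<le> s' ==> l j t \<notin> u" and t: "t \<in> {0..1}"
 shows "legpath l i s j s' t \<in> legs l" "legpath l i s j s' t \<notin> u - {l i s}"
proof -
 have "legpath l i s j s' t \<in> legs l \<and> legpath l i s j s' t \<notin> u - {l i s}"
  using legpath(4)[OF T ij s t]
 proof (elim disjE conjE)
  assume e: "legpath l i s j s' t = l i (s * (1 - 2 * t))" "s * (1 - 2 * t) \<in> {0..s}"
  have b: "0 \<le> s * (1 - 2 * t)" "s * (1 - 2 * t) \<le> s" using e(2) by (simp_all only: atLeastAtMost_iff)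
  have "l i (s * (1 - 2 * t)) \<in> legs l" by (intro legs_in ij) (use b s in linarith)+
  moreover have "s * (1 - 2 * t) = s \<or> l i (s * (1 - 2 * t)) \<notin> u" using free(1)[OF b(1)] b(2) by linarith
  ultimately show ?thesis using e(1) by auto
 next
  assume e: "legpath l i s j s' t = l j (s' * (2 * t - 1))" "s' * (2 * t - 1) \<in> {0<..s'}"
  have b: "0 < s' * (2 * t - 1)" "s' * (2 * t - 1) \<le> s'" using e(2) by (simp_all only: greaterThanAtMost_iff)
  have "l j (s' * (2 * t - 1)) \<in> legs l" by (intro legs_in ij) (use b s in linarith)+
  moreover have "l j (s' * (2 * t - 1)) \<notin> u" using free(2)[OF less_imp_le[OF b(1)] b(2)] .
  ultimately show ?thesis using e(1) by simp
 qed
 thus "legpath l i s j s' t \<in> legs l" "legpath l i s j s' t \<notin> u - {l i s}" by auto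
qed

lemma reach_leg:
 assumes T: "tripod T l" and ij: "i < 3" "j < 3" and s: "0 < s" "s \<le> 1" "0 < s'" "s' \<le> 1"
  and u: "l i s \<in> u" "u \<subseteq> topspace T"
  and free: "\<And>t. 0 \<le> t ==> t < s ==> l i t \<notin> u" "\<And>t. 0 \<le> t ==> t \<le> s' ==> l j t \<notin> u"
 shows "reach T (legs l) u (\<lambda>e. if e = l i s then l j s' else e)"
proof -
 let ?\<gamma> = "legpath l i s j s'"
 have m: "moves T u (legs l) (slide (l i s) ?\<gamma>)"
  by (rule moves_slide(1)[OF u(1) _ legpath(1,2)[OF T ij s]])
   (use legpath_free[OF T ij s, of u] free u(2) legs_in[of i s l] ij s in auto)
 have "\<forall>a\<in>u. slide (l i s) ?\<gamma> a 1 = (if a = l i s then l j s' else a)"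
  using legpath(3)[OF T ij s] by (simp add: slide_at)
 thus ?thesis unfolding reach_def using m by blast
qed

lemma leg_finite:
 assumes T: "tripod T l" and j: "j < 3" and u: "finite u"
 shows "finite {t \<in> {0..1}. l j t \<in> u}"
proof -
 have "inj_on (l j) {t \<in> {0..1}. l j t \<in> u}" using tripodD(2)[OF T j j] by (auto simp: inj_on_def)
 moreover have "l j ` {t \<in> {0..1}. l j t \<in> u} \<subseteq> u" by auto
 ultimately show ?thesis using u by (meson finite_imageD finite_subset)
qed

lemma ex_small:
 assumes T: "tripod T l" and j: "j < 3" and u: "finite u" and c: "l j 0 \<notin> u"
 obtains \<epsilon> where "0 < \<epsilon>" "\<epsilon> \<le> 1" "\<And>t. 0 \<le> t ==> t \<le> \<epsilon> ==> l j t \<notin> u"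
proof -
 let ?D = "insert 1 {t \<in> {0..1}. l j t \<in> u}"
 have fin: "finite ?D" using leg_finite[OF T j u] by simp
 note M = Min_in[OF fin insert_not_empty] Min_le[OF fin]
 have pos: "Min ?D > 0" using M(1) c by (cases "Min ?D = 0") auto
 have le1: "Min ?D \<le> 1" by (rule M(2)) simp
 show ?thesis
 proof (rule that[of "Min ?D / 2"])
  fix t assume t: "0 \<le> t" "t \<le> Min ?D / 2"
  show "l j t \<notin> u"
  proof
   assume "l j t \<in> u"
   hence "Min ?D \<le> t" using t le1 by (intro M(2)) auto
   thus False using t pos by simp
  qed
 qed (use pos le1 in auto)
qed

lemma image_update: "a \<in> u ==> (\<lambda>e. if e = a then b else e) ` u = insert b (u - {a})"
 by auto

text \<open>The front token steps onto leg 1 and the next one onto leg 2; they come back in the same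
  order, so the one that left first now takes the outer place. The stops on legs 1 and 2 are chosen
  below all tokens there.\<close>

lemma front_swap:
 assumes T: "tripod T l" and u: "finite u" "u \<subseteq> topspace T"
  and x: "0 < x" "x < y" "y \<le> 1" "l 0 x \<in> u" "l 0 y \<in> u"
  and free: "\<And>t. 0 \<le> t ==> t < y ==> t \<noteq> x ==> l 0 t \<notin> u"
 shows "reach T (legs l) u (swp (l 0 x) (l 0 y))"
proof -
 have cen: "l i 0 = l 0 0" if "i < 3" for i using tripodD(2)[OF T that, of 0 0 0] by simp
 have c: "l i 0 \<notin> u" if "i < 3" for i unfolding cen[OF that] using free[of 0] x by simp
 obtain \<epsilon> where e: "0 < \<epsilon>" "\<epsilon> \<le> 1" "\<And>t. 0 \<le> t ==> t \<le> \<epsilon> ==> l 1 t \<notin> u"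
  using ex_small[OF T _ u(1), of 1] c by auto
 obtain \<epsilon>' where e': "0 < \<epsilon>'" "\<epsilon>' \<le> 1" "\<And>t. 0 \<le> t ==> t \<le> \<epsilon>' ==> l 2 t \<notin> u"
  using ex_small[OF T _ u(1), of 2] c by auto
 define a b p q where "a = l 0 x" and "b = l 0 y" and "p = l 1 \<epsilon>" and "q = l 2 \<epsilon>'"
 note L = tripodD(2)[OF T]
 have dist: "a \<noteq> b" "a \<noteq> p" "a \<noteq> q" "b \<noteq> p" "b \<noteq> q" "p \<noteq> q"
  using x e e' L by (auto simp: a_def b_def p_def q_def)
 have pq: "p \<notin> u" "q \<notin> u" using e(3)[of \<epsilon>] e'(3)[of \<epsilon>'] e e' by (auto simp: p_def q_def)
 have ab: "a \<in> u" "b \<in> u" using x by (auto simp: a_def b_def)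
 have pT: "p \<in> topspace T" "q \<in> topspace T"
  using legs_subset[OF T] legs_in[of 1 \<epsilon> l] legs_in[of 2 \<epsilon>' l] e e' by (auto simp: p_def q_def)
 have l0: "l 0 t \<noteq> p" "l 0 t \<noteq> q" "l 0 t = a \<longleftrightarrow> t = x" "l 0 t = b \<longleftrightarrow> t = y" if "0 \<le> t" "t \<le> 1" for t
  using that x e e' L by (auto simp: a_def b_def p_def q_def)
 have l1: "l 1 t \<noteq> q" "l 1 t = p \<longleftrightarrow> t = \<epsilon>" "l 1 t \<noteq> b" if "0 \<le> t" "t \<le> 1" for t
  using that x e e' L by (auto simp: b_def p_def q_def)
 have l2: "l 2 t \<noteq> p" "l 2 t = q \<longleftrightarrow> t = \<epsilon>'" "l 2 t \<noteq> b" if "0 \<le> t" "t \<le> 1" for t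
  using that x e e' L by (auto simp: b_def p_def q_def)
 let ?f1 = "\<lambda>e. if e = a then p else e"
 let ?f2 = "\<lambda>e. if e = b then q else e"
 let ?f3 = "\<lambda>e. if e = p then b else e"
 let ?f4 = "\<lambda>e. if e = q then a else e"
 let ?u1 = "insert p (u - {a})" let ?u2 = "insert q (?u1 - {b})" let ?u3 = "insert b (?u2 - {p})"
 have 1: "reach T (legs l) u ?f1" unfolding a_def p_def
  by (rule reach_leg[OF T]) (use x e u free in auto)
 have 2: "reach T (legs l) ?u1 ?f2"
 proof -
  have "reach T (legs l) ?u1 (\<lambda>e. if e = l 0 y then l 2 \<epsilon>' else e)"
 proof (rule reach_leg[OF T])
  fix t :: real assume t: "0 \<le> t" "t < y"
  show "l 0 t \<notin> ?u1" using free[OF t] l0[of t] t x by auto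
 next
  fix t assume t: "0 \<le> t" "t \<le> \<epsilon>'"
  show "l 2 t \<notin> ?u1" using e'(2,3) l2[of t] t by auto
 qed (use x e' u pT ab dist in \<open>auto simp: b_def\<close>)
  thus ?thesis by (simp only: b_def q_def)
 qed
 have 3: "reach T (legs l) ?u2 ?f3"
 proof -
  have "reach T (legs l) ?u2 (\<lambda>e. if e = l 1 \<epsilon> then l 0 y else e)"
 proof (rule reach_leg[OF T])
  fix t :: real assume t: "0 \<le> t" "t < \<epsilon>"
  show "l 1 t \<notin> ?u2" using e(2,3) l1[of t] t by auto
 next
  fix t assume t: "0 \<le> t" "t \<le> y"
  show "l 0 t \<notin> ?u2" using free[of t] l0[of t] t x by (cases "t = y") auto
 qed (use x e u pT dist in \<open>auto simp: p_def\<close>)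
  thus ?thesis by (simp only: b_def p_def)
 qed
 have 4: "reach T (legs l) ?u3 ?f4"
 proof -
  have "reach T (legs l) ?u3 (\<lambda>e. if e = l 2 \<epsilon>' then l 0 x else e)"
  proof (rule reach_leg[OF T])
   fix t :: real assume t: "0 \<le> t" "t < \<epsilon>'"
   show "l 2 t \<notin> ?u3" using e'(2,3) l2[of t] t by auto
  next
   fix t assume t: "0 \<le> t" "t \<le> x"
   show "l 0 t \<notin> ?u3" using free[of t] l0[of t] t x by (cases "t = x") auto
  qed (use x e' u pT dist ab in \<open>auto simp: q_def\<close>)
  thus ?thesis by (simp only: a_def q_def)
 qed
 have i1: "?f1 ` u = ?u1" using ab by (intro image_update)
 have i2: "?f2 ` ?u1 = ?u2" using ab dist by (intro image_update) auto
 have i3: "?f3 ` ?u2 = ?u3" using dist by (intro image_update) auto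
 have "reach T (legs l) ?u2 (\<lambda>e. ?f4 (?f3 e))" by (rule reach_comp[OF 3]) (simp_all only: i3 4)
 hence "reach T (legs l) ?u1 (\<lambda>e. ?f4 (?f3 (?f2 e)))" by (intro reach_comp[OF 2]) (simp_all only: i2)
 hence "reach T (legs l) u (swp a b)"
  by (intro reach_comp[OF 1]) (use dist pq ab in \<open>auto simp only: i1 swp_def split: if_splits\<close>)
 thus ?thesis by (simp only: a_def b_def)
qed

text \<open>Induction on the number of tokens between the centre and x: the innermost is parked on
  leg 1, the swap is made, and it returns, by \<open>reach_swp_conj\<close>.\<close>

lemma adjacent_swap:
 assumes T: "tripod T l"
 shows "finite u ==> u \<subseteq> topspace T ==> l 0 0 \<notin> u ==> 0 < x ==> x < y ==> y \<le> 1 ==> l 0 x \<in> u ==> l 0 y \<in> u ==>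
  (\<And>t. x < t ==> t < y ==> l 0 t \<notin> u) ==> reach T (legs l) u (swp (l 0 x) (l 0 y))"
proof (induction "card {t \<in> {0..<x}. l 0 t \<in> u}" arbitrary: u)
 case 0
 have fin: "finite {t \<in> {0..<x}. l 0 t \<in> u}"
  using 0(5-7) by (intro finite_subset[OF _ leg_finite[OF T _ 0(2), of 0]]) auto
 hence em: "{t \<in> {0..<x}. l 0 t \<in> u} = {}" using 0(1) by simp
 show ?case
 proof (rule front_swap[OF T 0(2,3,5,6,7,8,9)])
  fix t assume "0 \<le> t" "t < y" "t \<noteq> x"
  thus "l 0 t \<notin> u" using em 0(10)[of t] by (cases "t < x") auto
 qed
next
 case (Suc k)
 let ?D = "{t \<in> {0..<x}. l 0 t \<in> u}"
 have fin: "finite ?D"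
  using Suc.prems by (intro finite_subset[OF _ leg_finite[OF T _ Suc.prems(1), of 0]]) auto
 have ne: "?D \<noteq> {}"
 proof
  assume "?D = {}"
  hence "card ?D = 0" by (simp only: card.empty)
  thus False using Suc.hyps(2) by linarith
 qed
 define z where "z = Min ?D"
 have z: "z \<in> ?D" "\<And>t. t \<in> ?D ==> z \<le> t" using Min_in[OF fin ne] Min_le[OF fin] by (auto simp: z_def)
 have z0: "0 < z" "z < x" "l 0 z \<in> u" using z(1) Suc.prems(3) by (cases "z = 0"; auto)+
 have cen: "l 1 0 = l 0 0" using tripodD(2)[OF T, of 1 0 0 0] by simp
 obtain \<epsilon> where e: "0 < \<epsilon>" "\<epsilon> \<le> 1" "\<And>t. 0 \<le> t ==> t \<le> \<epsilon> ==> l 1 t \<notin> u"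
  using ex_small[OF T _ Suc.prems(1), of 1] cen Suc.prems(3) by auto
 note L = tripodD(2)[OF T]
 let ?f = "\<lambda>e. if e = l 0 z then l 1 \<epsilon> else e" let ?u = "insert (l 1 \<epsilon>) (u - {l 0 z})"
 have im: "?f ` u = ?u" using z0 by (intro image_update)
 have f: "reach T (legs l) u ?f"
 proof (rule reach_leg[OF T])
  fix t assume t: "0 \<le> t" "t < z"
  show "l 0 t \<notin> u" using z(2)[of t] t z0 by auto
 qed (use z0 e Suc.prems in auto)
 have ne': "l 0 t \<noteq> l 1 \<epsilon>" if "0 \<le> t" "t \<le> 1" for t using L[of 0 1 t \<epsilon>] e that by auto
 have zz: "l 0 t = l 0 z \<longleftrightarrow> t = z" if "0 \<le> t" "t \<le> 1" for t using L[of 0 0 t z] z0 that Suc.prems by auto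
 have fx: "?f (l 0 x) = l 0 x" "?f (l 0 y) = l 0 y" using zz[of x] zz[of y] z0 Suc.prems by auto
 have "reach T (legs l) ?u (swp (l 0 x) (l 0 y))"
 proof (rule Suc.hyps(1))
  have "{t \<in> {0..<x}. l 0 t \<in> ?u} = ?D - {z}"
   using ne' zz Suc.prems by auto
  thus "k = card {t \<in> {0..<x}. l 0 t \<in> ?u}" using Suc.hyps(2) z(1) fin by simp
  show "?u \<subseteq> topspace T" using Suc.prems(2) legs_subset[OF T] legs_in[of 1 \<epsilon> l] e by auto
  show "l 0 0 \<notin> ?u" using Suc.prems(3) ne'[of 0] by auto
  fix t assume "x < t" "t < y"
  thus "l 0 t \<notin> ?u" using Suc.prems(9)[of t] ne'[of t] Suc.prems by auto
 qed (use Suc.prems zz[of x] zz[of y] z0 in auto)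
 thus ?case
  using reach_swp_conj[OF f Suc.prems(7,8)] unfolding im fx by blast
qed

section \<open>The first case: three branch points in a triangle\<close>

section \<open>Three tripods\<close>

lemma perm_group_inv:
 assumes "p permutes A"
 shows "inv\<^bsub>perm_group A\<^esub> p = inv_into UNIV p"
proof -
 interpret P: group "perm_group A" by (rule group_perm_group)
 show ?thesis using assms permutes_inv[OF assms] permutes_inv_o(2)[OF assms] by (intro P.inv_equality) auto
qed

lemma commutator_of_swaps:
 assumes "distinct [p, q, r]"
 shows "(swp p q \<circ> swp q r \<circ> swp p q \<circ> swp q r) p = r" "(swp p q \<circ> swp q r \<circ> swp p q \<circ> swp q r) r = q"
  "(swp p q \<circ> swp q r \<circ> swp p q \<circ> swp q r) q = p"
  "x \<notin> {p, q, r} ==> (swp p q \<circ> swp q r \<circ> swp p q \<circ> swp q r) x = x"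
 using assms by (auto simp: swp_def)

text \<open>On the support of a 3-cycle commuting with it, \<sigma> acts as a power of that cycle;
  hence its cube is the identity on S and S contains no 2-cycle. If \<sigma> fixed a and b, its cube
  would be the identity everywhere and \<sigma> would be even. So \<sigma> exchanges a and
  b.\<close>

lemma commutes_with_three_cycles:
 assumes A: "finite S" "A = S \<union> {a, b}" "a \<noteq> b" "a \<notin> S" "b \<notin> S"
  and \<sigma>: "\<sigma> permutes A" "sign \<sigma> = - 1"
  and cyc: "\<And>x. x \<in> S ==> \<exists>c. \<sigma> \<circ> c = c \<circ> \<sigma> \<and> c x \<in> S \<and> c (c x) \<in> S \<and> c x \<noteq> x \<and> c (c (c x)) = x \<and> {y. c y \<noteq> y} \<subseteq> {x, c x, c (c x)}"
 shows "two_cycle_points \<sigma> = {a, b}"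
proof -
 have S: "\<sigma> x \<in> S \<and> \<sigma> (\<sigma> (\<sigma> x)) = x \<and> (\<sigma> (\<sigma> x) = x --> \<sigma> x = x)" if x: "x \<in> S" for x
 proof -
  obtain c where c: "\<sigma> \<circ> c = c \<circ> \<sigma>" "c x \<in> S" "c (c x) \<in> S" "c x \<noteq> x" "c (c (c x)) = x" "{y. c y \<noteq> y} \<subseteq> {x, c x, c (c x)}"
   using cyc[OF x] by blast
  have cm: "\<sigma> (c y) = c (\<sigma> y)" for y using fun_cong[OF c(1), of y] by simp
  have inj: "inj \<sigma>" using \<sigma>(1) by (simp add: permutes_inj)
  have "c (\<sigma> x) \<noteq> \<sigma> x" using cm[of x] c(4) inj by (metis injD)
  hence "\<sigma> x \<in> {x, c x, c (c x)}" using c(6) by blast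
  moreover have "c (c x) \<noteq> x" using c(4,5) by metis
  ultimately show ?thesis using c cm x by (elim insertE) auto
 qed
 have fixed_outside: "\<sigma> x = x" if "x \<notin> A" for x using \<sigma>(1) that by (simp add: permutes_def)
 have inj: "inj \<sigma>" using \<sigma>(1) by (simp add: permutes_inj)
 have ab: "\<sigma> x \<in> {a, b}" if x: "x \<in> {a, b}" for x
 proof -
  have "\<sigma> x \<in> A" using x A(2) permutes_in_image[OF \<sigma>(1)] by blast
  moreover have "\<sigma> x \<notin> S"
  proof
   assume "\<sigma> x \<in> S"
   hence s2: "\<sigma> (\<sigma> (\<sigma> x)) \<in> S" "\<sigma> (\<sigma> (\<sigma> (\<sigma> x))) = \<sigma> x" using S by blast+
   hence "\<sigma> (\<sigma> (\<sigma> x)) = x" using inj by (simp add: inj_eq)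
   thus False using s2 x A by auto
  qed
  ultimately show ?thesis using A(2) by blast
 qed
 have "\<sigma> a \<noteq> a"
 proof
  assume sa: "\<sigma> a = a"
  hence sb: "\<sigma> b = b" using ab[of b] inj A(3) by (auto dest: injD)
  have "\<sigma> (\<sigma> (\<sigma> x)) = x" for x
   using S[of x] sa sb fixed_outside[of x] A(2) by (cases "x \<in> A") auto
  hence "\<sigma> \<circ> \<sigma> \<circ> \<sigma> = id" by auto
  moreover have "permutation \<sigma>" unfolding permutation_permutes using \<sigma>(1) A(1,2) by (intro exI[of _ A]) simp
  ultimately have "sign \<sigma> * sign \<sigma> * sign \<sigma> = 1"
   by (metis permutation_compose sign_compose sign_id)
  thus False using \<sigma>(2) by simp
 qed
 hence "\<sigma> a = b" using ab[of a] by blast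
 moreover have "\<sigma> b \<noteq> \<sigma> a" using A(3) inj by (simp add: inj_eq)
 ultimately have sab: "\<sigma> a = b" "\<sigma> b = a" using ab[of b] by auto
 show ?thesis
 proof (rule Set.set_eqI)
  fix p
  have "p \<in> {a, b}" if p: "\<sigma> p \<noteq> p" "\<sigma> (\<sigma> p) = p"
  proof -
   have "p \<in> A" using fixed_outside p(1) by blast
   moreover have "p \<notin> S" using S p by blast
   ultimately show ?thesis using A(2) by blast
  qed
  thus "p \<in> two_cycle_points \<sigma> \<longleftrightarrow> p \<in> {a, b}"
   unfolding two_cycle_points_def mem_Collect_eq using sab A(3) by auto
 qed
qed

context metric_braid
begin

lemma conj_motion:
 assumes F: "moves T u Z F" and K: "moves T (fin F u) Z K" "fin K (fin F u) = fin F u" and u: "finite u" "card u = n"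
 obtains C where "moves T u Z C" "fin C u = u" "M u C = M u F \<star> M (fin F u) K \<star> inv\<^sub>F M u F"
  "\<And>e. e \<in> u ==> F (C e 1) 1 = K (F e 1) 1"
proof -
 let ?v = "fin F u"
 let ?R = "mrev u F"
 have v: "finite ?v" "card ?v = n" using finite_fin[OF u(1)] card_fin[OF F] u by auto
 note R = moves_mrev[OF F]
 have R': "moves T (fin K ?v) Z ?R" using R(1) K(2) by simp
 note C1 = moves_mcomp[OF K(1) R']
 note C2 = moves_mcomp[OF F C1(1)]
 let ?C = "mcomp u F (mcomp ?v K ?R)"
 have fC: "fin ?C u = u" using C2(2) C1(2) K(2) R(2) by simp
 have "M u ?C = M u F \<star> M ?v (mcomp ?v K ?R)" by (rule M_mcomp[OF F C1(1) u])
 also have "M ?v (mcomp ?v K ?R) = M ?v K \<star> M (fin K ?v) ?R" by (rule M_mcomp[OF K(1) R' v])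
 also have "M (fin K ?v) ?R = inv\<^sub>F M u F" unfolding K(2) by (rule M_mrev[OF F u])
 finally have "M u ?C = M u F \<star> (M ?v K \<star> inv\<^sub>F M u F)" .
 hence M: "M u ?C = M u F \<star> M ?v K \<star> inv\<^sub>F M u F"
  using M_closed[OF F u] M_closed[OF K(1) v] by (simp add: FG.m_assoc)
 have "F (?C e 1) 1 = K (F e 1) 1" if e: "e \<in> u" for e
 proof -
  have "F e 1 \<in> ?v" using e by (simp add: fin_def)
  hence "K (F e 1) 1 \<in> ?v" using K(2) unfolding fin_def by blast
  then obtain b where b: "b \<in> u" "K (F e 1) 1 = F b 1" by (auto simp: fin_def)
  have "?C e 1 = ?R (K (F e 1) 1) 1" using e \<open>F e 1 \<in> ?v\<close> by (simp add: mcomp_at)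
  also have "\<dots> = b" unfolding b(2) mrev_at[OF F b(1)] using movesD(2)[OF F] by simp
  finally show ?thesis using b(2) by simp
 qed
 thus ?thesis using that[of ?C] C2(1) fC M by blast
qed

lemma M_commute_closed:
 assumes "moves T u Z F" "moves T u Z' H" "Z \<inter> Z' = {}" "fin F u = u" "fin H u = u" "finite u" "card u = n"
 shows "M u F \<star> M u H = M u H \<star> M u F"
 using M_commute[OF assms(1,2,3,6,7)] assms(4,5) by simp

lemma reachE:
 assumes "reach T Z u (swp a b)" "a \<in> u" "b \<in> u"
 obtains F where "moves T u Z F" "fin F u = u" "\<And>e. e \<in> u ==> F e 1 = swp a b e"
proof -
 obtain F where F: "moves T u Z F" "\<forall>e\<in>u. F e 1 = swp a b e" using assms(1) by (auto simp: reach_def)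
 have "fin F u = swp a b ` u" unfolding fin_def using F(2) by (intro image_cong) auto
 thus ?thesis using that[of F] F swp_image[OF assms(2,3)] by simp
qed

text \<open>Y swaps two tokens at the second tripod. Y' and Zm are both conjugates of one swap Ka at
  the third, to which either a, b are carried (inside Z23, away from l1) or two tokens of S1 (inside
  Z13, away from l2). Hence Y' commutes with the swaps at l1 and Zm with Y. The motion \<theta>
  inside Z12, away from l3, identifies the two occurrences of Ka up to conjugation, which gives
  \<open>no_swap_triangle\<close> its \<delta>.\<close>

theorem no_three_tripods:
 assumes n: "n \<ge> 5" and l: "tripod T l1" "tripod T l2" "tripod T l3"
  and Z: "path_connectedin T Z23" "path_connectedin T Z13" "path_connectedin T Z12"
  and sub: "legs l2 \<subseteq> Z23" "legs l3 \<subseteq> Z23" "legs l1 \<subseteq> Z13" "legs l3 \<subseteq> Z13" "legs l1 \<subseteq> Z12" "legs l2 \<subseteq> Z12"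
  and disj: "Z23 \<inter> legs l1 = {}" "Z13 \<inter> legs l2 = {}" "Z12 \<inter> legs l3 = {}"
 shows "\<not> is_raag FG"
proof
 assume "is_raag FG"
 then obtain S R q where rg: "raag FG S R q" by (rule is_raag_obtain)
 interpret rg: raag FG S R q by (rule rg)
 define m where "m = n - 2"
 have m: "m \<ge> 3" "n = m + 2" using n by (auto simp: m_def)
 define x where "x i = real (Suc i) / real m" for i
 define s where "s i = l1 0 (x i)" for i
 have x: "0 < x i" "x i \<le> 1" if "i < m" for i using that by (auto simp: x_def divide_le_eq_1)
 have xinj: "x i = x j \<longleftrightarrow> i = j" "x i < x j \<longleftrightarrow> i < j" for i j using m by (auto simp: x_def divide_less_cancel)
 have sinj: "s i = s j \<longleftrightarrow> i = j" if "i < m" "j < m" for i j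
  using tripodD(2)[OF l(1), of 0 0 "x i" "x j"] x[OF that(1)] x[OF that(2)] xinj by (auto simp: s_def)
 define S1 where "S1 = s ` {..<m}"
 define a b a' b' where "a = l2 0 (1/2)" and "b = l2 0 1" and "a' = l3 0 (1/2)" and "b' = l3 0 1"
 have S1l: "S1 \<subseteq> legs l1"
 proof
  fix e assume "e \<in> S1"
  then obtain i where i: "i < m" "e = l1 0 (x i)" by (auto simp: S1_def s_def)
  show "e \<in> legs l1" unfolding i(2) using x[OF i(1)] by (intro legs_in) auto
 qed
 have abl: "a \<in> legs l2" "b \<in> legs l2" "a' \<in> legs l3" "b' \<in> legs l3"
  by (auto simp: a_def b_def a'_def b'_def intro!: legs_in)
 have abne: "a \<noteq> b" "a' \<noteq> b'" using tripodD(2)[OF l(2), of 0 0 "1/2" 1] tripodD(2)[OF l(3), of 0 0 "1/2" 1]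
  by (auto simp: a_def b_def a'_def b'_def)
 have d12: "legs l1 \<inter> legs l2 = {}" and d13: "legs l1 \<inter> legs l3 = {}" and d23: "legs l2 \<inter> legs l3 = {}"
  using sub disj by blast+
 have cS1: "finite S1" "card S1 = m"
  unfolding S1_def using sinj by (auto simp: card_image inj_on_def)
 define u1 where "u1 = S1 \<union> {a, b}"
 define u3 where "u3 = S1 \<union> {a', b'}"
 have notin: "a \<notin> S1" "b \<notin> S1" "a' \<notin> S1" "b' \<notin> S1" "a \<noteq> a'" "a \<noteq> b'" "b \<noteq> a'" "b \<noteq> b'"
  using S1l abl d12 d13 d23 by blast+
 have u1: "finite u1" "card u1 = n" "u1 \<subseteq> topspace T" and u3: "finite u3" "card u3 = n" "u3 \<subseteq> topspace T"
  using cS1 notin abne m legs_subset[OF l(1)] legs_subset[OF l(2)] legs_subset[OF l(3)] S1l abl by (auto simp: u1_def u3_def)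
 have cen: "l1 0 0 \<in> legs l1" "l2 0 0 \<in> legs l2" "l3 0 0 \<in> legs l3" by (auto intro: legs_in)
 have cen1: "l1 0 0 \<notin> S1"
 proof
  assume "l1 0 0 \<in> S1"
  then obtain i where "i < m" "l1 0 0 = l1 0 (x i)" by (auto simp: S1_def s_def)
  thus False using tripodD(2)[OF l(1), of 0 0 0 "x i"] x[of i] by auto
 qed
 have cen2: "l2 0 0 \<notin> {a, b}" "l3 0 0 \<notin> {a', b'}"
  using tripodD(2)[OF l(2), of 0 0 0] tripodD(2)[OF l(3), of 0 0 0] by (auto simp: a_def b_def a'_def b'_def)
 have mono_swp: "transition u1 u1 id (\<lambda>e. F e 1) = swp c d" if "c \<in> u1" "d \<in> u1" "\<And>e. e \<in> u1 ==> F e 1 = swp c d e" for F c d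
  by (rule transition_swp) (use that in auto)
 have "\<exists>F. moves T u1 (legs l1) F \<and> fin F u1 = u1 \<and> (\<forall>e\<in>u1. F e 1 = swp (s i) (s (Suc i)) e)" if i: "Suc i < m" for i
 proof -
  have in1: "s i \<in> u1" "s (Suc i) \<in> u1" using i by (auto simp: u1_def S1_def)
  have "reach T (legs l1) u1 (swp (l1 0 (x i)) (l1 0 (x (Suc i))))"
  proof (rule adjacent_swap[OF l(1) u1(1,3)])
   show "l1 0 0 \<notin> u1" using cen1 cen abl d12 by (auto simp: u1_def)
   fix t assume t: "x i < t" "t < x (Suc i)"
   have t01: "0 \<le> t" "t \<le> 1" using t x[of i] x[of "Suc i"] i by auto
   show "l1 0 t \<notin> u1"
   proof
    assume "l1 0 t \<in> u1"
    moreover have "l1 0 t \<in> legs l1" using t01 by (intro legs_in) auto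
    ultimately obtain j where j: "j < m" "l1 0 t = l1 0 (x j)" using abl d12 by (auto simp: u1_def S1_def s_def)
    hence "t = x j" using tripodD(2)[OF l(1), of 0 0 t "x j"] x[of j] t01 by auto
    thus False using t xinj by auto
   qed
  qed (use x[of i] x[of "Suc i"] xinj i in1 in \<open>auto simp: s_def\<close>)
  hence "reach T (legs l1) u1 (swp (s i) (s (Suc i)))" by (simp add: s_def)
  from reachE[OF this in1] show ?thesis by metis
 qed
 then obtain P where P: "\<And>i. Suc i < m ==> moves T u1 (legs l1) (P i) \<and> fin (P i) u1 = u1 \<and> (\<forall>e\<in>u1. P i e 1 = swp (s i) (s (Suc i)) e)"
  by metis
 obtain Y where Y: "moves T u1 (legs l2) Y" "fin Y u1 = u1" "\<And>e. e \<in> u1 ==> Y e 1 = swp a b e"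
 proof (rule reachE)
  show "reach T (legs l2) u1 (swp a b)" unfolding a_def b_def
  proof (rule adjacent_swap[OF l(2) u1(1,3)])
   show "l2 0 0 \<notin> u1" using cen2 cen S1l d12 by (auto simp: u1_def)
   fix t :: real assume t: "1/2 < t" "t < 1"
   hence "l2 0 t \<in> legs l2" "l2 0 t \<noteq> a" "l2 0 t \<noteq> b"
    using tripodD(2)[OF l(2), of 0 0 t "1/2"] tripodD(2)[OF l(2), of 0 0 t 1] by (auto simp: a_def b_def intro: legs_in)
   thus "l2 0 t \<notin> u1" using S1l d12 by (auto simp: u1_def)
  qed (auto simp: u1_def a_def b_def)
 qed (auto simp: u1_def)
 obtain Ka where Ka: "moves T u3 (legs l3) Ka" "fin Ka u3 = u3" "\<And>e. e \<in> u3 ==> Ka e 1 = swp a' b' e"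
 proof (rule reachE)
  show "reach T (legs l3) u3 (swp a' b')" unfolding a'_def b'_def
  proof (rule adjacent_swap[OF l(3) u3(1,3)])
   show "l3 0 0 \<notin> u3" using cen2 cen S1l d13 by (auto simp: u3_def)
   fix t :: real assume t: "1/2 < t" "t < 1"
   hence "l3 0 t \<in> legs l3" "l3 0 t \<noteq> a'" "l3 0 t \<noteq> b'"
    using tripodD(2)[OF l(3), of 0 0 t "1/2"] tripodD(2)[OF l(3), of 0 0 t 1] by (auto simp: a'_def b'_def intro: legs_in)
   thus "l3 0 t \<notin> u3" using S1l d13 by (auto simp: u3_def)
  qed (auto simp: u3_def a'_def b'_def)
 qed (auto simp: u3_def)
 \<comment> \<open>Reached from u1 by moving two tokens of S1 to the third tripod, and from u3 by
   moving two tokens of S1 to the second.\<close>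
 define u3' where "u3' = (S1 - {s 0, s 1}) \<union> {a', b'} \<union> {a, b}"
 have s01: "s 0 \<in> S1" "s 1 \<in> S1" "s 0 \<noteq> s 1" using m sinj[of 0 1] by (auto simp: S1_def)
 have in_Z: "u1 \<inter> Z23 = {a, b}" "u1 \<inter> Z13 = S1" "u3 \<inter> Z12 = S1"
  using S1l abl sub disj by (auto simp: u1_def u3_def)
 obtain \<eta> where \<eta>: "moves T u1 Z23 \<eta>" "fin \<eta> u1 = u3"
 proof -
  have "\<exists>F. moves T u1 Z23 F \<and> fin F u1 = (u1 - Z23) \<union> {a', b'}"
   by (rule conf_connected[OF Hausdorff Z(1) u1(1,3)]) (use in_Z abl sub abne in auto)
  moreover have "u1 - Z23 = S1"
  proof -
   have "a \<in> Z23" "b \<in> Z23" "S1 \<inter> Z23 = {}" using S1l abl sub(1) disj(1) by blast+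
   thus ?thesis by (auto simp: u1_def)
  qed
  ultimately show thesis using that by (auto simp: u3_def)
 qed
 have cB: "card ((S1 - {s 0, s 1}) \<union> {c, d}) = m" if "c \<notin> S1" "d \<notin> S1" "c \<noteq> d" for c d
 proof -
  have "card (S1 - {s 0, s 1}) = m - 2" using s01 cS1 by (simp add: card_Diff_subset)
  moreover have "(S1 - {s 0, s 1}) \<inter> {c, d} = {}" using that by auto
  ultimately show ?thesis using that cS1 m by (subst card_Un_disjoint) auto
 qed
 obtain \<zeta> where \<zeta>: "moves T u1 Z13 \<zeta>" "fin \<zeta> u1 = u3'"
 proof -
  have "\<exists>F. moves T u1 Z13 F \<and> fin F u1 = (u1 - Z13) \<union> ((S1 - {s 0, s 1}) \<union> {a', b'})"
  proof (rule conf_connected[OF Hausdorff Z(2) u1(1,3)])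
   show "(S1 - {s 0, s 1}) \<union> {a', b'} \<subseteq> Z13" using S1l sub(3,4) abl(3,4) by blast
   show "finite ((S1 - {s 0, s 1}) \<union> {a', b'})" using cS1 by simp
   show "card ((S1 - {s 0, s 1}) \<union> {a', b'}) = card (u1 \<inter> Z13)"
    unfolding in_Z(2) cS1(2) by (rule cB[OF notin(3,4) abne(2)])
  qed
  moreover have "u1 - Z13 = {a, b}"
  proof -
   have "a \<notin> Z13" "b \<notin> Z13" "S1 \<subseteq> Z13" using S1l abl sub(3) disj(2) by blast+
   thus ?thesis by (auto simp: u1_def)
  qed
  ultimately show thesis using that by (auto simp: u3'_def Un_commute Un_left_commute)
 qed
 obtain \<theta> where \<theta>: "moves T u3 Z12 \<theta>" "fin \<theta> u3 = u3'"
 proof -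
  have "\<exists>F. moves T u3 Z12 F \<and> fin F u3 = (u3 - Z12) \<union> ((S1 - {s 0, s 1}) \<union> {a, b})"
  proof (rule conf_connected[OF Hausdorff Z(3) u3(1,3)])
   show "(S1 - {s 0, s 1}) \<union> {a, b} \<subseteq> Z12" using S1l sub(5,6) abl(1,2) by blast
   show "finite ((S1 - {s 0, s 1}) \<union> {a, b})" using cS1 by simp
   show "card ((S1 - {s 0, s 1}) \<union> {a, b}) = card (u3 \<inter> Z12)"
    unfolding in_Z(3) cS1(2) by (rule cB[OF notin(1,2) abne(1)])
  qed
  moreover have "u3 - Z12 = {a', b'}"
  proof -
   have "a' \<notin> Z12" "b' \<notin> Z12" "S1 \<subseteq> Z12" using S1l abl sub(5) disj(3) by blast+
   thus ?thesis by (auto simp: u3_def)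
  qed
  ultimately show thesis using that by (auto simp: u3'_def Un_commute Un_left_commute)
 qed
 have u3': "finite u3'" "card u3' = n" using finite_fin[OF u3(1), of \<theta>] card_fin[OF \<theta>(1)] \<theta>(2) u3 by auto
 have Ka': "moves T u3' (legs l3) Ka" using moves_disjoint(1)[OF \<theta>(1) Ka(1) disj(3)] \<theta>(2) by simp
 have Kval: "Ka e 1 = swp a' b' e" if "e \<in> u3'" for e
 proof (cases "e \<in> u3")
  case False
  hence "e \<noteq> a'" "e \<noteq> b'" "Ka e 1 = e" using movesD(5)[OF Ka(1), of e 1] by (auto simp: u3_def)
  thus ?thesis by (simp add: swp_def)
 qed (use Ka(3) in auto)
 have Kfin': "fin Ka u3' = u3'"
 proof -
  have "fin Ka u3' = swp a' b' ` u3'" unfolding fin_def using Kval by (intro image_cong) auto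
  thus ?thesis using swp_image[of a' u3' b'] by (simp add: u3'_def)
 qed
 define gy gk gk' ge gz gt where "gy = M u1 Y" and "gk = M u3 Ka" and "gk' = M u3' Ka"
  and "ge = M u1 \<eta>" and "gz = M u1 \<zeta>" and "gt = M u3 \<theta>"
 have cl: "gy \<in> carrier FG" "gk \<in> carrier FG" "gk' \<in> carrier FG" "ge \<in> carrier FG" "gz \<in> carrier FG" "gt \<in> carrier FG"
  unfolding gy_def gk_def gk'_def ge_def gz_def gt_def
  using M_closed[OF Y(1) u1(1,2)] M_closed[OF Ka(1) u3(1,2)] M_closed[OF Ka' u3'] M_closed[OF \<eta>(1) u1(1,2)]
   M_closed[OF \<zeta>(1) u1(1,2)] M_closed[OF \<theta>(1) u3(1,2)] by auto
 \<comment> \<open>\<theta> has support in Z12 and Ka in the legs of l3, so they commute, although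
   Ka acts on different configurations before and after \<theta>.\<close>
 have tk: "gt \<star> gk' = gk \<star> gt"
  using M_commute[OF \<theta>(1) Ka(1) disj(3) u3(1,2)] \<theta>(2) Ka(2) by (simp add: gt_def gk'_def gk_def)
 obtain Y' where Y': "moves T u1 Z23 Y'" "fin Y' u1 = u1" "M u1 Y' = ge \<star> gk \<star> inv\<^sub>F ge"
  "\<And>e. e \<in> u1 ==> \<eta> (Y' e 1) 1 = swp a' b' (\<eta> e 1)"
 proof (rule conj_motion[OF \<eta>(1) _ _ u1(1,2), of Ka])
  show "moves T (fin \<eta> u1) Z23 Ka" using moves_mono[OF Ka(1) sub(2)] \<eta>(2) by simp
  show "fin Ka (fin \<eta> u1) = fin \<eta> u1" using Ka(2) \<eta>(2) by simp
  fix C assume C: "moves T u1 Z23 C" "fin C u1 = u1" "M u1 C = M u1 \<eta> \<star> M (fin \<eta> u1) Ka \<star> inv\<^sub>F M u1 \<eta>"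
   "\<And>e. e \<in> u1 ==> \<eta> (C e 1) 1 = Ka (\<eta> e 1) 1"
  have "\<eta> (C e 1) 1 = swp a' b' (\<eta> e 1)" if "e \<in> u1" for e
  proof -
   have "\<eta> e 1 \<in> u3" using that \<eta>(2) unfolding fin_def by blast
   thus ?thesis using C(4)[OF that] Ka(3) by simp
  qed
  thus thesis using that[of C] C(1-3) \<eta>(2) by (simp add: ge_def gk_def)
 qed
 obtain Zm where Zm: "moves T u1 Z13 Zm" "fin Zm u1 = u1" "M u1 Zm = gz \<star> gk' \<star> inv\<^sub>F gz"
  "\<And>e. e \<in> u1 ==> \<zeta> (Zm e 1) 1 = swp a' b' (\<zeta> e 1)"
 proof (rule conj_motion[OF \<zeta>(1) _ _ u1(1,2), of Ka])
  show "moves T (fin \<zeta> u1) Z13 Ka" using moves_mono[OF Ka' sub(4)] \<zeta>(2) by simp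
  show "fin Ka (fin \<zeta> u1) = fin \<zeta> u1" using Kfin' \<zeta>(2) by simp
  fix C assume C: "moves T u1 Z13 C" "fin C u1 = u1" "M u1 C = M u1 \<zeta> \<star> M (fin \<zeta> u1) Ka \<star> inv\<^sub>F M u1 \<zeta>"
   "\<And>e. e \<in> u1 ==> \<zeta> (C e 1) 1 = Ka (\<zeta> e 1) 1"
  have "\<zeta> (C e 1) 1 = swp a' b' (\<zeta> e 1)" if "e \<in> u1" for e
  proof -
   have "\<zeta> e 1 \<in> u3'" using that \<zeta>(2) unfolding fin_def by blast
   thus ?thesis using C(4)[OF that] Kval by simp
  qed
  thus thesis using that[of C] C(1-3) \<zeta>(2) by (simp add: gz_def gk'_def)
 qed
 \<comment> \<open>\<open>conf_connected\<close> does not tell which tokens arrive at a' and b'; c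
   and d are whichever do.\<close>
 have lift_swp: "\<exists>c\<in>u1. \<exists>d\<in>u1. c \<noteq> d \<and> F c 1 = a' \<and> F d 1 = b' \<and> (\<forall>e\<in>u1. C e 1 = swp c d e)"
  if F: "moves T u1 W F" "a' \<in> fin F u1" "b' \<in> fin F u1" and C: "fin C u1 = u1" "\<And>e. e \<in> u1 ==> F (C e 1) 1 = swp a' b' (F e 1)"
  for F C W
 proof -
  obtain c d where cd: "c \<in> u1" "d \<in> u1" "F c 1 = a'" "F d 1 = b'" using F(2,3) by (auto simp: fin_def)
  have inj: "inj_on (\<lambda>e. F e 1) u1" using movesD(3)[OF F(1), of 1] by simp
  have "C e 1 = swp c d e" if e: "e \<in> u1" for e
  proof (rule inj_onD[OF inj])
   show "C e 1 \<in> u1" using C(1) e unfolding fin_def by blast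
   show "swp c d e \<in> u1" using cd e by (simp add: swp_def)
   have "F e 1 = a' \<longleftrightarrow> e = c" "F e 1 = b' \<longleftrightarrow> e = d" using inj_onD[OF inj] cd e by auto
   thus "F (C e 1) 1 = F (swp c d e) 1" using C(2)[OF e] cd by (auto simp: swp_def)
  qed
  moreover have "c \<noteq> d" using cd(3,4) abne(2) by auto
  ultimately show ?thesis using cd by (intro bexI[of _ c] bexI[of _ d] conjI ballI) assumption+
 qed
 obtain c d where cd: "c \<in> u1" "d \<in> u1" "c \<noteq> d" "\<eta> c 1 = a'" "\<eta> d 1 = b'" "\<And>e. e \<in> u1 ==> Y' e 1 = swp c d e"
  using lift_swp[of Z23 \<eta> Y', OF \<eta>(1) _ _ Y'(2,4)] \<eta>(2) by (auto simp: u3_def)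
 have cdab: "{c, d} = {a, b}"
 proof -
  have "e \<in> {a, b}" if "e \<in> u1" "\<eta> e 1 \<notin> S1" for e
  proof (rule ccontr)
   assume "e \<notin> {a, b}"
   hence eS: "e \<in> S1" using that(1) by (simp add: u1_def)
   hence "e \<notin> Z23" using S1l disj(1) by blast
   hence "\<eta> e 1 = e" using movesD(5)[OF \<eta>(1), of e 1] by simp
   thus False using eS that(2) by simp
  qed
  hence "c \<in> {a, b}" "d \<in> {a, b}" using cd notin by auto
  thus ?thesis using cd(3) by auto
 qed
 obtain c' d' where cd': "c' \<in> u1" "d' \<in> u1" "c' \<noteq> d'" "\<zeta> c' 1 = a'" "\<zeta> d' 1 = b'" "\<And>e. e \<in> u1 ==> Zm e 1 = swp c' d' e"
  using lift_swp[of Z13 \<zeta> Zm, OF \<zeta>(1) _ _ Zm(2,4)] \<zeta>(2) by (auto simp: u3'_def)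
 have cdS: "c' \<in> S1"
 proof (rule ccontr)
  assume "c' \<notin> S1"
  hence "c' \<in> {a, b}" using cd'(1) by (auto simp: u1_def)
  hence "\<zeta> c' 1 = c'" using movesD(5)[OF \<zeta>(1), of c' 1] disj abl by auto
  thus False using cd'(4) \<open>c' \<in> {a, b}\<close> notin by auto
 qed
 obtain \<pi> where \<pi>: "\<pi> \<in> hom FG (perm_group u1)"
  "\<And>F Z. moves T u1 Z F ==> fin F u1 = u1 ==> \<pi> (M u1 F) = transition u1 u1 id (\<lambda>a. F a 1)"
  using ex_monodromy[OF u1(3,1,2)] by blast
 have \<pi>Y: "\<pi> gy = swp a b" unfolding gy_def \<pi>(2)[OF Y(1,2)] using Y(3) by (intro mono_swp) (auto simp: u1_def)
 have \<pi>Y': "\<pi> (M u1 Y') = swp c d" unfolding \<pi>(2)[OF Y'(1,2)] using cd by (intro mono_swp) auto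
 have \<pi>Z: "\<pi> (M u1 Zm) = swp c' d'" unfolding \<pi>(2)[OF Zm(1,2)] using cd' by (intro mono_swp) auto
 have \<pi>P: "\<pi> (M u1 (P i)) = swp (s i) (s (Suc i))" if "Suc i < m" for i
 proof -
  have "s i \<in> u1" "s (Suc i) \<in> u1" using that by (auto simp: u1_def S1_def)
  thus ?thesis using \<pi>(2)[of "legs l1" "P i"] P[OF that] mono_swp[of "s i" "s (Suc i)" "P i"] by simp
 qed
 \<comment> \<open>Y' is gk conjugated by ge, Zm is gk' conjugated by gz, and gk' is gk conjugated
   by the inverse of gt; this product leads from the first to the second.\<close>
 define \<delta> where "\<delta> = gz \<star> inv\<^sub>F gt \<star> inv\<^sub>F ge"
 have \<delta>c: "\<delta> \<in> carrier FG" using cl by (simp add: \<delta>_def)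
 have k': "gk' = inv\<^sub>F gt \<star> gk \<star> gt"
 proof -
  have "inv\<^sub>F gt \<star> (gt \<star> gk') = inv\<^sub>F gt \<star> (gk \<star> gt)" using tk by simp
  moreover have "inv\<^sub>F gt \<star> (gt \<star> gk') = gk'" using cl by (simp add: FG.m_assoc[symmetric])
  ultimately show ?thesis using cl by (simp add: FG.m_assoc)
 qed
 have zcj: "M u1 Zm = \<delta> \<star> M u1 Y' \<star> inv\<^sub>F \<delta>"
 proof -
  have i1: "inv\<^sub>F ge \<star> (ge \<star> w) = w" if "w \<in> carrier FG" for w
   using cl that by (simp add: FG.m_assoc[symmetric])
  have "inv\<^sub>F \<delta> = ge \<star> (gt \<star> inv\<^sub>F gz)" using cl by (simp add: \<delta>_def FG.inv_mult_group)
  thus ?thesis unfolding Zm(3) Y'(3) k' \<delta>_def using cl i1 by (simp add: FG.m_assoc)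
 qed
 \<comment> \<open>The triples of consecutive tokens cover S1 as soon as m >= 3, which is where n >=
   5 enters.\<close>
 define N where "N = (\<lambda>i. group_commutator FG (M u1 (P i)) (M u1 (P (Suc i)))) ` {i. Suc (Suc i) < m}"
 have Pc: "M u1 (P i) \<in> carrier FG" if "Suc i < m" for i using P[OF that] M_closed u1 by blast
 have Ncl: "N \<subseteq> carrier FG" unfolding N_def group_commutator_def using Pc by auto
 have comm_N: "x \<star> w = w \<star> x" if x: "x \<in> N" and w: "w \<in> carrier FG"
  and cm: "\<And>i. Suc i < m ==> w \<star> M u1 (P i) = M u1 (P i) \<star> w" for x w
 proof -
  obtain i where i: "Suc (Suc i) < m" "x = group_commutator FG (M u1 (P i)) (M u1 (P (Suc i)))" using x by (auto simp: N_def)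
  have "x \<in> generate FG {M u1 (P i), M u1 (P (Suc i))}"
   unfolding i(2) group_commutator_def by (intro generate.intros) auto
  thus ?thesis using Pc[of i] Pc[of "Suc i"] cm[of i] cm[of "Suc i"] i
   by (intro FG.generate_commute[OF w, symmetric]) auto
 qed
 have \<pi>N: "\<pi> (group_commutator FG (M u1 (P i)) (M u1 (P (Suc i)))) =
   swp (s i) (s (Suc i)) \<circ> swp (s (Suc i)) (s (Suc (Suc i))) \<circ> swp (s i) (s (Suc i)) \<circ> swp (s (Suc i)) (s (Suc (Suc i)))"
  if i: "Suc (Suc i) < m" for i
 proof -
  interpret h: group_hom FG "perm_group u1" \<pi>
   by (simp add: group_hom_def group_hom_axioms_def group_perm_group grp \<pi>(1))
  have su: "s j \<in> u1" if "j < m" for j using that by (auto simp: u1_def S1_def)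
  have iv: "inv\<^bsub>perm_group u1\<^esub> (swp p q) = swp p q" if "p \<in> u1" "q \<in> u1" for p q
   using h.H.inv_equality[of "swp p q" "swp p q"] swp_permutes[OF that] by (auto simp: fun_eq_iff)
  show ?thesis unfolding group_commutator_def
   using Pc[of i] Pc[of "Suc i"] i \<pi>P[of i] \<pi>P[of "Suc i"] su[of i] su[of "Suc i"] su[of "Suc (Suc i)"] by (simp add: iv)
 qed
 have Y'c: "M u1 Y' \<in> carrier FG" using M_closed[OF Y'(1) u1(1,2)] .
 show False
 proof (rule rg.no_swap_triangle[OF \<pi>(1) u1(1) cl(1) Y'c \<delta>c Ncl, of "{a, b}"])
  show "finite N" unfolding N_def by (intro finite_imageI finite_subset[of "{i. Suc (Suc i) < m}" "{..<m}"]) auto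
  show "gy \<star> (\<delta> \<star> M u1 Y' \<star> inv\<^sub>F \<delta>) = \<delta> \<star> M u1 Y' \<star> inv\<^sub>F \<delta> \<star> gy"
   unfolding zcj[symmetric] gy_def by (rule M_commute_closed[OF Y(1) Zm(1) _ Y(2) Zm(2) u1(1,2)]) (use disj in auto)
  fix x assume x: "x \<in> N"
  show "x \<star> gy = gy \<star> x"
  proof (rule comm_N[OF x cl(1)])
   fix i assume "Suc i < m"
   thus "gy \<star> M u1 (P i) = M u1 (P i) \<star> gy"
    unfolding gy_def using P[of i] d12 by (intro M_commute_closed[OF Y(1) _ _ Y(2) _ u1(1,2), of "legs l1"]) auto
  qed
  show "x \<star> M u1 Y' = M u1 Y' \<star> x"
  proof (rule comm_N[OF x Y'c])
   fix i assume "Suc i < m"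
   thus "M u1 Y' \<star> M u1 (P i) = M u1 (P i) \<star> M u1 Y'"
    using P[of i] disj by (intro M_commute_closed[OF Y'(1) _ _ Y'(2) _ u1(1,2), of "legs l1"]) auto
  qed
  fix t
  obtain i where "Suc (Suc i) < m" "x = group_commutator FG (M u1 (P i)) (M u1 (P (Suc i)))" using x by (auto simp: N_def)
  thus "rg.expo t x = 0" using Pc[of i] Pc[of "Suc i"] by (simp add: group_commutator_def)
 next
  show "sign (\<pi> gy) = - 1" using \<pi>Y sign_swp abne by simp
  show "sign (\<pi> (\<delta> \<star> M u1 Y' \<star> inv\<^sub>F \<delta>)) = - 1" unfolding zcj[symmetric] using \<pi>Z sign_swp cd' by simp
 next
  fix \<sigma> assume \<sigma>: "\<sigma> permutes u1" "sign \<sigma> = - 1" "\<And>x. x \<in> N ==> \<sigma> \<circ> \<pi> x = \<pi> x \<circ> \<sigma>"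
  show "two_cycle_points \<sigma> = {a, b}"
  proof (rule commutes_with_three_cycles[OF cS1(1) u1_def abne(1) notin(1,2) \<sigma>(1,2)])
   fix y assume "y \<in> S1"
   then obtain j where j: "j < m" "y = s j" by (auto simp: S1_def)
   obtain i where i: "Suc (Suc i) < m" "j = i \<or> j = Suc i \<or> j = Suc (Suc i)"
   proof (rule that[of "if 2 \<le> j then j - 2 else 0"])
    show "Suc (Suc (if 2 \<le> j then j - 2 else 0)) < m" using j(1) m(1) by auto
    show "j = (if 2 \<le> j then j - 2 else 0) \<or> j = Suc (if 2 \<le> j then j - 2 else 0) \<or> j = Suc (Suc (if 2 \<le> j then j - 2 else 0))"
     by auto
   qed
   define p q r where "p = s i" and "q = s (Suc i)" and "r = s (Suc (Suc i))"
   let ?c = "swp p q \<circ> swp q r \<circ> swp p q \<circ> swp q r"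
   have dis: "distinct [p, q, r]" using i sinj by (auto simp: p_def q_def r_def)
   have inS: "p \<in> S1" "q \<in> S1" "r \<in> S1" using i by (auto simp: p_def q_def r_def S1_def)
   have "group_commutator FG (M u1 (P i)) (M u1 (P (Suc i))) \<in> N" using i by (auto simp: N_def)
   from \<sigma>(3)[OF this] have "\<sigma> \<circ> ?c = ?c \<circ> \<sigma>" unfolding \<pi>N[OF i(1)] p_def q_def r_def .
   moreover have "y = p \<or> y = q \<or> y = r" using i j by (auto simp: p_def q_def r_def)
   moreover note C = commutator_of_swaps[OF dis]
   moreover have "{z. ?c z \<noteq> z} \<subseteq> {p, q, r}" using C(4) by blast
   ultimately have "\<sigma> \<circ> ?c = ?c \<circ> \<sigma> \<and> ?c y \<in> S1 \<and> ?c (?c y) \<in> S1 \<and> ?c y \<noteq> y \<and> ?c (?c (?c y)) = y \<and> {z. ?c z \<noteq> z} \<subseteq> {y, ?c y, ?c (?c y)}"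
    using inS dis unfolding distinct.simps by (elim disjE) (simp_all only: C(1-3), auto)
   thus "\<exists>c. \<sigma> \<circ> c = c \<circ> \<sigma> \<and> c y \<in> S1 \<and> c (c y) \<in> S1 \<and> c y \<noteq> y \<and> c (c (c y)) = y \<and> {z. c z \<noteq> z} \<subseteq> {y, c y, c (c y)}" by blast
  qed
 next
  interpret h: group_hom FG "perm_group u1" \<pi>
   by (simp add: group_hom_def group_hom_axioms_def group_perm_group grp \<pi>(1))
  have pd: "\<pi> \<delta> permutes u1" using h.hom_closed[OF \<delta>c] by simp
  have "\<pi> (M u1 Zm) = \<pi> \<delta> \<circ> \<pi> (M u1 Y') \<circ> inv_into UNIV (\<pi> \<delta>)"
   unfolding zcj using \<delta>c Y'c perm_group_inv[OF pd] by simp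
  hence "two_cycle_points (swp c' d') = \<pi> \<delta> ` two_cycle_points (swp c d)"
   using two_cycle_points_conj[OF permutes_bij[OF pd], of "\<pi> (M u1 Y')"] \<pi>Y' \<pi>Z by simp
  hence "\<pi> \<delta> ` {a, b} = {c', d'}" using two_cycle_points_swp cd(3) cd'(3) cdab by metis
  thus "\<pi> \<delta> ` {a, b} \<noteq> {a, b}" using cdS notin by auto
 qed
qed

end

section \<open>Recording how tokens pass a vertex\<close>

section \<open>Holonomy at a vertex\<close>

definition closest :: "('a => real) => 'a set => 'a" where
 "closest \<mu> u = (SOME q. q \<in> u \<and> (\<forall>q'\<in>u. \<mu> q \<le> \<mu> q'))"

text \<open>The factor 2 separates this condition from a tie for the nearest token: on the boundary
  of the occupied set the nearest token is unique and away from the vertex, so that its side is well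
  defined there.\<close>

definition occupied :: "('a => real) => 'a set => bool" where
 "occupied \<mu> u \<longleftrightarrow> (\<exists>q\<in>u. \<forall>q'\<in>u - {q}. 2 * \<mu> q < \<mu> q')"

lemma closest:
 assumes "finite u" "u \<noteq> {}"
 shows "closest \<mu> u \<in> u \<and> (\<forall>q'\<in>u. \<mu> (closest \<mu> u) \<le> \<mu> q')"
proof -
 have "Min (\<mu> ` u) \<in> \<mu> ` u" using assms by (intro Min_in) auto
 then obtain q where "q \<in> u" "\<mu> q = Min (\<mu> ` u)" by force
 hence "\<exists>q. q \<in> u \<and> (\<forall>q'\<in>u. \<mu> q \<le> \<mu> q')" using assms(1) by (intro exI[of _ q]) auto
 thus ?thesis unfolding closest_def by (rule someI_ex)
qed

lemma closest_eq:
 assumes "q \<in> u" "\<And>q'. q' \<in> u ==> q' \<noteq> q ==> \<mu> q < \<mu> q'"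
 shows "closest \<mu> u = q"
 unfolding closest_def
proof (rule some_equality)
 show "q \<in> u \<and> (\<forall>q'\<in>u. \<mu> q \<le> \<mu> q')" using assms by force
 show "q1 = q" if "q1 \<in> u \<and> (\<forall>q'\<in>u. \<mu> q1 \<le> \<mu> q')" for q1
  using that assms by force
qed

text \<open>A configuration in which a single token is much closer to the vertex than the others does
 not record on which side of the vertex this token is; passing through such configurations
 collects the labels of the two sides.\<close>

definition vertex_pot :: "('w, 'z) monoid_scheme => ('a => real) => ('a => 'w) => 'a set => 'w" where
 "vertex_pot W \<mu> \<xi> u = (if occupied \<mu> u then \<one>\<^bsub>W\<^esub> else \<xi> (closest \<mu> u))"

text \<open>Only a change of status is recorded: entering the vertex gives the inverse label of the
  side left, leaving it gives the label of the side entered. Equal status gives 1 even if the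
  nearest tokens have different labels.\<close>

definition vertex_cocycle :: "('w, 'z) monoid_scheme => ('a => real) => ('a => 'w) => 'a set => 'a set => 'w" where
 "vertex_cocycle W \<mu> \<xi> u v = (if occupied \<mu> u = occupied \<mu> v then \<one>\<^bsub>W\<^esub>
  else inv\<^bsub>W\<^esub> vertex_pot W \<mu> \<xi> u \<otimes>\<^bsub>W\<^esub> vertex_pot W \<mu> \<xi> v)"

definition matched :: "('a => 'a => real) => real => 'a set => ('a => 'a) => 'a set => bool" where
 "matched d \<rho> u \<phi> v \<longleftrightarrow> bij_betw \<phi> u v \<and> (\<forall>a\<in>u. d a (\<phi> a) < \<rho>)"

lemma matched_mono: "matched d \<rho> u \<phi> v ==> \<rho> \<le> \<rho>' ==> matched d \<rho>' u \<phi> v"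
 unfolding matched_def by force

context metric_conf
begin

lemma openin_matched:
 assumes u: "finite u" "card u = n" "u \<subseteq> topspace T" and \<rho>: "0 < \<rho>"
 shows "openin (unord_conf T n) {w \<in> topspace (unord_conf T n). \<exists>\<phi>. matched d \<rho> u \<phi> w}"
  "u \<in> {w \<in> topspace (unord_conf T n). \<exists>\<phi>. matched d \<rho> u \<phi> w}"
proof -
 let ?O = "{w \<in> topspace (unord_conf T n). \<exists>\<phi>. bij_betw \<phi> u w \<and> (\<forall>a\<in>u. \<phi> a \<in> {b \<in> topspace T. d a b < \<rho>})}"
 have "openin (unord_conf T n) ?O"
  using u(3) by (intro openin_unord_conf_box[OF u(1,2)] ball_open) auto
 moreover have "?O = {w \<in> topspace (unord_conf T n). \<exists>\<phi>. matched d \<rho> u \<phi> w}"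
 proof (rule Collect_cong, rule conj_cong[OF refl])
  fix w assume w: "w \<in> topspace (unord_conf T n)"
  show "(\<exists>\<phi>. bij_betw \<phi> u w \<and> (\<forall>a\<in>u. \<phi> a \<in> {b \<in> topspace T. d a b < \<rho>})) = (\<exists>\<phi>. matched d \<rho> u \<phi> w)"
  proof (rule ex_cong1)
   fix \<phi>
   have "\<phi> a \<in> topspace T" if "bij_betw \<phi> u w" "a \<in> u" for a
    using bij_betwE[OF that(1)] that(2) w by (auto simp: topspace_unord_conf)
   thus "(bij_betw \<phi> u w \<and> (\<forall>a\<in>u. \<phi> a \<in> {b \<in> topspace T. d a b < \<rho>})) = matched d \<rho> u \<phi> w"
    by (auto simp: matched_def)
  qed
 qed
 ultimately show "openin (unord_conf T n) {w \<in> topspace (unord_conf T n). \<exists>\<phi>. matched d \<rho> u \<phi> w}" by simp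
 have "matched d \<rho> u id u" using u \<rho> by (auto simp: matched_def)
 thus "u \<in> {w \<in> topspace (unord_conf T n). \<exists>\<phi>. matched d \<rho> u \<phi> w}"
  using u by (auto simp: topspace_unord_conf)
qed

end

text \<open>\<mu> is a distance from the vertex capped at 1, and \<xi> labels the sides; local
  constancy of labels is asked only strictly between the vertex and the rim of the chart.\<close>

locale vertex_chart = metric_conf T d + W: group W for T :: "'a topology" and d and W :: "('w, 'z) monoid_scheme" (structure) +
 fixes \<mu> :: "'a => real" and \<xi> :: "'a => 'w"
 assumes lipschitz: "\<And>a b. a \<in> topspace T ==> b \<in> topspace T ==> \<bar>\<mu> a - \<mu> b\<bar> \<le> d a b"
  and \<mu>_bounds: "\<And>a. a \<in> topspace T ==> 0 \<le> \<mu> a \<and> \<mu> a \<le> 1"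
  and \<mu>_zero: "\<And>a b. a \<in> topspace T ==> b \<in> topspace T ==> \<mu> a = 0 ==> \<mu> b = 0 ==> a = b"
  and \<xi>_closed: "\<And>a. a \<in> topspace T ==> \<xi> a \<in> carrier W"
  and \<xi>_local: "\<And>a. a \<in> topspace T ==> 0 < \<mu> a ==> \<mu> a < 1 ==> \<exists>\<rho>>0. \<forall>b\<in>topspace T. d a b < \<rho> --> \<xi> b = \<xi> a"
begin

text \<open>Let q be a nearest token. If the minimum is attained twice, no nearby configuration is
  occupied. Otherwise q stays nearest under small perturbations, and either u is occupied, an open
  condition, or q is off the vertex and its label is locally constant.\<close>

lemma local_chart:
 assumes u: "finite u" "card u \<ge> 2" "u \<subseteq> topspace T"
 shows "\<exists>\<rho>>0. ((\<forall>\<phi> v. matched d \<rho> u \<phi> v --> v \<subseteq> topspace T --> \<not> occupied \<mu> v) \<and> (\<forall>a\<in>u. 0 < \<mu> a)) \<or>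
  (\<exists>q\<in>u. \<mu> q < 1 \<and> (\<forall>a\<in>u - {q}. 0 < \<mu> a) \<and>
   (\<forall>\<phi> v. matched d \<rho> u \<phi> v --> v \<subseteq> topspace T --> closest \<mu> v = \<phi> q) \<and>
   ((\<forall>\<phi> v. matched d \<rho> u \<phi> v --> v \<subseteq> topspace T --> occupied \<mu> v) \<or>
    (0 < \<mu> q \<and> (\<forall>b\<in>topspace T. d q b < \<rho> --> \<xi> b = \<xi> q))))"
proof -
 define q where "q = closest \<mu> u"
 have une: "u \<noteq> {}" using u(2) by auto
 have q: "q \<in> u" "\<And>a. a \<in> u ==> \<mu> q \<le> \<mu> a" using closest[OF u(1) une] by (auto simp: q_def)
 have close: "\<bar>\<mu> a - \<mu> (\<phi> a)\<bar> < \<rho>" if "matched d \<rho> u \<phi> v" "v \<subseteq> topspace T" "a \<in> u" for \<rho> \<phi> v a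
 proof -
  have "\<phi> a \<in> topspace T" "a \<in> topspace T" "d a (\<phi> a) < \<rho>" using that u(3) bij_betwE[of \<phi> u v] by (auto simp: matched_def)
  thus ?thesis using lipschitz[of a "\<phi> a"] by linarith
 qed
 have onto: "\<exists>a\<in>u. b = \<phi> a" if "matched d \<rho> u \<phi> v" "b \<in> v" for \<rho> \<phi> v b
  using that by (auto simp: matched_def bij_betw_def)
 show ?thesis
 proof (cases "\<exists>q'\<in>u. q' \<noteq> q \<and> \<mu> q' = \<mu> q")
  case True
  then obtain q' where q': "q' \<in> u" "q' \<noteq> q" "\<mu> q' = \<mu> q" by blast
  have pos: "0 < \<mu> q" using \<mu>_zero[of q q'] \<mu>_bounds[of q] q q' u(3) by force
  have "\<not> occupied \<mu> v" if m: "matched d (\<mu> q / 4) u \<phi> v" and v: "v \<subseteq> topspace T" for \<phi> v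
  proof
   assume "occupied \<mu> v"
   then obtain b where b: "b \<in> v" "\<And>c. c \<in> v ==> c \<noteq> b ==> 2 * \<mu> b < \<mu> c" by (auto simp: occupied_def)
   obtain a where a: "a \<in> u" "b = \<phi> a" using onto[OF m b(1)] by blast
   obtain c where c: "c \<in> u" "c \<noteq> a" "\<mu> c = \<mu> q" using q(1) q' by metis
   have "\<phi> c \<in> v" "\<phi> c \<noteq> \<phi> a" using m a c by (auto simp: matched_def bij_betw_def inj_on_def)
   hence "2 * \<mu> (\<phi> a) < \<mu> (\<phi> c)" using b(2) a(2) by simp
   thus False using close[OF m v a(1)] close[OF m v c(1)] c(3) q(2)[OF a(1)] pos by linarith
  qed
  moreover have "0 < \<mu> a" if "a \<in> u" for a using q(2)[OF that] pos by simp
  ultimately show ?thesis using pos by (intro exI[of _ "\<mu> q / 4"]) auto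
 next
  case False
  hence lt: "\<mu> q < \<mu> a" if "a \<in> u - {q}" for a using q(2)[of a] that by fastforce
  obtain q1 where q1: "q1 \<in> u - {q}"
  proof -
   have "u \<noteq> {q}" using u(2) by auto
   thus thesis using that q(1) by blast
  qed
  have q_lt: "\<mu> q < 1" using lt[OF q1] \<mu>_bounds[of q1] q1 u(3) by force
  have fin: "finite (u - {q})" "u - {q} \<noteq> {}" using u(1) q1 by auto
  define gap where "gap k = Min ((\<lambda>a. \<mu> a - k * \<mu> q) ` (u - {q}))" for k
  have gap: "gap k \<le> \<mu> a - k * \<mu> q" if "a \<in> u - {q}" for k a using fin that by (auto simp: gap_def)
  have gap_pos: "0 < gap k" if "\<And>a. a \<in> u - {q} ==> k * \<mu> q < \<mu> a" for k
   using fin that by (auto simp: gap_def)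
  have near: "closest \<mu> v = \<phi> q" if m: "matched d \<rho> u \<phi> v" and v: "v \<subseteq> topspace T" and \<rho>: "2 * \<rho> \<le> gap 1" for \<rho> \<phi> v
  proof (rule closest_eq)
   show "\<phi> q \<in> v" using m q(1) by (auto simp: matched_def bij_betw_def)
   fix b assume b: "b \<in> v" "b \<noteq> \<phi> q"
   then obtain a where a: "a \<in> u" "b = \<phi> a" using onto[OF m] by blast
   hence "a \<in> u - {q}" using b by auto
   thus "\<mu> (\<phi> q) < \<mu> b" using close[OF m v a(1)] close[OF m v q(1)] gap[of a 1] \<rho> a(2) by simp
  qed
  have others: "\<forall>a\<in>u - {q}. 0 < \<mu> a"
  proof
   fix a assume a: "a \<in> u - {q}"
   have "0 \<le> \<mu> q" using \<mu>_bounds[of q] q(1) u(3) by auto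
   thus "0 < \<mu> a" using lt[OF a] by linarith
  qed
  show ?thesis
  proof (cases "\<forall>a\<in>u - {q}. 2 * \<mu> q < \<mu> a")
   case True
   define \<rho> where "\<rho> = min (gap 1) (gap 2) / 4"
   have \<rho>: "0 < \<rho>" "2 * \<rho> \<le> gap 1" "4 * \<rho> \<le> gap 2" using gap_pos[of 1] gap_pos[of 2] True lt by (auto simp: \<rho>_def)
   have "occupied \<mu> v" if m: "matched d \<rho> u \<phi> v" and v: "v \<subseteq> topspace T" for \<phi> v
    unfolding occupied_def
   proof (intro bexI ballI)
    show "\<phi> q \<in> v" using m q(1) by (auto simp: matched_def bij_betw_def)
    fix b assume b: "b \<in> v - {\<phi> q}"
    then obtain a where a: "a \<in> u" "b = \<phi> a" using onto[OF m] by blast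
    hence "a \<in> u - {q}" using b by auto
    thus "2 * \<mu> (\<phi> q) < \<mu> b"
     unfolding a(2) using close[OF m v a(1)] close[OF m v q(1)] gap[of a 2] \<rho> by linarith
   qed
   hence "\<forall>\<phi> v. matched d \<rho> u \<phi> v --> v \<subseteq> topspace T --> occupied \<mu> v" by blast
   moreover have "\<forall>\<phi> v. matched d \<rho> u \<phi> v --> v \<subseteq> topspace T --> closest \<mu> v = \<phi> q" using near \<rho>(2) by blast
   ultimately show ?thesis using \<rho>(1) q(1) q_lt others by blast
  next
   case notocc: False
   have "0 < \<mu> q"
   proof (rule ccontr)
    assume "\<not> 0 < \<mu> q"
    thus False using notocc lt \<mu>_bounds[of q] q(1) u(3) by force
   qed
   then obtain \<rho>0 where \<rho>0: "\<rho>0 > 0" "\<And>b. b \<in> topspace T ==> d q b < \<rho>0 ==> \<xi> b = \<xi> q"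
    using \<xi>_local[of q] q_lt q(1) u(3) by blast
   define \<rho> where "\<rho> = min \<rho>0 (gap 1 / 2)"
   have \<rho>: "0 < \<rho>" "2 * \<rho> \<le> gap 1" "\<rho> \<le> \<rho>0" using gap_pos[of 1] lt \<rho>0 by (auto simp: \<rho>_def)
   have "\<forall>b\<in>topspace T. d q b < \<rho> --> \<xi> b = \<xi> q" using \<rho>0(2) \<rho>(3) by force
   moreover have "\<forall>\<phi> v. matched d \<rho> u \<phi> v --> v \<subseteq> topspace T --> closest \<mu> v = \<phi> q" using near \<rho>(2) by blast
   ultimately show ?thesis using \<rho>(1) q(1) q_lt others \<open>0 < \<mu> q\<close> by blast
  qed
 qed
qed

lemma vertex_is_cocycle:
 assumes n: "n \<ge> 2"
 shows "cocycle W (unord_conf T n) (vertex_cocycle W \<mu> \<xi>)"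
proof
 have pot: "vertex_pot W \<mu> \<xi> u \<in> carrier W" if "u \<in> topspace (unord_conf T n)" for u
 proof -
  have "u \<noteq> {}" "finite u" "u \<subseteq> topspace T" using that n by (auto simp: topspace_unord_conf)
  hence "closest \<mu> u \<in> topspace T" using closest[of u \<mu>] by blast
  thus ?thesis using \<xi>_closed by (simp add: vertex_pot_def)
 qed
 show "vertex_cocycle W \<mu> \<xi> a b \<in> carrier W" if "a \<in> topspace (unord_conf T n)" "b \<in> topspace (unord_conf T n)" for a b
  using pot[OF that(1)] pot[OF that(2)] by (simp add: vertex_cocycle_def)
 fix u assume ut: "u \<in> topspace (unord_conf T n)"
 hence u: "finite u" "card u = n" "u \<subseteq> topspace T" by (auto simp: topspace_unord_conf)
 obtain \<rho> where \<rho>: "\<rho> > 0" "(\<forall>\<phi> v. matched d \<rho> u \<phi> v --> v \<subseteq> topspace T --> \<not> occupied \<mu> v) \<or>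
  (\<exists>q\<in>u. (\<forall>\<phi> v. matched d \<rho> u \<phi> v --> v \<subseteq> topspace T --> closest \<mu> v = \<phi> q) \<and>
   ((\<forall>\<phi> v. matched d \<rho> u \<phi> v --> v \<subseteq> topspace T --> occupied \<mu> v) \<or> (\<forall>b\<in>topspace T. d q b < \<rho> --> \<xi> b = \<xi> q)))"
  using local_chart[OF u(1) _ u(3)] u(2) n by blast
 let ?O = "{w \<in> topspace (unord_conf T n). \<exists>\<phi>. matched d \<rho> u \<phi> w}"
 let ?g = "vertex_cocycle W \<mu> \<xi>" and ?p = "vertex_pot W \<mu> \<xi>"
 have sub: "v \<subseteq> topspace T" if "v \<in> ?O" for v using that by (auto simp: topspace_unord_conf)
 \<comment> \<open>Near u the cocycle depends on the two statuses alone, through a constant c: the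
   label of the nearest token, or 1 if the status cannot change.\<close>
 have "\<exists>c\<in>carrier W. \<forall>v\<in>?O. \<forall>w\<in>?O. ?g v w = (if occupied \<mu> v = occupied \<mu> w then \<one> else if occupied \<mu> w then inv c else c)"
  using \<rho>(2)
 proof (elim disjE bexE conjE)
  assume "\<forall>\<phi> v. matched d \<rho> u \<phi> v --> v \<subseteq> topspace T --> \<not> occupied \<mu> v"
  hence "\<not> occupied \<mu> v" if "v \<in> ?O" for v using that sub by blast
  thus ?thesis by (intro bexI[of _ "\<one>"]) (auto simp: vertex_cocycle_def)
 next
  assume "\<forall>\<phi> v. matched d \<rho> u \<phi> v --> v \<subseteq> topspace T --> occupied \<mu> v"
  hence "occupied \<mu> v" if "v \<in> ?O" for v using that sub by blast
  thus ?thesis by (intro bexI[of _ "\<one>"]) (auto simp: vertex_cocycle_def)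
 next
  fix q assume q: "q \<in> u" and near: "\<forall>\<phi> v. matched d \<rho> u \<phi> v --> v \<subseteq> topspace T --> closest \<mu> v = \<phi> q"
   and loc: "\<forall>b\<in>topspace T. d q b < \<rho> --> \<xi> b = \<xi> q"
  have c: "\<xi> q \<in> carrier W" using q u(3) \<xi>_closed by blast
  have p: "?p v = (if occupied \<mu> v then \<one> else \<xi> q)" if v: "v \<in> ?O" for v
  proof -
   obtain \<phi> where m: "matched d \<rho> u \<phi> v" using v by blast
   have "\<phi> q \<in> v" "d q (\<phi> q) < \<rho>" using m q by (auto simp: matched_def bij_betw_def)
   hence "\<xi> (closest \<mu> v) = \<xi> q" using near[rule_format, OF m sub[OF v]] loc sub[OF v] by auto
   thus ?thesis by (simp add: vertex_pot_def)
  qed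
  show ?thesis using c p by (intro bexI[of _ "\<xi> q"] ballI) (auto simp: vertex_cocycle_def)
 qed
 then obtain c where c: "c \<in> carrier W" "\<And>v w. v \<in> ?O ==> w \<in> ?O ==>
   ?g v w = (if occupied \<mu> v = occupied \<mu> w then \<one> else if occupied \<mu> w then inv c else c)" by blast
 have "?g v w \<otimes> ?g w z = ?g v z" if "v \<in> ?O" "w \<in> ?O" "z \<in> ?O" for v w z
  unfolding c(2)[OF that(1,2)] c(2)[OF that(2,3)] c(2)[OF that(1,3)] using c(1)
  by (cases "occupied \<mu> v"; cases "occupied \<mu> w"; cases "occupied \<mu> z") simp_all
 thus "\<exists>B. openin (unord_conf T n) B \<and> u \<in> B \<and> (\<forall>a\<in>B. \<forall>b\<in>B. \<forall>c\<in>B. ?g a b \<otimes> ?g b c = ?g a c)"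
  using openin_matched[OF u \<rho>(1)] by (intro exI[of _ ?O]) blast
qed

lemma not_occupied:
 assumes "finite u" "card u \<ge> 2" "u \<subseteq> topspace T" "\<And>b. b \<in> u ==> 1/2 \<le> \<mu> b"
 shows "\<not> occupied \<mu> u"
proof
 assume "occupied \<mu> u"
 then obtain q where q: "q \<in> u" "\<And>q'. q' \<in> u - {q} ==> 2 * \<mu> q < \<mu> q'" by (auto simp: occupied_def)
 have "u \<noteq> {q}" using assms(2) by auto
 then obtain b where b: "b \<in> u - {q}" using q(1) by blast
 thus False using q(2)[OF b] assms(4)[OF q(1)] \<mu>_bounds[of b] assms(3) by force
qed

abbreviation "vhol n \<equiv> cocycle.hol W (unord_conf T n) (vertex_cocycle W \<mu> \<xi>)"

lemma hol_constant_status: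
 assumes n: "n \<ge> 2" and p: "pathin (unord_conf T n) p"
  and occ: "\<And>t. t \<in> {0..1} ==> occupied \<mu> (p t) = occupied \<mu> (p 0)"
 shows "vhol n p = \<one>"
proof -
 interpret c: cocycle W "unord_conf T n" "vertex_cocycle W \<mu> \<xi>" by (rule vertex_is_cocycle[OF n])
 have "c.hol p = inv \<one> \<otimes> \<one>"
 proof (rule c.hol_local[OF p, of "\<lambda>_. \<one>"])
  fix t :: real
  have "vertex_cocycle W \<mu> \<xi> (p s) (p s') = inv \<one> \<otimes> \<one>" if "s \<in> {0..1}" "s' \<in> {0..1}" for s s'
   using occ[OF that(1)] occ[OF that(2)] by (simp add: vertex_cocycle_def)
  thus "\<exists>e>0. \<forall>s\<in>{0..1}. \<forall>s'\<in>{0..1}. \<bar>s - t\<bar> < e --> \<bar>s' - t\<bar> < e -->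
   vertex_cocycle W \<mu> \<xi> (p s) (p s') = inv \<one> \<otimes> \<one>" by (intro exI[of _ 1]) simp
 qed simp
 thus ?thesis by simp
qed

text \<open>The primitive \<theta> is 1 while the moving token occupies the vertex, \<alpha> before
  and \<beta> after. Since n >= 3 there are at least two other tokens, at distances between 1/2 and
  1, so none of them can occupy the vertex.\<close>

lemma hol_passage:
 assumes n: "n \<ge> 3" and u: "finite u" "card u = n" "u \<subseteq> topspace T" "a \<in> u"
  and \<gamma>: "pathin T \<gamma>" "\<gamma> 0 = a" and free: "\<And>t. t \<in> {0..1} ==> \<gamma> t \<notin> u - {a}"
  and far: "\<And>b. b \<in> u - {a} ==> 1/2 \<le> \<mu> b" and ends: "1/2 \<le> \<mu> (\<gamma> 0)" "1/2 \<le> \<mu> (\<gamma> 1)" and mid: "\<mu> (\<gamma> (1/2)) = 0"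
  and left: "\<And>t. 0 \<le> t ==> t < 1/2 ==> \<xi> (\<gamma> t) = \<alpha>" and right: "\<And>t. 1/2 < t ==> t \<le> 1 ==> \<xi> (\<gamma> t) = \<beta>"
 shows "vhol n (track (slide a \<gamma>) u) = inv \<alpha> \<otimes> \<beta>"
proof -
 have n2: "n \<ge> 2" using n by simp
 interpret c: cocycle W "unord_conf T n" "vertex_cocycle W \<mu> \<xi>" by (rule vertex_is_cocycle[OF n2])
 let ?p = "track (slide a \<gamma>) u" and ?g = "vertex_cocycle W \<mu> \<xi>"
 define R where "R = u - {a}"
 have R: "finite R" "card R \<ge> 2" "R \<subseteq> topspace T" using u n by (auto simp: R_def)
 have \<gamma>T: "\<gamma> t \<in> topspace T" if "t \<in> {0..1}" for t using pathin_in[OF \<gamma>(1)] that by simp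
 have pt: "?p t = insert (\<gamma> t) R" for t
  using u(4) unfolding track_def slide_at R_def by (rule image_update)
 have \<gamma>R: "\<gamma> t \<notin> R" if "t \<in> {0..1}" for t using free[OF that] by (simp add: R_def)
 have "moves T u UNIV (slide a \<gamma>)"
  using free \<gamma> u by (intro moves_slide) auto
 hence p: "pathin (unord_conf T n) ?p" using u by (intro pathin_track) auto
 define D where "D = Min (\<mu> ` R)"
 have Rne: "R \<noteq> {}" using R(2) by auto
 have D: "D \<in> \<mu> ` R" "\<And>b. b \<in> R ==> D \<le> \<mu> b" using R(1) Rne by (auto simp: D_def)
 have D1: "1/2 \<le> D" "D \<le> 1" using D(1) far \<mu>_bounds R(3) by (force simp: R_def)+
 have occ: "occupied \<mu> (?p t) \<longleftrightarrow> 2 * \<mu> (\<gamma> t) < D" if t: "t \<in> {0..1}" for t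
 proof
  assume "occupied \<mu> (?p t)"
  then obtain q where q: "q \<in> insert (\<gamma> t) R" "\<And>q'. q' \<in> insert (\<gamma> t) R - {q} ==> 2 * \<mu> q < \<mu> q'"
   unfolding pt occupied_def by blast
  have "q \<notin> R"
  proof
   assume qR: "q \<in> R"
   have "R \<noteq> {q}" using R(2) by auto
   then obtain b where b: "b \<in> R" "b \<noteq> q" using qR by blast
   hence "2 * \<mu> q < \<mu> b" using q(2) by simp
   thus False using far[of q] qR \<mu>_bounds[of b] b R(3) by (force simp: R_def)
  qed
  hence qe: "q = \<gamma> t" using q(1) by simp
  obtain b where b: "b \<in> R" "D = \<mu> b" using D(1) by blast
  hence "b \<in> insert (\<gamma> t) R - {q}" using \<open>q \<notin> R\<close> by auto
  thus "2 * \<mu> (\<gamma> t) < D" using q(2) b qe by simp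
 next
  assume lt: "2 * \<mu> (\<gamma> t) < D"
  have "\<forall>q'\<in>insert (\<gamma> t) R - {\<gamma> t}. 2 * \<mu> (\<gamma> t) < \<mu> q'"
  proof
   fix q' assume "q' \<in> insert (\<gamma> t) R - {\<gamma> t}"
   thus "2 * \<mu> (\<gamma> t) < \<mu> q'" using D(2)[of q'] lt by auto
  qed
  thus "occupied \<mu> (?p t)" unfolding pt occupied_def by blast
 qed
 have cl: "closest \<mu> (?p t) = \<gamma> t" if t: "t \<in> {0..1}" "\<mu> (\<gamma> t) < D" for t
  unfolding pt using that D(2) by (intro closest_eq) force+
 define \<theta> where "\<theta> t = (if 2 * \<mu> (\<gamma> t) < D then \<one> else if t < 1/2 then \<alpha> else \<beta>)" for t
 have \<alpha>\<beta>: "\<alpha> \<in> carrier W" "\<beta> \<in> carrier W"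
  using left[of 0] right[of 1] \<xi>_closed[OF \<gamma>T, of 0] \<xi>_closed[OF \<gamma>T, of 1] by auto
 have "c.hol ?p = inv \<theta> 0 \<otimes> \<theta> 1"
 proof (rule c.hol_local[OF p, of \<theta>])
  show "\<theta> t \<in> carrier W" for t using \<alpha>\<beta> by (simp add: \<theta>_def)
  fix t :: real assume t: "t \<in> {0..1}"
  have close: "\<exists>e>0. \<forall>s\<in>{0..1}. \<bar>s - t\<bar> < e --> \<bar>\<mu> (\<gamma> s) - \<mu> (\<gamma> t)\<bar> < r" if r: "r > 0" for r
  proof -
   obtain e where e: "e > 0" "\<And>s b. s \<in> {0..1} ==> \<bar>s - t\<bar> < e ==> b \<in> {a} ==> d (\<gamma> t) (\<gamma> s) < r"
    by (rule path_close[of "{a}" "\<lambda>_. \<gamma>" t r]) (use \<gamma> t r in auto)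
   have "\<bar>\<mu> (\<gamma> s) - \<mu> (\<gamma> t)\<bar> < r" if s: "s \<in> {0..1}" "\<bar>s - t\<bar> < e" for s
    using e(2)[OF s] lipschitz[OF \<gamma>T[OF t] \<gamma>T[OF s(1)]] by simp
   thus ?thesis using e(1) by blast
  qed
  show "\<exists>e>0. \<forall>s\<in>{0..1}. \<forall>s'\<in>{0..1}. \<bar>s - t\<bar> < e --> \<bar>s' - t\<bar> < e --> ?g (?p s) (?p s') = inv \<theta> s \<otimes> \<theta> s'"
  proof (cases "2 * \<mu> (\<gamma> t) < D")
   case True
   then obtain e where e: "e > 0" "\<And>s. s \<in> {0..1} ==> \<bar>s - t\<bar> < e ==> \<bar>\<mu> (\<gamma> s) - \<mu> (\<gamma> t)\<bar> < (D - 2 * \<mu> (\<gamma> t)) / 2"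
    using close[of "(D - 2 * \<mu> (\<gamma> t)) / 2"] by auto
   have lt: "2 * \<mu> (\<gamma> s) < D" if "s \<in> {0..1}" "\<bar>s - t\<bar> < e" for s using e(2)[OF that] by argo
   have "?g (?p s) (?p s') = inv \<theta> s \<otimes> \<theta> s'"
    if s: "s \<in> {0..1}" "s' \<in> {0..1}" "\<bar>s - t\<bar> < e" "\<bar>s' - t\<bar> < e" for s s'
    using lt[OF s(1,3)] lt[OF s(2,4)] occ[OF s(1)] occ[OF s(2)] by (simp add: vertex_cocycle_def \<theta>_def)
   thus ?thesis using e(1) by blast
  next
   case False
   have t2: "t \<noteq> 1/2"
   proof
    assume t2: "t = 1/2"
    show False using False mid D1 unfolding t2 by linarith
   qed
   \<comment> \<open>At the threshold the radius D / 2 keeps the moving token nearest, so its label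
     is the potential; above the threshold the radius keeps the configuration unoccupied.\<close>
   define r where "r = (if 2 * \<mu> (\<gamma> t) = D then D / 2 else (2 * \<mu> (\<gamma> t) - D) / 2)"
   have "r > 0" using False D1 by (auto simp: r_def)
   then obtain e where e: "e > 0" "\<And>s. s \<in> {0..1} ==> \<bar>s - t\<bar> < e ==> \<bar>\<mu> (\<gamma> s) - \<mu> (\<gamma> t)\<bar> < r"
    using close by blast
   define e' where "e' = min e \<bar>t - 1/2\<bar>"
   have "?g (?p s) (?p s') = inv \<theta> s \<otimes> \<theta> s'"
    if s: "s \<in> {0..1}" "s' \<in> {0..1}" "\<bar>s - t\<bar> < e'" "\<bar>s' - t\<bar> < e'" for s s'
   proof -
    have se: "\<bar>s - t\<bar> < e" "\<bar>s' - t\<bar> < e" "s < 1/2 \<longleftrightarrow> t < 1/2" "s' < 1/2 \<longleftrightarrow> t < 1/2" "s \<noteq> 1/2" "s' \<noteq> 1/2"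
     using s t2 by (auto simp: e'_def)
    show ?thesis
    proof (cases "2 * \<mu> (\<gamma> t) = D")
     case True
     hence "r = D / 2" by (simp add: r_def)
     hence lt: "\<mu> (\<gamma> s) < D" "\<mu> (\<gamma> s') < D" using e(2)[OF s(1) se(1)] e(2)[OF s(2) se(2)] True by linarith+
     have "vertex_pot W \<mu> \<xi> (?p s) = \<theta> s" "vertex_pot W \<mu> \<xi> (?p s') = \<theta> s'"
      unfolding vertex_pot_def \<theta>_def cl[OF s(1) lt(1)] cl[OF s(2) lt(2)]
      using occ[OF s(1)] occ[OF s(2)] left[of s] right[of s] left[of s'] right[of s'] se s(1,2) by auto
     thus ?thesis using occ[OF s(1)] occ[OF s(2)] se \<alpha>\<beta> by (simp add: vertex_cocycle_def \<theta>_def)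
    next
     case neq: False
     hence "r = \<mu> (\<gamma> t) - D / 2" by (simp add: r_def)
     hence "\<not> 2 * \<mu> (\<gamma> s) < D" "\<not> 2 * \<mu> (\<gamma> s') < D"
      using e(2)[OF s(1) se(1)] e(2)[OF s(2) se(2)] by linarith+
     thus ?thesis using occ[OF s(1)] occ[OF s(2)] se \<alpha>\<beta> by (simp add: vertex_cocycle_def \<theta>_def)
    qed
   qed
   moreover have "e' > 0" using e(1) t2 by (simp add: e'_def)
   ultimately show ?thesis by blast
  qed
 qed
 moreover have "\<theta> 0 = \<alpha>" "\<theta> 1 = \<beta>" using ends D1 by (auto simp: \<theta>_def)
 ultimately show ?thesis by simp
qed

end

section \<open>The second case: an arc without branch points\<close>

section \<open>Two vertices joined by a free arc\<close>

lemma fst_dihedral_mult: "fst (a \<otimes>\<^bsub>dihedral\<^esub> b) = fst a * fst b"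
 by (simp add: dihedral_def case_prod_unfold)

lemma fst_dihedral_hprod: "fst (hprod dihedral N f) = (\<Prod>i<N. fst (f i))"
 by (induction N) (simp_all add: fst_dihedral_mult mult.commute)

lemma dihedral_sign: "a \<in> carrier dihedral ==> fst a * fst a = 1"
 by auto

lemma fst_dihedral_inv:
 assumes "a \<in> carrier dihedral"
 shows "fst (inv\<^bsub>dihedral\<^esub> a) = fst a"
proof -
 interpret D: group dihedral by (rule group_dihedral)
 have "fst (inv\<^bsub>dihedral\<^esub> a) * fst a = 1" using D.l_inv[OF assms] by (simp add: fst_dihedral_mult[symmetric] del: dihedral_simps(1))
 hence "fst (inv\<^bsub>dihedral\<^esub> a) * (fst a * fst a) = fst a" by (simp add: mult.assoc[symmetric])
 thus ?thesis using dihedral_sign[OF assms] by simp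
qed

text \<open>A token occupying the vertex counts as 1 because its side is not recorded.\<close>

definition chart_sign :: "('a => real) => ('a => int) => 'a set => 'a => int" where
 "chart_sign \<mu> s v b = (if occupied \<mu> v \<and> b = closest \<mu> v then 1 else s b)"

lemma vertex_cocycle_sign:
 assumes "\<xi> (closest \<mu> v) \<in> carrier dihedral" "\<xi> (closest \<mu> w) \<in> carrier dihedral"
  and "occupied \<mu> v = occupied \<mu> w \<or> fst (\<xi> (closest \<mu> v)) = fst (\<xi> (closest \<mu> w))"
  and "fst (\<xi> (closest \<mu> v)) = fst (\<xi> (closest \<mu> w)) \<or> occupied \<mu> v \<and> occupied \<mu> w"
 shows "fst (vertex_cocycle dihedral \<mu> \<xi> v w) =
  chart_sign \<mu> (\<lambda>b. fst (\<xi> b)) v (closest \<mu> v) * chart_sign \<mu> (\<lambda>b. fst (\<xi> b)) w (closest \<mu> w)"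
proof -
 interpret D: group dihedral by (rule group_dihedral)
 have i1: "inv\<^bsub>dihedral\<^esub> (1, 0) = (1, 0)" using D.inv_one by simp
 note S = dihedral_sign[OF assms(1)] dihedral_sign[OF assms(2)]
 show ?thesis
 proof (cases "occupied \<mu> v"; cases "occupied \<mu> w")
  assume "\<not> occupied \<mu> v" "\<not> occupied \<mu> w"
  thus ?thesis using assms(4) S by (simp add: vertex_cocycle_def chart_sign_def del: dihedral_simps(1))
 qed (use assms(1,2) in \<open>auto simp: vertex_cocycle_def vertex_pot_def chart_sign_def fst_dihedral_mult fst_dihedral_inv i1 simp del: dihedral_simps(1)\<close>)
qed

text \<open>Q is empty or consists of the nearest token; packing it into a set lets both
  alternatives of \<open>local_chart\<close> enter \<open>parity\<close> through one product
  formula.\<close>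

lemma (in metric_conf) local_sign:
 assumes c: "vertex_chart T d dihedral \<mu> \<xi>" and u: "finite u" "card u \<ge> 2" "u \<subseteq> topspace T"
  and s: "\<And>b. fst (\<xi> b) = s b"
 obtains \<rho> Q where "\<rho> > 0" "Q \<subseteq> u" "\<forall>a\<in>u - Q. 0 < \<mu> a" "\<forall>a\<in>Q. \<mu> a < 1"
  "\<forall>\<phi> v. matched d \<rho> u \<phi> v --> v \<subseteq> topspace T --> (\<forall>a\<in>u - Q. chart_sign \<mu> s v (\<phi> a) = s (\<phi> a))"
  "\<forall>\<phi> v \<tau> w. matched d \<rho> u \<phi> v --> v \<subseteq> topspace T --> matched d \<rho> u \<tau> w --> w \<subseteq> topspace T -->
   fst (vertex_cocycle dihedral \<mu> \<xi> v w) = (\<Prod>a\<in>Q. chart_sign \<mu> s v (\<phi> a) * chart_sign \<mu> s w (\<tau> a))"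
proof -
 interpret c: vertex_chart T d dihedral \<mu> \<xi> by (rule c)
 have s': "(\<lambda>b. fst (\<xi> b)) = s" using s by auto
 obtain \<rho> where \<rho>: "\<rho> > 0" and cases: "((\<forall>\<phi> v. matched d \<rho> u \<phi> v --> v \<subseteq> topspace T --> \<not> occupied \<mu> v) \<and> (\<forall>a\<in>u. 0 < \<mu> a)) \<or>
  (\<exists>q\<in>u. \<mu> q < 1 \<and> (\<forall>a\<in>u - {q}. 0 < \<mu> a) \<and>
   (\<forall>\<phi> v. matched d \<rho> u \<phi> v --> v \<subseteq> topspace T --> closest \<mu> v = \<phi> q) \<and>
   ((\<forall>\<phi> v. matched d \<rho> u \<phi> v --> v \<subseteq> topspace T --> occupied \<mu> v) \<or>
    (0 < \<mu> q \<and> (\<forall>b\<in>topspace T. d q b < \<rho> --> \<xi> b = \<xi> q))))"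
  using c.local_chart[OF u] by blast
 show thesis
 proof (cases "\<forall>a\<in>u. 0 < \<mu> a \<and> (\<forall>\<phi> v. matched d \<rho> u \<phi> v --> v \<subseteq> topspace T --> \<not> occupied \<mu> v)")
  case True
  moreover have "u \<noteq> {}" using u(2) by auto
  ultimately have no: "\<forall>\<phi> v. matched d \<rho> u \<phi> v --> v \<subseteq> topspace T --> \<not> occupied \<mu> v" and pos: "\<forall>a\<in>u. 0 < \<mu> a" by blast+
  have 1: "chart_sign \<mu> s v (\<phi> a) = s (\<phi> a)" if "matched d \<rho> u \<phi> v" "v \<subseteq> topspace T" for \<phi> v a
   using no[rule_format, OF that] by (simp add: chart_sign_def)
  have 2: "fst (vertex_cocycle dihedral \<mu> \<xi> v w) = 1"
   if "matched d \<rho> u \<phi> v" "v \<subseteq> topspace T" "matched d \<rho> u \<tau> w" "w \<subseteq> topspace T" for \<phi> v \<tau> w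
   using no[rule_format, OF that(1,2)] no[rule_format, OF that(3,4)] by (simp add: vertex_cocycle_def)
  show thesis by (rule that[of \<rho> "{}"]) (use \<rho> pos 1 2 in \<open>auto simp del: dihedral_simps(1)\<close>)
 next
  case False
  with cases obtain q where q: "q \<in> u" "\<mu> q < 1" "\<forall>a\<in>u - {q}. 0 < \<mu> a"
   and near: "\<forall>\<phi> v. matched d \<rho> u \<phi> v --> v \<subseteq> topspace T --> closest \<mu> v = \<phi> q"
   and alt: "(\<forall>\<phi> v. matched d \<rho> u \<phi> v --> v \<subseteq> topspace T --> occupied \<mu> v) \<or>
    (0 < \<mu> q \<and> (\<forall>b\<in>topspace T. d q b < \<rho> --> \<xi> b = \<xi> q))" by blast
  have 1: "chart_sign \<mu> s v (\<phi> a) = s (\<phi> a)" if m: "matched d \<rho> u \<phi> v" "v \<subseteq> topspace T" and a: "a \<in> u - {q}" for \<phi> v a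
  proof -
   have "\<phi> a \<noteq> \<phi> q" using m(1) a q(1) by (auto simp: matched_def bij_betw_def inj_on_def)
   thus ?thesis using near[rule_format, OF m] by (simp add: chart_sign_def)
  qed
  have 2: "fst (vertex_cocycle dihedral \<mu> \<xi> v w) =
   chart_sign \<mu> s v (\<phi> q) * chart_sign \<mu> s w (\<tau> q)"
   if m: "matched d \<rho> u \<phi> v" "v \<subseteq> topspace T" "matched d \<rho> u \<tau> w" "w \<subseteq> topspace T" for \<phi> v \<tau> w
  proof -
   have n: "closest \<mu> v = \<phi> q" "closest \<mu> w = \<tau> q" using near[rule_format, OF m(1,2)] near[rule_format, OF m(3,4)] by auto
   have t: "\<phi> q \<in> topspace T" "\<tau> q \<in> topspace T" "d q (\<phi> q) < \<rho>" "d q (\<tau> q) < \<rho>"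
    using m q(1) by (auto simp: matched_def bij_betw_def)
   have "(occupied \<mu> v \<and> occupied \<mu> w) \<or> \<xi> (\<phi> q) = \<xi> (\<tau> q)" using alt
   proof
    assume "\<forall>\<phi> v. matched d \<rho> u \<phi> v --> v \<subseteq> topspace T --> occupied \<mu> v"
    thus ?thesis using m by blast
   next
    assume "0 < \<mu> q \<and> (\<forall>b\<in>topspace T. d q b < \<rho> --> \<xi> b = \<xi> q)"
    thus ?thesis using t by auto
   qed
   hence "(occupied \<mu> v = occupied \<mu> w \<or> fst (\<xi> (\<phi> q)) = fst (\<xi> (\<tau> q))) \<and>
     (fst (\<xi> (\<phi> q)) = fst (\<xi> (\<tau> q)) \<or> occupied \<mu> v \<and> occupied \<mu> w)" by auto
   thus ?thesis
    using vertex_cocycle_sign[of \<xi> \<mu> v w] c.\<xi>_closed[OF t(1)] c.\<xi>_closed[OF t(2)] unfolding n s' by blast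
  qed
  show thesis by (rule that[of \<rho> "{q}"]) (use \<rho> q 1 2 in \<open>auto simp del: dihedral_simps(1)\<close>)
 qed
qed

text \<open>Give each token in U the sign - 1, except that a token occupying one of the two vertices
  counts as 1, and let \<open>h\<close> be the product over a configuration. The product of the two
  sign cocycles is locally the coboundary of \<open>h\<close>, hence 1 on closed paths: membership
  in U changes only at the two vertices, and by \<open>sep\<close> no token is near both.\<close>

lemma (in metric_conf) parity:
 assumes cx: "vertex_chart T d dihedral \<mu> \<xi>" and cy: "vertex_chart T d dihedral \<mu>' \<xi>'"
  and sep: "\<And>a. a \<in> topspace T ==> \<mu> a < 1 ==> \<mu>' a = 1"
  and U: "\<And>a. a \<in> topspace T ==> 0 < \<mu> a ==> 0 < \<mu>' a ==> \<exists>\<rho>>0. \<forall>b\<in>topspace T. d a b < \<rho> --> (b \<in> U \<longleftrightarrow> a \<in> U)"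
  and sgn: "\<And>a. fst (\<xi> a) = (if a \<in> U then - 1 else 1)" "\<And>a. fst (\<xi>' a) = (if a \<in> U then - 1 else 1)"
  and n: "n \<ge> 2" and p: "pathin (unord_conf T n) p" "p 0 = p 1"
 shows "fst (cocycle.hol dihedral (unord_conf T n) (vertex_cocycle dihedral \<mu> \<xi>) p) =
  fst (cocycle.hol dihedral (unord_conf T n) (vertex_cocycle dihedral \<mu>' \<xi>') p)"
proof -
 interpret X: vertex_chart T d dihedral \<mu> \<xi> by (rule cx)
 interpret Y: vertex_chart T d dihedral \<mu>' \<xi>' by (rule cy)
 let ?T = "unord_conf T n"
 let ?gx = "vertex_cocycle dihedral \<mu> \<xi>" and ?gy = "vertex_cocycle dihedral \<mu>' \<xi>'"
 interpret gx: cocycle dihedral ?T ?gx by (rule X.vertex_is_cocycle[OF n])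
 interpret gy: cocycle dihedral ?T ?gy by (rule Y.vertex_is_cocycle[OF n])
 define s where "s b = (if b \<in> U then - 1 else 1 :: int)" for b
 have s2: "s b * s b = 1" for b by (simp add: s_def)
 have sx: "fst (\<xi> b) = s b" "fst (\<xi>' b) = s b" for b using sgn by (auto simp: s_def)
 define c where "c v b = (if (occupied \<mu> v \<and> b = closest \<mu> v) \<or> (occupied \<mu>' v \<and> b = closest \<mu>' v) then 1 else s b)" for v b
 define h where "h v = (\<Prod>b\<in>v. c v b)" for v
 have h2: "h v * h v = 1" for v
 proof -
  have "h v * h v = (\<Prod>b\<in>v. c v b * c v b)" by (simp add: h_def prod.distrib)
  also have "\<dots> = 1" by (intro prod.neutral) (auto simp: c_def s_def)
  finally show ?thesis .
 qed
 define P where "P B \<longleftrightarrow> (\<forall>v\<in>B. \<forall>w\<in>B. fst (?gx v w) * fst (?gy v w) = h v * h w)" for B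
 have "\<exists>B. openin ?T B \<and> u \<in> B \<and> P B" if ut: "u \<in> topspace ?T" for u
 proof -
  have u: "finite u" "card u = n" "u \<subseteq> topspace T" using ut by (auto simp: topspace_unord_conf)
  have u2: "card u \<ge> 2" using u(2) n by simp
  obtain \<rho>1 Q1 where 1: "\<rho>1 > 0" "Q1 \<subseteq> u" "\<forall>a\<in>u - Q1. 0 < \<mu> a" "\<forall>a\<in>Q1. \<mu> a < 1"
   "\<forall>\<phi> v. matched d \<rho>1 u \<phi> v --> v \<subseteq> topspace T --> (\<forall>a\<in>u - Q1. chart_sign \<mu> s v (\<phi> a) = s (\<phi> a))"
   "\<forall>\<phi> v \<tau> w. matched d \<rho>1 u \<phi> v --> v \<subseteq> topspace T --> matched d \<rho>1 u \<tau> w --> w \<subseteq> topspace T -->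
   fst (?gx v w) = (\<Prod>a\<in>Q1. chart_sign \<mu> s v (\<phi> a) * chart_sign \<mu> s w (\<tau> a))"
   by (rule local_sign[OF cx u(1) u2 u(3) sx(1)])
  obtain \<rho>2 Q2 where 2: "\<rho>2 > 0" "Q2 \<subseteq> u" "\<forall>a\<in>u - Q2. 0 < \<mu>' a" "\<forall>a\<in>Q2. \<mu>' a < 1"
   "\<forall>\<phi> v. matched d \<rho>2 u \<phi> v --> v \<subseteq> topspace T --> (\<forall>a\<in>u - Q2. chart_sign \<mu>' s v (\<phi> a) = s (\<phi> a))"
   "\<forall>\<phi> v \<tau> w. matched d \<rho>2 u \<phi> v --> v \<subseteq> topspace T --> matched d \<rho>2 u \<tau> w --> w \<subseteq> topspace T -->
   fst (?gy v w) = (\<Prod>a\<in>Q2. chart_sign \<mu>' s v (\<phi> a) * chart_sign \<mu>' s w (\<tau> a))"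
   by (rule local_sign[OF cy u(1) u2 u(3) sx(2)])
  have Q: "Q1 \<inter> Q2 = {}"
  proof -
   have "a \<notin> Q2" if "a \<in> Q1" for a
   proof
    assume "a \<in> Q2"
    thus False using sep[of a] that 1(2,4) 2(4) u(3) by force
   qed
   thus ?thesis by blast
  qed
  have "\<forall>a\<in>u - Q1 - Q2. \<exists>\<rho>>0. \<forall>b\<in>topspace T. d a b < \<rho> --> (b \<in> U \<longleftrightarrow> a \<in> U)"
   using U 1(3) 2(3) u(3) by blast
  then obtain r where r: "\<And>a. a \<in> u - Q1 - Q2 ==> r a > 0 \<and> (\<forall>b\<in>topspace T. d a b < r a --> (b \<in> U \<longleftrightarrow> a \<in> U))"
   by metis
  define \<rho> where "\<rho> = Min (insert \<rho>1 (insert \<rho>2 (r ` (u - Q1 - Q2))))"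
  have fin: "finite (insert \<rho>1 (insert \<rho>2 (r ` (u - Q1 - Q2))))" using u(1) by simp
  have "0 < \<rho>" using fin 1(1) 2(1) r by (simp only: \<rho>_def Min_gr_iff insert_not_empty) auto
  moreover have "\<rho> \<le> \<rho>1" "\<rho> \<le> \<rho>2" unfolding \<rho>_def by (rule Min_le[OF fin], simp)+
  ultimately have \<rho>: "0 < \<rho>" "\<rho> \<le> \<rho>1" "\<rho> \<le> \<rho>2" by auto
  have \<rho>r: "\<rho> \<le> r a" if "a \<in> u - Q1 - Q2" for a unfolding \<rho>_def using that fin by (intro Min_le) auto
  let ?O = "{w \<in> topspace ?T. \<exists>\<phi>. matched d \<rho> u \<phi> w}"
  have "fst (?gx v w) * fst (?gy v w) = h v * h w" if v: "v \<in> ?O" and w: "w \<in> ?O" for v w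
  proof -
   obtain \<phi> where \<phi>: "matched d \<rho> u \<phi> v" using v by blast
   obtain \<tau> where \<tau>: "matched d \<rho> u \<tau> w" using w by blast
   have vt: "v \<subseteq> topspace T" and wt: "w \<subseteq> topspace T" using v w by (auto simp: topspace_unord_conf)
   note m1 = matched_mono[OF \<phi> \<rho>(2)] vt matched_mono[OF \<tau> \<rho>(2)] wt and m2 = matched_mono[OF \<phi> \<rho>(3)] vt matched_mono[OF \<tau> \<rho>(3)] wt
   have bij: "bij_betw \<phi> u v" "bij_betw \<tau> u w" using \<phi> \<tau> by (auto simp: matched_def)
   define F G where "F a = (if a \<in> Q1 then chart_sign \<mu> s v (\<phi> a) * chart_sign \<mu> s w (\<tau> a) else 1)"
    and "G a = (if a \<in> Q2 then chart_sign \<mu>' s v (\<phi> a) * chart_sign \<mu>' s w (\<tau> a) else 1)" for a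
   have FG: "fst (?gx v w) = prod F u" "fst (?gy v w) = prod G u"
   proof -
    have "prod F Q1 = prod F u" by (rule prod.mono_neutral_left) (use u(1) 1(2) in \<open>auto simp: F_def\<close>)
    moreover have "prod F Q1 = fst (?gx v w)" unfolding 1(6)[rule_format, OF m1] by (rule prod.cong) (simp_all add: F_def)
    ultimately show "fst (?gx v w) = prod F u" by simp
    have "prod G Q2 = prod G u" by (rule prod.mono_neutral_left) (use u(1) 2(2) in \<open>auto simp: G_def\<close>)
    moreover have "prod G Q2 = fst (?gy v w)" unfolding 2(6)[rule_format, OF m2] by (rule prod.cong) (simp_all add: G_def)
    ultimately show "fst (?gy v w) = prod G u" by simp
   qed
   have cx': "c z b = chart_sign \<mu> s z b" if "chart_sign \<mu>' s z b = s b" for z b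
    using that by (auto simp: c_def chart_sign_def)
   have cy': "c z b = chart_sign \<mu>' s z b" if "chart_sign \<mu> s z b = s b" for z b
    using that by (auto simp: c_def chart_sign_def)
   have "c v (\<phi> a) * c w (\<tau> a) = F a * G a" if a: "a \<in> u" for a
   proof -
    consider "a \<in> Q1" "a \<in> u - Q2" | "a \<in> Q2" "a \<in> u - Q1" | "a \<in> u - Q1 - Q2" using Q a by blast
    thus ?thesis
    proof cases
     case 1
     thus ?thesis
      using 2(5)[rule_format, OF m2(1,2)] 2(5)[rule_format, OF m2(3,4)] by (simp add: F_def G_def cx')
    next
     case 2
     thus ?thesis
      using 1(5)[rule_format, OF m1(1,2)] 1(5)[rule_format, OF m1(3,4)] by (simp add: F_def G_def cy')
    next
     case 3
     hence a3: "a \<in> u - Q1" "a \<in> u - Q2" "a \<notin> Q1" "a \<notin> Q2" by auto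
     have e: "chart_sign \<mu>' s v (\<phi> a) = s (\<phi> a)" "chart_sign \<mu>' s w (\<tau> a) = s (\<tau> a)"
      "chart_sign \<mu> s v (\<phi> a) = s (\<phi> a)" "chart_sign \<mu> s w (\<tau> a) = s (\<tau> a)"
      using 2(5)[rule_format, OF m2(1,2) a3(2)] 2(5)[rule_format, OF m2(3,4) a3(2)]
       1(5)[rule_format, OF m1(1,2) a3(1)] 1(5)[rule_format, OF m1(3,4) a3(1)] by auto
     have "\<phi> a \<in> topspace T" "d a (\<phi> a) < r a" "\<tau> a \<in> topspace T" "d a (\<tau> a) < r a"
      using bij_betwE[OF bij(1)] bij_betwE[OF bij(2)] a vt wt \<phi> \<tau> \<rho>r[OF 3] by (auto simp: matched_def intro: less_le_trans)
     hence "s (\<phi> a) = s a" "s (\<tau> a) = s a" using r[OF 3] by (simp_all add: s_def)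
     thus ?thesis using cx'[OF e(1)] cx'[OF e(2)] e a3 s2 by (simp add: F_def G_def)
    qed
   qed
   hence "prod F u * prod G u = (\<Prod>a\<in>u. c v (\<phi> a) * c w (\<tau> a))"
    unfolding prod.distrib[symmetric] by (intro prod.cong) simp_all
   also have "\<dots> = h v * h w"
    unfolding prod.distrib h_def prod.reindex_bij_betw[OF bij(1)] prod.reindex_bij_betw[OF bij(2)] ..
   finally show ?thesis using FG by simp
  qed
  hence "P ?O" unfolding P_def by blast
  thus ?thesis using openin_matched[OF u \<rho>(1)] by blast
 qed
 from path_mesh[OF p(1) this] obtain N0 where N0: "N0 \<ge> 1" "\<And>N. N \<ge> N0 ==> \<forall>i<N.
  \<exists>B. openin ?T B \<and> P B \<and> p ` {real i / real N..real (Suc i) / real N} \<subseteq> B" by blast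
 obtain N1 where N1: "\<And>N. N \<ge> N1 ==> gx.fine_mesh N p" using gx.ex_fine_mesh[OF p(1)] by blast
 obtain N2 where N2: "\<And>N. N \<ge> N2 ==> gy.fine_mesh N p" using gy.ex_fine_mesh[OF p(1)] by blast
 define N where "N = max N0 (max N1 N2)"
 have N: "N \<ge> 1" "N \<ge> N0" "N \<ge> N1" "N \<ge> N2" using N0(1) by (auto simp: N_def)
 let ?a = "\<lambda>i. p (real i / real N)"
 have "fst (gx.hol p) * fst (gy.hol p) = (\<Prod>i<N. fst (?gx (?a i) (?a (Suc i))) * fst (?gy (?a i) (?a (Suc i))))"
  unfolding gx.hol_eq[OF p(1) N1[OF N(3)]] gy.hol_eq[OF p(1) N2[OF N(4)]] gx.hol_mesh_def gy.hol_mesh_def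
  by (simp only: fst_dihedral_hprod prod.distrib)
 also have "\<dots> = (\<Prod>i<N. h (?a i) * h (?a (Suc i)))"
 proof (rule prod.cong[OF refl])
  fix i assume "i \<in> {..<N}"
  then obtain B where B: "P B" "p ` {real i / real N..real (Suc i) / real N} \<subseteq> B" using N0(2)[OF N(2)] by auto
  have "?a i \<in> B" "?a (Suc i) \<in> B"
   by (rule subsetD[OF B(2)], rule imageI, simp add: divide_right_mono)+
  thus "fst (?gx (?a i) (?a (Suc i))) * fst (?gy (?a i) (?a (Suc i))) = h (?a i) * h (?a (Suc i))"
   using B(1) unfolding P_def by blast
 qed
 also have "\<dots> = h (?a 0) * h (?a N)"
 proof -
  have "(\<Prod>i<k. h (?a i) * h (?a (Suc i))) = h (?a 0) * h (?a k)" for k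
  proof (induction k)
   case (Suc k)
   have "h (?a 0) * h (?a k) * (h (?a k) * h (?a (Suc k))) = h (?a 0) * (h (?a k) * h (?a k)) * h (?a (Suc k))" by (simp only: mult.assoc)
   thus ?case using Suc h2 by (simp del: of_nat_Suc)
  qed (use h2 in simp)
  thus ?thesis .
 qed
 also have "\<dots> = 1" using N(1) p(2) h2 by simp
 finally have e: "fst (gx.hol p) * fst (gy.hol p) = 1" .
 have "fst (gx.hol p) \<in> {1, - 1}" "fst (gy.hol p) \<in> {1, - 1}"
  using gx.hol_closed[OF p(1)] gy.hol_closed[OF p(1)] by auto
 thus ?thesis using e by auto
qed

lemma fin_disjoint:
 assumes F: "moves T u Z F" and H: "moves T u Z' H" and Z: "Z \<inter> Z' = {}" and c: "fin H u = u"
 shows "fin H (fin F u) = fin F u"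
proof -
 have H': "moves T (fin F u) Z' H" and i: "fin F u \<inter> Z' = u \<inter> Z'" using moves_disjoint[OF F H Z] by auto
 have split: "fin H w = (\<lambda>a. H a 1) ` (w \<inter> Z') \<union> (w - Z')" "(\<lambda>a. H a 1) ` (w \<inter> Z') \<subseteq> Z'" if "moves T w Z' H" for w
 proof -
  have "(\<lambda>a. H a 1) ` (w - Z') = w - Z'" using movesD(5)[OF that, of _ 1] by force
  moreover have "w = (w \<inter> Z') \<union> (w - Z')" by blast
  ultimately show "fin H w = (\<lambda>a. H a 1) ` (w \<inter> Z') \<union> (w - Z')" unfolding fin_def by (metis image_Un)
  show "(\<lambda>a. H a 1) ` (w \<inter> Z') \<subseteq> Z'" using movesD(4)[OF that, of _ 1] by auto
 qed
 have "(\<lambda>a. H a 1) ` (u \<inter> Z') = u \<inter> Z'" using split[OF H] c by blast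
 hence "fin H (fin F u) = (u \<inter> Z') \<union> (fin F u - Z')" using split(1)[OF H'] unfolding i by simp
 also have "\<dots> = fin F u" using i by blast
 finally show ?thesis .
qed

lemma occupied_image:
 assumes f: "inj_on f u" "\<And>a. a \<in> u ==> \<mu> (f a) = \<mu> a"
 shows "occupied \<mu> (f ` u) = occupied \<mu> u"
proof -
 have "f ` u - {f q} = f ` (u - {q})" if "q \<in> u" for q using f(1) that by (auto simp: inj_on_def)
 thus ?thesis using f(2) by (simp add: occupied_def)
qed

context vertex_chart
begin

text \<open>Moving tokens stay at the capped distance 1, so no distance and hence no status
  changes.\<close>

lemma hol_far:
 assumes n: "n \<ge> 2" and F: "moves T u Z F" and u: "finite u" "card u = n" and Z: "\<And>a. a \<in> Z ==> a \<in> topspace T ==> \<mu> a = 1"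
 shows "vhol n (track F u) = \<one>"
proof (rule hol_constant_status[OF n pathin_track[OF F u]])
 fix t :: real assume t: "t \<in> {0..1}"
 have "\<mu> (F a t) = \<mu> a" if a: "a \<in> u" for a
 proof (cases "a \<in> Z")
  case True
  have "F a t \<in> topspace T" using pathin_in[OF movesD(1)[OF F a]] t by simp
  thus ?thesis using Z[OF True] Z[OF movesD(4)[OF F a True t]] a moves_subset[OF F] by auto
 qed (use movesD(5)[OF F _ t] in auto)
 hence "occupied \<mu> (track F u t) = occupied \<mu> u"
  unfolding track_def by (intro occupied_image movesD(3)[OF F t])
 thus "occupied \<mu> (track F u t) = occupied \<mu> (track F u 0)" using track_ends(1)[OF F] by simp
qed

text \<open>With all tokens at distance at least 1/2 and at most 1, none can be closer than half of
  another, so the vertex is never occupied.\<close>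

lemma hol_away:
 assumes n: "n \<ge> 2" and F: "moves T u Z F" and u: "finite u" "card u = n"
  and Z: "\<And>a. a \<in> u ==> 1/2 \<le> \<mu> a" "\<And>a. a \<in> Z ==> 1/2 \<le> \<mu> a"
 shows "vhol n (track F u) = \<one>"
proof (rule hol_constant_status[OF n pathin_track[OF F u]])
 have "\<not> occupied \<mu> (track F u t)" if t: "t \<in> {0..1}" for t
 proof (rule not_occupied)
  have "track F u t \<in> topspace (unord_conf T n)" using pathin_in[OF pathin_track[OF F u]] t by simp
  thus "finite (track F u t)" "card (track F u t) \<ge> 2" "track F u t \<subseteq> topspace T"
   using n by (auto simp: topspace_unord_conf)
  fix b assume "b \<in> track F u t"
  then obtain a where a: "a \<in> u" "b = F a t" by (auto simp: track_def)
  show "1/2 \<le> \<mu> b" using movesD(4)[OF F a(1) _ t] movesD(5)[OF F _ t, of a] Z a by (cases "a \<in> Z") auto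
 qed
 thus "occupied \<mu> (track F u t) = occupied \<mu> (track F u 0)" if "t \<in> {0..1}" for t using that by simp
qed

text \<open>A single passage along \<open>legpath\<close>. The radius r of the support is kept
  explicit because commutation with other motions depends on it.\<close>

lemma turn:
 assumes n: "n \<ge> 3" and l: "tripod T l" "\<And>k t. k < 3 ==> 0 \<le> t ==> t \<le> 1 ==> \<mu> (l k t) = t"
  and ij: "i < 3" "j < 3" and s: "1/2 \<le> s" "s < 1" "1/2 \<le> s'" "s' < 1" "s \<le> r" "s' \<le> r"
  and \<xi>: "\<And>t. 0 < t ==> t < 1 ==> \<xi> (l i t) = \<alpha>" "\<And>t. 0 < t ==> t < 1 ==> \<xi> (l j t) = \<beta>"
  and u: "finite u" "card u = n" "u \<subseteq> topspace T" "l i s \<in> u" and far: "\<And>b. b \<in> u ==> 1/2 \<le> \<mu> b"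
  and free: "\<And>t. 1/2 \<le> t ==> t < s ==> l i t \<notin> u" "\<And>t. 1/2 \<le> t ==> t \<le> s' ==> l j t \<notin> u"
 shows "\<exists>F. moves T u {p \<in> topspace T. \<mu> p \<le> r} F \<and> fin F u = insert (l j s') (u - {l i s}) \<and>
  vhol n (track F u) = inv \<alpha> \<otimes> \<beta>"
proof -
 let ?\<gamma> = "legpath l i s j s'"
 have s0: "0 < s" "s \<le> 1" "0 < s'" "s' \<le> 1" using s by auto
 note L = legpath[OF l(1) ij s0]
 have low: "l k t \<notin> u" if "k < 3" "0 \<le> t" "t < 1/2" for k t
  using far[of "l k t"] l(2)[of k t] that by auto
 have free': "l i t \<notin> u" if "0 \<le> t" "t < s" for t using low[OF ij(1)] free(1)[of t] that by (cases "t < 1/2") auto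
 have free'': "l j t \<notin> u" if "0 \<le> t" "t \<le> s'" for t using low[OF ij(2)] free(2)[of t] that by (cases "t < 1/2") auto
 note LF = legpath_free[OF l(1) ij s0 free' free'']
 have pos: "\<exists>k x. ?\<gamma> t = l k x \<and> k < 3 \<and> 0 \<le> x \<and> x \<le> r \<and> x \<le> 1" if t: "t \<in> {0..1}" for t
  using L(4)[OF t]
 proof (elim disjE conjE)
  assume a: "?\<gamma> t = l i (s * (1 - 2 * t))" and "s * (1 - 2 * t) \<in> {0..s}"
  hence "0 \<le> s * (1 - 2 * t)" "s * (1 - 2 * t) \<le> s" unfolding atLeastAtMost_iff by auto
  moreover from this have "s * (1 - 2 * t) \<le> r" "s * (1 - 2 * t) \<le> 1" using s by linarith+
  ultimately show ?thesis using a ij(1) by blast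
 next
  assume a: "?\<gamma> t = l j (s' * (2 * t - 1))" and "s' * (2 * t - 1) \<in> {0<..s'}"
  hence "0 < s' * (2 * t - 1)" "s' * (2 * t - 1) \<le> s'" unfolding greaterThanAtMost_iff by auto
  moreover from this have "0 \<le> s' * (2 * t - 1)" "s' * (2 * t - 1) \<le> r" "s' * (2 * t - 1) \<le> 1" using s by linarith+
  ultimately show ?thesis using a ij(2) by blast
 qed
 have Z: "?\<gamma> t \<in> {p \<in> topspace T. \<mu> p \<le> r}" if t: "t \<in> {0..1}" for t
 proof -
  obtain k x where "?\<gamma> t = l k x" "k < 3" "0 \<le> x" "x \<le> r" "x \<le> 1" using pos[OF t] by blast
  thus ?thesis using l(2)[of k x] pathin_in[OF L(1), of t] t by auto
 qed
 have m: "moves T u {p \<in> topspace T. \<mu> p \<le> r} (slide (l i s) ?\<gamma>)" "fin (slide (l i s) ?\<gamma>) u = insert (?\<gamma> 1) (u - {l i s})"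
 proof -
  have a: "l i s \<in> {p \<in> topspace T. \<mu> p \<le> r}" using Z[of 0] L(2) by simp
  have f: "?\<gamma> t \<in> {p \<in> topspace T. \<mu> p \<le> r} \<and> ?\<gamma> t \<notin> u - {l i s}" if "t \<in> {0..1}" for t using Z[OF that] LF(2) that by blast
  show "moves T u {p \<in> topspace T. \<mu> p \<le> r} (slide (l i s) ?\<gamma>)" by (rule moves_slide[OF u(4) a L(1,2) f u(3)])
  show "fin (slide (l i s) ?\<gamma>) u = insert (?\<gamma> 1) (u - {l i s})" by (rule moves_slide[OF u(4) a L(1,2) f u(3)])
 qed
 have "vhol n (track (slide (l i s) ?\<gamma>) u) = inv \<alpha> \<otimes> \<beta>"
 proof (rule hol_passage[OF n u L(1,2)])
  show "?\<gamma> t \<notin> u - {l i s}" if "t \<in> {0..1}" for t using LF(2) that by blast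
  show "1/2 \<le> \<mu> b" if "b \<in> u - {l i s}" for b using far that by blast
  show "1/2 \<le> \<mu> (?\<gamma> 0)" "1/2 \<le> \<mu> (?\<gamma> 1)" using L(2,3) l(2)[OF ij(1), of s] l(2)[OF ij(2), of s'] s by auto
  show "\<mu> (?\<gamma> (1/2)) = 0" using L(4)[of "1/2"] l(2)[OF ij(1), of 0] by auto
  show "\<xi> (?\<gamma> t) = \<alpha>" if t: "0 \<le> t" "t < 1/2" for t
  proof -
   have "0 < s * (1 - 2 * t)" "s * (1 - 2 * t) \<le> s * 1" using s t by (simp, intro mult_left_mono) auto
   hence "\<xi> (l i (s * (1 - 2 * t))) = \<alpha>" using s by (intro \<xi>(1)) linarith+
   thus ?thesis using L(4)[of t] t by auto
  qed
  show "\<xi> (?\<gamma> t) = \<beta>" if t: "1/2 < t" "t \<le> 1" for t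
  proof -
   have "0 < s' * (2 * t - 1)" "s' * (2 * t - 1) \<le> s' * 1" using s t by (simp, intro mult_left_mono) auto
   hence "\<xi> (l j (s' * (2 * t - 1))) = \<beta>" using s by (intro \<xi>(2)) linarith+
   thus ?thesis using L(4)[of t] t by auto
  qed
 qed
 thus ?thesis using m L(3) by (intro exI[of _ "slide (l i s) ?\<gamma>"]) simp
qed

text \<open>Two tokens leave leg 0 through the legs 1 and 2 and return in the opposite order.\<close>

lemma double_turn:
 assumes n: "n \<ge> 3" and l: "tripod T l" "\<And>k t. k < 3 ==> 0 \<le> t ==> t \<le> 1 ==> \<mu> (l k t) = t"
  and \<xi>: "\<And>t. 0 < t ==> t < 1 ==> \<xi> (l 0 t) = \<one>" "\<And>t. 0 < t ==> t < 1 ==> \<xi> (l 1 t) = \<alpha>"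
   "\<And>t. 0 < t ==> t < 1 ==> \<xi> (l 2 t) = \<beta>"
  and u: "finite u" "card u = n" "u \<subseteq> topspace T" "l 0 (1/2) \<in> u" "l 0 (3/5) \<in> u"
  and far: "\<And>b. b \<in> u ==> b \<noteq> l 0 (1/2) ==> b \<noteq> l 0 (3/5) ==> 3/5 < \<mu> b"
 shows "\<exists>F. moves T u {p \<in> topspace T. \<mu> p \<le> 3/5} F \<and> fin F u = u \<and>
  vhol n (track F u) = \<alpha> \<otimes> \<beta> \<otimes> inv \<alpha> \<otimes> inv \<beta>"
proof -
 have n2: "n \<ge> 2" using n by simp
 interpret c: cocycle W "unord_conf T n" "vertex_cocycle W \<mu> \<xi>" by (rule vertex_is_cocycle[OF n2])
 let ?Z = "{p \<in> topspace T. \<mu> p \<le> 3/5}"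
 define R where "R = u - {l 0 (1/2), l 0 (3/5)}"
 have far': "3/5 < \<mu> b" if "b \<in> R" for b using far[of b] that by (auto simp: R_def)
 have ne: "l i s = l j t \<longleftrightarrow> s = t \<and> (i = j \<or> s = 0)" if "i < 3" "j < 3" "0 \<le> s" "s \<le> 1" "0 \<le> t" "t \<le> 1" for i j s t
  by (rule tripodD(2)[OF l(1) that])
 have lR: "l k t \<notin> R" if "k < 3" "0 \<le> t" "t \<le> 3/5" for k t using far'[of "l k t"] l(2)[of k t] that by force
 have lT: "l k t \<in> topspace T" if "k < 3" "0 \<le> t" "t \<le> 1" for k t
  using pathin_in[OF tripodD(1)[OF l(1) that(1)], of t] that by simp
 have farR: "1/2 \<le> \<mu> b" if "b \<in> R" for b using far'[OF that] by simp
 have RT: "R \<subseteq> topspace T" "finite R" using u by (auto simp: R_def)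
 have ue: "u = insert (l 0 (1/2)) (insert (l 0 (3/5)) R)" using u(4,5) by (auto simp: R_def)
 have cR: "card R + 2 = n"
  using u(1,2) RT(2) ne[of 0 0 "1/2" "3/5"] lR[of 0 "1/2"] lR[of 0 "3/5"] unfolding ue by simp
 have cfg: "finite (insert (l i s) (insert (l j t) R))" "card (insert (l i s) (insert (l j t) R)) = n"
   "insert (l i s) (insert (l j t) R) \<subseteq> topspace T" "\<And>b. b \<in> insert (l i s) (insert (l j t) R) ==> 1/2 \<le> \<mu> b"
  if "i < 3" "j < 3" "1/2 \<le> s" "s \<le> 3/5" "1/2 \<le> t" "t \<le> 3/5" "l i s \<noteq> l j t" for i j s t
  using that RT cR lR[of i s] lR[of j t] lT[of i s] lT[of j t] l(2)[of i s] l(2)[of j t] by (auto dest: farR)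
 let ?o = "\<one>" and ?h = "c.hol"
 \<comment> \<open>The four turns between these configurations contribute \<alpha>, \<beta>, the
   inverse of \<alpha> and the inverse of \<beta>, as leg 0 has label 1.\<close>
 define u1 where "u1 = insert (l 1 (1/2)) (insert (l 0 (3/5)) R)"
 define u2 where "u2 = insert (l 1 (1/2)) (insert (l 2 (1/2)) R)"
 define u3 where "u3 = insert (l 2 (1/2)) (insert (l 0 (3/5)) R)"
 have c0: "finite u" "card u = n" "u \<subseteq> topspace T" "\<And>b. b \<in> u ==> 1/2 \<le> \<mu> b"
  using cfg[of 0 0 "1/2" "3/5"] ne[of 0 0 "1/2" "3/5"] unfolding ue by auto
 have c1: "finite u1" "card u1 = n" "u1 \<subseteq> topspace T" "\<And>b. b \<in> u1 ==> 1/2 \<le> \<mu> b"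
  using cfg[of 1 0 "1/2" "3/5"] ne[of 1 0 "1/2" "3/5"] unfolding u1_def by auto
 have c2: "finite u2" "card u2 = n" "u2 \<subseteq> topspace T" "\<And>b. b \<in> u2 ==> 1/2 \<le> \<mu> b"
  using cfg[of 1 2 "1/2" "1/2"] ne[of 1 2 "1/2" "1/2"] unfolding u2_def by auto
 have c3: "finite u3" "card u3 = n" "u3 \<subseteq> topspace T" "\<And>b. b \<in> u3 ==> 1/2 \<le> \<mu> b"
  using cfg[of 2 0 "1/2" "3/5"] ne[of 2 0 "1/2" "3/5"] unfolding u3_def by auto
 have ne': "l k t = l i s \<longleftrightarrow> t = s \<and> k = i"
  if "k < 3" "i < 3" "1/2 \<le> t" "t \<le> 1" "1/2 \<le> s" "s \<le> 1" for k i s t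
  using ne[of k i t s] that by auto
 have lR': "l k t \<notin> R" if "k < 3" "1/2 \<le> t" "t \<le> 3/5" for k t using lR that by simp
 have rm: "insert p (insert x (insert y R) - {x}) = insert p (insert y R)" if "x \<notin> insert y R" for x y p
  using that by blast
 have "\<exists>F. moves T u ?Z F \<and> fin F u = insert (l 1 (1/2)) (u - {l 0 (1/2)}) \<and> ?h (track F u) = inv ?o \<otimes> \<alpha>"
  by (rule turn[OF n l]) (use \<xi> c0 u in \<open>auto simp: ue ne' lR'\<close>)
 moreover have "insert (l 1 (1/2)) (u - {l 0 (1/2)}) = u1"
  unfolding ue u1_def by (rule rm) (use ne[of 0 0 "1/2" "3/5"] lR[of 0 "1/2"] in auto)
 ultimately obtain F1 where F1: "moves T u ?Z F1" "fin F1 u = u1" "?h (track F1 u) = inv ?o \<otimes> \<alpha>" by auto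
 have u1': "u1 = insert (l 0 (3/5)) (insert (l 1 (1/2)) R)" unfolding u1_def by blast
 have "\<exists>F. moves T u1 ?Z F \<and> fin F u1 = insert (l 2 (1/2)) (u1 - {l 0 (3/5)}) \<and> ?h (track F u1) = inv ?o \<otimes> \<beta>"
  by (rule turn[OF n l]) (use \<xi> c1 in \<open>auto simp: u1_def ne' lR'\<close>)
 moreover have "insert (l 2 (1/2)) (u1 - {l 0 (3/5)}) = u2"
  unfolding u1' u2_def by (subst rm) (use ne[of 0 1 "3/5" "1/2"] lR[of 0 "3/5"] in auto)
 ultimately obtain F2 where F2: "moves T u1 ?Z F2" "fin F2 u1 = u2" "?h (track F2 u1) = inv ?o \<otimes> \<beta>" by auto
 have "\<exists>F. moves T u2 ?Z F \<and> fin F u2 = insert (l 0 (3/5)) (u2 - {l 1 (1/2)}) \<and> ?h (track F u2) = inv \<alpha> \<otimes> ?o"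
  by (rule turn[OF n l]) (use \<xi> c2 in \<open>auto simp: u2_def ne' lR'\<close>)
 moreover have "insert (l 0 (3/5)) (u2 - {l 1 (1/2)}) = u3"
  unfolding u2_def u3_def by (subst rm) (use ne[of 1 2 "1/2" "1/2"] lR[of 1 "1/2"] in auto)
 ultimately obtain F3 where F3: "moves T u2 ?Z F3" "fin F3 u2 = u3" "?h (track F3 u2) = inv \<alpha> \<otimes> ?o" by auto
 have "\<exists>F. moves T u3 ?Z F \<and> fin F u3 = insert (l 0 (1/2)) (u3 - {l 2 (1/2)}) \<and> ?h (track F u3) = inv \<beta> \<otimes> ?o"
  by (rule turn[OF n l]) (use \<xi> c3 in \<open>auto simp: u3_def ne' lR'\<close>)
 moreover have "insert (l 0 (1/2)) (u3 - {l 2 (1/2)}) = u"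
  unfolding ue u3_def by (rule rm) (use ne[of 2 0 "1/2" "3/5"] lR[of 2 "1/2"] in auto)
 ultimately obtain F4 where F4: "moves T u3 ?Z F4" "fin F4 u3 = u" "?h (track F4 u3) = inv \<beta> \<otimes> ?o" by auto
 have \<alpha>\<beta>: "\<alpha> \<in> carrier W" "\<beta> \<in> carrier W"
  using \<xi>(2)[of "1/2"] \<xi>(3)[of "1/2"] \<xi>_closed[OF lT, of 1 "1/2"] \<xi>_closed[OF lT, of 2 "1/2"] by auto
 have join: "moves T v ?Z (mcomp v A B) \<and> fin (mcomp v A B) v = fin B (fin A v) \<and>
   ?h (track (mcomp v A B) v) = ?h (track A v) \<otimes> ?h (track B (fin A v))"
  if A: "moves T v ?Z A" "moves T (fin A v) ?Z B" and v: "finite v" "card v = n" for v A B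
 proof -
  have "card (fin A v) = n" "finite (fin A v)" using card_fin[OF A(1)] finite_fin[OF v(1)] v by auto
  thus ?thesis
   using moves_mcomp[OF A] pathin_track[OF A(1) v] pathin_track[OF A(2)] track_ends(2)[of A v] track_ends(1)[OF A(2)]
   by (simp add: c.hol_join)
 qed
 define G3 where "G3 = mcomp u2 F3 F4"
 have G3: "moves T u2 ?Z G3" "fin G3 u2 = u" "?h (track G3 u2) = (inv \<alpha> \<otimes> ?o) \<otimes> (inv \<beta> \<otimes> ?o)"
  using join[of u2 F3 F4] F3 F4 c2 unfolding G3_def by auto
 define G2 where "G2 = mcomp u1 F2 G3"
 have G2: "moves T u1 ?Z G2" "fin G2 u1 = u"
  "?h (track G2 u1) = (inv ?o \<otimes> \<beta>) \<otimes> ((inv \<alpha> \<otimes> ?o) \<otimes> (inv \<beta> \<otimes> ?o))"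
  using join[of u1 F2 G3] F2 G3 c1 unfolding G2_def by auto
 have "moves T u ?Z (mcomp u F1 G2) \<and> fin (mcomp u F1 G2) u = u \<and> ?h (track (mcomp u F1 G2) u) =
  (inv ?o \<otimes> \<alpha>) \<otimes> ((inv ?o \<otimes> \<beta>) \<otimes> ((inv \<alpha> \<otimes> ?o) \<otimes> (inv \<beta> \<otimes> ?o)))"
  using join[of u F1 G2] F1 G2 c0 by auto
 thus ?thesis using \<alpha>\<beta> by (intro exI[of _ "mcomp u F1 G2"]) (simp add: W.m_assoc)
qed

end

lemma dihedral_values:
 "inv\<^bsub>dihedral\<^esub> (- 1, 0) = (- 1, 0)" "inv\<^bsub>dihedral\<^esub> (1, k) = (1, - k)"
proof -
 interpret D: group dihedral by (rule group_dihedral)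
 show "inv\<^bsub>dihedral\<^esub> (- 1, 0) = (- 1, 0)" "inv\<^bsub>dihedral\<^esub> (1, k) = (1, - k)"
  by (rule D.inv_equality; simp)+
qed

context metric_braid
begin

text \<open>y and z are double turns at the two vertices, each with holonomy the commutator of (- 1,
  0) and (1, 1), that is (1, - 2). H takes a token through the first vertex from leg 1 to leg 2, and
  K produces the same change of configuration inside Z, without approaching the vertex; c is H
  followed by the reverse of K, and only H contributes to its sign. Because K and y have disjoint
  supports, conjugating y by c amounts to conjugating by H alone, so the result is supported near
  the first vertex and commutes with z.\<close>

theorem no_free_arc:
 assumes n: "n \<ge> 5" and l: "tripod T l" "tripod T l'"
  and cx: "vertex_chart T d dihedral \<mu> \<xi>" and cy: "vertex_chart T d dihedral \<mu>' \<xi>'"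
  and \<mu>l: "\<And>k t. k < 3 ==> 0 \<le> t ==> t \<le> 1 ==> \<mu> (l k t) = t" "\<And>k t. k < 3 ==> 0 \<le> t ==> t \<le> 1 ==> \<mu>' (l' k t) = t"
  and sep: "\<And>a. a \<in> topspace T ==> \<mu> a < 1 ==> \<mu>' a = 1"
  and \<xi>: "\<And>t. 0 < t ==> t < 1 ==> \<xi> (l 0 t) = (1, 0)" "\<And>t. 0 < t ==> t < 1 ==> \<xi> (l 1 t) = (- 1, 0)"
   "\<And>t. 0 < t ==> t < 1 ==> \<xi> (l 2 t) = (1, 1)"
  and \<xi>': "\<And>t. 0 < t ==> t < 1 ==> \<xi>' (l' 0 t) = (1, 0)" "\<And>t. 0 < t ==> t < 1 ==> \<xi>' (l' 1 t) = (- 1, 0)"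
   "\<And>t. 0 < t ==> t < 1 ==> \<xi>' (l' 2 t) = (1, 1)"
  and U: "\<And>a. a \<in> topspace T ==> 0 < \<mu> a ==> 0 < \<mu>' a ==> \<exists>\<rho>>0. \<forall>b\<in>topspace T. d a b < \<rho> --> (b \<in> U \<longleftrightarrow> a \<in> U)"
  and sgn: "\<And>a. fst (\<xi> a) = (if a \<in> U then - 1 else 1)" "\<And>a. fst (\<xi>' a) = (if a \<in> U then - 1 else 1)"
  and Z: "path_connectedin T Z" "l 1 (7/10) \<in> Z" "l 2 (7/10) \<in> Z" "\<And>a. a \<in> Z ==> 7/10 \<le> \<mu> a"
 shows "\<not> is_raag FG"
proof
 assume "is_raag FG"
 then obtain S R q where rg: "raag FG S R q" by (rule is_raag_obtain)
 interpret rg: raag FG S R q by (rule rg)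
 interpret X: vertex_chart T d dihedral \<mu> \<xi> by (rule cx)
 interpret Y: vertex_chart T d dihedral \<mu>' \<xi>' by (rule cy)
 have n3: "n \<ge> 3" and n2: "n \<ge> 2" using n by auto
 let ?T = "unord_conf T n"
 interpret gx: based_cocycle ?T base dihedral "vertex_cocycle dihedral \<mu> \<xi>"
  by (intro based_cocycle.intro based_space_axioms X.vertex_is_cocycle n2)
 interpret gy: based_cocycle ?T base dihedral "vertex_cocycle dihedral \<mu>' \<xi>'"
  by (intro based_cocycle.intro based_space_axioms Y.vertex_is_cocycle n2)
 have lT: "l k t \<in> topspace T" "l' k t \<in> topspace T" if "k < 3" "0 \<le> t" "t \<le> 1" for k t
  using pathin_in[OF tripodD(1)[OF l(1) that(1)], of t] pathin_in[OF tripodD(1)[OF l(2) that(1)], of t] that by auto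
 have sep': "\<mu> a = 1" if "a \<in> topspace T" "\<mu>' a < 1" for a
  using sep[OF that(1)] that X.\<mu>_bounds[OF that(1)] by fastforce
 \<comment> \<open>Distinct distances in (7/10, 9/10] for the remaining n - 5 tokens, outside the
   radius 3/5 of the double turn at the second vertex.\<close>
 define r where "r i = 7/10 + 1 / (5 * real (Suc i))" for i :: nat
 have r: "7/10 < r i" "r i < 1" for i
 proof -
  show "7/10 < r i" by (simp add: r_def)
  have "1 / (5 * real (Suc i)) \<le> 1 / 5" by (intro divide_left_mono) auto
  thus "r i < 1" unfolding r_def by linarith
 qed
 define S0 where "S0 = (\<lambda>i. l' 0 (r i)) ` {..<n - 5}"
 have inj: "inj_on (\<lambda>i. l' 0 (r i)) {..<n - 5}"
 proof (rule inj_onI)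
  fix i j assume "l' 0 (r i) = l' 0 (r j)"
  hence "r i = r j" using tripodD(2)[OF l(2), of 0 0 "r i" "r j"] r[of i] r[of j] by auto
  thus "i = j" by (simp add: r_def)
 qed
 have S0: "finite S0" "card S0 = n - 5" using card_image[OF inj] by (auto simp: S0_def)
 have S0T: "S0 \<subseteq> topspace T" "\<And>b. b \<in> S0 ==> 7/10 < \<mu>' b \<and> \<mu>' b < 1"
  using lT(2)[of 0] \<mu>l(2)[of 0] r by (auto simp: S0_def less_imp_le order_trans[OF _ less_imp_le[OF r(1)]])
 \<comment> \<open>Radii 1/2 and 3/5 for the exchanged tokens, as in \<open>double_turn\<close>, and
   7/10 for the token carried by c; \<open>B2\<close> is A after that token has changed
   legs.\<close>
 define A where "A = {l 0 (1/2), l 0 (3/5), l 1 (7/10)}"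
 define B where "B = insert (l' 0 (1/2)) (insert (l' 0 (3/5)) S0)"
 define B2 where "B2 = {l 0 (1/2), l 0 (3/5), l 2 (7/10)}"
 have dA: "\<mu> b < 1" "\<mu>' b = 1" if "b \<in> A \<union> B2" for b
 proof -
  show 1: "\<mu> b < 1" using that \<mu>l(1)[of 0 "1/2"] \<mu>l(1)[of 0 "3/5"] \<mu>l(1)[of 1 "7/10"] \<mu>l(1)[of 2 "7/10"] by (auto simp: A_def B2_def)
  have "b \<in> topspace T" using that lT(1)[of 0 "1/2"] lT(1)[of 0 "3/5"] lT(1)[of 1 "7/10"] lT(1)[of 2 "7/10"] by (auto simp: A_def B2_def)
  thus "\<mu>' b = 1" using sep 1 by blast
 qed
 have dB: "\<mu>' b < 1" "\<mu> b = 1" if "b \<in> B" for b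
 proof -
  show 1: "\<mu>' b < 1" using that \<mu>l(2)[of 0 "1/2"] \<mu>l(2)[of 0 "3/5"] S0T(2) by (auto simp: B_def)
  have "b \<in> topspace T" using that lT(2)[of 0 "1/2"] lT(2)[of 0 "3/5"] S0T(1) by (auto simp: B_def)
  thus "\<mu> b = 1" using sep' 1 by blast
 qed
 have cA: "card A = 3" "finite A" "A \<subseteq> topspace T" "card B2 = 3" "finite B2" "B2 \<subseteq> topspace T"
  using lT(1)[of 0 "1/2"] lT(1)[of 0 "3/5"] lT(1)[of 1 "7/10"] lT(1)[of 2 "7/10"]
   \<mu>l(1)[of 0 "1/2"] \<mu>l(1)[of 0 "3/5"] \<mu>l(1)[of 1 "7/10"] \<mu>l(1)[of 2 "7/10"]
  by (auto simp: A_def B2_def card_insert_if)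
 have cB: "card B = n - 3" "finite B" "B \<subseteq> topspace T"
 proof -
  have "l' 0 (1/2) \<notin> insert (l' 0 (3/5)) S0" "l' 0 (3/5) \<notin> S0"
   using \<mu>l(2)[of 0 "1/2"] \<mu>l(2)[of 0 "3/5"] S0T(2)[of "l' 0 (1/2)"] S0T(2)[of "l' 0 (3/5)"] by auto
  thus "card B = n - 3" "finite B" "B \<subseteq> topspace T"
   using S0 S0T(1) n lT(2)[of 0 "1/2"] lT(2)[of 0 "3/5"] by (auto simp: B_def)
 qed
 define u where "u = A \<union> B"
 define u2 where "u2 = B2 \<union> B"
 have AB: "A \<inter> B = {}" "B2 \<inter> B = {}" using dA dB by fastforce+
 have u: "finite u" "card u = n" "u \<subseteq> topspace T" and u2: "finite u2" "card u2 = n" "u2 \<subseteq> topspace T"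
  using cA cB AB n by (auto simp: u_def u2_def card_Un_disjoint)
 have l12: "l 1 (7/10) \<notin> B2" "l 2 (7/10) \<notin> A" "l 1 (7/10) \<noteq> l 0 (1/2)" "l 1 (7/10) \<noteq> l 0 (3/5)"
  using tripodD(2)[OF l(1), of 1 0 "7/10" "1/2"] tripodD(2)[OF l(1), of 1 0 "7/10" "3/5"] tripodD(2)[OF l(1), of 1 2 "7/10" "7/10"]
   tripodD(2)[OF l(1), of 2 0 "7/10" "1/2"] tripodD(2)[OF l(1), of 2 0 "7/10" "3/5"] by (auto simp: A_def B2_def)
 have \<mu>u: "3/5 < \<mu> b" if "b \<in> u" "b \<noteq> l 0 (1/2)" "b \<noteq> l 0 (3/5)" for b
  using that dB(2)[of b] \<mu>l(1)[of 1 "7/10"] by (auto simp: u_def A_def)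
 have \<mu>u': "3/5 < \<mu>' b" if "b \<in> u" "b \<noteq> l' 0 (1/2)" "b \<noteq> l' 0 (3/5)" for b
  using that dA(2)[of b] S0T(2)[of b] by (auto simp: u_def B_def)
 have half: "1/2 \<le> \<mu> b" if "b \<in> u" for b
  using \<mu>u[OF that] \<mu>l(1)[of 0 "1/2"] \<mu>l(1)[of 0 "3/5"] by (cases "b = l 0 (1/2) \<or> b = l 0 (3/5)") auto
 have "l 0 (1/2) \<in> u" "l 0 (3/5) \<in> u" by (auto simp: u_def A_def)
 hence "\<exists>F. moves T u {p \<in> topspace T. \<mu> p \<le> 3/5} F \<and> fin F u = u \<and> gx.hol (track F u) = (- 1, 0) \<otimes>\<^bsub>dihedral\<^esub> (1, 1) \<otimes>\<^bsub>dihedral\<^esub> inv\<^bsub>dihedral\<^esub> (- 1, 0) \<otimes>\<^bsub>dihedral\<^esub> inv\<^bsub>dihedral\<^esub> (1, 1)"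
  by (intro X.double_turn[OF n3 l(1) \<mu>l(1)]) (use \<xi> u \<mu>u in auto)
 then obtain F where F: "moves T u {p \<in> topspace T. \<mu> p \<le> 3/5} F" "fin F u = u"
  "gx.hol (track F u) = (- 1, 0) \<otimes>\<^bsub>dihedral\<^esub> (1, 1) \<otimes>\<^bsub>dihedral\<^esub> inv\<^bsub>dihedral\<^esub> (- 1, 0) \<otimes>\<^bsub>dihedral\<^esub> inv\<^bsub>dihedral\<^esub> (1, 1)"
  by blast
 have "l' 0 (1/2) \<in> u" "l' 0 (3/5) \<in> u" by (auto simp: u_def B_def)
 hence "\<exists>F. moves T u {p \<in> topspace T. \<mu>' p \<le> 3/5} F \<and> fin F u = u \<and> gy.hol (track F u) = (- 1, 0) \<otimes>\<^bsub>dihedral\<^esub> (1, 1) \<otimes>\<^bsub>dihedral\<^esub> inv\<^bsub>dihedral\<^esub> (- 1, 0) \<otimes>\<^bsub>dihedral\<^esub> inv\<^bsub>dihedral\<^esub> (1, 1)"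
  by (intro Y.double_turn[OF n3 l(2) \<mu>l(2)]) (use \<xi>' u \<mu>u' in auto)
 then obtain F' where F': "moves T u {p \<in> topspace T. \<mu>' p \<le> 3/5} F'" "fin F' u = u"
  "gy.hol (track F' u) = (- 1, 0) \<otimes>\<^bsub>dihedral\<^esub> (1, 1) \<otimes>\<^bsub>dihedral\<^esub> inv\<^bsub>dihedral\<^esub> (- 1, 0) \<otimes>\<^bsub>dihedral\<^esub> inv\<^bsub>dihedral\<^esub> (1, 1)"
  by blast
 have F0: "gy.hol (track F u) = (1, 0)" "gx.hol (track F' u) = (1, 0)"
  using Y.hol_far[OF n2 F(1) u(1,2)] X.hol_far[OF n2 F'(1) u(1,2)] sep sep' by auto
 let ?Zx = "{p \<in> topspace T. \<mu> p \<le> 7/10}"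
 have "l 1 t \<notin> u" if "1/2 \<le> t" "t < 7/10" for t
  using that \<mu>l(1)[of 1 t] dB(2)[of "l 1 t"] tripodD(2)[OF l(1), of 1 0 t "1/2"] tripodD(2)[OF l(1), of 1 0 t "3/5"]
   tripodD(2)[OF l(1), of 1 1 t "7/10"] by (auto simp: u_def A_def)
 moreover have "l 2 t \<notin> u" if "1/2 \<le> t" "t \<le> 7/10" for t
  using that \<mu>l(1)[of 2 t] dB(2)[of "l 2 t"] tripodD(2)[OF l(1), of 2 0 t "1/2"] tripodD(2)[OF l(1), of 2 0 t "3/5"]
   tripodD(2)[OF l(1), of 2 1 t "7/10"] by (auto simp: u_def A_def)
 moreover have "l 1 (7/10) \<in> u" by (simp add: u_def A_def)
 ultimately have "\<exists>H. moves T u ?Zx H \<and> fin H u = insert (l 2 (7/10)) (u - {l 1 (7/10)}) \<and>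
   gx.hol (track H u) = inv\<^bsub>dihedral\<^esub> (- 1, 0) \<otimes>\<^bsub>dihedral\<^esub> (1, 1)"
  by (intro X.turn[OF n3 l(1) \<mu>l(1)]) (use \<xi> u half in auto)
 moreover have "insert (l 2 (7/10)) (u - {l 1 (7/10)}) = u2"
 proof -
  have "l 1 (7/10) \<notin> B" using dB(2)[of "l 1 (7/10)"] \<mu>l(1)[of 1 "7/10"] by auto
  thus ?thesis using l12 by (auto simp: u_def u2_def A_def B2_def)
 qed
 ultimately obtain H where H: "moves T u ?Zx H" "fin H u = u2" "gx.hol (track H u) = inv\<^bsub>dihedral\<^esub> (- 1, 0) \<otimes>\<^bsub>dihedral\<^esub> (1, 1)"
  by auto
 \<comment> \<open>Tokens of B inside Z may get permuted as well; this is harmless, since only the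
   final set and the support of K matter.\<close>
 obtain K where K: "moves T u Z K" "fin K u = u2"
 proof -
  have nZ: "l 0 (1/2) \<notin> Z" "l 0 (3/5) \<notin> Z" using Z(4)[of "l 0 (1/2)"] Z(4)[of "l 0 (3/5)"] \<mu>l(1)[of 0 "1/2"] \<mu>l(1)[of 0 "3/5"] by auto
  have uZ: "u \<inter> Z = insert (l 1 (7/10)) (B \<inter> Z)" "u2 \<inter> Z = insert (l 2 (7/10)) (B \<inter> Z)"
   using nZ Z(2,3) by (auto simp: u_def u2_def A_def B2_def)
  have "l 1 (7/10) \<notin> B" "l 2 (7/10) \<notin> B"
   using dB(2)[of "l 1 (7/10)"] \<mu>l(1)[of 1 "7/10"] dB(2)[of "l 2 (7/10)"] \<mu>l(1)[of 2 "7/10"] by auto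
  hence c: "card (u2 \<inter> Z) = card (u \<inter> Z)" unfolding uZ using cB(2) by simp
  have "\<exists>F. moves T u Z F \<and> fin F u = (u - Z) \<union> (u2 \<inter> Z)"
   by (rule conf_connected[OF Hausdorff Z(1) u(1,3) _ _ c]) (use u2(1) in auto)
  moreover have "(u - Z) \<union> (u2 \<inter> Z) = u2"
   using nZ Z(2,3) unfolding u_def u2_def A_def B2_def by blast
  ultimately show thesis using that by auto
 qed
 have K0: "gx.hol (track K u) = (1, 0)"
 proof -
  have "1/2 \<le> \<mu> a" if "a \<in> Z" for a using Z(4)[OF that] by simp
  thus ?thesis using X.hol_away[OF n2 K(1) u(1,2) half] by simp
 qed
 have ZF: "Z \<inter> {p \<in> topspace T. \<mu> p \<le> 3/5} = {}" using Z(4) by fastforce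
 have K2: "moves T u2 {p \<in> topspace T. \<mu> p \<le> 3/5} F" "fin F u2 = u2"
  using moves_disjoint(1)[OF K(1) F(1) ZF] fin_disjoint[OF K(1) F(1) ZF F(2)] K(2) by auto
 define y z a b y2 where "y = M u F" and "z = M u F'" and "a = M u K" and "b = M u H" and "y2 = M u2 F"
 have cl: "y \<in> carrier FG" "z \<in> carrier FG" "a \<in> carrier FG" "b \<in> carrier FG" "y2 \<in> carrier FG"
  unfolding y_def z_def a_def b_def y2_def
  using M_closed[OF F(1) u(1,2)] M_closed[OF F'(1) u(1,2)] M_closed[OF K(1) u(1,2)] M_closed[OF H(1) u(1,2)] M_closed[OF K2(1) u2(1,2)] by auto
 have ay: "a \<star> y2 = y \<star> a"
  using M_commute[OF K(1) F(1) ZF u(1,2)] F(2) K(2) by (simp add: a_def y2_def y_def)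
 define c where "c = b \<star> inv\<^sub>F a"
 have cc: "c \<in> carrier FG" using cl by (simp add: c_def)
 have cyc: "c \<star> y \<star> inv\<^sub>F c = b \<star> y2 \<star> inv\<^sub>F b"
 proof -
  have i: "inv\<^sub>F a \<star> (a \<star> w) = w" if "w \<in> carrier FG" for w
   using cl(3) that by (simp add: FG.m_assoc[symmetric])
  have e: "y \<star> (a \<star> w) = a \<star> (y2 \<star> w)" if "w \<in> carrier FG" for w
   using cl that ay by (simp add: FG.m_assoc[symmetric])
  have "inv\<^sub>F c = a \<star> inv\<^sub>F b" using cl by (simp add: c_def FG.inv_mult_group)
  thus ?thesis using cl by (simp add: c_def FG.m_assoc e i)
 qed
 obtain C where C: "moves T u ?Zx C" "fin C u = u" "M u C = b \<star> y2 \<star> inv\<^sub>F b"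
 proof (rule conj_motion[OF H(1) _ _ u(1,2), of F])
  show "moves T (fin H u) ?Zx F" unfolding H(2) by (rule moves_mono[OF K2(1)]) auto
  show "fin F (fin H u) = fin H u" using K2(2) H(2) by simp
  show thesis if "moves T u ?Zx C" "fin C u = u" "M u C = M u H \<star> M (fin H u) F \<star> inv\<^sub>F M u H" for C
   using \<open>\<And>C. _ ==> _ ==> _ ==> thesis\<close>[OF that(1,2)] that(3) H(2) by (simp add: b_def y2_def)
 qed
 have dis: "?Zx \<inter> {p \<in> topspace T. \<mu>' p \<le> 3/5} = {}" "{p \<in> topspace T. \<mu> p \<le> 3/5} \<inter> {p \<in> topspace T. \<mu>' p \<le> 3/5} = {}"
  using sep by fastforce+
 have ut: "u \<in> topspace ?T" using u by (simp add: topspace_unord_conf)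
 obtain \<psi> k where \<psi>: "\<psi> \<in> hom FG dihedral" "\<And>p. pathin ?T p ==> p 0 = u ==> p 1 = u ==> \<psi> (cls p) = gx.hol p"
  "k \<in> carrier dihedral" "\<And>p. p \<in> loops ?T base ==> \<psi> (loop_class ?T base p) = inv\<^bsub>dihedral\<^esub> k \<otimes>\<^bsub>dihedral\<^esub> gx.hol p \<otimes>\<^bsub>dihedral\<^esub> k"
  by (rule gx.ex_hol_hom_conj[OF ut]) (rule that)
 obtain \<psi>' k' where \<psi>': "\<psi>' \<in> hom FG dihedral" "\<And>p. pathin ?T p ==> p 0 = u ==> p 1 = u ==> \<psi>' (cls p) = gy.hol p"
  "k' \<in> carrier dihedral" "\<And>p. p \<in> loops ?T base ==> \<psi>' (loop_class ?T base p) = inv\<^bsub>dihedral\<^esub> k' \<otimes>\<^bsub>dihedral\<^esub> gy.hol p \<otimes>\<^bsub>dihedral\<^esub> k'"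
  by (rule gy.ex_hol_hom_conj[OF ut]) (rule that)
 have val: "\<psi> (M u F0) = gx.hol (track F0 u)" "\<psi>' (M u F0) = gy.hol (track F0 u)" if "moves T u Z0 F0" "fin F0 u = u" for F0 Z0
  using \<psi>(2) \<psi>'(2) pathin_track[OF that(1) u(1,2)] track_ends(1)[OF that(1)] track_ends(2)[of F0 u] that(2) by (simp_all add: M_def)
 show False
 proof (rule rg.no_twisted_torus[OF \<psi>(1) \<psi>'(1) _ cl(1,2) cc])
  fix x assume "x \<in> carrier FG"
  then obtain p where p: "p \<in> loops ?T base" "x = loop_class ?T base p" by (auto simp: fundamental_group_def)
  hence pl: "pathin ?T p" "p 0 = p 1" by (auto simp: loops_def)
  have e: "fst (gx.hol p) = fst (gy.hol p)"
   by (rule parity[where U = U]) (fact cx cy sep U sgn n2 pl)+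
  \<comment> \<open>Conjugation does not affect signs, so \<open>parity\<close> for loops at the
    base point decides.\<close>
  have "fst (\<psi> x) = fst k * fst k * fst (gx.hol p)" "fst (\<psi>' x) = fst k' * fst k' * fst (gy.hol p)"
   using \<psi>(3,4) \<psi>'(3,4) p by (simp_all add: fst_dihedral_mult fst_dihedral_inv del: dihedral_simps(1))
  thus "fst (\<psi> x) = fst (\<psi>' x)" using e dihedral_sign[OF \<psi>(3)] dihedral_sign[OF \<psi>'(3)] by simp
 next
  show "y \<star> z = z \<star> y" unfolding y_def z_def by (rule M_commute_closed[OF F(1) F'(1) dis(2) F(2) F'(2) u(1,2)])
  show "(c \<star> y \<star> inv\<^sub>F c) \<star> z = z \<star> (c \<star> y \<star> inv\<^sub>F c)"
   unfolding cyc C(3)[symmetric] z_def by (rule M_commute_closed[OF C(1) F'(1) dis(1) C(2) F'(2) u(1,2)])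
  show "\<psi> y = (1, - 2)" "\<psi>' y = (1, 0)" "\<psi> z = (1, 0)" "\<psi>' z = (1, - 2)"
   unfolding y_def z_def val[OF F(1,2)] val[OF F'(1,2)] F0 F(3) F'(3) by (simp_all add: dihedral_values)
  have "fst (\<psi> c) = fst (gx.hol (track H u)) * fst (gx.hol (track K u))"
  proof -
   have m: "moves T (fin H u) UNIV (mrev u K)" using moves_mono[OF moves_mrev(1)[OF K(1)]] K(2) H(2) by simp
   have H': "moves T u UNIV H" by (rule moves_mono[OF H(1)]) simp
   have mc: "moves T u UNIV (mcomp u H (mrev u K))" "fin (mcomp u H (mrev u K)) u = u"
    "track (mcomp u H (mrev u K)) u = path_join (track H u) (path_rev (track K u))"
    using moves_mcomp[OF H' m] moves_mrev(2,3)[OF K(1)] H(2) K(2) by auto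
   have "c = M u (mcomp u H (mrev u K))"
    unfolding M_mcomp[OF H' m u(1,2)] c_def b_def a_def using M_mrev[OF K(1) u(1,2)] H(2) K(2) by simp
   hence "\<psi> c = gx.hol (path_join (track H u) (path_rev (track K u)))" using val[OF mc(1,2)] mc(3) by simp
   also have "\<dots> = gx.hol (track H u) \<otimes>\<^bsub>dihedral\<^esub> inv\<^bsub>dihedral\<^esub> gx.hol (track K u)"
   proof -
    have pK: "pathin ?T (track K u)" and pH: "pathin ?T (track H u)"
     using pathin_track[OF H(1) u(1,2)] pathin_track[OF K(1) u(1,2)] by auto
    have "track H u 1 = path_rev (track K u) 0"
     using track_ends(2)[of H u] track_ends(2)[of K u] H(2) K(2) by (simp add: path_rev_def)
    thus ?thesis by (simp add: gx.hol_join[OF pH pathin_rev[OF pK]] gx.hol_rev[OF pK])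
   qed
   finally show ?thesis
    using gx.hol_closed[OF pathin_track[OF K(1) u(1,2)]] by (simp add: fst_dihedral_mult fst_dihedral_inv del: dihedral_simps(1))
  qed
  thus "fst (\<psi> c) = - 1" unfolding H(3) K0 by (simp add: dihedral_values)
 qed simp_all
qed

end

section \<open>A metric on the graph, compactness and connectedness\<close>

section \<open>The topology of a graph\<close>

definition avoids :: "'a topology => 'a set => 'a => 'a => bool" where
 "avoids T S a b \<longleftrightarrow> (\<exists>\<gamma>. pathin T \<gamma> \<and> \<gamma> 0 = a \<and> \<gamma> 1 = b \<and> \<gamma> ` {0..1} \<inter> S = {})"

lemma avoids_sym: "avoids T S a b ==> avoids T S b a"
proof -
 assume "avoids T S a b"
 then obtain \<gamma> where \<gamma>: "pathin T \<gamma>" "\<gamma> 0 = a" "\<gamma> 1 = b" "\<gamma> ` {0..1} \<inter> S = {}" by (auto simp: avoids_def)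
 have "path_rev \<gamma> t \<notin> S" if "t \<in> {0..1}" for t using \<gamma>(4) that by (auto simp: path_rev_def disjoint_iff)
 thus ?thesis unfolding avoids_def using \<gamma> pathin_rev[OF \<gamma>(1)] by (intro exI[of _ "path_rev \<gamma>"]) (auto simp: path_rev_def)
qed

lemma avoids_trans [trans]: "avoids T S a b ==> avoids T S b c ==> avoids T S a c"
proof -
 assume "avoids T S a b" "avoids T S b c"
 then obtain \<gamma> \<gamma>' where \<gamma>: "pathin T \<gamma>" "\<gamma> 0 = a" "\<gamma> 1 = b" "\<gamma> ` {0..1} \<inter> S = {}"
  and \<gamma>': "pathin T \<gamma>'" "\<gamma>' 0 = b" "\<gamma>' 1 = c" "\<gamma>' ` {0..1} \<inter> S = {}" by (auto simp: avoids_def)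
 have "path_join \<gamma> \<gamma>' t \<notin> S" if "t \<in> {0..1}" for t using \<gamma>(4) \<gamma>'(4) that by (auto simp: path_join_def disjoint_iff)
 hence "path_join \<gamma> \<gamma>' ` {0..1} \<inter> S = {}" by blast
 moreover have "pathin T (path_join \<gamma> \<gamma>')" using \<gamma> \<gamma>' by (intro pathin_join) auto
 moreover have "path_join \<gamma> \<gamma>' 0 = a" "path_join \<gamma> \<gamma>' 1 = c" using \<gamma> \<gamma>' by (auto simp: path_join_def)
 ultimately show ?thesis unfolding avoids_def by blast
qed

lemma avoids_path:
 assumes "pathin T \<gamma>" "s \<in> {0..1}" "t \<in> {0..1}" "\<And>r. min s t \<le> r ==> r \<le> max s t ==> \<gamma> r \<notin> S"
 shows "avoids T S (\<gamma> s) (\<gamma> t)"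
 unfolding avoids_def
proof (intro exI conjI)
 show "pathin T (\<lambda>r. \<gamma> (s + (t - s) * r))" by (rule pathin_subpath[OF assms(1-3)])
 have "\<gamma> (s + (t - s) * r) \<notin> S" if r: "r \<in> {0..1}" for r
 proof (rule assms(4))
  have "min s t * (1 - r) + min s t * r \<le> s * (1 - r) + t * r"
   using r by (intro add_mono mult_right_mono) auto
  thus "min s t \<le> s + (t - s) * r" by (simp add: algebra_simps)
  have "s * (1 - r) + t * r \<le> max s t * (1 - r) + max s t * r"
   using r by (intro add_mono mult_right_mono) auto
  thus "s + (t - s) * r \<le> max s t" by (simp add: algebra_simps)
 qed
 thus "(\<lambda>r. \<gamma> (s + (t - s) * r)) ` {0..1} \<inter> S = {}" by auto
qed auto

lemma path_connectedin_avoids: "path_connectedin T {p. avoids T S c p}"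
 unfolding path_connectedin
proof (intro conjI ballI)
 show "{p. avoids T S c p} \<subseteq> topspace T" using pathin_in[of T _ 1] by (auto simp: avoids_def)
 fix a b assume ab: "a \<in> {p. avoids T S c p}" "b \<in> {p. avoids T S c p}"
 hence "avoids T S a c" "avoids T S c b" by (auto intro: avoids_sym)
 hence "avoids T S a b" by (rule avoids_trans)
 then obtain \<gamma> where \<gamma>: "pathin T \<gamma>" "\<gamma> 0 = a" "\<gamma> 1 = b" "\<gamma> ` {0..1} \<inter> S = {}" by (auto simp: avoids_def)
 have "\<gamma> r \<notin> S" if "0 \<le> r" "r \<le> 1" for r using \<gamma>(4) that by (auto simp: disjoint_iff)
 hence "avoids T S (\<gamma> 0) (\<gamma> t)" if "t \<in> {0..1}" for t using that by (intro avoids_path[OF \<gamma>(1)]) auto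
 hence "\<gamma> t \<in> {p. avoids T S c p}" if "t \<in> {0..1}" for t
  using ab(1) avoids_trans[of T S c a "\<gamma> t"] that \<gamma>(2) by simp
 thus "\<exists>g. pathin T g \<and> g \<in> {0..1} \<rightarrow> {p. avoids T S c p} \<and> g 0 = a \<and> g 1 = b" using \<gamma> by blast
qed

text \<open>The factor 3 makes the distance reach its cap at a third of an edge, so the charts of
  distinct vertices are disjoint, as are the two ends of a loop.\<close>

primrec vdist :: "('e => 'v \<times> 'v) => 'v => ('v, 'e) gpt => real" where
 "vdist ends v (GV w) = (if w = v then 0 else 1)"
| "vdist ends v (GE e t) = min 1 (min (if fst (ends e) = v then 3 * t else 1) (if snd (ends e) = v then 3 * (1 - t) else 1))"

text \<open>For k = 0 and k = 1 these functions vanish off the open edge e and have quotient t on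
  it, so together they determine the edge and the parameter.\<close>

primrec ecoord :: "nat => 'e => ('v, 'e) gpt => real" where
 "ecoord k e (GV w) = 0"
| "ecoord k e (GE e' t) = (if e' = e then t ^ Suc k * (1 - t) else 0)"

locale finite_graph =
 fixes V :: "'v set" and E :: "'e set" and ends :: "'e => 'v \<times> 'v"
 assumes graph: "finite_connected_graph V E ends"
begin

abbreviation "Tg \<equiv> graph_top V E ends"
abbreviation "ch \<equiv> char_map ends"

lemma fin: "finite V" "finite E" and ends_V: "e \<in> E ==> fst (ends e) \<in> V" "e \<in> E ==> snd (ends e) \<in> V"
 using graph by (auto simp: finite_connected_graph_def)

lemma openin_graph:
 "openin Tg U \<longleftrightarrow> U \<subseteq> graph_points V E \<and> (\<forall>e\<in>E. openin (top_of_set {0..1::real}) {t \<in> {0..1}. ch e t \<in> U})"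
proof -
 have "istopology (\<lambda>U. U \<subseteq> graph_points V E \<and> (\<forall>e\<in>E. openin (top_of_set {0..1::real}) {t \<in> {0..1}. ch e t \<in> U}))"
  unfolding istopology_def
 proof (intro conjI allI impI ballI)
  fix A B e assume A: "A \<subseteq> graph_points V E \<and> (\<forall>e\<in>E. openin (top_of_set {0..1::real}) {t \<in> {0..1}. ch e t \<in> A})"
   and B: "B \<subseteq> graph_points V E \<and> (\<forall>e\<in>E. openin (top_of_set {0..1::real}) {t \<in> {0..1}. ch e t \<in> B})"
  show "A \<inter> B \<subseteq> graph_points V E" using A by blast
  assume "e \<in> E"
  moreover have "{t \<in> {0..1}. ch e t \<in> A \<inter> B} = {t \<in> {0..1}. ch e t \<in> A} \<inter> {t \<in> {0..1}. ch e t \<in> B}" by auto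
  ultimately show "openin (top_of_set {0..1}) {t \<in> {0..1}. ch e t \<in> A \<inter> B}" using A B by auto
 next
  fix K e assume K: "\<forall>A\<in>K. A \<subseteq> graph_points V E \<and> (\<forall>e\<in>E. openin (top_of_set {0..1::real}) {t \<in> {0..1}. ch e t \<in> A})"
  thus "\<Union>K \<subseteq> graph_points V E" by blast
  assume "e \<in> E"
  moreover have "{t \<in> {0..1}. ch e t \<in> \<Union>K} = \<Union>((\<lambda>A. {t \<in> {0..1}. ch e t \<in> A}) ` K)" by auto
  ultimately show "openin (top_of_set {0..1}) {t \<in> {0..1}. ch e t \<in> \<Union>K}" using K by auto
 qed
 thus ?thesis by (simp add: graph_top_def)
qed

lemma ch_points: "e \<in> E ==> t \<in> {0..1} ==> ch e t \<in> graph_points V E"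
 using ends_V by (auto simp: char_map_def graph_points_def)

lemma topspace_graph [simp]: "topspace Tg = graph_points V E"
proof -
 have "{t \<in> {0..1}. ch e t \<in> graph_points V E} = {0..1}" if "e \<in> E" for e using ch_points[OF that] by auto
 hence "openin Tg (graph_points V E)" by (simp add: openin_graph)
 thus ?thesis using openin_subset[of Tg] openin_graph by (meson openin_topspace subset_antisym)
qed

lemma pathin_ch: "e \<in> E ==> pathin Tg (ch e)"
 unfolding pathin_def continuous_map_def using ch_points openin_graph by auto

lemma continuous_map_graph:
 assumes "\<And>e. e \<in> E ==> continuous_on {0..1} (\<lambda>t. f (ch e t))"
 shows "continuous_map Tg euclideanreal f"
 unfolding continuous_map_def
proof (intro conjI allI impI)
 fix U :: "real set" assume "openin euclideanreal U"
 hence U: "open U" by simp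
 have "openin (top_of_set {0..1}) {t \<in> {0..1}. ch e t \<in> {x \<in> graph_points V E. f x \<in> U}}" if e: "e \<in> E" for e
 proof -
  have "{t \<in> {0..1}. ch e t \<in> {x \<in> graph_points V E. f x \<in> U}} = {0..1} \<inter> (\<lambda>t. f (ch e t)) -` U" using ch_points[OF e] by auto
  thus ?thesis using continuous_openin_preimage_gen[OF assms[OF e] U] by simp
 qed
 thus "openin Tg {x \<in> topspace Tg. f x \<in> U}" by (simp add: openin_graph)
qed simp

lemma vdist_ch: "t \<in> {0..1} ==> vdist ends v (ch e t) =
  min 1 (min (if fst (ends e) = v then 3 * t else 1) (if snd (ends e) = v then 3 * (1 - t) else 1))"
 by (auto simp: char_map_def)

lemma ecoord_ch: "ecoord k e' (ch e t) = (if e = e' then t ^ Suc k * (1 - t) else 0)"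
 by (auto simp: char_map_def)

lemma continuous_features: "continuous_on {0..1} (\<lambda>t. vdist ends v (ch e t))" "continuous_on {0..1} (\<lambda>t. ecoord k e' (ch e t))"
proof -
 have "continuous_on {0..1} (\<lambda>t::real. min 1 (min (if fst (ends e) = v then 3 * t else 1) (if snd (ends e) = v then 3 * (1 - t) else 1)))"
  by (cases "fst (ends e) = v"; cases "snd (ends e) = v") (auto intro!: continuous_intros)
 thus "continuous_on {0..1} (\<lambda>t. vdist ends v (ch e t))" by (rule continuous_on_eq) (simp add: vdist_ch)
 show "continuous_on {0..1} (\<lambda>t. ecoord k e' (ch e t))"
  unfolding ecoord_ch by (cases "e = e'") (auto intro!: continuous_intros)
qed

lemma continuous_vdist: "continuous_map Tg euclideanreal (vdist ends v)"
 by (intro continuous_map_graph continuous_features)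

text \<open>Finitely many continuous functions that separate points, summed up: the
  \<open>vdist\<close> distinguish vertices, the \<open>ecoord\<close> distinguish interior points
  of edges.\<close>

definition gd :: "('v, 'e) gpt => ('v, 'e) gpt => real" where
 "gd p q = (\<Sum>v\<in>V. \<bar>vdist ends v p - vdist ends v q\<bar>) + (\<Sum>e\<in>E. \<Sum>k\<in>{0,1}. \<bar>ecoord k e p - ecoord k e q\<bar>)"

lemma vdist_lipschitz: "v \<in> V ==> \<bar>vdist ends v p - vdist ends v q\<bar> \<le> gd p q"
proof -
 assume "v \<in> V"
 hence "\<bar>vdist ends v p - vdist ends v q\<bar> \<le> (\<Sum>v\<in>V. \<bar>vdist ends v p - vdist ends v q\<bar>)"
  by (intro member_le_sum fin) auto
 moreover have "0 \<le> (\<Sum>e\<in>E. \<Sum>k\<in>{0,1}. \<bar>ecoord k e p - ecoord k e q\<bar>)" by (intro sum_nonneg) auto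
 ultimately show ?thesis by (simp add: gd_def)
qed

lemma gd_zero:
 assumes p: "p \<in> graph_points V E" and q: "q \<in> graph_points V E" and 0: "gd p q = 0"
 shows "p = q"
proof -
 have nn: "0 \<le> (\<Sum>v\<in>V. \<bar>vdist ends v p - vdist ends v q\<bar>)" "0 \<le> (\<Sum>e\<in>E. \<Sum>k\<in>{0,1::nat}. \<bar>ecoord k e p - ecoord k e q\<bar>)"
  by (intro sum_nonneg; simp)+
 have v: "vdist ends v p = vdist ends v q" if "v \<in> V" for v
  using vdist_lipschitz[OF that, of p q] 0 by simp
 have "(\<Sum>e\<in>E. \<Sum>k\<in>{0,1::nat}. \<bar>ecoord k e p - ecoord k e q\<bar>) = 0" using 0 nn unfolding gd_def by linarith
 hence "\<forall>e\<in>E. (\<Sum>k\<in>{0,1::nat}. \<bar>ecoord k e p - ecoord k e q\<bar>) = 0" using fin(2) by (subst (asm) sum_nonneg_eq_0_iff) auto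
 hence e: "ecoord 0 e p = ecoord 0 e q" "ecoord 1 e p = ecoord 1 e q" if "e \<in> E" for e using that by fastforce+
 show ?thesis
 proof (cases p)
  case (GV w)
  hence w: "w \<in> V" using p by (auto simp: graph_points_def)
  show ?thesis
  proof (cases q)
   case (GV w')
   thus ?thesis using v[OF w] \<open>p = GV w\<close> by (auto split: if_splits)
  next
   case (GE f t)
   hence "f \<in> E" "0 < t" "t < 1" using q by (auto simp: graph_points_def)
   thus ?thesis using e(1)[of f] \<open>p = GV w\<close> GE by auto
  qed
 next
  case (GE f t)
  hence f: "f \<in> E" "0 < t" "t < 1" using p by (auto simp: graph_points_def)
  show ?thesis
  proof (cases q)
   case (GV w')
   thus ?thesis using e(1)[OF f(1)] GE f by auto
  next
   case (GE f' s)
   have a: "t * (1 - t) = (if f' = f then s * (1 - s) else 0)" "t ^ 2 * (1 - t) = (if f' = f then s ^ 2 * (1 - s) else 0)"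
    using e[OF f(1)] GE \<open>p = GE f t\<close> by (auto simp: power2_eq_square)
   have pos: "t * (1 - t) > 0" using f by simp
   hence f': "f' = f" using a(1) by (metis less_irrefl)
   have "t * (t * (1 - t)) = s * (t * (1 - t))" using a unfolding f' by (simp add: power2_eq_square mult.assoc)
   thus ?thesis using pos f GE \<open>p = GE f t\<close> f' by simp
  qed
 qed
qed

lemma continuous_gd: "continuous_map Tg euclideanreal (gd p)"
 unfolding gd_def by (intro continuous_map_graph continuous_intros continuous_features)

lemma gd_tri: "gd a c \<le> gd a b + gd b c"
proof -
 have "gd a c \<le> (\<Sum>v\<in>V. \<bar>vdist ends v a - vdist ends v b\<bar> + \<bar>vdist ends v b - vdist ends v c\<bar>) +
  (\<Sum>e\<in>E. \<Sum>k\<in>{0,1}. \<bar>ecoord k e a - ecoord k e b\<bar> + \<bar>ecoord k e b - ecoord k e c\<bar>)"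
  unfolding gd_def by (intro add_mono sum_mono) auto
 thus ?thesis by (simp only: gd_def sum.distrib)
qed

text \<open>Dividing by \<eta> keeps a vertex distance 1-Lipschitz after it has been stretched to
  reach its cap at radius \<eta>, as \<open>free_arc\<close> does.\<close>

lemma metric_conf_graph:
 assumes "\<eta> > 0"
 shows "metric_conf Tg (\<lambda>p q. gd p q / \<eta>)"
proof
 fix a b c :: "('v, 'e) gpt" and r :: real
 show "0 \<le> gd a b / \<eta>" using assms unfolding gd_def by (intro divide_nonneg_pos add_nonneg_nonneg sum_nonneg) auto
 show "gd a b / \<eta> = gd b a / \<eta>" unfolding gd_def by (simp only: abs_minus_commute)
 show "gd a c / \<eta> \<le> gd a b / \<eta> + gd b c / \<eta>"
  using gd_tri[of a c b] assms by (simp add: add_divide_distrib[symmetric] divide_right_mono)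
 show "gd a b / \<eta> = 0 \<longleftrightarrow> a = b" if "a \<in> topspace Tg" "b \<in> topspace Tg"
  using gd_zero[of a b] that assms by (auto simp: gd_def)
 have "openin Tg {b \<in> topspace Tg. gd a b \<in> {..<r * \<eta>}}" by (rule openin_continuous_map_preimage[OF continuous_gd]) simp
 thus "openin Tg {b \<in> topspace Tg. gd a b / \<eta> < r}" using assms by (simp add: pos_divide_less_eq)
qed

lemma compact_graph: "compact_space Tg"
proof -
 have "graph_points V E = GV ` V \<union> \<Union>((\<lambda>e. ch e ` {0..1}) ` E)"
 proof (intro subset_antisym subsetI)
  fix p assume "p \<in> graph_points V E"
  then consider "p \<in> GV ` V" | e t where "p = GE e t" "e \<in> E" "0 < t" "t < 1" by (auto simp: graph_points_def)
  thus "p \<in> GV ` V \<union> \<Union>((\<lambda>e. ch e ` {0..1}) ` E)"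
  proof cases
   case 2
   hence "p = ch e t" "t \<in> {0..1}" by (auto simp: char_map_def)
   thus ?thesis using 2 by blast
  qed blast
 next
  fix p assume "p \<in> GV ` V \<union> \<Union>((\<lambda>e. ch e ` {0..1}) ` E)"
  then consider "p \<in> GV ` V" | e t where "e \<in> E" "t \<in> {0..1}" "p = ch e t" by blast
  thus "p \<in> graph_points V E" by cases (simp add: graph_points_def, simp only: ch_points)
 qed
 moreover have "compactin Tg (ch e ` {0..1})" if "e \<in> E" for e
  using image_compactin[of "top_of_set {0..1::real}" "{0..1}" Tg "ch e"] pathin_ch[OF that]
  by (simp add: pathin_def compactin_subtopology)
 hence "compactin Tg (\<Union>((\<lambda>e. ch e ` {0..1}) ` E))" using fin(2) by (intro compactin_Union) auto
 moreover have "compactin Tg (GV ` V)" using fin(1) by (intro finite_imp_compactin) (auto simp: graph_points_def)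
 ultimately have "compactin Tg (topspace Tg)" unfolding topspace_graph by (simp only: compactin_Un)
 thus ?thesis by (simp add: compact_space_def)
qed

text \<open>The complement of U is compact and \<open>gd p\<close> is continuous and positive on it,
  hence bounded below.\<close>

lemma ball_in_open:
 assumes U: "openin Tg U" and p: "p \<in> U" and \<eta>: "\<eta> > 0"
 shows "\<exists>\<rho>>0. \<forall>q\<in>topspace Tg. gd p q / \<eta> < \<rho> --> q \<in> U"
proof -
 let ?K = "topspace Tg - U"
 have pT: "p \<in> topspace Tg" using openin_subset[OF U] p by blast
 have "compactin Tg ?K" using closedin_compact_space[OF compact_graph] U by (simp add: openin_closedin_eq)
 hence "compactin euclideanreal (gd p ` ?K)" by (rule image_compactin[OF _ continuous_gd])
 hence c: "compact (gd p ` ?K)" by simp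
 show ?thesis
 proof (cases "?K = {}")
  case True
  thus ?thesis by (intro exI[of _ 1]) auto
 next
  case False
  then obtain m where m: "m \<in> gd p ` ?K" "\<forall>x\<in>gd p ` ?K. m \<le> x" using compact_attains_inf[OF c] by blast
  obtain q where q: "q \<in> ?K" "m = gd p q" using m(1) by blast
  have "gd p q \<ge> 0" unfolding gd_def by (intro add_nonneg_nonneg sum_nonneg) auto
  moreover have "gd p q \<noteq> 0" using q(1) p pT gd_zero[of p q] by auto
  ultimately have "m > 0" using q(2) by simp
  moreover have "q \<in> U" if "q \<in> topspace Tg" "gd p q / \<eta> < m / \<eta>" for q
  proof (rule ccontr)
   assume "q \<notin> U"
   hence "m \<le> gd p q" using m(2) that(1) by blast
   thus False using that(2) \<eta> by (simp add: divide_less_cancel)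
  qed
  ultimately show ?thesis using \<eta> by (intro exI[of _ "m / \<eta>"]) auto
 qed
qed

lemma path_connected_graph: "path_connected_space Tg"
proof -
 have seg: "avoids Tg {} (ch e s) (ch e t)" if "e \<in> E" "s \<in> {0..1}" "t \<in> {0..1}" for e s t
  by (rule avoids_path[OF pathin_ch[OF that(1)] that(2,3)]) simp
 have adj: "avoids Tg {} (GV a) (GV b)" if g: "graph_adj E ends a b" for a b
 proof -
  obtain e where e: "e \<in> E" "ends e = (a, b) \<or> ends e = (b, a)" using g by (auto simp: graph_adj_def)
  thus ?thesis using seg[OF e(1), of 0 1] seg[OF e(1), of 1 0] by (auto simp: char_map_def)
 qed
 have ref: "avoids Tg {} p p" if "p \<in> topspace Tg" for p
  unfolding avoids_def by (intro exI[of _ "\<lambda>_. p"]) (use that in \<open>simp add: pathin_const\<close>)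
 have vv: "avoids Tg {} (GV a) (GV b)" if "a \<in> V" "b \<in> V" for a b
 proof -
  have "(graph_adj E ends)\<^sup>*\<^sup>* a b" using graph that by (simp add: finite_connected_graph_def)
  thus ?thesis
  proof (induction rule: rtranclp_induct)
   case base
   thus ?case using ref that by (simp add: graph_points_def)
  next
   case (step y z)
   show ?case by (rule avoids_trans[OF step(3) adj[OF step(2)]])
  qed
 qed
 have pv: "\<exists>a\<in>V. avoids Tg {} p (GV a)" if "p \<in> topspace Tg" for p
 proof (cases p)
  case (GV a)
  thus ?thesis using that ref by (auto simp: graph_points_def)
 next
  case (GE e t)
  hence e: "e \<in> E" "0 < t" "t < 1" using that by (auto simp: graph_points_def)
  hence "avoids Tg {} p (GV (fst (ends e)))" using seg[OF e(1), of t 0] GE by (simp add: char_map_def)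
  thus ?thesis using ends_V e(1) by blast
 qed
 have "avoids Tg {} p q" if pq: "p \<in> topspace Tg" "q \<in> topspace Tg" for p q
 proof -
  obtain a b where a: "a \<in> V" "avoids Tg {} p (GV a)" and b: "b \<in> V" "avoids Tg {} q (GV b)" using pv[OF pq(1)] pv[OF pq(2)] by blast
  show ?thesis by (rule avoids_trans[OF avoids_trans[OF a(2) vv[OF a(1) b(1)]] avoids_sym[OF b(2)]])
 qed
 thus ?thesis unfolding path_connected_space_def avoids_def by blast
qed

lemma metric_braid_graph:
 assumes "base \<in> topspace (unord_conf Tg n)" "group (fundamental_group (unord_conf Tg n) base)" "\<eta> > 0"
 shows "metric_braid Tg (\<lambda>p q. gd p q / \<eta>) n base"
proof -
 interpret metric_conf Tg "\<lambda>p q. gd p q / \<eta>" by (rule metric_conf_graph[OF assms(3)])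
 show ?thesis
  by (intro metric_braid.intro braid.intro based_space.intro metric_conf_axioms assms
    path_connected_space_conf[OF Hausdorff path_connected_graph])
qed

end

section \<open>The two tripod configurations expressed by half-edges\<close>

section \<open>Half-edges and the two criteria\<close>

context finite_graph
begin

text \<open>The flag names an end of the edge, so that a loop counts twice at its vertex.\<close>

definition half_edges :: "'v => ('e \<times> bool) set" where
 "half_edges v = {(e, b). e \<in> E \<and> (if b then snd (ends e) else fst (ends e)) = v}"

text \<open>Division by 3 undoes the factor in \<open>vdist\<close>: the distance from the vertex at
  time t is \<eta> t.\<close>

definition leg :: "real => 'e \<times> bool => real => ('v, 'e) gpt" where
 "leg \<eta> h t = ch (fst h) (if snd h then 1 - \<eta> * t / 3 else \<eta> * t / 3)"

text \<open>The midpoint is left out so that the two halves of an edge are open and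
  disjoint.\<close>

definition half_open :: "'e \<times> bool => ('v, 'e) gpt set" where
 "half_open h = {GE (fst h) t | t. 0 < t \<and> t < 1 \<and> (t < 1/2 \<longleftrightarrow> \<not> snd h) \<and> t \<noteq> 1/2}"

lemma half_edgesD: "h \<in> half_edges v ==> fst h \<in> E" "h \<in> half_edges v ==> v \<in> V"
 using ends_V by (auto simp: half_edges_def split: if_splits)

context
 fixes v :: 'v and h :: "'e \<times> bool" and \<eta> :: real
 assumes h: "h \<in> half_edges v" and \<eta>: "0 < \<eta>" "\<eta> \<le> 1"
begin

lemma leg_range: "t \<in> {0..1} ==> 0 \<le> \<eta> * t \<and> \<eta> * t \<le> 1"
 using \<eta> by (auto intro: mult_le_one)

lemma leg_zero: "leg \<eta> h 0 = GV v"
 using h by (cases "snd h") (auto simp: leg_def char_map_def half_edges_def)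

lemma leg_half: "0 < t ==> t \<le> 1 ==> leg \<eta> h t \<in> half_open h"
proof -
 assume t: "0 < t" "t \<le> 1"
 define x where "x = \<eta> * t / 3"
 have "0 < x" "x \<le> 1/3" using leg_range[of t] \<eta> t by (auto simp: x_def)
 thus ?thesis unfolding leg_def x_def[symmetric] by (cases "snd h") (auto simp: char_map_def half_open_def)
qed

lemma vdist_leg: "t \<in> {0..1} ==> vdist ends v (leg \<eta> h t) = \<eta> * t"
proof -
 assume t: "t \<in> {0..1}"
 define x where "x = \<eta> * t"
 have "0 \<le> x" "x \<le> 1" using leg_range[OF t] by (auto simp: x_def)
 thus ?thesis unfolding leg_def x_def[symmetric] using h by (cases "snd h") (auto simp: vdist_ch half_edges_def min_def)
qed

lemma pathin_leg: "pathin Tg (leg \<eta> h)"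
proof -
 have "pathin Tg (\<lambda>s. ch (fst h) (a + (b - a) * s))" if "a \<in> {0..1}" "b \<in> {0..1}" for a b
  by (rule pathin_subpath[OF pathin_ch[OF half_edgesD(1)[OF h]] that])
 from this[of 0 "\<eta> / 3"] this[of 1 "1 - \<eta> / 3"] show ?thesis
  using \<eta> unfolding leg_def by (cases "snd h") (simp_all add: algebra_simps)
qed

end

lemma half_open_disjoint: "h \<noteq> h' ==> half_open h \<inter> half_open h' = {}"
 by (cases h; cases h') (auto simp: half_open_def)

lemma tripod_leg:
 assumes h: "\<And>i. i < 3 ==> h i \<in> half_edges v" "inj_on h {..<3::nat}" and \<eta>: "0 < \<eta>" "\<eta> \<le> 1"
 shows "tripod Tg (\<lambda>i. leg \<eta> (h i))"
 unfolding tripod_def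
proof (intro conjI allI impI ballI)
 fix i j s t assume i: "i < (3::nat)" and j: "j < (3::nat)" and s: "s \<in> {0..1::real}" and t: "t \<in> {0..1::real}"
 note z = leg_zero[OF h(1)[OF i] \<eta>] leg_zero[OF h(1)[OF j] \<eta>]
 note v = vdist_leg[OF h(1)[OF i] \<eta> s] vdist_leg[OF h(1)[OF j] \<eta> t]
 show "leg \<eta> (h i) s = leg \<eta> (h j) t \<longleftrightarrow> s = t \<and> (i = j \<or> s = 0)"
 proof
  assume e: "leg \<eta> (h i) s = leg \<eta> (h j) t"
  hence st: "s = t" using v \<eta> by simp
  show "s = t \<and> (i = j \<or> s = 0)"
  proof (rule ccontr)
   assume "\<not> (s = t \<and> (i = j \<or> s = 0))"
   hence ij: "i \<noteq> j" "s \<noteq> 0" using st by auto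
   hence "h i \<noteq> h j" using h(2) i j by (auto simp: inj_on_def)
   hence "half_open (h i) \<inter> half_open (h j) = {}" by (rule half_open_disjoint)
   thus False using leg_half[OF h(1)[OF i] \<eta>, of s] leg_half[OF h(1)[OF j] \<eta>, of t] s t ij st e by auto
  qed
 next
  assume "s = t \<and> (i = j \<or> s = 0)"
  thus "leg \<eta> (h i) s = leg \<eta> (h j) t" using z by auto
 qed
qed (rule pathin_leg[OF h(1) \<eta>])

lemma vdist_zero: "p \<in> graph_points V E ==> vdist ends v p = 0 \<longleftrightarrow> p = GV v"
 by (cases p) (auto simp: graph_points_def min_def)

lemma vdist_bounds: "p \<in> graph_points V E ==> 0 \<le> vdist ends v p \<and> vdist ends v p \<le> 1"
 by (cases p) (auto simp: graph_points_def)

lemma vdist_apart: "p \<in> graph_points V E ==> v \<noteq> w ==> vdist ends v p < 1 ==> vdist ends w p = 1"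
 by (cases p) (auto simp: graph_points_def min_def split: if_splits)

lemma near_vertex:
 assumes "p \<in> graph_points V E" "0 < vdist ends v p" "vdist ends v p < 1"
 shows "\<exists>h\<in>half_edges v. p \<in> half_open h"
proof (cases p)
 case (GE e t)
 hence e: "e \<in> E" "0 < t" "t < 1" using assms(1) by (auto simp: graph_points_def)
 have "fst (ends e) = v \<and> t < 1/2 \<or> snd (ends e) = v \<and> t > 1/2"
  using assms(3) GE by (auto simp: min_less_iff_disj split: if_splits)
 thus ?thesis
 proof
  assume "fst (ends e) = v \<and> t < 1/2"
  thus ?thesis using e GE by (intro bexI[of _ "(e, False)"]) (auto simp: half_edges_def half_open_def)
 next
  assume "snd (ends e) = v \<and> t > 1/2"
  thus ?thesis using e GE by (intro bexI[of _ "(e, True)"]) (auto simp: half_edges_def half_open_def)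
 qed
qed (use assms in \<open>auto split: if_splits\<close>)

lemma open_edge:
 assumes "open A" "A \<subseteq> {0<..<1}" "e \<in> E"
 shows "openin Tg {GE e t | t. t \<in> A}"
proof -
 have "openin (top_of_set {0..1}) {t \<in> {0..1}. ch f t \<in> {GE e t | t. t \<in> A}}" for f
 proof -
  have "{t \<in> {0..1}. ch f t \<in> {GE e t | t. t \<in> A}} = (if f = e then {0..1} \<inter> A else {})"
   using assms(2) by (auto simp: char_map_def)
  thus ?thesis using openin_open_Int[OF assms(1), of "{0..1}"] by simp
 qed
 thus ?thesis using assms(2,3) by (auto simp: openin_graph graph_points_def)
qed

lemma openin_half:
 assumes "fst h \<in> E"
 shows "openin Tg (half_open h)"
proof -
 have "half_open h = {GE (fst h) t | t. t \<in> (if snd h then {1/2<..<1} else {0<..<1/2})}" by (auto simp: half_open_def)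
 moreover have "open (if snd h then {1/2<..<1} else {0<..<1/2::real})" by simp
 moreover have "(if snd h then {1/2<..<1} else {0<..<1/2::real}) \<subseteq> {0<..<1}" by auto
 ultimately show ?thesis using open_edge[OF _ _ assms] by presburger
qed

text \<open>On a compact path missing v the distance from v has a positive minimum. Avoiding a
  vertex thus becomes avoiding a ball, which leaves room for the support of a motion at that
  vertex.\<close>

lemma path_distance:
 assumes "avoids Tg {GV v} a b"
 obtains m where "0 < m" "m \<le> 1" "avoids Tg {p. vdist ends v p < m} a b"
proof -
 obtain \<gamma> where \<gamma>: "pathin Tg \<gamma>" "\<gamma> 0 = a" "\<gamma> 1 = b" "\<gamma> ` {0..1} \<inter> {GV v} = {}" using assms by (auto simp: avoids_def)
 have "continuous_on {0..1} (\<lambda>t. vdist ends v (\<gamma> t))"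
  using continuous_map_compose[OF \<gamma>(1)[unfolded pathin_def] continuous_vdist, unfolded o_def] by simp
 hence "compact ((\<lambda>t. vdist ends v (\<gamma> t)) ` {0..1})" by (rule compact_continuous_image) simp
 then obtain m where m: "m \<in> (\<lambda>t. vdist ends v (\<gamma> t)) ` {0..1}" "\<forall>x\<in>(\<lambda>t. vdist ends v (\<gamma> t)) ` {0..1}. m \<le> x"
  using compact_attains_inf by (metis atLeastAtMost_iff empty_iff image_eqI order_refl zero_le_one)
 obtain t where t: "t \<in> {0..1}" "m = vdist ends v (\<gamma> t)" using m(1) by auto
 have p: "\<gamma> t \<in> graph_points V E" using pathin_in[OF \<gamma>(1), of t] t(1) by auto
 have "\<gamma> t \<noteq> GV v" using t(1) \<gamma>(4) by blast
 note p = p this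
 have "0 < m" "m \<le> 1" using vdist_zero[OF p(1), of v] vdist_bounds[OF p(1), of v] p(2) t(2) by auto
 moreover have "avoids Tg {p. vdist ends v p < m} a b"
  unfolding avoids_def using \<gamma>(1-3) m(2) by (intro exI[of _ \<gamma>]) (auto simp: not_less)
 ultimately show thesis using that by blast
qed

lemma avoids_mono: "avoids T S a b ==> S' \<subseteq> S ==> avoids T S' a b"
 unfolding avoids_def by blast

definition essential :: "'v => bool" where
 "essential v \<longleftrightarrow> (\<exists>h. (\<forall>i<3. h i \<in> half_edges v) \<and> inj_on h {..<3::nat})"

theorem three_essential:
 assumes n: "n \<ge> 5" and base: "base \<in> topspace (unord_conf Tg n)"
  and v: "essential x" "essential y" "essential z" "x \<noteq> y" "x \<noteq> z" "y \<noteq> z"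
  and conn: "avoids Tg {GV x} (GV y) (GV z)" "avoids Tg {GV y} (GV x) (GV z)" "avoids Tg {GV z} (GV x) (GV y)"
 shows "\<not> is_raag (fundamental_group (unord_conf Tg n) base)"
proof
 assume r: "is_raag (fundamental_group (unord_conf Tg n) base)"
 hence "group (fundamental_group (unord_conf Tg n) base)" by (simp add: is_raag_def)
 then interpret metric_braid Tg "\<lambda>p q. gd p q / 1" n base using base by (intro metric_braid_graph) auto
 obtain m1 m2 m3 where m: "0 < m1" "avoids Tg {p. vdist ends x p < m1} (GV y) (GV z)" "0 < m2" "avoids Tg {p. vdist ends y p < m2} (GV x) (GV z)"
  "0 < m3" "avoids Tg {p. vdist ends z p < m3} (GV x) (GV y)"
  using path_distance[OF conn(1)] path_distance[OF conn(2)] path_distance[OF conn(3)] by metis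
 \<comment> \<open>Half of the minimum, so that the closed balls containing the legs lie in the open
   balls missed by the connecting paths and are pairwise disjoint.\<close>
 define \<eta> where "\<eta> = min (min m1 m2) (min m3 1) / 2"
 have \<eta>: "0 < \<eta>" "\<eta> < m1" "\<eta> < m2" "\<eta> < m3" "\<eta> < 1" using m by (auto simp: \<eta>_def)
 hence \<eta>1: "\<eta> \<le> 1" by simp
 obtain hx hy hz where h: "\<forall>i<3. hx i \<in> half_edges x" "inj_on hx {..<3::nat}" "\<forall>i<3. hy i \<in> half_edges y" "inj_on hy {..<3::nat}"
  "\<forall>i<3. hz i \<in> half_edges z" "inj_on hz {..<3::nat}" using v(1-3) unfolding essential_def by blast
 let ?l = "\<lambda>h i. leg \<eta> (h i)"
 have tri: "tripod Tg (?l hx)" "tripod Tg (?l hy)" "tripod Tg (?l hz)" using h \<eta>(1) \<eta>1 by (auto intro!: tripod_leg)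
 let ?S = "\<lambda>w. {p. vdist ends w p \<le> \<eta>}"
 have lg: "legs (?l h) \<subseteq> ?S w" "\<And>w'. w' \<noteq> w ==> legs (?l h) \<subseteq> {p. avoids Tg (?S w') (GV w) p}"
  if hh: "\<forall>i<3. h i \<in> half_edges w" for h w
 proof -
  have v: "vdist ends w (?l h i t) \<le> \<eta>" "?l h i t \<in> graph_points V E" if i: "i < 3" and t: "t \<in> {0..1}" for i t
   using vdist_leg[OF hh[rule_format, OF i] \<eta>(1) \<eta>1 t] \<eta> t mult_left_mono[of t 1 \<eta>]
    pathin_in[OF pathin_leg[OF hh[rule_format, OF i] \<eta>(1) \<eta>1], of t] by auto
  thus "legs (?l h) \<subseteq> ?S w" by (auto simp: legs_def)
  fix w' assume w': "w' \<noteq> w"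
  have "avoids Tg (?S w') (GV w) (?l h i t)" if i: "i < 3" and t: "t \<in> {0..1}" for i t
  proof -
   have "?l h i r \<notin> ?S w'" if "r \<in> {0..1}" for r
    using v[OF i that] vdist_apart[of "?l h i r" w w'] w' \<eta>(5) by auto
   hence "avoids Tg (?S w') (?l h i 0) (?l h i t)" using t
    by (intro avoids_path[OF pathin_leg[OF hh[rule_format, OF i] \<eta>(1) \<eta>1]]) auto
   thus ?thesis using leg_zero[OF hh[rule_format, OF i] \<eta>(1) \<eta>1] by simp
  qed
  thus "legs (?l h) \<subseteq> {p. avoids Tg (?S w') (GV w) p}" by (auto simp: legs_def)
 qed
 have sub: "?S w \<subseteq> {p. vdist ends w p < m}" if "\<eta> < m" for w m using that by auto
 have far: "legs (?l h) \<subseteq> {p. avoids Tg (?S w) (GV a) p}"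
  if "\<forall>i<3. h i \<in> half_edges b" "avoids Tg {p. vdist ends w p < m} (GV a) (GV b)" "\<eta> < m" "w \<noteq> b" for h a b w m
  using lg(2)[OF that(1,4)] avoids_trans[OF avoids_mono[OF that(2) sub[OF that(3)]]] by blast
 have dis: "{p. avoids Tg (?S w) c p} \<inter> ?S w = {}" for w c
 proof -
  have "p \<notin> ?S w" if av: "avoids Tg (?S w) c p" for p
  proof -
   obtain \<gamma> :: "real => ('v, 'e) gpt" where \<gamma>: "\<gamma> 1 = p" "\<gamma> ` {0..1} \<inter> ?S w = {}" using av unfolding avoids_def by blast
   have "\<gamma> 1 \<in> \<gamma> ` {0..1}" by (rule imageI) simp
   thus ?thesis using \<gamma> by blast
  qed
  thus ?thesis by blast
 qed
 note P = path_connectedin_avoids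
 have "\<not> is_raag (fundamental_group (unord_conf Tg n) base)"
 proof (rule no_three_tripods[OF n tri P[of Tg "?S x" "GV y"] P[of Tg "?S y" "GV x"] P[of Tg "?S z" "GV x"]])
  show "legs (?l hy) \<subseteq> {p. avoids Tg (?S x) (GV y) p}" by (rule lg(2)[OF h(3)]) (use v in auto)
  show "legs (?l hz) \<subseteq> {p. avoids Tg (?S x) (GV y) p}" by (rule far[OF h(5) m(2)]) (use \<eta> v in auto)
  show "legs (?l hx) \<subseteq> {p. avoids Tg (?S y) (GV x) p}" by (rule lg(2)[OF h(1)]) (use v in auto)
  show "legs (?l hz) \<subseteq> {p. avoids Tg (?S y) (GV x) p}" by (rule far[OF h(5) m(4)]) (use \<eta> v in auto)
  show "legs (?l hx) \<subseteq> {p. avoids Tg (?S z) (GV x) p}" by (rule lg(2)[OF h(1)]) (use v in auto)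
  show "legs (?l hy) \<subseteq> {p. avoids Tg (?S z) (GV x) p}" by (rule far[OF h(3) m(6)]) (use \<eta> v in auto)
  show "{p. avoids Tg (?S x) (GV y) p} \<inter> legs (?l hx) = {}" using dis[of x "GV y"] lg(1)[OF h(1)] by blast
  show "{p. avoids Tg (?S y) (GV x) p} \<inter> legs (?l hy) = {}" using dis[of y "GV x"] lg(1)[OF h(3)] by blast
  show "{p. avoids Tg (?S z) (GV x) p} \<inter> legs (?l hz) = {}" using dis[of z "GV x"] lg(1)[OF h(5)] by blast
 qed
 thus False using r by simp
qed

text \<open>B and N are the edges and inner vertices of the arc from x to y. \<open>BN\<close> makes
  the arc without its ends both open and closed in the graph away from x and y, which is the
  hypothesis on U in \<open>no_free_arc\<close>. The return path required there comes from
  \<open>conn\<close>.\<close>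

theorem free_arc:
 assumes n: "n \<ge> 5" and base: "base \<in> topspace (unord_conf Tg n)" and xy: "x \<noteq> y" "x \<notin> N" "y \<notin> N"
  and hx: "\<And>i. i < 3 ==> hx i \<in> half_edges x" "inj_on hx {..<3::nat}" and hy: "\<And>i. i < 3 ==> hy i \<in> half_edges y" "inj_on hy {..<3::nat}"
  and B: "fst (hx 1) \<in> B" "fst (hx 0) \<notin> B" "fst (hx 2) \<notin> B" "fst (hy 1) \<in> B" "fst (hy 0) \<notin> B" "fst (hy 2) \<notin> B"
  and BN: "\<And>e. e \<in> B ==> e \<in> E ==> fst (ends e) \<in> N \<union> {x, y} \<and> snd (ends e) \<in> N \<union> {x, y}"
   "\<And>e. e \<in> E ==> e \<notin> B ==> fst (ends e) \<notin> N \<and> snd (ends e) \<notin> N"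
  and conn: "avoids Tg {GV x} (leg 1 (hx 1) 1) (leg 1 (hx 2) 1)"
 shows "\<not> is_raag (fundamental_group (unord_conf Tg n) base)"
proof
 assume r: "is_raag (fundamental_group (unord_conf Tg n) base)"
 hence gr: "group (fundamental_group (unord_conf Tg n) base)" by (simp add: is_raag_def)
 obtain \<eta> where \<eta>: "0 < \<eta>" "\<eta> \<le> 1" "avoids Tg {p. vdist ends x p < \<eta>} (leg 1 (hx 1) 1) (leg 1 (hx 2) 1)"
  using path_distance[OF conn] by blast
 interpret metric_braid Tg "\<lambda>p q. gd p q / \<eta>" n base by (rule metric_braid_graph[OF base gr \<eta>(1)])
 have xV: "x \<in> V" "y \<in> V" using half_edgesD(2)[OF hx(1)[of 0]] half_edgesD(2)[OF hy(1)[of 0]] by auto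
 define U where "U = GV ` N \<union> {GE e t | e t. e \<in> B}"
 define \<mu> where "\<mu> p = min 1 (vdist ends x p / \<eta>)" for p
 let ?\<mu>' = "vdist ends y"
 \<comment> \<open>The translation part is 1 only on the third leg. The legs get the labels (1, 0),
   (- 1, 0) and (1, 1), of which the last two do not commute.\<close>
 define \<xi> where "\<xi> h p = (if p \<in> U then - 1 else 1 :: int, if p \<in> half_open h then 1 else 0 :: int)" for h p
 have half_U: "p \<in> U \<longleftrightarrow> fst h \<in> B" if "p \<in> half_open h" for p h using that by (auto simp: half_open_def U_def)
 have local: "\<exists>\<rho>>0. \<forall>b\<in>topspace Tg. gd p b / \<eta> < \<rho> --> \<xi> k b = \<xi> k p"
  if pw: "p \<in> topspace Tg" "0 < vdist ends w p" "vdist ends w p < 1" for p w k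
 proof -
  obtain h where h: "h \<in> half_edges w" "p \<in> half_open h" using near_vertex[of p w] pw unfolding topspace_graph by blast
  have "\<xi> k b = \<xi> k p" if "b \<in> half_open h" for b
   using half_U[OF that] half_U[OF h(2)] half_open_disjoint[of h k] that h(2) by (cases "h = k") (auto simp: \<xi>_def)
  thus ?thesis using ball_in_open[OF openin_half[OF half_edgesD(1)[OF h(1)]] h(2) \<eta>(1)] by blast
 qed
 have lip: "\<bar>vdist ends w a - vdist ends w b\<bar> / \<eta> \<le> gd a b / \<eta>" if "w \<in> V" for w a b
  using vdist_lipschitz[OF that, of a b] \<eta>(1) by (intro divide_right_mono) auto
 have cx: "vertex_chart Tg (\<lambda>p q. gd p q / \<eta>) dihedral \<mu> (\<xi> (hx 2))"
 proof (intro vertex_chart.intro metric_conf_axioms group_dihedral vertex_chart_axioms.intro)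
  fix a b assume ab: "a \<in> topspace Tg" "b \<in> topspace Tg"
  have "\<bar>\<mu> a - \<mu> b\<bar> \<le> \<bar>vdist ends x a / \<eta> - vdist ends x b / \<eta>\<bar>" by (auto simp: \<mu>_def)
  also have "\<dots> \<le> gd a b / \<eta>" using lip[OF xV(1), of a b] \<eta>(1) by (simp add: diff_divide_distrib[symmetric] abs_divide)
  finally show "\<bar>\<mu> a - \<mu> b\<bar> \<le> gd a b / \<eta>" .
  show "a = b" if "\<mu> a = 0" "\<mu> b = 0"
  proof -
   have "vdist ends x a = 0" "vdist ends x b = 0" using that \<eta>(1) by (auto simp: \<mu>_def min_def split: if_splits)
   thus ?thesis using vdist_zero ab by simp
  qed
 next
  fix a assume a: "a \<in> topspace Tg"
  thus "0 \<le> \<mu> a \<and> \<mu> a \<le> 1" using vdist_bounds[of a x] \<eta>(1) by (simp add: \<mu>_def)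
  show "\<xi> (hx 2) a \<in> carrier dihedral" by (simp add: \<xi>_def)
  assume "0 < \<mu> a" "\<mu> a < 1"
  hence "0 < vdist ends x a" "vdist ends x a < \<eta>" using \<eta>(1) by (auto simp: \<mu>_def zero_less_divide_iff min_less_iff_disj)
  thus "\<exists>\<rho>>0. \<forall>b\<in>topspace Tg. gd a b / \<eta> < \<rho> --> \<xi> (hx 2) b = \<xi> (hx 2) a" using local[OF a, of x] \<eta>(2) by simp
 qed
 have cy: "vertex_chart Tg (\<lambda>p q. gd p q / \<eta>) dihedral ?\<mu>' (\<xi> (hy 2))"
 proof (intro vertex_chart.intro metric_conf_axioms group_dihedral vertex_chart_axioms.intro)
  fix a b assume ab: "a \<in> topspace Tg" "b \<in> topspace Tg"
  have "\<bar>?\<mu>' a - ?\<mu>' b\<bar> * 1 \<le> \<bar>?\<mu>' a - ?\<mu>' b\<bar> * (1 / \<eta>)" using \<eta> by (intro mult_left_mono) auto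
  thus "\<bar>?\<mu>' a - ?\<mu>' b\<bar> \<le> gd a b / \<eta>" using lip[OF xV(2), of a b] by simp
  show "a = b" if "?\<mu>' a = 0" "?\<mu>' b = 0" using vdist_zero ab that by simp
 qed (use vdist_bounds local[of _ y] in \<open>auto simp: \<xi>_def\<close>)
 let ?lx = "\<lambda>i. leg \<eta> (hx i)" and ?ly = "\<lambda>i. leg 1 (hy i)"
 have one: "(0::real) < 1" "(1::real) \<le> 1" by auto
 have \<mu>x: "\<mu> (?lx k t) = t" if "k < 3" "0 \<le> t" "t \<le> 1" for k t
  using vdist_leg[OF hx(1)[OF that(1)] \<eta>(1,2)] that \<eta>(1) by (simp add: \<mu>_def)
 have \<mu>y: "?\<mu>' (?ly k t) = t" if "k < 3" "0 \<le> t" "t \<le> 1" for k t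
  using vdist_leg[OF hy(1)[OF that(1)] one] that by simp
 have hh: "?lx k t \<in> half_open (hx k)" "?ly k t \<in> half_open (hy k)" if "k < 3" "0 < t" "t < 1" for k t
  using leg_half[OF hx(1)[OF that(1)] \<eta>(1,2)] leg_half[OF hy(1)[OF that(1)] one] that by auto
 have hne: "hx 0 \<noteq> hx 2" "hx 1 \<noteq> hx 2" "hy 0 \<noteq> hy 2" "hy 1 \<noteq> hy 2"
  using inj_onD[OF hx(2), of 0 2] inj_onD[OF hx(2), of 1 2] inj_onD[OF hy(2), of 0 2] inj_onD[OF hy(2), of 1 2] by auto
 \<comment> \<open>The region for the way back: everything reachable without coming closer to x than
   the position of the carried token.\<close>
 let ?Z = "{p. avoids Tg {p. vdist ends x p < 7/10 * \<eta>} (?lx 1 (7/10)) p}"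
 have le: "7/10 * \<eta> \<le> \<eta>" using \<eta> by simp
 have leg_out: "avoids Tg {p. vdist ends x p < 7/10 * \<eta>} (?lx k (7/10)) (leg 1 (hx k) 1)" if k: "k < 3" for k
 proof -
  have e: "?lx k (7/10) = leg 1 (hx k) (7/10 * \<eta>)" by (simp add: leg_def mult.commute)
  show ?thesis unfolding e
  proof (rule avoids_path[OF pathin_leg[OF hx(1)[OF k] one]])
   fix r :: real assume "min (7/10 * \<eta>) 1 \<le> r" "r \<le> max (7/10 * \<eta>) 1"
   thus "leg 1 (hx k) r \<notin> {p. vdist ends x p < 7/10 * \<eta>}"
    using vdist_leg[OF hx(1)[OF k] one, of r] \<eta> le by (auto simp: min_def max_def split: if_splits)
  qed (use \<eta> in auto)
 qed
 have mid: "avoids Tg {p. vdist ends x p < 7/10 * \<eta>} (leg 1 (hx 1) 1) (leg 1 (hx 2) 1)"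
  by (rule avoids_mono[OF \<eta>(3)]) (use le in auto)
 have l2: "?lx 2 (7/10) \<in> ?Z"
  using avoids_trans[OF avoids_trans[OF leg_out[of 1] mid] avoids_sym[OF leg_out[of 2]]] by simp
 have l1: "?lx 1 (7/10) \<in> ?Z"
  using avoids_trans[OF leg_out[of 1] avoids_sym[OF leg_out[of 1]]] by simp
 have "\<not> is_raag (fundamental_group (unord_conf Tg n) base)"
 proof (rule no_free_arc[where \<mu> = \<mu> and \<mu>' = ?\<mu>' and l = ?lx and l' = ?ly and U = U, OF n tripod_leg[OF hx \<eta>(1,2)] tripod_leg[OF hy one] cx cy])
  show "\<mu> (?lx k t) = t" "?\<mu>' (?ly k t) = t" if "k < 3" "0 \<le> t" "t \<le> 1" for k t using \<mu>x \<mu>y that by auto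
  show "?\<mu>' a = 1" if "a \<in> topspace Tg" "\<mu> a < 1" for a
  proof -
   have "vdist ends x a < \<eta>" using that(2) \<eta>(1) by (auto simp: \<mu>_def min_less_iff_disj)
   hence "vdist ends x a < 1" using \<eta>(2) by simp
   thus ?thesis using vdist_apart xy(1) that(1) by simp
  qed
  fix t :: real assume t: "0 < t" "t < 1"
  have "?lx k t \<in> half_open (hx 2) \<longleftrightarrow> hx k = hx 2" "?ly k t \<in> half_open (hy 2) \<longleftrightarrow> hy k = hy 2" if "k < 3" for k
   using hh[OF that t] half_open_disjoint[of "hx k" "hx 2"] half_open_disjoint[of "hy k" "hy 2"] by (force, force)
  hence v: "\<xi> (hx 2) (?lx k t) = (if fst (hx k) \<in> B then - 1 else 1, if hx k = hx 2 then 1 else 0)"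
   "\<xi> (hy 2) (?ly k t) = (if fst (hy k) \<in> B then - 1 else 1, if hy k = hy 2 then 1 else 0)" if "k < 3" for k
   using half_U[OF hh(1)[OF that t]] half_U[OF hh(2)[OF that t]] that by (auto simp: \<xi>_def)
  show "\<xi> (hx 2) (?lx 0 t) = (1, 0)" "\<xi> (hx 2) (?lx 1 t) = (- 1, 0)" "\<xi> (hx 2) (?lx 2 t) = (1, 1)"
   "\<xi> (hy 2) (?ly 0 t) = (1, 0)" "\<xi> (hy 2) (?ly 1 t) = (- 1, 0)" "\<xi> (hy 2) (?ly 2 t) = (1, 1)"
   using v[of 0] v[of 1] v[of 2] B hne by auto
 next
  fix a assume a: "a \<in> topspace Tg" and pos: "0 < \<mu> a" "0 < ?\<mu>' a"
  show "\<exists>\<rho>>0. \<forall>b\<in>topspace Tg. gd a b / \<eta> < \<rho> --> (b \<in> U) = (a \<in> U)"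
  proof (cases a)
   case (GE e t)
   hence e: "e \<in> E" "t \<in> {0<..<1}" using a by (auto simp: graph_points_def)
   have "a \<in> {GE e t | t. t \<in> {0<..<1}}" using GE e by blast
   from ball_in_open[OF open_edge[OF _ _ e(1)] this \<eta>(1)] obtain \<rho> where
    \<rho>: "\<rho> > 0" "\<And>b. b \<in> topspace Tg ==> gd a b / \<eta> < \<rho> ==> b \<in> {GE e t | t. t \<in> {0<..<1}}" by auto
   have "b \<in> U \<longleftrightarrow> a \<in> U" if "b \<in> topspace Tg" "gd a b / \<eta> < \<rho>" for b using \<rho>(2)[OF that] GE by (auto simp: U_def)
   thus ?thesis using \<rho>(1) by blast
  next
   case (GV w)
   hence w: "w \<in> V" "w \<noteq> y" "w \<noteq> x" using a pos \<eta>(1) by (auto simp: graph_points_def \<mu>_def)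
   have "openin Tg {q \<in> topspace Tg. vdist ends w q \<in> {..<1}}" by (rule openin_continuous_map_preimage[OF continuous_vdist]) simp
   moreover have "a \<in> {q \<in> topspace Tg. vdist ends w q \<in> {..<1}}" using a GV by simp
   ultimately obtain \<rho> where \<rho>: "\<rho> > 0" "\<forall>q\<in>topspace Tg. gd a q / \<eta> < \<rho> --> q \<in> {q \<in> topspace Tg. vdist ends w q \<in> {..<1}}"
    using ball_in_open \<eta>(1) by blast
   have "b \<in> U \<longleftrightarrow> a \<in> U" if b: "b \<in> topspace Tg" "gd a b / \<eta> < \<rho>" for b
   proof (cases "b = GV w")
    case False
    have "vdist ends w b < 1" using \<rho>(2) b by auto
    moreover have "0 < vdist ends w b" using False vdist_zero[of b w] vdist_bounds[of b w] b(1) by force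
    ultimately obtain h where h: "h \<in> half_edges w" "b \<in> half_open h" using near_vertex[of b w] b(1) unfolding topspace_graph by blast
    have "fst h \<in> E" "w = fst (ends (fst h)) \<or> w = snd (ends (fst h))" using h(1) by (auto simp: half_edges_def split: if_splits)
    \<comment> \<open>All edges at a vertex other than x and y lie on the same side: in B if the
      vertex is in N, outside B otherwise.\<close>
    hence "fst h \<in> B \<longleftrightarrow> w \<in> N" using BN(1)[of "fst h"] BN(2)[of "fst h"] w(2,3) by blast
    thus ?thesis using half_U[OF h(2)] GV by (auto simp: U_def)
   qed (simp add: GV)
   thus ?thesis using \<rho>(1) by blast
  qed
 next
  show "fst (\<xi> (hx 2) a) = (if a \<in> U then - 1 else 1)" "fst (\<xi> (hy 2) a) = (if a \<in> U then - 1 else 1)" for a by (simp_all add: \<xi>_def)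
  show "path_connectedin Tg ?Z" by (rule path_connectedin_avoids)
  show "?lx 1 (7/10) \<in> ?Z" "?lx 2 (7/10) \<in> ?Z" by (rule l1, rule l2)
  fix a assume "a \<in> ?Z"
  then obtain \<gamma> :: "real => ('v, 'e) gpt" where \<gamma>: "\<gamma> 1 = a" "\<gamma> ` {0..1} \<inter> {p. vdist ends x p < 7/10 * \<eta>} = {}" unfolding avoids_def by blast
  have "\<gamma> 1 \<in> \<gamma> ` {0..1}" by (rule imageI) simp
  hence "7/10 * \<eta> \<le> vdist ends x a" using \<gamma> by auto
  thus "7/10 \<le> \<mu> a" using \<eta>(1) by (simp add: \<mu>_def pos_le_divide_eq)
 qed
 thus False using r by simp
qed

end

section \<open>From containment of subdivisions to half-edges and connecting paths\<close>

section \<open>Embedded subdivisions\<close>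

locale embedding = finite_graph V E ends
 for V :: "'v set" and E :: "'e set" and ends :: "'e => 'v \<times> 'v" +
 fixes V' :: "'w set" and E' :: "'f set" and ends' :: "'f => 'w \<times> 'w" and k k' fv fe
 assumes k: "\<And>e. e \<in> E ==> 1 \<le> k e" and k': "\<And>e. e \<in> E' ==> 1 \<le> k' e"
  and fv: "inj_on fv (subdiv_V V' E' k')" "fv ` subdiv_V V' E' k' \<subseteq> subdiv_V V E k"
  and fe: "inj_on fe (subdiv_E E' k')" "fe ` subdiv_E E' k' \<subseteq> subdiv_E E k"
  and inc: "\<And>z. z \<in> subdiv_E E' k' ==> subdiv_ends ends k (fe z) = map_prod fv fv (subdiv_ends ends' k' z) \<or>
   subdiv_ends ends k (fe z) = prod.swap (map_prod fv fv (subdiv_ends ends' k' z))"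
  and ends': "\<And>e. e \<in> E' ==> fst (ends' e) \<in> V' \<and> snd (ends' e) \<in> V' \<and> fst (ends' e) \<noteq> snd (ends' e)"
begin

abbreviation "node \<equiv> subdiv_node ends k"
abbreviation "node' \<equiv> subdiv_node ends' k'"

definition im :: "'f => nat => 'v + 'e \<times> nat" where
 "im e i = fv (node' e i)"

definition en :: "'e \<times> nat => ('v + 'e \<times> nat) set" where
 "en z = {node (fst z) (snd z), node (fst z) (Suc (snd z))}"

text \<open>The piece of the subdivided edge that contains the germ of the half-edge at its
  vertex.\<close>

definition sub :: "'e \<times> bool => 'e \<times> nat" where
 "sub h = (fst h, if snd h then k (fst h) - 1 else 0)"

primrec pt :: "'v + 'e \<times> nat => ('v, 'e) gpt" where
 "pt (Inl v) = GV v"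
| "pt (Inr z) = GE (fst z) (real (snd z) / real (k (fst z)))"

lemma subdiv_E_iff: "(e, i) \<in> subdiv_E A K \<longleftrightarrow> e \<in> A \<and> i < K e"
 by (simp add: subdiv_E_def)

lemma pt_node: "e \<in> E ==> i \<le> k e ==> pt (node e i) = ch e (real i / real (k e))"
 using k[of e] by (auto simp: subdiv_node_def char_map_def)

lemma node'_in: "e \<in> E' ==> i \<le> k' e ==> node' e i \<in> subdiv_V V' E' k'"
 using ends'[of e] by (auto simp: subdiv_node_def subdiv_V_def)

lemma node'_inj:
 assumes "e \<in> E'" "f \<in> E'" "i \<le> k' e" "j \<le> k' f" "node' e i = node' f j" "0 < i" "i < k' e"
 shows "f = e \<and> j = i"
 using assms by (auto simp: subdiv_node_def split: if_splits)

lemma node'_vertex: "e \<in> E' ==> i \<le> k' e ==> node' e i = Inl a ==> (i = 0 \<and> a = fst (ends' e)) \<or> (i = k' e \<and> a = snd (ends' e))"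
 by (auto simp: subdiv_node_def split: if_splits)

lemma node'_Suc: "e \<in> E' ==> i < k' e ==> node' e i \<noteq> node' e (Suc i)"
 using ends'[of e] by (auto simp: subdiv_node_def)

lemma im_eq: "e \<in> E' ==> i \<le> k' e ==> x \<in> subdiv_V V' E' k' ==> im e i = fv x \<longleftrightarrow> node' e i = x"
 using fv(1) node'_in[of e i] by (auto simp: im_def inj_on_def)

lemma im_ends: "e \<in> E' ==> im e 0 = fv (Inl (fst (ends' e)))" "e \<in> E' ==> im e (k' e) = fv (Inl (snd (ends' e)))"
 using k'[of e] by (auto simp: im_def subdiv_node_def)

lemma im_in: "e \<in> E' ==> i \<le> k' e ==> im e i \<in> subdiv_V V E k"
 using fv(2) node'_in unfolding im_def by blast

lemma Inl_in: "a \<in> V' ==> Inl a \<in> subdiv_V V' E' k'"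
 by (auto simp: subdiv_V_def)

lemma fe_edge:
 assumes "e \<in> E'" "i < k' e"
 shows "fe (e, i) \<in> subdiv_E E k" "en (fe (e, i)) = {im e i, im e (Suc i)}" "im e i \<noteq> im e (Suc i)"
proof -
 have z: "(e, i) \<in> subdiv_E E' k'" using assms by (simp add: subdiv_E_iff)
 thus "fe (e, i) \<in> subdiv_E E k" using fe(2) by blast
 have "subdiv_ends ends k (fe (e, i)) = (node (fst (fe (e, i))) (snd (fe (e, i))), node (fst (fe (e, i))) (Suc (snd (fe (e, i)))))"
  by (simp add: subdiv_ends_def case_prod_unfold)
 moreover have "map_prod fv fv (subdiv_ends ends' k' (e, i)) = (im e i, im e (Suc i))" by (simp add: subdiv_ends_def im_def)
 ultimately show "en (fe (e, i)) = {im e i, im e (Suc i)}" using inc[OF z] by (auto simp: en_def)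
 show "im e i \<noteq> im e (Suc i)" using im_eq[OF assms(1) _ node'_in[OF assms(1), of "Suc i"], of i] node'_Suc[OF assms] assms by (simp add: im_def)
qed

lemma fe_inj: "e \<in> E' ==> i < k' e ==> f \<in> E' ==> j < k' f ==> fe (e, i) = fe (f, j) \<longleftrightarrow> e = f \<and> i = j"
 using inj_on_eq_iff[OF fe(1), of "(e, i)" "(f, j)"] by (simp add: subdiv_E_iff)

lemma pt_points: "a \<in> subdiv_V V E k ==> pt a \<in> graph_points V E"
 by (auto simp: subdiv_V_def graph_points_def)

lemma segment:
 assumes "z \<in> subdiv_E E k" "en z = {a, b}" "Inl c \<notin> en z"
 shows "avoids Tg {GV c} (pt a) (pt b)"
proof -
 obtain e i where z: "z = (e, i)" "e \<in> E" "i < k e" using assms(1) by (auto simp: subdiv_E_def)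
 have n: "Inl c \<noteq> node e i" "Inl c \<noteq> node e (Suc i)" using assms(3) by (auto simp: en_def z)
 have "avoids Tg {GV c} (ch e (real i / real (k e))) (ch e (real (Suc i) / real (k e)))"
 proof (rule avoids_path[OF pathin_ch[OF z(2)]])
  have le: "real i / real (k e) \<le> real (Suc i) / real (k e)" by (simp add: divide_right_mono)
  fix r assume "min (real i / real (k e)) (real (Suc i) / real (k e)) \<le> r" "r \<le> max (real i / real (k e)) (real (Suc i) / real (k e))"
  hence r: "real i / real (k e) \<le> r" "r \<le> real (Suc i) / real (k e)" using le by (auto simp: min_absorb1 max_absorb2 simp del: of_nat_Suc)
  have "i = 0" if "r = 0" using r(1) that z(3) by (simp add: divide_le_0_iff)
  moreover have "Suc i = k e" if "r = 1"
  proof -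
   have "real (k e) \<le> real (Suc i)" using r(2) that z(3) by (simp add: le_divide_eq del: of_nat_Suc)
   thus ?thesis using z(3) by linarith
  qed
  ultimately show "ch e r \<notin> {GV c}" using n by (auto simp: char_map_def subdiv_node_def)
 qed (use z(3) in \<open>auto simp: divide_le_eq_1\<close>)
 hence e: "avoids Tg {GV c} (pt (node e i)) (pt (node e (Suc i)))" using z by (simp add: pt_node del: of_nat_Suc)
 have "(a = node e i \<and> b = node e (Suc i)) \<or> (b = node e i \<and> a = node e (Suc i))"
  using assms(2) by (auto simp: en_def z doubleton_eq_iff)
 thus ?thesis using e avoids_sym[OF e] by blast
qed

lemma chain:
 assumes e: "e \<in> E'" and ij: "i \<le> j" "j \<le> k' e" and c: "\<And>m. i \<le> m ==> m \<le> j ==> im e m \<noteq> Inl c"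
 shows "avoids Tg {GV c} (pt (im e i)) (pt (im e j))"
 using ij c
proof (induction j rule: dec_induct)
 case base
 have "pt (im e i) \<noteq> GV c" using base(2)[of i] by (cases "im e i") auto
 thus ?case unfolding avoids_def using pt_points[OF im_in[OF e base(1)]]
  by (intro exI[of _ "\<lambda>_. pt (im e i)"]) (auto simp: pathin_const)
next
 case (step m)
 have m: "m < k' e" using step by simp
 have "avoids Tg {GV c} (pt (im e m)) (pt (im e (Suc m)))"
  using step.prems(2)[of m] step.prems(2)[of "Suc m"] step.hyps fe_edge(2)[OF e m]
  by (intro segment[OF fe_edge(1,2)[OF e m]]) auto
 thus ?case using avoids_trans[OF step.IH] step.prems by simp
qed

lemma whole_edge:
 assumes e: "e \<in> E'" and c: "c' \<in> V'" "fv (Inl c') = Inl c" "c' \<noteq> fst (ends' e)" "c' \<noteq> snd (ends' e)"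
 shows "avoids Tg {GV c} (pt (fv (Inl (fst (ends' e))))) (pt (fv (Inl (snd (ends' e)))))"
proof -
 have "im e m \<noteq> Inl c" if "m \<le> k' e" for m
  using im_eq[OF e that Inl_in[OF c(1)]] node'_vertex[OF e that, of c'] c by auto
 thus ?thesis using chain[OF e, of 0 "k' e" c] im_ends[OF e] by simp
qed

text \<open>The leg ends at a third of the edge, the piece z after one k-th of it; the two points
  are joined along the edge. The condition on a excludes a loop consisting of one piece, where this
  way could run back into v.\<close>

lemma half_edge:
 assumes z: "z \<in> subdiv_E E k" "en z = {Inl v, a}" "a \<noteq> Inl v"
 shows "\<exists>h\<in>half_edges v. sub h = z \<and> avoids Tg {GV v} (leg 1 h 1) (pt a)"
proof -
 obtain e i where e: "z = (e, i)" "e \<in> E" "i < k e" using z(1) by (auto simp: subdiv_E_def)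
 have in01: "real j / real (k e) \<in> {0..1}" if "j \<le> k e" for j using that by (auto simp: divide_le_eq_1)
 have "(Inl v = node e i \<and> a = node e (Suc i)) \<or> (a = node e i \<and> Inl v = node e (Suc i))"
  using z(2,3) by (auto simp: en_def e doubleton_eq_iff)
 thus ?thesis
 proof (elim disjE conjE)
  assume v: "Inl v = node e i" "a = node e (Suc i)"
  hence i: "i = 0" "v = fst (ends e)" using e(3) by (auto simp: subdiv_node_def split: if_splits)
  have "avoids Tg {GV v} (ch e (1/3)) (ch e (real 1 / real (k e)))"
  proof (rule avoids_path[OF pathin_ch[OF e(2)]])
   fix r :: real assume r: "min (1/3) (real 1 / real (k e)) \<le> r" "r \<le> max (1/3) (real 1 / real (k e))"
   have "0 < real 1 / real (k e)" using e(3) by simp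
   hence "0 < r" using r(1) unfolding min_le_iff_disj by linarith
   moreover have "snd (ends e) \<noteq> v" if "r = 1"
   proof -
    have "k e = 1" using r(2) that e(3) by (auto simp: max_def field_simps split: if_splits)
    thus ?thesis using v z(3) i by (auto simp: subdiv_node_def)
   qed
   ultimately show "ch e r \<notin> {GV v}" by (auto simp: char_map_def)
  qed (use in01[of 1] e(3) in auto)
  hence "avoids Tg {GV v} (leg 1 (e, False) 1) (pt a)" using v(2) i e by (simp add: pt_node leg_def)
  thus ?thesis using e i by (intro bexI[of _ "(e, False)"]) (auto simp: sub_def half_edges_def)
 next
  assume v: "a = node e i" "Inl v = node e (Suc i)"
  hence i: "Suc i = k e" "v = snd (ends e)" using e(3) by (auto simp: subdiv_node_def split: if_splits)
  have "avoids Tg {GV v} (ch e (2/3)) (ch e (real i / real (k e)))"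
  proof (rule avoids_path[OF pathin_ch[OF e(2)]])
   have i1: "real i / real (k e) < 1" using e(3) by simp
   fix r :: real assume r: "min (2/3) (real i / real (k e)) \<le> r" "r \<le> max (2/3) (real i / real (k e))"
   have "r < 1" using r(2) i1 by (auto simp: max_def split: if_splits)
   moreover have "fst (ends e) \<noteq> v" if "r = 0"
   proof -
    have "i = 0" using r(1) that e(3) by (auto simp: min_def divide_le_0_iff split: if_splits)
    thus ?thesis using v z(3) i by (auto simp: subdiv_node_def)
   qed
   ultimately show "ch e r \<notin> {GV v}" by (auto simp: char_map_def)
  qed (use in01[of i] e(3) in auto)
  hence "avoids Tg {GV v} (leg 1 (e, True) 1) (pt a)" using v(1) i e by (simp add: pt_node leg_def)
  thus ?thesis using e i by (intro bexI[of _ "(e, True)"]) (auto simp: sub_def half_edges_def)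
 qed
qed

lemma inr_incident: "Inr (e, i) \<in> en z ==> z = (e, i) \<or> (0 < i \<and> z = (e, i - 1))"
 by (cases z) (auto simp: en_def subdiv_node_def split: if_splits)

lemma half_edge_of_sub:
 assumes "z \<in> subdiv_E E k" "Inl v \<in> en z"
 shows "\<exists>h\<in>half_edges v. sub h = z"
proof -
 obtain e i where e: "z = (e, i)" "e \<in> E" "i < k e" using assms(1) by (auto simp: subdiv_E_def)
 have "Inl v = node e i \<or> Inl v = node e (Suc i)" using assms(2) by (auto simp: en_def e)
 thus ?thesis
 proof
  assume "Inl v = node e i"
  hence "i = 0 \<and> v = fst (ends e)" using e(3) by (auto simp: subdiv_node_def split: if_splits)
  thus ?thesis using e by (intro bexI[of _ "(e, False)"]) (auto simp: sub_def half_edges_def)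
 next
  assume "Inl v = node e (Suc i)"
  hence "Suc i = k e \<and> v = snd (ends e)" using e(3) by (auto simp: subdiv_node_def split: if_splits)
  thus ?thesis using e by (intro bexI[of _ "(e, True)"]) (auto simp: sub_def half_edges_def)
 qed
qed

text \<open>A subdivision point meets only the two neighbouring pieces of its own edge. Three
  distinct pieces can therefore meet only at an original vertex, and they come from three distinct
  half-edges there.\<close>

lemma three_incident:
 assumes z: "z0 \<in> subdiv_E E k" "z1 \<in> subdiv_E E k" "z2 \<in> subdiv_E E k" "z0 \<noteq> z1" "z0 \<noteq> z2" "z1 \<noteq> z2"
  and a: "a \<in> en z0" "a \<in> en z1" "a \<in> en z2"
 shows "\<exists>v. a = Inl v \<and> essential v"
proof (cases a)
 case (Inr c)
 obtain e i where c: "c = (e, i)" by (cases c)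
 show ?thesis using inr_incident[of e i z0] inr_incident[of e i z1] inr_incident[of e i z2] a z(4-6) unfolding Inr c by auto
next
 case (Inl v)
 obtain h0 h1 h2 where h: "h0 \<in> half_edges v" "sub h0 = z0" "h1 \<in> half_edges v" "sub h1 = z1" "h2 \<in> half_edges v" "sub h2 = z2"
  using half_edge_of_sub z(1-3) a unfolding Inl by metis
 have "essential v" unfolding essential_def
  using h z(4-6) by (intro exI[of _ "\<lambda>i. if i = 0 then h0 else if i = 1 then h1 else h2"]) (auto simp: inj_on_def)
 thus ?thesis using Inl by simp
qed

lemma vertex_sub:
 assumes "e \<in> E'" "a = fst (ends' e) \<or> a = snd (ends' e)"
 shows "\<exists>i<k' e. fv (Inl a) \<in> en (fe (e, i))"
 using assms(2)
proof
 assume "a = fst (ends' e)"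
 thus ?thesis using fe_edge(2)[OF assms(1), of 0] im_ends(1)[OF assms(1)] k'[OF assms(1)] by (intro exI[of _ 0]) auto
next
 assume "a = snd (ends' e)"
 thus ?thesis using fe_edge(2)[OF assms(1), of "k' e - 1"] im_ends(2)[OF assms(1)] k'[OF assms(1)] by (intro exI[of _ "k' e - 1"]) auto
qed

lemma branch_vertex:
 assumes "e \<in> E'" "f \<in> E'" "g \<in> E'" "e \<noteq> f" "e \<noteq> g" "f \<noteq> g"
  and "a \<in> {fst (ends' e), snd (ends' e)}" "a \<in> {fst (ends' f), snd (ends' f)}" "a \<in> {fst (ends' g), snd (ends' g)}"
 obtains v where "fv (Inl a) = Inl v" "essential v"
proof -
 obtain i where i: "i < k' e" "fv (Inl a) \<in> en (fe (e, i))" using vertex_sub[OF assms(1)] assms(7) by blast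
 obtain j where j: "j < k' f" "fv (Inl a) \<in> en (fe (f, j))" using vertex_sub[OF assms(2)] assms(8) by blast
 obtain m where m: "m < k' g" "fv (Inl a) \<in> en (fe (g, m))" using vertex_sub[OF assms(3)] assms(9) by blast
 have "\<exists>v. fv (Inl a) = Inl v \<and> essential v"
  by (rule three_incident[OF fe_edge(1)[OF assms(1) i(1)] fe_edge(1)[OF assms(2) j(1)] fe_edge(1)[OF assms(3) m(1)]])
   (use fe_inj i j m assms(1-6) in auto)
 thus thesis using that by blast
qed

lemma fv_Inl_inj: "a \<in> V' ==> b \<in> V' ==> fv (Inl a) = fv (Inl b) \<longleftrightarrow> a = b"
 using fv(1) Inl_in by (auto simp: inj_on_def)

end

lemma (in finite_graph) ex_embedding:
 assumes c: "graph_contains V E ends V' E' ends'"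
  and e: "\<And>e. e \<in> E' ==> fst (ends' e) \<in> V' \<and> snd (ends' e) \<in> V' \<and> fst (ends' e) \<noteq> snd (ends' e)"
 shows "\<exists>k k' fv fe. embedding V E ends V' E' ends' k k' fv fe"
 using c unfolding graph_contains_def
proof (elim exE conjE)
 fix k k' fv fe
 assume a: "\<forall>e\<in>E. 1 \<le> k e" "\<forall>e\<in>E'. 1 \<le> k' e" "inj_on fv (subdiv_V V' E' k')" "fv ` subdiv_V V' E' k' \<subseteq> subdiv_V V E k"
  "inj_on fe (subdiv_E E' k')" "fe ` subdiv_E E' k' \<subseteq> subdiv_E E k"
  and i: "\<forall>x\<in>subdiv_E E' k'. subdiv_ends ends k (fe x) = map_prod fv fv (subdiv_ends ends' k' x) \<or>
   subdiv_ends ends k (fe x) = prod.swap (map_prod fv fv (subdiv_ends ends' k' x))"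
 have "embedding V E ends V' E' ends' k k' fv fe"
  by (intro embedding.intro finite_graph_axioms embedding_axioms.intro a(3-6) e)
   (use a(1,2) i in simp_all)
 thus ?thesis by blast
qed

text \<open>Any two of the three branch vertices are joined through the centre by two edges, neither
  of which contains the third.\<close>

theorem (in finite_graph) not_raag_T0:
 assumes c: "graph_contains V E ends T0_V T0_E T0_ends" and n: "n \<ge> 5" and base: "base \<in> topspace (unord_conf Tg n)"
 shows "\<not> is_raag (fundamental_group (unord_conf Tg n) base)"
proof -
 have T0: "fst (T0_ends e) \<in> T0_V \<and> snd (T0_ends e) \<in> T0_V \<and> fst (T0_ends e) \<noteq> snd (T0_ends e)" if "e \<in> T0_E" for e
 proof -
  have "e \<in> {0,1,2,3,4,5,6,7,8}" using that by (auto simp: T0_E_def)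
  thus ?thesis by (auto simp: T0_ends_def T0_V_def)
 qed
 obtain k k' fv fe where "embedding V E ends T0_V T0_E T0_ends k k' fv fe" using ex_embedding[OF c T0] by blast
 then interpret embedding V E ends T0_V T0_E T0_ends k k' fv fe .
 note ed = T0_E_def T0_ends_def T0_V_def
 have V: "a \<in> T0_V" if "a < 10" for a using that by (simp add: T0_V_def)
 obtain x where x: "fv (Inl 1) = Inl x" "essential x" by (rule branch_vertex[of 0 3 4 1]) (auto simp: ed)
 obtain y where y: "fv (Inl 2) = Inl y" "essential y" by (rule branch_vertex[of 1 5 6 2]) (auto simp: ed)
 obtain z where z: "fv (Inl 3) = Inl z" "essential z" by (rule branch_vertex[of 2 7 8 3]) (auto simp: ed)
 have ne: "x \<noteq> y" "x \<noteq> z" "y \<noteq> z" using fv_Inl_inj[of 1 2] fv_Inl_inj[of 1 3] fv_Inl_inj[of 2 3] x y z V by auto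
 have "avoids Tg {GV c} (pt (fv (Inl 0))) (pt (fv (Inl a)))"
  if "fv (Inl b) = Inl c" "a \<in> {1, 2, 3}" "b \<in> {1, 2, 3}" "a \<noteq> b" for a b c
  using whole_edge[of "a - 1" b c] that V[of b] by (auto simp: ed)
 hence "avoids Tg {GV c} (pt (fv (Inl a))) (pt (fv (Inl a')))"
  if "fv (Inl b) = Inl c" "a \<in> {1, 2, 3}" "a' \<in> {1, 2, 3}" "b \<in> {1, 2, 3}" "a \<noteq> b" "a' \<noteq> b" for a a' b c
  using avoids_trans[OF avoids_sym] that by meson
 from this[of 1 x 2 3] this[of 2 y 1 3] this[of 3 z 1 2] show ?thesis
  using x y z by (intro three_essential[OF n base x(2) y(2) z(2) ne]) simp_all
qed

text \<open>The case distinction inspects arc 0, the image of edge 0 of the cycle. The free case has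
  to return from pieces of a subdivision to the graph itself: a closed-off set of pieces is shown to
  consist of whole edges.\<close>

theorem (in finite_graph) not_raag_S0:
 assumes c: "graph_contains V E ends S0_V S0_E S0_ends" and n: "n \<ge> 5" and base: "base \<in> topspace (unord_conf Tg n)"
 shows "\<not> is_raag (fundamental_group (unord_conf Tg n) base)"
proof -
 have S0: "fst (S0_ends e) \<in> S0_V \<and> snd (S0_ends e) \<in> S0_V \<and> fst (S0_ends e) \<noteq> snd (S0_ends e)" if "e \<in> S0_E" for e
 proof -
  have "e \<in> {0,1,2,3}" using that by (auto simp: S0_E_def)
  thus ?thesis by (auto simp: S0_ends_def S0_V_def)
 qed
 obtain k k' fv fe where "embedding V E ends S0_V S0_E S0_ends k k' fv fe" using ex_embedding[OF c S0] by blast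
 then interpret embedding V E ends S0_V S0_E S0_ends k k' fv fe .
 note ed = S0_E_def S0_ends_def S0_V_def
 have V: "a \<in> S0_V" if "a < 4" for a using that by (simp add: S0_V_def)
 have E: "0 \<in> S0_E" "1 \<in> S0_E" "2 \<in> S0_E" "3 \<in> S0_E" by (auto simp: S0_E_def)
 obtain x where x: "fv (Inl 0) = Inl x" "essential x" by (rule branch_vertex[of 0 1 2 0]) (auto simp: ed)
 obtain y where y: "fv (Inl 1) = Inl y" "essential y" by (rule branch_vertex[of 0 1 3 1]) (auto simp: ed)
 have xy: "x \<noteq> y" using fv_Inl_inj[of 0 1] x y V by auto
 have im: "im 0 0 = Inl x" "im 0 (k' 0) = Inl y" "im 1 0 = Inl y" "im 1 (k' 1) = Inl x" "im 2 0 = Inl x" "im 3 0 = Inl y"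
  using im_ends[OF E(1)] im_ends[OF E(2)] im_ends[OF E(3)] im_ends[OF E(4)] x y by (simp_all add: S0_ends_def)
 have k1: "k' 0 \<ge> 1" "k' 1 \<ge> 1" "k' 2 \<ge> 1" "k' 3 \<ge> 1" using k' E by auto
 have ix: "im e m = Inl x \<longleftrightarrow> (e, m) \<in> {(0, 0), (1, k' 1), (2, 0)}" if "e \<in> S0_E" "m \<le> k' e" for e m
 proof -
  have "e \<in> {0, 1, 2, 3}" using that(1) by (auto simp: S0_E_def)
  thus ?thesis using im_eq[OF that Inl_in[OF V, of 0]] node'_vertex[OF that, of 0] x(1) im by (auto simp: S0_ends_def)
 qed
 have iy: "im e m = Inl y \<longleftrightarrow> (e, m) \<in> {(0, k' 0), (1, 0), (3, 0)}" if "e \<in> S0_E" "m \<le> k' e" for e m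
 proof -
  have "e \<in> {0, 1, 2, 3}" using that(1) by (auto simp: S0_E_def)
  thus ?thesis using im_eq[OF that Inl_in[OF V, of 1]] node'_vertex[OF that, of 1] y(1) im by (auto simp: S0_ends_def)
 qed
 \<comment> \<open>Original vertices strictly inside arc 0; F below is the set of pieces forming
   this arc.\<close>
 define N where "N = {v. \<exists>i. 0 < i \<and> i < k' 0 \<and> im 0 i = Inl v}"
 define F where "F = (\<lambda>i. fe (0, i)) ` {..<k' 0}"
 show ?thesis
 proof (cases "\<exists>w\<in>N. \<exists>z\<in>subdiv_E E k. Inl w \<in> en z \<and> z \<notin> F")
  case True
  then obtain w i z where i: "0 < i" "i < k' 0" "im 0 i = Inl w" and z: "z \<in> subdiv_E E k" "Inl w \<in> en z" "z \<notin> F"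
   unfolding N_def by blast
  \<comment> \<open>Two pieces of the arc meet at w, and z is a third.\<close>
  have "fe (0, i - 1) \<noteq> z" "fe (0, i) \<noteq> z" using z(3) i by (auto simp: F_def)
  hence "\<exists>v. Inl w = (Inl v :: _ + 'e \<times> nat) \<and> essential v"
   using three_incident[OF fe_edge(1)[OF E(1), of "i - 1"] fe_edge(1)[OF E(1), of i] z(1), of "Inl w"]
    fe_edge(2)[OF E(1), of "i - 1"] fe_edge(2)[OF E(1), of i] fe_inj[OF E(1) _ E(1), of "i - 1" i] i z(2) by auto
  hence w: "essential w" by auto
  have wne: "x \<noteq> w" "y \<noteq> w" using ix[OF E(1), of i] iy[OF E(1), of i] i by auto
  have "avoids Tg {GV x} (pt (im 0 i)) (pt (im 0 (k' 0)))" by (rule chain[OF E(1)]) (use i ix[OF E(1)] in auto)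
  moreover have "avoids Tg {GV y} (pt (im 0 0)) (pt (im 0 i))" by (rule chain[OF E(1)]) (use i iy[OF E(1)] in auto)
  moreover have "avoids Tg {GV w} (pt (im 1 0)) (pt (im 1 (k' 1)))"
  proof (rule chain[OF E(2)])
   fix m assume m: "m \<le> k' 1"
   have "node' 0 i \<noteq> node' 1 m" using node'_inj[OF E(1,2), of i m] i m by auto
   thus "im 1 m \<noteq> Inl w" using im_eq[OF E(1) _ node'_in[OF E(2) m], of i] i by (auto simp: im_def)
  qed auto
  ultimately show ?thesis
   by (intro three_essential[OF n base x(2) y(2) w xy wne]) (use im i in \<open>auto intro: avoids_sym\<close>)
 next
  case False
  hence closed: "z \<in> F" if "w \<in> N" "z \<in> subdiv_E E k" "Inl w \<in> en z" for w z using that by blast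
  define B where "B = fst ` F"
  have Fin: "z \<in> subdiv_E E k" if "z \<in> F" for z using that fe_edge(1)[OF E(1)] by (auto simp: F_def)
  have Fen: "\<exists>m\<le>k' 0. a = im 0 m" if za: "z \<in> F" "a \<in> en z" for a z
  proof -
   obtain i where "i < k' 0" "z = fe (0, i)" using za(1) by (auto simp: F_def)
   thus ?thesis using za(2) fe_edge(2)[OF E(1), of i] by (auto intro: exI[of _ i] exI[of _ "Suc i"])
  qed
  \<comment> \<open>x and y are original vertices, so a subdivision point on the arc lies strictly
    inside it and both pieces at that point belong to the arc.\<close>
  have inner: "(e, j) \<in> F \<and> (e, j - 1) \<in> F" if a: "Inr (e, j) \<in> en z" "z \<in> F" for e j z
  proof -
   obtain m where m: "m \<le> k' 0" "im 0 m = Inr (e, j)" using Fen[OF a(2,1)] by metis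
   have m0: "0 < m" "m < k' 0" using m im by (auto intro: ccontr le_neq_implies_less)
   have "Inr (e, j) \<in> en (fe (0, m - 1))" "Inr (e, j) \<in> en (fe (0, m))" "fe (0, m - 1) \<noteq> fe (0, m)"
    using fe_edge(2)[OF E(1), of "m - 1"] fe_edge(2)[OF E(1), of m] fe_inj[OF E(1) _ E(1), of "m - 1" m] m0 m by auto
   moreover have "fe (0, m - 1) \<in> F" "fe (0, m) \<in> F" using m0 by (auto simp: F_def)
   ultimately show ?thesis using inr_incident by metis
  qed
  have up: "(e, Suc j) \<in> F" if "(e, j) \<in> F" "Suc j < k e" for e j
  proof -
   have "Inr (e, Suc j) \<in> en (e, j)" using that by (auto simp: en_def subdiv_node_def)
   thus ?thesis using inner that(1) by blast
  qed
  have down: "(e, j) \<in> F" if "(e, Suc j) \<in> F" "Suc j < k e" for e j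
  proof -
   have "Inr (e, Suc j) \<in> en (e, Suc j)" using that by (auto simp: en_def subdiv_node_def)
   thus ?thesis using inner[of e "Suc j"] that(1) by fastforce
  qed
  have whole: "(e, j) \<in> F" if e: "e \<in> B" "j < k e" for e j
  proof -
   obtain i where i: "(e, i) \<in> F" using e(1) by (auto simp: B_def)
   have ik: "i < k e" using Fin[OF i] by (simp add: subdiv_E_iff)
   have z: "(e, 0) \<in> F" using i ik by (induction i) (auto intro: down)
   show ?thesis using e(2) by (induction j) (use z up in auto)
  qed
  have FN: "a \<in> N \<union> {x, y}" if az: "Inl a \<in> en z" "z \<in> F" for a z
  proof -
   obtain m where "m \<le> k' 0" "Inl a = im 0 m" using Fen[OF az(2,1)] by blast
   thus ?thesis using im by (cases "m = 0 \<or> m = k' 0") (auto simp: N_def intro!: exI[of _ m])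
  qed
  have eEnd: "Inl (fst (ends e)) \<in> en (e, 0)" "Inl (snd (ends e)) \<in> en (e, k e - 1)" "(e, 0) \<in> subdiv_E E k" "(e, k e - 1) \<in> subdiv_E E k"
   if "e \<in> E" for e using k[OF that] that by (auto simp: en_def subdiv_node_def subdiv_E_iff)
  have h: "\<exists>h\<in>half_edges v. sub h = fe (e, i) \<and> avoids Tg {GV v} (leg 1 h 1) (pt a)"
   if "e \<in> S0_E" "i < k' e" "{im e i, im e (Suc i)} = {Inl v, a}" for e i v a
  proof (rule half_edge)
   show "a \<noteq> Inl v" using fe_edge(3)[OF that(1,2)] that(3) by (auto simp: doubleton_eq_iff)
  qed (use fe_edge[OF that(1,2)] that(3) in auto)
  have k0: "0 < k' e" "Suc (k' e - 1) = k' e" "k' e - 1 < k' e" if "e \<in> S0_E" for e using k'[OF that] by auto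
  obtain h0 where h0: "h0 \<in> half_edges x" "sub h0 = fe (2, 0)" using h[OF E(3) k0(1)[OF E(3)], of x "im 2 (Suc 0)"] im by auto
  obtain h1 where h1: "h1 \<in> half_edges x" "sub h1 = fe (0, 0)" "avoids Tg {GV x} (leg 1 h1 1) (pt (im 0 (Suc 0)))"
   using h[OF E(1) k0(1)[OF E(1)], of x "im 0 (Suc 0)"] im by auto
  obtain h2 where h2: "h2 \<in> half_edges x" "sub h2 = fe (1, k' 1 - 1)" "avoids Tg {GV x} (leg 1 h2 1) (pt (im 1 (k' 1 - 1)))"
   using h[OF E(2) k0(3)[OF E(2)], of x "im 1 (k' 1 - 1)"] im k0(2)[OF E(2)] by (auto simp: insert_commute)
  obtain g0 where g0: "g0 \<in> half_edges y" "sub g0 = fe (1, 0)" using h[OF E(2) k0(1)[OF E(2)], of y "im 1 (Suc 0)"] im by auto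
  obtain g1 where g1: "g1 \<in> half_edges y" "sub g1 = fe (0, k' 0 - 1)"
   using h[OF E(1) k0(3)[OF E(1)], of y "im 0 (k' 0 - 1)"] im k0(2)[OF E(1)] by (auto simp: insert_commute)
  obtain g2 where g2: "g2 \<in> half_edges y" "sub g2 = fe (3, 0)" using h[OF E(4) k0(1)[OF E(4)], of y "im 3 (Suc 0)"] im by auto
  have inB: "fst h \<in> B" if "sub h = fe (0, i)" "i < k' 0" for h i
  proof -
   have "sub h \<in> F" using that by (auto simp: F_def)
   hence "fst (sub h) \<in> B" unfolding B_def by (rule imageI)
   thus ?thesis by (simp add: sub_def)
  qed
  have notB: "fst h \<notin> B" if hh: "sub h = fe (e, i)" "e \<in> S0_E" "i < k' e" "e \<noteq> 0" "h \<in> half_edges v" for h e i v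
  proof
   assume "fst h \<in> B"
   hence "sub h \<in> F" using whole[of "fst h"] k[OF half_edgesD(1)[OF hh(5)]] by (auto simp: sub_def)
   then obtain j where "j < k' 0" "fe (e, i) = fe (0, j)" using hh(1) by (auto simp: F_def)
   thus False using fe_inj[OF hh(2,3) E(1)] hh(4) by auto
  qed
  \<comment> \<open>Index 1 enters arc 0 at either end. At x, index 2 must start the way back along
    arc 1, which leaves the pendant edge for index 0; at y the order of the other two is
    immaterial.\<close>
  define hx where "hx i = (if i = 0 then h0 else if i = 1 then h1 else h2)" for i :: nat
  define hy where "hy i = (if i = 0 then g0 else if i = 1 then g1 else g2)" for i :: nat
  have dist: "h0 \<noteq> h1" "h0 \<noteq> h2" "h1 \<noteq> h2" "g0 \<noteq> g1" "g0 \<noteq> g2" "g1 \<noteq> g2"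
   using h0 h1 h2 g0 g1 g2 fe_inj[OF E(3) k0(1)[OF E(3)] E(1) k0(1)[OF E(1)]] fe_inj[OF E(3) k0(1)[OF E(3)] E(2) k0(3)[OF E(2)]]
    fe_inj[OF E(1) k0(1)[OF E(1)] E(2) k0(3)[OF E(2)]] fe_inj[OF E(2) k0(1)[OF E(2)] E(1) k0(3)[OF E(1)]]
    fe_inj[OF E(2) k0(1)[OF E(2)] E(4) k0(1)[OF E(4)]] fe_inj[OF E(1) k0(3)[OF E(1)] E(4) k0(1)[OF E(4)]] by auto
  have a1: "avoids Tg {GV x} (pt (im 0 (Suc 0))) (pt (im 0 (k' 0)))" by (rule chain[OF E(1)]) (use k1 ix[OF E(1)] in auto)
  have a2: "avoids Tg {GV x} (pt (im 1 0)) (pt (im 1 (k' 1 - 1)))" by (rule chain[OF E(2)]) (use k1 ix[OF E(2)] in auto)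
  have "avoids Tg {GV x} (leg 1 h1 1) (leg 1 h2 1)"
   using avoids_trans[OF avoids_trans[OF h1(3) a1] avoids_trans[OF _ avoids_sym[OF h2(3)]]] a2 im by simp
  thus ?thesis
  proof (intro free_arc[OF n base xy, of N hx hy B])
   show "x \<notin> N" "y \<notin> N" using ix[OF E(1)] iy[OF E(1)] by (auto simp: N_def)
   show "hx i \<in> half_edges x" "hy i \<in> half_edges y" for i using h0 h1 h2 g0 g1 g2 by (auto simp: hx_def hy_def)
   show "inj_on hx {..<3}" "inj_on hy {..<3}" using dist by (auto simp: inj_on_def hx_def hy_def)
   show "fst (hx 1) \<in> B" "fst (hy 1) \<in> B" using inB[OF h1(2)] inB[OF g1(2)] k1 by (auto simp: hx_def hy_def)
   show "fst (hx 0) \<notin> B" using notB[OF h0(2) E(3) _ _ h0(1)] k1 by (simp add: hx_def)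
   show "fst (hx 2) \<notin> B" using notB[OF h2(2) E(2) _ _ h2(1)] k1 by (simp add: hx_def)
   show "fst (hy 0) \<notin> B" using notB[OF g0(2) E(2) _ _ g0(1)] k1 by (simp add: hy_def)
   show "fst (hy 2) \<notin> B" using notB[OF g2(2) E(4) _ _ g2(1)] k1 by (simp add: hy_def)
   fix e assume e: "e \<in> E"
   show "fst (ends e) \<in> N \<union> {x, y} \<and> snd (ends e) \<in> N \<union> {x, y}" if "e \<in> B"
    using FN[OF eEnd(1)[OF e] whole[OF that]] FN[OF eEnd(2)[OF e] whole[OF that]] k[OF e] by auto
   show "fst (ends e) \<notin> N \<and> snd (ends e) \<notin> N" if "e \<notin> B"
    using closed[OF _ eEnd(3)[OF e] eEnd(1)[OF e]] closed[OF _ eEnd(4)[OF e] eEnd(2)[OF e]] that by (force simp: B_def)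
  qed (simp add: hx_def)
 qed
qed

theorem theoremB:
  fixes V :: "'v set" and E :: "'e set" and ends :: "'e \<Rightarrow> 'v \<times> 'v"
    and n :: nat and base :: "('v, 'e) gpt set"
  assumes "finite_connected_graph V E ends"
    and "graph_contains V E ends T0_V T0_E T0_ends \<or> graph_contains V E ends S0_V S0_E S0_ends"
    and "n \<ge> 5"
    and "base \<in> topspace (unord_conf (graph_top V E ends) n)"
  shows "\<not> is_raag (graph_braid_group V E ends n base)"
proof -
  interpret finite_graph V E ends by (rule finite_graph.intro[OF assms(1)])
  show ?thesis unfolding graph_braid_group_def using assms(2) not_raag_T0[OF _ assms(3,4)] not_raag_S0[OF _ assms(3,4)] by blast
qed

end
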